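(* Let $g \geq 1$ and $r$ be integers with $g \leq r < 2g+1$, let $m = r-g$ and $n = 2g-r$ (nonnegative integers), and let $\{a_k\}_{k=0}^{m}$, $\{b_\ell\}_{\ell=0}^{n}$ be two strictly increasing convex sequences of nonnegative rational numbers with $a_0 = b_0 = 0$. Put $$f(x) = x\prod_{k=1}^{m}(x^2-a_k^2)\prod_{\ell=1}^{n}(x^2+b_\ell^2).$$ Then $\mathcal{X}: y^2 = f(x)T + 1$ over $\mathbb{Q}(T)$ is an imaginary hyperelliptic curve with genus $g$ and $\operatorname{rank} J_{\mathcal{X}}(\mathbb{Q}(T)) = r$.
   Context: A finite sequence $\{a_k\}_{k=0}^m$ is convex if $a_{k+1}-a_k \geq a_k - a_{k-1}$ for all $1 \leq k \leq m-1$. A hyperelliptic curve of genus $g$ over $\mathbb{Q}(T)$ is a curve $\mathcal{X}: y^2 = F(x,T)$ of genus $g$ (meaning the smooth projective model of this affine equation, regarded as a curve over the field $\mathbb{Q}(T)$), so that $\deg_x F$ is either $2g+1$ or $2g+2$. It is called imaginary if $\deg_x F = 2g+1$. $J_{\mathcal{X}}$ denotes its Jacobian variety, an abelian variety of dimension $g$ over $\mathbb{Q}(T)$. If $(B,\tau)$ is the $\mathbb{Q}(T)/\mathbb{Q}$-trace of $J_{\mathcal{X}}$, then $J_{\mathcal{X}}(\mathbb{Q}(T))/\tau(B(\mathbb{Q}))$ is a finitely generated abelian group (Lang--N\'eron); it is assumed throughout that $\tau(B(\mathbb{Q}))$ is trivial, and $\operatorname{rank} J_{\mathcal{X}}(\mathbb{Q}(T))$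 is the number of free generators of this group. *)

theory Defs
  imports
    "HOL-Algebra.Free_Abelian_Groups"
    "HOL-Algebra.Algebraic_Closure_Type"
    "HOL-Library.Product_Plus"
    "HOL-Computational_Algebra.Computational_Algebra"
begin

text \<open>
  A curve \<open>y\<^sup>2 = F(x)\<close> over a perfect field \<open>K\<close> is given by \<open>F \<in> K[x]\<close>.  Its smooth projective model
  is handled geometrically, through the function field over the algebraic closure of \<open>K\<close>: the points
  of the model are the normalised discrete valuations of that function field which are trivial on
  the constants.  All these points have degree 1.  The Galois action on them recovers \<open>K\<close>-rationality.
\<close>

definition const_fn :: "'k::field \<Rightarrow> 'k poly fract" where
  "const_fn c = to_fract [:c:]"

text \<open>Convexity of the finite sequence \<open>a 0, \<dots>, a m\<close>; values of \<open>a\<close> beyond \<open>m\<close> are irrelevant.\<close>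

definition convex_seq :: "nat \<Rightarrow> (nat \<Rightarrow> rat) \<Rightarrow> bool" where
  "convex_seq m a \<longleftrightarrow> (\<forall>k. 1 \<le> k \<and> k + 1 \<le> m \<longrightarrow> a (k + 1) - a k \<ge> a k - a (k - 1))"


subsection \<open>The geometric function field\<close>

text \<open>
  The pair \<open>(a, b)\<close> stands for \<open>a + b y\<close>, with \<open>a\<close> and \<open>b\<close> rational functions of \<open>x\<close> over the algebraic
  closure of \<open>K\<close>.  Addition is that of the product type; multiplication uses \<open>y\<^sup>2 = F(x)\<close>.
\<close>

type_synonym 'k ff = "'k alg_closure poly fract \<times> 'k alg_closure poly fract"

definition geom :: "'k::field poly \<Rightarrow> 'k alg_closure poly" where
  "geom F = map_poly to_ac F"

definition ff_mult :: "'k::field poly \<Rightarrow> 'k ff \<Rightarrow> 'k ff \<Rightarrow> 'k ff" where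
  "ff_mult F h h' =
     (fst h * fst h' + snd h * snd h' * to_fract (geom F), fst h * snd h' + snd h * fst h')"

definition ff_scale :: "'k::field alg_closure \<Rightarrow> 'k ff \<Rightarrow> 'k ff" where
  "ff_scale c h = (const_fn c * fst h, const_fn c * snd h)"

lemma vector_space_ff_scale: "vector_space (ff_scale :: 'k::field alg_closure \<Rightarrow> 'k ff \<Rightarrow> 'k ff)"
proof
  fix a b :: "'k alg_closure" and x y :: "'k ff"
  have const_add: "const_fn (a + b) = const_fn a + const_fn b"
    by (simp add: const_fn_def flip: to_fract_add)
  have const_mult: "const_fn (a * b) = const_fn a * const_fn b"
    by (simp add: const_fn_def flip: to_fract_mult)
  have const_1: "const_fn (1 :: 'k alg_closure) = 1"
    by (simp add: const_fn_def to_fract_def One_fract_def flip: one_pCons)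
  show "ff_scale a (x + y) = ff_scale a x + ff_scale a y"
    by (simp add: ff_scale_def distrib_left)
  show "ff_scale (a + b) x = ff_scale a x + ff_scale b x"
    by (simp add: ff_scale_def const_add distrib_right)
  show "ff_scale a (ff_scale b x) = ff_scale (a * b) x"
    by (simp add: ff_scale_def const_mult mult.assoc)
  show "ff_scale 1 x = x"
    by (simp add: ff_scale_def const_1)
qed

text \<open>
  The value at \<open>0\<close>, mathematically \<open>\<infinity>\<close>, is set to \<open>0\<close>, so that distinct functions \<open>v\<close> are distinct points.
\<close>

definition points :: "'k::field poly \<Rightarrow> ('k ff \<Rightarrow> int) set" where
  "points F = {v.
     v 0 = 0 \<and>
     (\<forall>h h'. h \<noteq> 0 \<longrightarrow> h' \<noteq> 0 \<longrightarrow> v (ff_mult F h h') = v h + v h') \<and>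
     (\<forall>h h'. h \<noteq> 0 \<longrightarrow> h' \<noteq> 0 \<longrightarrow> h + h' \<noteq> 0 \<longrightarrow> min (v h) (v h') \<le> v (h + h')) \<and>
     (\<forall>c. c \<noteq> 0 \<longrightarrow> v (const_fn c, 0) = 0) \<and>
     (\<exists>h. h \<noteq> 0 \<and> v h = 1)}"


subsection \<open>Divisors and the genus\<close>

abbreviation divisors :: "'k::field poly \<Rightarrow> (('k ff \<Rightarrow> int) \<Rightarrow>\<^sub>0 int) monoid" where
  "divisors F \<equiv> free_Abelian_group (points F)"

definition div_degree :: "('p \<Rightarrow>\<^sub>0 int) \<Rightarrow> int" where
  "div_degree D = (\<Sum>v\<in>Poly_Mapping.keys D. Poly_Mapping.lookup D v)"

definition principal_divisors :: "'k::field poly \<Rightarrow> (('k ff \<Rightarrow> int) \<Rightarrow>\<^sub>0 int) set" where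
  "principal_divisors F =
     {D \<in> carrier (divisors F). \<exists>h. h \<noteq> 0 \<and> (\<forall>v\<in>points F. Poly_Mapping.lookup D v = v h)}"

definition riemann_roch_space ::
    "'k::field poly \<Rightarrow> (('k ff \<Rightarrow> int) \<Rightarrow>\<^sub>0 int) \<Rightarrow> 'k ff set" where
  "riemann_roch_space F D =
     {h. h = 0 \<or> (\<forall>v\<in>points F. v h + Poly_Mapping.lookup D v \<ge> 0)}"

definition ell :: "'k::field poly \<Rightarrow> (('k ff \<Rightarrow> int) \<Rightarrow>\<^sub>0 int) \<Rightarrow> nat" where
  "ell F D = vector_space.dim ff_scale (riemann_roch_space F D)"

text \<open>The genus is the maximum of \<open>deg D + 1 - \<ell>(D)\<close> over all divisors \<open>D\<close>.\<close>

definition has_genus :: "'k::field poly \<Rightarrow> nat \<Rightarrow> bool" where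
  "has_genus F g \<longleftrightarrow>
     (\<forall>D\<in>carrier (divisors F). div_degree D + 1 - int (ell F D) \<le> int g) \<and>
     (\<exists>D\<in>carrier (divisors F). div_degree D + 1 - int (ell F D) = int g)"

text \<open>The first conjunct says that \<open>y\<^sup>2 - F(x)\<close>, as a polynomial in \<open>y\<close>, defines a geometrically
  integral curve.\<close>

definition hyperelliptic_curve :: "'k::field poly \<Rightarrow> nat \<Rightarrow> bool" where
  "hyperelliptic_curve F g \<longleftrightarrow>
     Factorial_Ring.irreducible [:- geom F, 0, 1:] \<and> has_genus F g \<and>
     (Polynomial.degree F = 2 * g + 1 \<or> Polynomial.degree F = 2 * g + 2)"

definition imaginary_hyperelliptic_curve :: "'k::field poly \<Rightarrow> nat \<Rightarrow> bool" where
  "imaginary_hyperelliptic_curve F g \<longleftrightarrow>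
     hyperelliptic_curve F g \<and> Polynomial.degree F = 2 * g + 1"


subsection \<open>The rational points of the Jacobian\<close>

definition Pic0 :: "'k::field poly \<Rightarrow> (('k ff \<Rightarrow> int) \<Rightarrow>\<^sub>0 int) set monoid" where
  "Pic0 F = (divisors F)\<lparr>carrier := {D \<in> carrier (divisors F). div_degree D = 0}\<rparr>
     Mod principal_divisors F"

definition galois_group :: "('k::field alg_closure \<Rightarrow> 'k alg_closure) set" where
  "galois_group = {\<sigma>. bij \<sigma> \<and> (\<forall>x y. \<sigma> (x + y) = \<sigma> x + \<sigma> y) \<and> (\<forall>x y. \<sigma> (x * y) = \<sigma> x * \<sigma> y) \<and>
     (\<forall>c. \<sigma> (to_ac c) = to_ac c)}"

text \<open>\<open>\<sigma>\<close> acts on functions through the coefficients, fixing \<open>x\<close> and \<open>y\<close>.\<close>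

definition galois_rat :: "('c::field \<Rightarrow> 'c) \<Rightarrow> 'c poly fract \<Rightarrow> 'c poly fract" where
  "galois_rat \<sigma> h = (THE h'. \<forall>p q. q \<noteq> 0 \<longrightarrow> h = Fract p q \<longrightarrow> h' = Fract (map_poly \<sigma> p) (map_poly \<sigma> q))"

definition galois_ff :: "('k::field alg_closure \<Rightarrow> 'k alg_closure) \<Rightarrow> 'k ff \<Rightarrow> 'k ff" where
  "galois_ff \<sigma> h = (galois_rat \<sigma> (fst h), galois_rat \<sigma> (snd h))"

definition galois_point ::
    "('k::field alg_closure \<Rightarrow> 'k alg_closure) \<Rightarrow> ('k ff \<Rightarrow> int) \<Rightarrow> ('k ff \<Rightarrow> int)" where
  "galois_point \<sigma> v = (\<lambda>h. v (galois_ff (inv_into UNIV \<sigma>) h))"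

definition galois_div ::
    "('k::field alg_closure \<Rightarrow> 'k alg_closure) \<Rightarrow>
     (('k ff \<Rightarrow> int) \<Rightarrow>\<^sub>0 int) \<Rightarrow> (('k ff \<Rightarrow> int) \<Rightarrow>\<^sub>0 int)" where
  "galois_div \<sigma> = frag_extend (\<lambda>v. frag_of (galois_point \<sigma> v))"

text \<open>
  The group \<open>J(K)\<close>: over the algebraic closure the points of the Jacobian are the divisor classes of
  degree \<open>0\<close>, and the \<open>K\<close>-rational ones (\<open>K\<close> perfect) are the Galois-invariant classes; a class is a
  coset, required to be invariant as a set.
\<close>

definition jacobian_points :: "'k::field poly \<Rightarrow> (('k ff \<Rightarrow> int) \<Rightarrow>\<^sub>0 int) set monoid" where
  "jacobian_points F =
     (Pic0 F)\<lparr>carrier := {C \<in> carrier (Pic0 F). \<forall>\<sigma>\<in>galois_group. galois_div \<sigma> ` C = C}\<rparr>"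

text \<open>
  Finitely generated of rank \<open>r\<close>: the direct product of a free abelian group on \<open>r\<close> generators and
  a finite group, which is necessarily the torsion subgroup.
\<close>

definition fg_abelian_of_rank :: "('a, 'b) monoid_scheme \<Rightarrow> nat \<Rightarrow> bool" where
  "fg_abelian_of_rank G r \<longleftrightarrow> comm_group G \<and>
     (\<exists>H. subgroup H G \<and> finite H \<and> G \<cong> free_Abelian_group {..<r} \<times>\<times> G\<lparr>carrier := H\<rparr>)"

end

theory Submission
  imports Defs
begin

text \<open>
  Let \<open>K = \<rat>(T)\<close> and let \<open>C\<close> be the curve \<open>y\<^sup>2 = T f(x) + 1\<close> over \<open>K\<close>, where \<open>f\<close> is a separable polynomial
  of degree \<open>2 g + 1\<close> over \<open>\<rat>\<close>. Over each root \<open>a\<close> of \<open>f\<close> the curve has the two points \<open>(a, 1)\<close> and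
  \<open>(a, -1)\<close>. For an orbit \<open>S\<close> of roots under the Galois group of \<open>K\<close>, the sum of the \<open>(a, 1) - \<infinity>\<close> over
  \<open>a \<in> S\<close> is an invariant divisor, and \<open>J(K)\<close> turns out to be generated by the classes of these
  divisors, subject to the single relation that their sum is the divisor of \<open>y - 1\<close>. So \<open>J(K)\<close> is free
  of rank one less than the number of orbits (\<open>pencil_rank\<close>). For the given \<open>f\<close> the roots \<open>0\<close> and
  \<open>\<plusminus>a\<^sub>k\<close> are fixed and the roots \<open>\<plusminus>i b\<^sub>l\<close> form pairs, which makes \<open>1 + 2 m + n = r + 1\<close> orbits
  (\<open>card_orbits\<close>).

  The reason for the generation is that the surface \<open>y\<^sup>2 = T f(x) + 1\<close> is birational to the plane:
  \<open>T = (y\<^sup>2 - 1) / f(x)\<close>. Outside the fibre \<open>f = 0\<close>, the Galois orbits of points of \<open>C\<close> correspond to prime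
  polynomials \<open>G(x, y)\<close> over \<open>\<rat>\<close>, namely the prime that vanishes at the orbit, and \<open>G\<close> has a simple zero
  at each point of its orbit and no other zero outside the fibre (\<open>vanishing_iff_dvd\<close>,
  \<open>same_prime_conjugate\<close>, \<open>prime_is_uniformizer\<close>). Modulo principal divisors an invariant divisor can
  therefore be moved into the fibre, where \<open>(a, -1)\<close> is equivalent to minus \<open>(a, 1)\<close> as \<open>x - a\<close> shows
  (\<open>invariant_divisor_in_span\<close>).

  For the independence, let the divisor of \<open>h\<close> be a combination of the orbits. After multiplication by a
  constant and a power of \<open>f\<close> one has \<open>h = A + B y\<close> with \<open>A, B \<in> \<rat>[T][x]\<close>, and its norm divides \<open>c f\<^sup>M\<close> with
  \<open>c \<in> \<rat>[T]\<close>. A descent on the prime factors of \<open>c\<close> multiplies \<open>h\<close> by constants and by functions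
  \<open>y \<mp> 1\<close> until it is a function of \<open>x\<close> alone (\<open>norm_dividing_imp_constant_gap\<close>). Hence the difference of the values of
  \<open>h\<close> at \<open>(a, 1)\<close> and \<open>(a, -1)\<close> is the same for all roots \<open>a\<close>, and all coefficients of the combination
  are equal (\<open>orbit_classes_relation\<close>).

  These arguments need the geometry of \<open>C\<close> in explicit form. The points are valuations; each of them
  is determined by its centre and exists because of a parametrisation by Laurent series
  (\<open>points_cases\<close>). The genus is computed from explicit bases of enough Riemann-Roch spaces
  (\<open>genus\<close>). Finally, the elements of \<open>J(K)\<close> are invariant classes of divisors, and such a class contains
  an invariant divisor, because its effective representative of least degree relative to the rational
  point \<open>\<infinity>\<close> is unique (\<open>invariant_class_has_invariant_divisor\<close>).
\<close>

section \<open>Ring homomorphisms between types\<close>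

definition is_hom :: "('a::comm_ring_1 \<Rightarrow> 'b::comm_ring_1) \<Rightarrow> bool" where
  "is_hom f \<longleftrightarrow> f 1 = 1 \<and> (\<forall>x y. f (x + y) = f x + f y) \<and> (\<forall>x y. f (x * y) = f x * f y)"

lemma is_homI:
  assumes "f 1 = 1" "\<And>x y. f (x + y) = f x + f y" "\<And>x y. f (x * y) = f x * f y"
  shows "is_hom f"
  using assms unfolding is_hom_def by blast

lemma hom_1: "is_hom f \<Longrightarrow> f 1 = 1"
  and hom_add: "is_hom f \<Longrightarrow> f (x + y) = f x + f y"
  and hom_mult: "is_hom f \<Longrightarrow> f (x * y) = f x * f y"
  unfolding is_hom_def by auto

lemma hom_0: assumes "is_hom f" shows "f 0 = 0"
  using hom_add[OF assms, of 0 0] by simp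

lemma hom_uminus: assumes "is_hom f" shows "f (- x) = - f x"
  using hom_add[OF assms, of "x" "- x"] by (simp add: hom_0[OF assms] add_eq_0_iff)

lemma hom_diff: assumes "is_hom f" shows "f (x - y) = f x - f y"
  using hom_add[OF assms, of "x" "- y"] by (simp add: hom_uminus[OF assms])

lemma hom_power: assumes "is_hom f" shows "f (x ^ n) = f x ^ n"
  by (induction n) (simp_all add: hom_1[OF assms] hom_mult[OF assms])

lemma hom_sum: assumes "is_hom f" shows "f (sum h A) = (\<Sum>x\<in>A. f (h x))"
  by (induction A rule: infinite_finite_induct) (simp_all add: hom_0[OF assms] hom_add[OF assms])

lemma hom_prod: assumes "is_hom f" shows "f (prod h A) = (\<Prod>x\<in>A. f (h x))"
  by (induction A rule: infinite_finite_induct) (simp_all add: hom_1[OF assms] hom_mult[OF assms])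

lemmas hom_simps = hom_0 hom_1 hom_add hom_mult hom_uminus hom_diff hom_power

lemma is_hom_compose: "is_hom f \<Longrightarrow> is_hom h \<Longrightarrow> is_hom (\<lambda>x. f (h x))"
  by (rule is_homI) (simp_all add: hom_simps)

lemma is_hom_id: "is_hom (\<lambda>x. x)"
  by (rule is_homI) simp_all

lemma hom_eq_0_iff:
  fixes f :: "'a::field \<Rightarrow> 'b::comm_ring_1"
  assumes "is_hom f" shows "f x = 0 \<longleftrightarrow> x = 0"
proof
  assume "f x = 0"
  show "x = 0"
  proof (rule ccontr)
    assume "x \<noteq> 0"
    then have "f x * f (inverse x) = 1"
      using hom_mult[OF assms, of x "inverse x"] hom_1[OF assms] by simp
    with \<open>f x = 0\<close> show False by simp
  qed
qed (simp add: hom_0[OF assms])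

lemma hom_eq_iff:
  fixes f :: "'a::field \<Rightarrow> 'b::comm_ring_1"
  assumes "is_hom f" shows "f x = f y \<longleftrightarrow> x = y"
  using hom_eq_0_iff[OF assms, of "x - y"] by (simp add: hom_diff[OF assms])

lemma hom_inverse:
  fixes f :: "'a::field \<Rightarrow> 'b::field"
  assumes "is_hom f" shows "f (inverse x) = inverse (f x)"
proof (cases "x = 0")
  case False
  then have "f x * f (inverse x) = 1"
    using hom_mult[OF assms, of x "inverse x"] hom_1[OF assms] by simp
  then show ?thesis by (metis inverse_unique)
qed (simp add: hom_0[OF assms])

lemma hom_divide:
  fixes f :: "'a::field \<Rightarrow> 'b::field"
  assumes "is_hom f" shows "f (x / y) = f x / f y"
  by (simp add: divide_inverse hom_mult[OF assms] hom_inverse[OF assms])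

lemma is_hom_map_poly: assumes "is_hom f" shows "is_hom (map_poly f)"
proof (rule is_homI)
  note s = hom_simps[OF assms]
  show "map_poly f 1 = 1" by (simp add: s)
  show "map_poly f (p + q) = map_poly f p + map_poly f q" for p q
    by (rule poly_eqI) (simp add: coeff_map_poly s)
  show "map_poly f (p * q) = map_poly f p * map_poly f q" for p q
    by (rule poly_eqI) (simp add: coeff_map_poly s coeff_mult hom_sum[OF assms])
qed

lemma is_hom_poly: "is_hom (\<lambda>p. poly p x)"
  by (rule is_homI) simp_all

lemma is_hom_eval: "is_hom f \<Longrightarrow> is_hom (\<lambda>p. poly (map_poly f p) x)"
  by (rule is_hom_compose[OF is_hom_poly is_hom_map_poly])

lemma poly_map_poly_hom:
  assumes "is_hom f" shows "poly (map_poly f p) (f x) = f (poly p x)"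
  by (induction p) (simp_all add: hom_simps[OF assms] map_poly_pCons)

lemma map_poly_hom_compose:
  assumes "is_hom f" "is_hom h"
  shows "map_poly f (map_poly h p) = map_poly (\<lambda>x. f (h x)) p"
  by (rule poly_eqI) (simp add: coeff_map_poly hom_0 assms)

lemma map_poly_hom_smult: "is_hom f \<Longrightarrow> map_poly f (smult c p) = smult (f c) (map_poly f p)"
  by (rule poly_eqI) (simp add: coeff_map_poly hom_simps)

lemma map_poly_hom_pCons: "is_hom f \<Longrightarrow> map_poly f (pCons c p) = pCons (f c) (map_poly f p)"
  by (simp add: map_poly_pCons hom_0)

lemma degree_map_poly_hom:
  fixes f :: "'a::field \<Rightarrow> 'b::comm_ring_1"
  assumes "is_hom f" shows "Polynomial.degree (map_poly f p) = Polynomial.degree p"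
  by (rule degree_map_poly) (simp add: hom_eq_0_iff[OF assms])

lemma map_poly_hom_eq_0_iff:
  fixes f :: "'a::field \<Rightarrow> 'b::comm_ring_1"
  assumes "is_hom f" shows "map_poly f p = 0 \<longleftrightarrow> p = 0"
  by (rule map_poly_eq_0_iff) (simp_all add: hom_eq_0_iff[OF assms])

lemma map_poly_hom_pderiv: "is_hom f \<Longrightarrow> map_poly f (pderiv p) = pderiv (map_poly f p)"
proof (rule poly_eqI)
  fix n assume f: "is_hom f"
  have "f (of_nat k) = of_nat k" for k by (induction k) (simp_all add: hom_simps[OF f])
  then show "poly.coeff (map_poly f (pderiv p)) n = poly.coeff (pderiv (map_poly f p)) n"
    by (simp add: coeff_map_poly coeff_pderiv hom_simps[OF f] del: of_nat_Suc)
qed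

lemma is_hom_to_ac: "is_hom to_ac" by (rule is_homI) simp_all
lemma is_hom_to_fract: "is_hom to_fract" by (rule is_homI) simp_all
lemma is_hom_const_poly: "is_hom (\<lambda>c. [:c:])"
  by (rule is_homI) (simp_all add: one_pCons)
lemma is_hom_const_fn: "is_hom const_fn"
  unfolding const_fn_def by (rule is_hom_compose[OF is_hom_to_fract is_hom_const_poly])
lemma is_hom_fls_const: "is_hom (fls_const :: 'a::comm_ring_1 \<Rightarrow> _)"
  by (rule is_homI) (simp_all add: fls_plus_const)
lemma is_hom_fps_const: "is_hom (fps_const :: 'a::comm_ring_1 \<Rightarrow> _)"
  by (rule is_homI) simp_all
lemma is_hom_fps_to_fls: "is_hom (fps_to_fls :: 'a::comm_ring_1 fps \<Rightarrow> _)"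
  by (rule is_homI) (simp_all add: fls_times_fps_to_fls)
lemma is_hom_fps_nth_0: "is_hom (\<lambda>s :: 'a::comm_ring_1 fps. fps_nth s 0)"
  by (rule is_homI) simp_all

lemma order_simple_root:
  fixes p :: "'a::idom poly"
  assumes "poly p a = 0" "poly (pderiv p) a \<noteq> 0"
  shows "Polynomial.order a p = 1"
proof (rule antisym)
  have "p \<noteq> 0" using assms(2) by auto
  then show "1 \<le> Polynomial.order a p" using assms(1) order_root[of p a] by simp
  show "Polynomial.order a p \<le> 1"
  proof (rule ccontr)
    assume "\<not> ?thesis"
    then have "[:-a, 1:] ^ 2 dvd p" using \<open>p \<noteq> 0\<close> by (simp add: order_divides)
    then obtain q where "p = [:-a, 1:] * ([:-a, 1:] * q)" by (metis dvdE mult.assoc power2_eq_square)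
    then have "poly (pderiv p) a = 0" by (simp only: pderiv_mult poly_add poly_mult) simp
    then show False using assms(2) by simp
  qed
qed

text \<open>For an injective homomorphism \<open>f\<close>, the quotient \<open>f p / f q\<close> is the same for all representations \<open>p / q\<close>
  of \<open>z\<close>.\<close>

definition fract_ext :: "('a::idom \<Rightarrow> 'b::field) \<Rightarrow> 'a fract \<Rightarrow> 'b" where
  "fract_ext f z = (THE w. \<forall>p q. q \<noteq> 0 \<longrightarrow> z = Fract p q \<longrightarrow> w = f p / f q)"

locale injective_hom =
  fixes f :: "'a::idom \<Rightarrow> 'b::field"
  assumes hom: "is_hom f" and inj: "f x = 0 \<Longrightarrow> x = 0"
begin

lemma fract_ext_Fract: assumes "b \<noteq> 0" shows "fract_ext f (Fract a b) = f a / f b"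
  unfolding fract_ext_def
proof (rule the_equality)
  show "\<forall>p q. q \<noteq> 0 \<longrightarrow> Fract a b = Fract p q \<longrightarrow> f a / f b = f p / f q"
  proof (intro allI impI)
    fix p q assume q: "q \<noteq> 0" and "Fract a b = Fract p q"
    then have "a * q = p * b" using assms by (simp add: eq_fract)
    then have "f a * f q = f p * f b" by (metis hom_mult[OF hom])
    moreover have "f b \<noteq> 0" "f q \<noteq> 0" using inj assms q by blast+
    ultimately show "f a / f b = f p / f q" by (simp add: frac_eq_eq)
  qed
qed (use assms in blast)

lemma fract_ext_to_fract [simp]: "fract_ext f (to_fract a) = f a"
  using fract_ext_Fract[of 1 a] by (simp add: to_fract_def hom_1[OF hom])

lemma is_hom_fract_ext: "is_hom (fract_ext f)"
proof (rule is_homI)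
  show "fract_ext f 1 = 1" by (metis fract_ext_to_fract hom_1[OF hom] to_fract_1)
  fix x y :: "'a fract"
  obtain a b where x: "x = Fract a b" "b \<noteq> 0" by (cases x) auto
  obtain c d where y: "y = Fract c d" "d \<noteq> 0" by (cases y) auto
  have nz: "f b \<noteq> 0" "f d \<noteq> 0" using inj x y by blast+
  show "fract_ext f (x + y) = fract_ext f x + fract_ext f y"
    using nz by (simp add: x y fract_ext_Fract hom_simps[OF hom] add_frac_eq)
  show "fract_ext f (x * y) = fract_ext f x * fract_ext f y"
    using nz by (simp add: x y fract_ext_Fract hom_simps[OF hom])
qed

end

text \<open>Evaluating polynomials over an algebraically closed field at a nonconstant element of a field
  extension is injective, because they split into linear factors.\<close>

lemma eval_nonconstant_injective:
  fixes c :: "'a::alg_closed_field \<Rightarrow> 'b::field"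
  assumes c: "is_hom c" and z: "\<And>a. z \<noteq> c a" and p: "poly (map_poly c p) z = 0"
  shows "p = 0"
proof (rule ccontr)
  assume "p \<noteq> 0"
  then obtain A where A: "p = smult (Polynomial.lead_coeff p) (\<Prod>x\<in>#A. [:-x, 1:])"
    using alg_closed_imp_factorization by blast
  have ne: "poly (map_poly c ((\<Prod>x\<in>#A. [:-x, 1:]))) z \<noteq> 0"
  proof (induction A)
    case empty
    then show ?case by (simp add: hom_simps[OF c])
  next
    case (add x A)
    have "poly (map_poly c [:-x, 1:]) z \<noteq> 0"
      using z by (simp add: map_poly_hom_pCons[OF c] hom_simps[OF c])
    with add show ?case
      by (simp only: image_mset_add_mset prod_mset.add_mset hom_mult[OF is_hom_map_poly[OF c]]
          poly_mult mult_eq_0_iff simp_thms)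
  qed
  have "c (Polynomial.lead_coeff p) \<noteq> 0" using \<open>p \<noteq> 0\<close> by (simp add: hom_eq_0_iff[OF c])
  with ne have "poly (map_poly c p) z \<noteq> 0"
    by (subst A) (simp add: map_poly_hom_smult[OF c])
  with p show False by simp
qed

section \<open>Automorphisms of the algebraic closure\<close>

text \<open>The graph of an embedding over \<open>K\<close> of an intermediate ring in the algebraic closure. The last
  condition says that the relation is a function. With graphs, the union of a chain of embeddings is
  just a union of sets.\<close>

definition partial_aut :: "('k::field alg_closure \<times> 'k alg_closure) set \<Rightarrow> bool" where
  "partial_aut G \<longleftrightarrow> (\<forall>c. (to_ac c, to_ac c) \<in> G) \<and>
     (\<forall>a b a' b'. (a, b) \<in> G \<longrightarrow> (a', b') \<in> G \<longrightarrow> (a + a', b + b') \<in> G \<and> (a * a', b * b') \<in> G) \<and>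
     (\<forall>b. (0, b) \<in> G \<longrightarrow> b = 0)"

text \<open>The embedding applied to the coefficients of polynomials.\<close>

definition poly_pairs :: "('a::zero \<times> 'b::zero) set \<Rightarrow> ('a poly \<times> 'b poly) set" where
  "poly_pairs G = {(q, q'). \<forall>i. (poly.coeff q i, poly.coeff q' i) \<in> G}"

context
  fixes G :: "('k::field alg_closure \<times> 'k alg_closure) set"
  assumes G: "partial_aut G"
begin

lemma pa_const: "(to_ac c, to_ac c) \<in> G"
  and pa_add: "(a, b) \<in> G \<Longrightarrow> (a', b') \<in> G \<Longrightarrow> (a + a', b + b') \<in> G"
  and pa_mult: "(a, b) \<in> G \<Longrightarrow> (a', b') \<in> G \<Longrightarrow> (a * a', b * b') \<in> G"
  and pa_zero: "(0, b) \<in> G \<Longrightarrow> b = 0"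
  using G unfolding partial_aut_def by blast+

lemma pa_0: "(0, 0) \<in> G" and pa_1: "(1, 1) \<in> G"
  using pa_const[of 0] pa_const[of 1] by simp_all

lemma pa_uminus: assumes "(a, b) \<in> G" shows "(- a, - b) \<in> G"
  using pa_mult[OF pa_const[of "- 1"] assms] by simp

lemma pa_diff: "(a, b) \<in> G \<Longrightarrow> (a', b') \<in> G \<Longrightarrow> (a - a', b - b') \<in> G"
  using pa_add[of a b "- a'" "- b'"] pa_uminus by simp

lemma pa_unique: "(a, b) \<in> G \<Longrightarrow> (a, b') \<in> G \<Longrightarrow> b = b'"
  using pa_diff[of a b a b'] pa_zero by fastforce

lemma pa_sum: "(\<And>i. i \<in> A \<Longrightarrow> (h i, h' i) \<in> G) \<Longrightarrow> (sum h A, sum h' A) \<in> G"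
  by (induction A rule: infinite_finite_induct) (auto intro: pa_0 pa_add)

lemma pp_add: "(p, p') \<in> poly_pairs G \<Longrightarrow> (q, q') \<in> poly_pairs G \<Longrightarrow> (p + q, p' + q') \<in> poly_pairs G"
  and pp_diff: "(p, p') \<in> poly_pairs G \<Longrightarrow> (q, q') \<in> poly_pairs G \<Longrightarrow> (p - q, p' - q') \<in> poly_pairs G"
  and pp_mult: "(p, p') \<in> poly_pairs G \<Longrightarrow> (q, q') \<in> poly_pairs G \<Longrightarrow> (p * q, p' * q') \<in> poly_pairs G"
  by (simp_all add: poly_pairs_def pa_add pa_diff coeff_mult pa_sum pa_mult)

lemma pp_monom: "(a, b) \<in> G \<Longrightarrow> (Polynomial.monom a n, Polynomial.monom b n) \<in> poly_pairs G"
  unfolding poly_pairs_def by (auto intro: pa_0)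

lemma pp_const: "(a, b) \<in> G \<Longrightarrow> ([:a:], [:b:]) \<in> poly_pairs G"
  using pp_monom[of a b 0] by (simp add: monom_0)

lemma pp_base: "(map_poly to_ac p, map_poly to_ac p) \<in> poly_pairs G"
  unfolding poly_pairs_def by (simp add: coeff_map_poly pa_const)

lemma pa_poly:
  assumes "(q, q') \<in> poly_pairs G" "(a, b) \<in> G" shows "(poly q a, poly q' b) \<in> G"
  using assms
proof (induction q arbitrary: q')
  case 0
  then have "q' = 0" using pa_zero by (auto simp: poly_pairs_def poly_eq_iff)
  then show ?case by (simp add: pa_0)
next
  case (pCons c q)
  obtain c' r' where r': "q' = pCons c' r'" by (cases q')
  have pair: "(poly.coeff (pCons c q) i, poly.coeff (pCons c' r') i) \<in> G" for i
    using pCons.prems r' by (simp add: poly_pairs_def)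
  have "(c, c') \<in> G" using pair[of 0] by simp
  moreover have "(q, r') \<in> poly_pairs G"
    using pair[of "Suc _"] by (simp add: poly_pairs_def)
  then have "(poly q a, poly r' b) \<in> G" using pCons.IH pCons.prems by blast
  ultimately show ?case using pCons.prems by (simp add: r' pa_add pa_mult)
qed

text \<open>The domain of a partial automorphism is algebraic over the base field, hence a field.\<close>

lemma pa_inverse: assumes ab: "(a, b) \<in> G" and a: "a \<noteq> 0" shows "(inverse a, inverse b) \<in> G"
proof -
  define P where "P = (\<lambda>p :: 'k poly. p \<noteq> 0 \<and> poly (map_poly to_ac p) a = 0)"
  obtain p0 where "P p0" unfolding P_def using alg_closure_algebraic[of a] by blast
  then obtain p where p: "P p" and min: "\<And>q. P q \<Longrightarrow> Polynomial.degree p \<le> Polynomial.degree q"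
    using ex_has_least_nat[of P p0 Polynomial.degree] by blast
  obtain c q where cq: "p = pCons c q" by (cases p)
  have root: "to_ac c + a * poly (map_poly to_ac q) a = 0"
    using p unfolding P_def cq by (simp add: map_poly_hom_pCons[OF is_hom_to_ac])
  have c: "c \<noteq> 0"
  proof
    assume "c = 0"
    then have "P q" using p root a unfolding P_def cq by auto
    with min[OF this] show False using p unfolding P_def cq by (auto split: if_splits)
  qed
  define s where "s = to_ac (- inverse c) * poly (map_poly to_ac q) a"
  define s' where "s' = to_ac (- inverse c) * poly (map_poly to_ac q) b"
  have ss: "(s, s') \<in> G"
    unfolding s_def s'_def by (intro pa_mult pa_const pa_poly pp_base ab)
  have "a * poly (map_poly to_ac q) a = - to_ac c" using root by (simp add: eq_neg_iff_add_eq_0 add.commute)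
  then have as: "a * s = 1"
    unfolding s_def using c by (simp add: mult.left_commute[of a])
  have "(1, b * s') \<in> G" using pa_mult[OF ab ss] as by simp
  then have "b * s' = 1" using pa_unique[OF pa_1] by simp
  then show ?thesis using ss as by (metis inverse_unique)
qed

text \<open>A monic \<open>p\<close> of least degree over the domain with \<open>p(z) = 0\<close> divides every \<open>q\<close> over the domain with
  \<open>q(z) = 0\<close>. So \<open>z\<close> can be sent to any root \<open>w\<close> of the image \<open>p'\<close> of \<open>p\<close>.\<close>

lemma partial_aut_extend:
  shows "\<exists>G' w. partial_aut G' \<and> G \<subseteq> G' \<and> (z, w) \<in> G'"
proof -
  define P where "P = (\<lambda>(p, p'). (p, p') \<in> poly_pairs G \<and> p \<noteq> 0 \<and> poly p z = 0)"
  obtain p0 :: "'k poly" where "p0 \<noteq> 0" "poly (map_poly to_ac p0) z = 0" using alg_closure_algebraic[of z] by blast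
  then have "P (map_poly to_ac p0, map_poly to_ac p0)"
    unfolding P_def by (simp add: pp_base map_poly_hom_eq_0_iff[OF is_hom_to_ac])
  then obtain r where r: "P r" and
    min: "\<And>s. P s \<Longrightarrow> Polynomial.degree (fst r) \<le> Polynomial.degree (fst s)"
    using ex_has_least_nat[of P _ "\<lambda>s. Polynomial.degree (fst s)"] by blast
  obtain p1 p1' where p1: "r = (p1, p1')" by (cases r)
  define d where "d = Polynomial.degree p1"
  define l where "l = inverse (poly.coeff p1 d)"
  define l' where "l' = inverse (poly.coeff p1' d)"
  have l: "(l, l') \<in> G" unfolding l_def l'_def
    by (rule pa_inverse) (use r in \<open>auto simp: P_def p1 d_def poly_pairs_def\<close>)
  define p where "p = [:l:] * p1"
  define p' where "p' = [:l':] * p1'"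
  have lnz: "l \<noteq> 0" using r by (auto simp: l_def P_def p1 d_def)
  have pp: "(p, p') \<in> poly_pairs G"
    unfolding p_def p'_def using r by (auto simp: P_def p1 simp del: mult_pCons_left intro!: pp_mult pp_const l)
  have p_root: "poly p z = 0" using r by (simp add: p_def P_def p1)
  have degp: "Polynomial.degree p = d" using lnz by (simp add: p_def d_def)
  have pd: "poly.coeff p d = 1" using r by (simp add: p_def l_def d_def P_def p1)
  have "(poly.coeff p d, poly.coeff p' d) \<in> G" using pp by (simp add: poly_pairs_def)
  then have "(1, poly.coeff p' d) \<in> G" using pd by simp
  then have p'd: "poly.coeff p' d = 1" using pa_unique[OF pa_1] by metis
  have deg_le: "Polynomial.degree q' \<le> Polynomial.degree q" if "(q, q') \<in> poly_pairs G" for q q'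
  proof (rule degree_le, intro allI impI)
    fix i assume "Polynomial.degree q < i"
    then show "poly.coeff q' i = 0" using that pa_zero[of "poly.coeff q' i"]
      by (auto simp: poly_pairs_def coeff_eq_0 dest!: spec[of _ i])
  qed
  have degp': "Polynomial.degree p' = d"
    using deg_le[OF pp] p'd degp by (intro antisym le_degree) auto
  have "d > 0"
  proof (rule ccontr)
    assume "\<not> d > 0"
    then obtain c where "p = [:c:]" using degp by (metis degree_eq_zeroE gr0I)
    then show False using p_root pd \<open>\<not> d > 0\<close> by simp
  qed
  then obtain w where w: "poly p' w = 0" using alg_closed_imp_poly_has_root degp' by blast
  \<comment> \<open>Division by the monic \<open>p\<close>, one leading term at a time, in parallel with division by \<open>p'\<close>.\<close>
  have key: "poly q' w = 0" if "(q, q') \<in> poly_pairs G" "poly q z = 0" for q q'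
    using that
  proof (induction "Polynomial.degree q" arbitrary: q q' rule: less_induct)
    case less
    show ?case
    proof (cases "q = 0")
      case True
      then have "q' = 0" using less.prems pa_zero by (auto simp: poly_pairs_def poly_eq_iff)
      then show ?thesis by simp
    next
      case False
      define n where "n = Polynomial.degree q"
      have dn: "d \<le> n" using min[of "(q, q')"] less.prems False by (simp add: P_def p1 d_def n_def)
      define m where "m = Polynomial.monom (poly.coeff q n) (n - d)"
      define m' where "m' = Polynomial.monom (poly.coeff q' n) (n - d)"
      have mm: "(m, m') \<in> poly_pairs G"
        unfolding m_def m'_def using less.prems by (intro pp_monom) (simp add: poly_pairs_def)
      have new: "(q - m * p, q' - m' * p') \<in> poly_pairs G"
        by (intro pp_diff pp_mult mm pp less.prems)
      have zero: "poly (q - m * p) z = 0" using less.prems p_root by simp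
      have mpn: "poly.coeff (m * p) n = poly.coeff q n"
        unfolding m_def using dn pd by (simp add: coeff_monom_mult)
      have degm: "Polynomial.degree (m * p) \<le> n"
        using degree_mult_le[of m p] degree_monom_le[of "poly.coeff q n" "n - d"] dn degp
        unfolding m_def by linarith
      have "poly (q' - m' * p') w = 0"
      proof (cases "n = 0")
        case True
        then show ?thesis using dn \<open>d > 0\<close> by simp
      next
        case n: False
        have "Polynomial.degree (q - m * p) < n"
        proof (rule degree_lessI)
          show "q - m * p \<noteq> 0 \<or> 0 < n" using n by simp
          show "\<forall>k\<ge>n. poly.coeff (q - m * p) k = 0"
          proof (intro allI impI)
            fix k assume "n \<le> k"
            show "poly.coeff (q - m * p) k = 0"
            proof (cases "k = n")
              case False
              then have "n < k" using \<open>n \<le> k\<close> by simp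
              then show ?thesis using degm by (simp add: coeff_eq_0 n_def)
            qed (simp add: mpn)
          qed
        qed
        then show ?thesis using less.hyps[OF _ new zero] by (simp add: n_def)
      qed
      then show ?thesis using w by simp
    qed
  qed
  define G' where "G' = {(poly q z, poly q' w) | q q'. (q, q') \<in> poly_pairs G}"
  have sub: "(a, b) \<in> G'" if "(a, b) \<in> G" for a b
    unfolding G'_def mem_Collect_eq
    by (rule exI[of _ "[:a:]"], rule exI[of _ "[:b:]"]) (simp add: pp_const[OF that])
  have "partial_aut G'"
    unfolding partial_aut_def
  proof (intro conjI allI impI)
    show "(to_ac c, to_ac c) \<in> G'" for c by (intro sub pa_const)
    show "b = 0" if "(0, b) \<in> G'" for b using that key unfolding G'_def by force
    fix a b a' b' assume "(a, b) \<in> G'" "(a', b') \<in> G'"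
    then obtain q q' s s' where "(q, q') \<in> poly_pairs G" "(s, s') \<in> poly_pairs G"
      "a = poly q z" "b = poly q' w" "a' = poly s z" "b' = poly s' w"
      unfolding G'_def by auto
    note st = this
    show "(a + a', b + b') \<in> G'" unfolding G'_def mem_Collect_eq
      by (rule exI[of _ "q + s"], rule exI[of _ "q' + s'"]) (simp add: st pp_add)
    show "(a * a', b * b') \<in> G'" unfolding G'_def mem_Collect_eq
      by (rule exI[of _ "q * s"], rule exI[of _ "q' * s'"]) (simp add: st pp_mult)
  qed
  moreover have "(z, w) \<in> G'"
    unfolding G'_def mem_Collect_eq
    by (rule exI[of _ "Polynomial.monom 1 1"], rule exI[of _ "Polynomial.monom 1 1"])
      (simp add: poly_monom pp_monom[OF pa_1])
  moreover have "G \<subseteq> G'" using sub by auto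
  ultimately show ?thesis by (intro exI conjI)
qed

end

lemma galois_groupD:
  assumes "\<sigma> \<in> galois_group"
  shows "is_hom \<sigma>" "bij \<sigma>" "\<sigma> (to_ac c) = to_ac c"
proof -
  show "bij \<sigma>" "\<sigma> (to_ac c) = to_ac c" using assms by (auto simp: galois_group_def)
  have "\<sigma> 1 = 1" using assms by (metis (mono_tags, lifting) galois_group_def mem_Collect_eq to_ac_1)
  then show "is_hom \<sigma>" using assms by (auto simp: galois_group_def intro!: is_homI)
qed

text \<open>By Zorn's lemma there is a maximal embedding that extends \<open>G\<close>, and by the previous lemma its domain
  is everything. It is surjective, as it permutes the finitely many roots of every polynomial over \<open>K\<close>.\<close>

theorem partial_aut_extends_to_galois_group:
  assumes "partial_aut G"
  shows "\<exists>\<sigma>\<in>galois_group. \<forall>a b. (a, b) \<in> G \<longrightarrow> \<sigma> a = b"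
proof -
  define S where "S = {H. partial_aut H \<and> G \<subseteq> H}"
  have "\<exists>M\<in>S. \<forall>H\<in>S. M \<subseteq> H \<longrightarrow> H = M"
  proof (rule subset_Zorn_nonempty)
    show "S \<noteq> {}" using assms by (auto simp: S_def)
    fix \<C> assume ne: "\<C> \<noteq> {}" and ch: "subset.chain S \<C>"
    have mem: "partial_aut H \<and> G \<subseteq> H" if "H \<in> \<C>" for H
      using ch that by (auto simp: subset.chain_def S_def)
    have dir: "\<exists>H\<in>\<C>. s \<in> H \<and> t \<in> H" if st: "s \<in> \<Union>\<C>" "t \<in> \<Union>\<C>" for s t
    proof -
      obtain H H' where "H \<in> \<C>" "s \<in> H" "H' \<in> \<C>" "t \<in> H'" using st by blast
      moreover from this have "H \<subseteq> H' \<or> H' \<subseteq> H" using ch by (auto simp: subset_chain_def)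
      ultimately show ?thesis by blast
    qed
    have "partial_aut (\<Union>\<C>)"
      unfolding partial_aut_def
    proof (intro conjI allI impI)
      show "(to_ac c, to_ac c) \<in> \<Union>\<C>" for c using ne mem pa_const by blast
      show "b = 0" if "(0, b) \<in> \<Union>\<C>" for b using that mem pa_zero by blast
      fix a b a' b' assume "(a, b) \<in> \<Union>\<C>" "(a', b') \<in> \<Union>\<C>"
      from dir[OF this] obtain H where "H \<in> \<C>" "(a, b) \<in> H" "(a', b') \<in> H" by blast
      then show "(a + a', b + b') \<in> \<Union>\<C>" "(a * a', b * b') \<in> \<Union>\<C>"
        using mem pa_add pa_mult by blast+
    qed
    then show "\<Union>\<C> \<in> S" using ne mem by (auto simp: S_def)
  qed
  then obtain M where MS: "M \<in> S" and maxS: "\<forall>H\<in>S. M \<subseteq> H \<longrightarrow> H = M" by (elim bexE)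
  have M: "partial_aut M" "G \<subseteq> M" using MS by (simp_all add: S_def)
  have max: "H = M" if H: "partial_aut H" "M \<subseteq> H" for H
    using maxS[rule_format, of H] H M(2) by (simp add: S_def)
  have tot: "\<exists>w. (z, w) \<in> M" for z
  proof -
    from partial_aut_extend[OF M(1), of z]
    obtain H w where H: "partial_aut H" "M \<subseteq> H" "(z, w) \<in> H" by (elim exE conjE)
    have "H = M" by (rule max[OF H(1,2)])
    with H(3) show ?thesis by (intro exI[of _ w]) simp
  qed
  define \<sigma> where "\<sigma> z = (THE w. (z, w) \<in> M)" for z
  have eq: "\<sigma> z = w" if "(z, w) \<in> M" for z w
    unfolding \<sigma>_def using that pa_unique[OF M(1)] by blast
  have mem: "(z, \<sigma> z) \<in> M" for z using tot[of z] eq by metis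
  have fix_base: "\<sigma> (to_ac c) = to_ac c" for c by (intro eq pa_const M)
  have hom: "is_hom \<sigma>"
  proof (rule is_homI)
    show "\<sigma> 1 = 1" by (intro eq pa_1 M)
  qed (intro eq pa_add pa_mult M mem)+
  have inj: "inj \<sigma>" by (rule injI) (simp add: hom_eq_iff[OF hom])
  have "surj \<sigma>"
    unfolding surj_def
  proof
    fix y
    obtain p :: "'a poly" where p: "p \<noteq> 0" "poly (map_poly to_ac p) y = 0" using alg_closure_algebraic[of y] by blast
    define R where "R = {r. poly (map_poly to_ac p) r = 0}"
    have fin: "finite R" unfolding R_def using p by (intro poly_roots_finite) (simp add: map_poly_hom_eq_0_iff[OF is_hom_to_ac])
    have "\<sigma> ` R \<subseteq> R"
    proof
      fix s assume "s \<in> \<sigma> ` R"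
      then obtain r where r: "s = \<sigma> r" "poly (map_poly to_ac p) r = 0" unfolding R_def by blast
      have "map_poly \<sigma> (map_poly to_ac p) = map_poly to_ac p"
        by (simp add: map_poly_hom_compose[OF hom is_hom_to_ac] fix_base)
      then have "poly (map_poly to_ac p) s = 0"
        using poly_map_poly_hom[OF hom, of "map_poly to_ac p" r] r by (simp add: hom_0[OF hom])
      then show "s \<in> R" unfolding R_def by simp
    qed
    then have "\<sigma> ` R = R" using fin inj by (metis card_image card_subset_eq inj_on_subset subset_UNIV)
    moreover have "y \<in> R" using p by (simp add: R_def)
    ultimately show "\<exists>x. y = \<sigma> x" by blast
  qed
  with inj have "\<sigma> \<in> galois_group"
    unfolding galois_group_def bij_def mem_Collect_eq
    by (intro conjI allI hom_add[OF hom] hom_mult[OF hom] fix_base)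
  then show ?thesis using eq M(2) by blast
qed

text \<open>A polynomial of least degree that vanishes at \<open>x\<close>; in characteristic 0 its derivative is a nonzero
  polynomial of smaller degree, so it does not vanish there.\<close>

lemma minimal_polynomial:
  fixes x :: "'k::field_char_0 alg_closure"
  obtains p :: "'k poly" where "p \<noteq> 0" "\<And>q. poly (map_poly to_ac q) x = 0 \<longleftrightarrow> p dvd q"
    "poly (map_poly to_ac (pderiv p)) x \<noteq> 0"
proof -
  note h = is_hom_map_poly[OF is_hom_to_ac]
  define P where "P = (\<lambda>p :: 'k poly. p \<noteq> 0 \<and> poly (map_poly to_ac p) x = 0)"
  obtain p0 where "P p0" unfolding P_def using alg_closure_algebraic[of x] by blast
  then obtain p where p: "P p" and min: "\<And>q. P q \<Longrightarrow> Polynomial.degree p \<le> Polynomial.degree q"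
    using ex_has_least_nat[of P p0 Polynomial.degree] by blast
  have pnz: "p \<noteq> 0" and root: "poly (map_poly to_ac p) x = 0" using p by (auto simp: P_def)
  have "poly (map_poly to_ac q) x = 0 \<longleftrightarrow> p dvd q" for q
  proof
    assume q: "poly (map_poly to_ac q) x = 0"
    have "map_poly to_ac q = map_poly to_ac p * map_poly to_ac (q div p) + map_poly to_ac (q mod p)"
      by (metis hom_add[OF h] hom_mult[OF h] mult_div_mod_eq)
    with q root have "poly (map_poly to_ac (q mod p)) x = 0" by simp
    then have "\<not> P (q mod p) \<Longrightarrow> q mod p = 0" by (simp add: P_def)
    moreover have "\<not> P (q mod p)"
      using min[of "q mod p"] degree_mod_less[OF pnz, of q] by (auto simp: P_def)
    ultimately show "p dvd q" by (simp add: mod_eq_0_iff_dvd)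
  next
    assume "p dvd q"
    then show "poly (map_poly to_ac q) x = 0" using root by (auto simp: dvd_def hom_mult[OF h])
  qed
  moreover have "poly (map_poly to_ac (pderiv p)) x \<noteq> 0"
  proof
    assume "poly (map_poly to_ac (pderiv p)) x = 0"
    moreover have d: "Polynomial.degree p \<noteq> 0"
    proof
      assume "Polynomial.degree p = 0"
      then obtain c where "p = [:c:]" by (metis degree_eq_zeroE)
      then show False using pnz root by (simp add: map_poly_hom_pCons[OF is_hom_to_ac])
    qed
    moreover have "pderiv p \<noteq> 0" using d by (simp add: pderiv_eq_0_iff)
    ultimately have "P (pderiv p)" by (simp add: P_def)
    from min[OF this] d show False by (simp add: degree_pderiv)
  qed
  ultimately show thesis using that pnz by blast
qed

text \<open>If the minimal polynomial of \<open>x\<close> is not linear, it has a second root \<open>x'\<close>, and some automorphism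
  sends \<open>x\<close> to \<open>x'\<close>.\<close>

theorem galois_fixed_field:
  fixes x :: "'k::field_char_0 alg_closure"
  assumes fix_x: "\<And>\<sigma>. \<sigma> \<in> galois_group \<Longrightarrow> \<sigma> x = x"
  shows "x \<in> range to_ac"
proof -
  note h = is_hom_map_poly[OF is_hom_to_ac]
  obtain p :: "'k poly" where pnz: "p \<noteq> 0" and dvd: "\<And>q. poly (map_poly to_ac q) x = 0 \<longleftrightarrow> p dvd q"
    and sep: "poly (map_poly to_ac (pderiv p)) x \<noteq> 0" using minimal_polynomial[of x] by blast
  have "poly (map_poly to_ac p) x = 0" using dvd[of p] by simp
  then obtain q where q: "map_poly to_ac p = [:-x, 1:] * q" by (meson dvdE poly_eq_0_iff_dvd)
  have qx: "poly q x \<noteq> 0"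
    using sep unfolding map_poly_hom_pderiv[OF is_hom_to_ac] q pderiv_mult by (simp add: pderiv_pCons)
  show ?thesis
  proof (cases "Polynomial.degree q = 0")
    case True
    then obtain c where c: "q = [:c:]" by (metis degree_eq_zeroE)
    then have "c \<noteq> 0" using qx by simp
    have "map_poly to_ac p = [:- x * c, c:]" by (simp add: q c mult.commute)
    then have "to_ac (poly.coeff p 0) = - x * c" "to_ac (poly.coeff p 1) = c"
      by (metis coeff_map_poly coeff_pCons_0 to_ac_0,
          metis One_nat_def coeff_map_poly coeff_pCons_0 coeff_pCons_Suc to_ac_0)
    then have "x = to_ac (- poly.coeff p 0 / poly.coeff p 1)" using \<open>c \<noteq> 0\<close> by simp
    then show ?thesis by blast
  next
    case False
    then obtain x' where x': "poly q x' = 0" using alg_closed_imp_poly_has_root by blast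
    have x'p: "poly (map_poly to_ac p) x' = 0" by (simp add: q x')
    define G where "G = {(poly (map_poly to_ac s) x, poly (map_poly to_ac s) x') | s. True}"
    have "partial_aut G"
      unfolding partial_aut_def
    proof (intro conjI allI impI)
      show "(to_ac c, to_ac c) \<in> G" for c
        unfolding G_def mem_Collect_eq by (rule exI[of _ "[:c:]"]) (simp add: map_poly_hom_pCons[OF is_hom_to_ac])
      show "b = 0" if bG: "(0, b) \<in> G" for b
      proof -
        obtain s where "(0, b) = (poly (map_poly to_ac s) x, poly (map_poly to_ac s) x')"
          using bG unfolding G_def by blast
        then have s: "poly (map_poly to_ac s) x = 0" "b = poly (map_poly to_ac s) x'" by simp_all
        then obtain t where "s = p * t" using dvd by (meson dvdE)
        then show ?thesis using s x'p by (simp add: hom_mult[OF h])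
      qed
      fix a b a' b' assume "(a, b) \<in> G" "(a', b') \<in> G"
      then obtain s t where st: "a = poly (map_poly to_ac s) x" "b = poly (map_poly to_ac s) x'"
        "a' = poly (map_poly to_ac t) x" "b' = poly (map_poly to_ac t) x'" unfolding G_def by auto
      show "(a + a', b + b') \<in> G" unfolding G_def mem_Collect_eq
        by (rule exI[of _ "s + t"]) (simp add: st hom_add[OF h])
      show "(a * a', b * b') \<in> G" unfolding G_def mem_Collect_eq
        by (rule exI[of _ "s * t"]) (simp add: st hom_mult[OF h])
    qed
    from partial_aut_extends_to_galois_group[OF this]
    obtain \<sigma> where \<sigma>: "\<sigma> \<in> galois_group" and \<sigma>G: "\<forall>a b. (a, b) \<in> G \<longrightarrow> \<sigma> a = b"
      by (elim bexE)
    have "(x, x') \<in> G" unfolding G_def mem_Collect_eq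
      by (rule exI[of _ "[:0, 1:]"]) (simp add: map_poly_hom_pCons[OF is_hom_to_ac])
    then have "x = x'" using \<sigma>G fix_x[OF \<sigma>] by simp
    then show ?thesis using qx x' by simp
  qed
qed

lemma galois_inv:
  assumes "\<sigma> \<in> galois_group"
  shows "inv_into UNIV \<sigma> \<in> galois_group" "inv_into UNIV \<sigma> (\<sigma> x) = x" "\<sigma> (inv_into UNIV \<sigma> x) = x"
proof -
  note \<sigma> = galois_groupD[OF assms]
  let ?t = "inv_into UNIV \<sigma>"
  have i: "inv_into UNIV \<sigma> (\<sigma> x) = x" for x using \<sigma>(2) by (simp add: bij_is_inj)
  have s: "\<sigma> (inv_into UNIV \<sigma> x) = x" for x using \<sigma>(2) by (simp add: bij_is_surj surj_f_inv_f)
  show "inv_into UNIV \<sigma> (\<sigma> x) = x" "\<sigma> (inv_into UNIV \<sigma> x) = x" using i s by auto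
  show "?t \<in> galois_group"
    unfolding galois_group_def mem_Collect_eq
  proof (intro conjI allI)
    show "bij ?t" using \<sigma>(2) by (rule bij_imp_bij_inv)
    show "?t (x + y) = ?t x + ?t y" for x y using i[of "?t x + ?t y"] by (simp add: hom_add[OF \<sigma>(1)] s)
    show "?t (x * y) = ?t x * ?t y" for x y using i[of "?t x * ?t y"] by (simp add: hom_mult[OF \<sigma>(1)] s)
    show "?t (to_ac c) = to_ac c" for c using i[of "to_ac c"] by (simp add: \<sigma>(3))
  qed
qed

text \<open>With this description, the action on rational functions inherits its properties from \<open>fract_ext\<close>.\<close>

lemma galois_rat_eq: "galois_rat \<sigma> = fract_ext (\<lambda>p. to_fract (map_poly \<sigma> p))"
  unfolding galois_rat_def fract_ext_def by (simp add: Fract_conv_to_fract)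

lemma injective_hom_galois:
  fixes \<sigma> :: "'c::field \<Rightarrow> 'c"
  assumes "is_hom \<sigma>" shows "injective_hom (\<lambda>p. to_fract (map_poly \<sigma> p))"
  by standard (auto intro: is_hom_compose[OF is_hom_to_fract is_hom_map_poly] assms
      simp: map_poly_hom_eq_0_iff[OF assms])

lemma is_hom_galois_rat:
  fixes \<sigma> :: "'c::field \<Rightarrow> 'c"
  assumes "is_hom \<sigma>" shows "is_hom (galois_rat \<sigma>)"
  unfolding galois_rat_eq by (rule injective_hom.is_hom_fract_ext[OF injective_hom_galois[OF assms]])

lemma galois_rat_to_fract:
  fixes \<sigma> :: "'c::field \<Rightarrow> 'c"
  assumes "is_hom \<sigma>" shows "galois_rat \<sigma> (to_fract p) = to_fract (map_poly \<sigma> p)"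
  unfolding galois_rat_eq by (rule injective_hom.fract_ext_to_fract[OF injective_hom_galois[OF assms]])

section \<open>The points of a hyperelliptic curve with one point at infinity\<close>

definition conj_ff :: "'k::field ff \<Rightarrow> 'k ff" where "conj_ff h = (fst h, - snd h)"

definition norm_ff :: "'k::field poly \<Rightarrow> 'k ff \<Rightarrow> 'k alg_closure poly fract" where
  "norm_ff F h = fst h * fst h - snd h * snd h * to_fract (geom F)"

definition of_rat_fn :: "'k::field alg_closure poly \<Rightarrow> 'k ff" where "of_rat_fn p = (to_fract p, 0)"

definition y_ff :: "'k::field ff" where "y_ff = (0, 1)"

lemma ff_mult_conj: "ff_mult F h (conj_ff h) = (norm_ff F h, 0)"
  by (simp add: ff_mult_def conj_ff_def norm_ff_def mult.commute)

lemma ff_mult_commute: "ff_mult F h h' = ff_mult F h' h"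
  by (simp add: ff_mult_def algebra_simps)

lemma ff_mult_assoc: "ff_mult F (ff_mult F h h') h'' = ff_mult F h (ff_mult F h' h'')"
  by (simp add: ff_mult_def algebra_simps)

lemma ff_mult_fst: "ff_mult F (a, 0) h = (a * fst h, a * snd h)"
  by (simp add: ff_mult_def)

lemma norm_ff_mult: "norm_ff F (ff_mult F h h') = norm_ff F h * norm_ff F h'"
  by (simp add: ff_mult_def norm_ff_def algebra_simps)

lemma conj_ff_conj [simp]: "conj_ff (conj_ff h) = h"
  by (simp add: conj_ff_def)

lemma conj_ff_eq_0 [simp]: "conj_ff h = 0 \<longleftrightarrow> h = 0"
  by (cases h) (simp add: conj_ff_def zero_prod_def)

lemma conj_ff_mult: "conj_ff (ff_mult F h h') = ff_mult F (conj_ff h) (conj_ff h')"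
  by (simp add: ff_mult_def conj_ff_def)

lemma of_rat_fn_mult: "of_rat_fn (p * q) = ff_mult F (of_rat_fn p) (of_rat_fn q)"
  by (simp add: of_rat_fn_def ff_mult_def)

lemma of_rat_fn_add: "of_rat_fn (p + q) = of_rat_fn p + of_rat_fn q"
  by (simp add: of_rat_fn_def)

lemma of_rat_fn_eq_0 [simp]: "of_rat_fn p = 0 \<longleftrightarrow> p = 0"
  by (simp add: of_rat_fn_def zero_prod_def)

lemma of_rat_fn_0 [simp]: "of_rat_fn 0 = 0"
  by simp

lemma of_rat_fn_const: "of_rat_fn [:c:] = (const_fn c, 0)"
  by (simp add: of_rat_fn_def const_fn_def)

lemma y_ff_squared: "ff_mult F y_ff y_ff = of_rat_fn (geom F)"
  by (simp add: y_ff_def of_rat_fn_def ff_mult_def)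

lemma y_ff_nz [simp]: "y_ff \<noteq> 0" by (simp add: y_ff_def zero_prod_def)

lemma ff_common_denominator:
  fixes h :: "'k::field ff"
  obtains d A B where "d \<noteq> 0" "ff_mult F (of_rat_fn d) h = (to_fract A, to_fract B)"
proof -
  obtain a b where h: "h = (a, b)" by (cases h)
  obtain p q where a: "a = Fract p q" "q \<noteq> 0" by (cases a) auto
  obtain r s where b: "b = Fract r s" "s \<noteq> 0" by (cases b) auto
  have "to_fract (q * s) * a = to_fract (p * s)" "to_fract (q * s) * b = to_fract (q * r)"
    using a b by (simp_all add: Fract_conv_to_fract)
  then show thesis
    using that[of "q * s" "p * s" "q * r"] a b by (simp add: h of_rat_fn_def ff_mult_def)
qed

subsection \<open>Valuations\<close>

text \<open>\<open>vge v n h\<close> is the inequality \<open>n \<le> v h\<close> with the value at \<open>0\<close> read as infinite.\<close>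

definition vge :: "('a::zero \<Rightarrow> int) \<Rightarrow> int \<Rightarrow> 'a \<Rightarrow> bool" where
  "vge v n h \<longleftrightarrow> h = 0 \<or> n \<le> v h"

context
  fixes F :: "'k::field_char_0 poly" and v :: "'k ff \<Rightarrow> int"
  assumes v: "v \<in> points F"
begin

lemma pt_mult: "h \<noteq> 0 \<Longrightarrow> h' \<noteq> 0 \<Longrightarrow> v (ff_mult F h h') = v h + v h'"
  and pt_add: "h \<noteq> 0 \<Longrightarrow> h' \<noteq> 0 \<Longrightarrow> h + h' \<noteq> 0 \<Longrightarrow> min (v h) (v h') \<le> v (h + h')"
  and pt_const: "c \<noteq> 0 \<Longrightarrow> v (const_fn c, 0) = 0"
  and pt_0: "v 0 = 0"
  and pt_uniformizer: "\<exists>h. h \<noteq> 0 \<and> v h = 1"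
  using v unfolding points_def by blast+

lemma vge_add: "vge v n h \<Longrightarrow> vge v n h' \<Longrightarrow> vge v n (h + h')"
  using pt_add[of h h'] by (cases "h = 0"; cases "h' = 0"; cases "h + h' = 0") (auto simp: vge_def)

lemma ff_mult_0: "ff_mult F 0 h = 0" "ff_mult F h 0 = 0"
  by (simp_all add: ff_mult_def zero_prod_def)

lemma vge_mult: "vge v m h \<Longrightarrow> vge v n h' \<Longrightarrow> vge v (m + n) (ff_mult F h h')"
  using pt_mult[of h h'] by (cases "h = 0"; cases "h' = 0") (auto simp: vge_def ff_mult_0)

lemma vge_mono: "vge v m h \<Longrightarrow> n \<le> m \<Longrightarrow> vge v n h"
  unfolding vge_def by auto

lemma vge_const: "vge v 0 (const_fn c, 0)"
  using pt_const[of c] by (cases "c = 0") (auto simp: vge_def hom_0[OF is_hom_const_fn] zero_prod_def)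

lemma pt_uminus: "v (- h) = v h"
proof (cases "h = 0")
  case False
  have c1: "const_fn (- 1 :: 'k alg_closure) = - 1"
    by (simp add: hom_uminus[OF is_hom_const_fn] hom_1[OF is_hom_const_fn])
  have "ff_mult F (const_fn (- 1), 0) h = - h" by (simp add: ff_mult_fst c1 uminus_prod_def)
  then show ?thesis
    using pt_mult[of "(const_fn (- 1), 0)" h] pt_const[of "- 1"] False c1 by (simp add: zero_prod_def)
qed simp

lemma vge_uminus: "vge v n (- h) \<longleftrightarrow> vge v n h"
  by (simp add: vge_def pt_uminus)

lemma vge_diff: "vge v n h \<Longrightarrow> vge v n h' \<Longrightarrow> vge v n (h - h')"
  using vge_add[of n h "- h'"] vge_uminus by simp

lemma pt_add_eq: assumes "h \<noteq> 0" "vge v (v h + 1) h'" shows "h + h' \<noteq> 0" "v (h + h') = v h"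
proof -
  show nz: "h + h' \<noteq> 0"
  proof
    assume "h + h' = 0"
    then have "h' = - h" by (simp add: eq_neg_iff_add_eq_0 add.commute)
    then show False using assms by (simp add: vge_def pt_uminus)
  qed
  have "vge v (v h) (h + h')" using assms by (intro vge_add) (auto simp: vge_def)
  moreover have "\<not> vge v (v h + 1) (h + h')"
  proof
    assume "vge v (v h + 1) (h + h')"
    from vge_diff[OF this assms(2)] show False using assms(1) by (simp add: vge_def)
  qed
  ultimately show "v (h + h') = v h" using nz by (simp add: vge_def)
qed

lemma pt_of_rat_fn_mult: "p \<noteq> 0 \<Longrightarrow> q \<noteq> 0 \<Longrightarrow> v (of_rat_fn (p * q)) = v (of_rat_fn p) + v (of_rat_fn q)"
  by (subst of_rat_fn_mult[of _ _ F]) (simp add: pt_mult)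

lemma pt_of_rat_fn_const: "c \<noteq> 0 \<Longrightarrow> v (of_rat_fn [:c:]) = 0"
  by (simp add: of_rat_fn_const pt_const)

lemma pt_of_rat_fn_power: "p \<noteq> 0 \<Longrightarrow> v (of_rat_fn (p ^ n)) = int n * v (of_rat_fn p)"
proof (induction n)
  case 0
  then show ?case using pt_of_rat_fn_const[of 1] by (simp add: one_pCons)
next
  case (Suc n)
  then show ?case by (simp add: pt_of_rat_fn_mult distrib_right)
qed

lemma vge_poly: assumes "0 \<le> v (of_rat_fn [:0, 1:])" shows "vge v 0 (of_rat_fn p)"
proof (induction p)
  case 0
  then show ?case by (simp add: vge_def)
next
  case (pCons c p)
  have "vge v 0 (of_rat_fn [:c:] + ff_mult F (of_rat_fn [:0, 1:]) (of_rat_fn p))"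
    by (intro vge_add, simp add: of_rat_fn_const vge_const)
      (rule vge_mult[of 0 _ 0, simplified], use assms pCons in \<open>auto simp: vge_def\<close>)
  also have "of_rat_fn [:c:] + ff_mult F (of_rat_fn [:0, 1:]) (of_rat_fn p) = of_rat_fn (pCons c p)"
    by (simp add: of_rat_fn_mult[symmetric] of_rat_fn_add[symmetric])
  finally show ?case .
qed

lemma pt_poly_nonneg_x: assumes "0 < v (of_rat_fn [:-a, 1:])" shows "0 \<le> v (of_rat_fn [:0, 1:])"
proof -
  have "vge v 0 (of_rat_fn [:a:] + of_rat_fn [:-a, 1:])"
    by (intro vge_add) (use assms in \<open>auto simp: of_rat_fn_const vge_const, simp add: vge_def\<close>)
  then show ?thesis by (simp add: of_rat_fn_add[symmetric] vge_def)
qed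

lemma pt_poly_unit:
  assumes "0 < v (of_rat_fn [:-a, 1:])" "poly p a \<noteq> 0" shows "v (of_rat_fn p) = 0"
proof -
  have "[:-a, 1:] dvd p - [:poly p a:]" by (simp add: poly_eq_0_iff_dvd[symmetric])
  then obtain q where q: "p = [:poly p a:] + [:-a, 1:] * q" by (metis dvdE add.commute diff_add_cancel)
  have "vge v (1 + 0) (ff_mult F (of_rat_fn [:-a, 1:]) (of_rat_fn q))"
    by (intro vge_mult vge_poly pt_poly_nonneg_x[OF assms(1)]) (use assms(1) in \<open>simp add: vge_def\<close>)
  moreover have "v (of_rat_fn [:poly p a:]) = 0" using assms(2) by (rule pt_of_rat_fn_const)
  ultimately have "v (of_rat_fn [:poly p a:] + ff_mult F (of_rat_fn [:-a, 1:]) (of_rat_fn q)) = 0"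
    using pt_add_eq(2)[of "of_rat_fn [:poly p a:]"] assms(2) by simp
  then show ?thesis using q by (metis of_rat_fn_add of_rat_fn_mult)
qed

lemma pt_poly_order:
  assumes "0 < v (of_rat_fn [:-a, 1:])" "p \<noteq> 0"
  shows "v (of_rat_fn p) = int (Polynomial.order a p) * v (of_rat_fn [:-a, 1:])"
proof -
  obtain q where q: "p = [:-a, 1:] ^ Polynomial.order a p * q" "\<not> [:-a, 1:] dvd q"
    using order_decomp[OF assms(2)] by blast
  have "v (of_rat_fn q) = 0" using q(2) by (intro pt_poly_unit[OF assms(1)]) (simp add: poly_eq_0_iff_dvd)
  moreover have "q \<noteq> 0" using q(2) by auto
  ultimately show ?thesis
    using q(1) pt_of_rat_fn_mult[of "[:-a, 1:] ^ Polynomial.order a p" q]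
      pt_of_rat_fn_power[of "[:-a, 1:]" "Polynomial.order a p"] by simp
qed

lemma pt_poly_degree:
  assumes "v (of_rat_fn [:0, 1:]) < 0" "p \<noteq> 0"
  shows "v (of_rat_fn p) = int (Polynomial.degree p) * v (of_rat_fn [:0, 1:])"
  using assms(2)
proof (induction p)
  case (pCons c p)
  show ?case
  proof (cases "p = 0")
    case True
    then show ?thesis using pCons pt_of_rat_fn_const by simp
  next
    case False
    let ?m = "ff_mult F (of_rat_fn [:0, 1:]) (of_rat_fn p)"
    have "v ?m = int (Polynomial.degree p + 1) * v (of_rat_fn [:0, 1:])"
      using False pCons by (simp add: pt_mult algebra_simps)
    moreover have "?m \<noteq> 0" using False by (simp add: of_rat_fn_mult[symmetric])
    ultimately have m: "v ?m = int (Polynomial.degree p + 1) * v (of_rat_fn [:0, 1:])" "?m \<noteq> 0" by auto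
    have "v ?m < 0" using m assms(1) by (simp add: mult_pos_neg)
    moreover have "vge v 0 (of_rat_fn [:c:])" by (simp add: of_rat_fn_const vge_const)
    ultimately have "v (?m + of_rat_fn [:c:]) = v ?m"
      by (intro pt_add_eq m) (auto intro: vge_mono)
    moreover have "?m + of_rat_fn [:c:] = of_rat_fn (pCons c p)"
      by (simp add: of_rat_fn_mult[symmetric] of_rat_fn_add[symmetric])
    ultimately show ?thesis using m False by simp
  qed
qed simp

text \<open>Otherwise the valuation would be trivial on polynomials in \<open>x\<close>, which split into linear factors, and
  then trivial on all functions: \<open>h\<close> and its conjugate have a sum and a product that are rational functions
  of \<open>x\<close>.\<close>

lemma pt_center_x: assumes "0 \<le> v (of_rat_fn [:0, 1:])" shows "\<exists>a. 0 < v (of_rat_fn [:-a, 1:])"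
proof (rule ccontr)
  assume "\<not> ?thesis"
  moreover have "0 \<le> v (of_rat_fn [:-a, 1:])" for a using vge_poly[OF assms, of "[:-a, 1:]"] by (simp add: vge_def)
  ultimately have lin: "v (of_rat_fn [:-a, 1:]) = 0" for a by (metis order_less_le)
  have poly: "v (of_rat_fn p) = 0" if "p \<noteq> 0" for p
    using that
  proof (induction "Polynomial.degree p" arbitrary: p rule: less_induct)
    case less
    show ?case
    proof (cases "Polynomial.degree p = 0")
      case True
      then obtain c where "p = [:c:]" by (metis degree_eq_zeroE)
      then show ?thesis using less.prems pt_of_rat_fn_const by simp
    next
      case False
      then obtain a where "poly p a = 0" using alg_closed_imp_poly_has_root by blast
      then obtain q where q: "p = [:-a, 1:] * q" by (meson dvdE poly_eq_0_iff_dvd)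
      then have "q \<noteq> 0" using less.prems by auto
      then have "Polynomial.degree q < Polynomial.degree p" by (simp add: q degree_mult_eq del: mult_pCons_left)
      then have "v (of_rat_fn q) = 0" using less.hyps \<open>q \<noteq> 0\<close> by blast
      then show ?thesis using pt_of_rat_fn_mult[of "[:-a, 1:]" q] lin \<open>q \<noteq> 0\<close> q by simp
    qed
  qed
  have rat: "v (a, 0) = 0" for a
  proof (cases "a = 0")
    case True
    then show ?thesis using pt_0 by (simp add: zero_prod_def)
  next
    case False
    obtain p q where a: "a = Fract p q" "q \<noteq> 0" by (cases a) auto
    then have p: "p \<noteq> 0" using False by (auto simp: Zero_fract_def eq_fract)
    have "of_rat_fn p = ff_mult F (a, 0) (of_rat_fn q)"
      using a by (simp add: of_rat_fn_def ff_mult_def Fract_conv_to_fract)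
    moreover have "(a, 0) \<noteq> (0 :: 'k ff)" using False by (simp add: zero_prod_def)
    ultimately show ?thesis using pt_mult[of "(a, 0)" "of_rat_fn q"] poly[OF p] poly[OF a(2)] a(2)
      by simp
  qed
  obtain h where h: "h \<noteq> 0" "v h = 1" using pt_uniformizer by blast
  have "v (ff_mult F h (conj_ff h)) = 0" by (simp add: ff_mult_conj rat)
  then have c: "v (conj_ff h) = - 1" using pt_mult[of h "conj_ff h"] h by simp
  have "v (conj_ff h + h) = - 1" using pt_add_eq(2)[of "conj_ff h" h] h c by (simp add: vge_def)
  moreover have "conj_ff h + h = (2 * fst h, 0)" by (cases h) (simp add: conj_ff_def)
  ultimately show False using rat by simp
qed

end

text \<open>A separable \<open>F\<close> of odd degree: the affine curve is smooth, and there is one point at infinity.\<close>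

locale hyperell =
  fixes F :: "'k::field_char_0 poly" and g :: nat
  assumes degF: "Polynomial.degree F = 2 * g + 1"
    and sepF: "\<And>a. poly (geom F) a = 0 \<Longrightarrow> poly (pderiv (geom F)) a \<noteq> 0"
begin

lemma deg_geom: "Polynomial.degree (geom F) = 2 * g + 1"
  by (simp add: geom_def degree_map_poly_hom[OF is_hom_to_ac] degF)

lemma geom_nz [simp]: "geom F \<noteq> 0"
  using deg_geom by auto

lemma order_geom: assumes "poly (geom F) a = 0" shows "Polynomial.order a (geom F) = 1"
  by (rule order_simple_root[OF assms sepF[OF assms]])

text \<open>The norm of \<open>A + B y\<close> is \<open>A\<^sup>2 - B\<^sup>2 F\<close>, where the two terms have degrees of different parity.\<close>

lemma norm_ff_eq_0_iff [simp]: "norm_ff F h = 0 \<longleftrightarrow> h = 0"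
proof
  assume n: "norm_ff F h = 0"
  obtain d A B where d: "d \<noteq> 0" "ff_mult F (of_rat_fn d) h = (to_fract A, to_fract B)"
    using ff_common_denominator by blast
  have "norm_ff F (ff_mult F (of_rat_fn d) h) = 0" using n by (simp add: norm_ff_mult)
  then have "to_fract (A * A - B * B * geom F) = 0" by (simp add: d norm_ff_def)
  then have "A * A - B * B * geom F = 0" by (simp only: to_fract_eq_0_iff)
  then have eq: "A * A = B * B * geom F" by simp
  have "B = 0"
  proof (rule ccontr)
    assume B: "B \<noteq> 0"
    then have "A \<noteq> 0" using eq by auto
    then have "2 * Polynomial.degree A = 2 * Polynomial.degree B + (2 * g + 1)"
      using arg_cong[OF eq, of Polynomial.degree] B by (simp add: degree_mult_eq deg_geom)
    then show False by presburger
  qed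
  then have "A = 0" using eq by simp
  have "ff_mult F (of_rat_fn d) h = 0" by (simp add: d \<open>A = 0\<close> \<open>B = 0\<close> zero_prod_def)
  then show "h = 0" using d(1) by (cases h) (simp add: of_rat_fn_def ff_mult_def zero_prod_def)
qed (simp add: norm_ff_def)

lemma ff_mult_eq_0_iff [simp]: "ff_mult F h h' = 0 \<longleftrightarrow> h = 0 \<or> h' = 0"
  using norm_ff_eq_0_iff[of "ff_mult F h h'"] unfolding norm_ff_mult by simp

lemma pt_conj: "v \<in> points F \<Longrightarrow> h \<noteq> 0 \<Longrightarrow> v h + v (conj_ff h) = v (norm_ff F h, 0)"
  using pt_mult[of v F h "conj_ff h"] by (simp add: ff_mult_conj)

definition poly_ff :: "'k alg_closure poly \<Rightarrow> 'k alg_closure poly \<Rightarrow> 'k ff" where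
  "poly_ff A B = (to_fract A, to_fract B)"

lemma poly_ff_eq: "poly_ff A B = of_rat_fn A + ff_mult F (of_rat_fn B) y_ff"
  by (simp add: poly_ff_def of_rat_fn_def y_ff_def ff_mult_def)

lemma poly_ff_eq_0 [simp]: "poly_ff A B = 0 \<longleftrightarrow> A = 0 \<and> B = 0"
  by (simp add: poly_ff_def zero_prod_def)

lemma norm_poly_ff: "norm_ff F (poly_ff A B) = to_fract (A * A - B * B * geom F)"
  by (simp add: norm_ff_def poly_ff_def)

lemma conj_poly_ff: "conj_ff (poly_ff A B) = poly_ff A (- B)"
  by (simp add: conj_ff_def poly_ff_def)

lemma ff_as_quotient:
  obtains d A B where "d \<noteq> 0" "ff_mult F (of_rat_fn d) h = poly_ff A B"
  using ff_common_denominator[of F h] by (auto simp: poly_ff_def)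

subsection \<open>Determination of the points\<close>

text \<open>The point lies over the affine point \<open>(a, b)\<close>, as \<open>x - a\<close> and \<open>y - b\<close> vanish there.\<close>

definition centered :: "('k ff \<Rightarrow> int) \<Rightarrow> 'k alg_closure \<Rightarrow> 'k alg_closure \<Rightarrow> bool" where
  "centered v a b \<longleftrightarrow> v \<in> points F \<and> 0 < v (of_rat_fn [:-a, 1:]) \<and> 0 < v (poly_ff [:-b:] 1)"

text \<open>At a centre \<open>a\<close> of \<open>x\<close>, the product \<open>(y - b) (y + b) = F(x) - F(a)\<close> vanishes for \<open>b\<^sup>2 = F(a)\<close>, hence so
  does one of its factors.\<close>

lemma centered_exists:
  assumes v: "v \<in> points F" and x: "0 \<le> v (of_rat_fn [:0, 1:])"
  shows "\<exists>a b. b ^ 2 = poly (geom F) a \<and> centered v a b"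
proof -
  obtain a where a: "0 < v (of_rat_fn [:-a, 1:])" using pt_center_x[OF v x] by blast
  obtain b where b: "b ^ 2 = poly (geom F) a" using nth_root_exists[of 2 "poly (geom F) a"] by auto
  have G: "geom F - [:b ^ 2:] \<noteq> 0"
  proof
    assume "geom F - [:b ^ 2:] = 0"
    then have "geom F = [:b ^ 2:]" by simp
    then show False using deg_geom by simp
  qed
  moreover have "poly (geom F - [:b ^ 2:]) a = 0" by (simp add: b)
  ultimately have "0 < Polynomial.order a (geom F - [:b ^ 2:])"
    using order_root by (metis gr0I)
  then have "0 < v (of_rat_fn (geom F - [:b ^ 2:]))"
    using pt_poly_order[OF v a G] a by simp
  moreover have "of_rat_fn (geom F - [:b ^ 2:]) = ff_mult F (poly_ff [:-b:] 1) (poly_ff [:b:] 1)"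
  proof -
    have "to_fract [:b:] * to_fract [:b:] = to_fract [:b ^ 2:]"
      by (simp add: to_fract_mult[symmetric] power2_eq_square del: to_fract_mult)
    moreover have "to_fract [:-b:] = - to_fract [:b:]" by (simp add: to_fract_uminus[symmetric] del: to_fract_uminus)
    ultimately show ?thesis by (simp add: of_rat_fn_def poly_ff_def ff_mult_def)
  qed
  ultimately have "0 < v (poly_ff [:-b:] 1) + v (poly_ff [:b:] 1)"
    using pt_mult[OF v, of "poly_ff [:-b:] 1" "poly_ff [:b:] 1"] by simp
  then consider "0 < v (poly_ff [:-b:] 1)" | "0 < v (poly_ff [:-(-b):] 1)" by force
  then show ?thesis
  proof cases
    case 1
    then show ?thesis using a b v by (auto simp: centered_def)
  next
    case 2
    then have "centered v a (-b)" using a v by (simp add: centered_def)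
    moreover have "(-b) ^ 2 = poly (geom F) a" using b by simp
    ultimately show ?thesis by blast
  qed
qed

context
  fixes v assumes v: "v \<in> points F"
begin

lemma pt_y_twice: "2 * v y_ff = v (of_rat_fn (geom F))"
  using pt_mult[OF v, of y_ff y_ff] by (simp add: y_ff_squared)

lemma pt_poly_ff_y: "B \<noteq> 0 \<Longrightarrow> v (ff_mult F (of_rat_fn B) y_ff) = v (of_rat_fn B) + v y_ff"
  by (simp add: pt_mult[OF v])

lemma pt_poly_ff_distinct:
  assumes "A \<noteq> 0" "B \<noteq> 0" "v (of_rat_fn A) \<noteq> v (of_rat_fn B) + v y_ff"
  shows "v (poly_ff A B) = min (v (of_rat_fn A)) (v (of_rat_fn B) + v y_ff)"
proof (cases "v (of_rat_fn A) < v (of_rat_fn B) + v y_ff")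
  case True
  then show ?thesis using assms pt_add_eq(2)[OF v, of "of_rat_fn A" "ff_mult F (of_rat_fn B) y_ff"]
    by (simp add: poly_ff_eq vge_def pt_poly_ff_y)
next
  case False
  then show ?thesis using assms pt_add_eq(2)[OF v, of "ff_mult F (of_rat_fn B) y_ff" "of_rat_fn A"]
    by (simp add: poly_ff_eq vge_def pt_poly_ff_y add.commute)
qed

text \<open>At a branch point and at infinity, polynomials in \<open>x\<close> have even values and \<open>y\<close> has an odd value (in
  units of \<open>e\<close>), so no cancellation occurs in \<open>A + B y\<close>.\<close>

lemma pt_poly_ff_parity:
  assumes "A \<noteq> 0 \<or> B \<noteq> 0"
    and A: "A \<noteq> 0 \<Longrightarrow> v (of_rat_fn A) = 2 * i * e"
    and B: "B \<noteq> 0 \<Longrightarrow> v (of_rat_fn B) + v y_ff = (2 * j + 1) * e" and e: "0 < e"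
  shows "v (poly_ff A B) = (if B = 0 then 2 * i else if A = 0 then 2 * j + 1 else min (2 * i) (2 * j + 1)) * e"
proof -
  consider "B = 0" | "A = 0" "B \<noteq> 0" | "A \<noteq> 0" "B \<noteq> 0" by blast
  then show ?thesis
  proof cases
    case 1
    then show ?thesis using assms by (simp add: poly_ff_def of_rat_fn_def)
  next
    case 2
    then show ?thesis using B pt_poly_ff_y by (simp add: poly_ff_eq)
  next
    case 3
    have "2 * i * e \<noteq> (2 * j + 1) * e" using e by (simp, presburger)
    then have "v (poly_ff A B) = min (2 * i * e) ((2 * j + 1) * e)"
      using pt_poly_ff_distinct[of A B] A B 3 by simp
    also have "\<dots> = min (2 * i) (2 * j + 1) * e" using e by (simp add: min_def)
    finally show ?thesis using 3 by simp
  qed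
qed

end

lemma pt_divide_poly:
  assumes v: "v \<in> points F" and "h \<noteq> 0" "d \<noteq> 0" "ff_mult F (of_rat_fn d) h = poly_ff A B"
  shows "v h = v (poly_ff A B) - v (of_rat_fn d)"
  using pt_mult[OF v, of "of_rat_fn d" h] assms by simp

text \<open>The set \<open>S\<close> is meant to consist of all points with a given centre, and \<open>u\<close> to be a uniformiser there.
  If all values are known multiples of the value of \<open>u\<close>, that value is 1, because the value group is all
  of the integers; then \<open>S\<close> has at most one element.\<close>

lemma proportional_values_unique:
  assumes S: "S \<subseteq> points F" and pos: "\<forall>v\<in>S. 0 < v u"
    and prp: "\<forall>h. h \<noteq> 0 \<longrightarrow> (\<exists>k. \<forall>v\<in>S. v h = k * v u)"
  shows "v \<in> S \<Longrightarrow> v u = 1" "v \<in> S \<Longrightarrow> w \<in> S \<Longrightarrow> v = w"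
proof -
  have one: "v u = 1" if vS: "v \<in> S" for v
  proof -
    obtain h where "h \<noteq> 0" "v h = 1" using pt_uniformizer[of v F] vS S by blast
    moreover from this obtain k where "v h = k * v u" using prp vS by blast
    ultimately have "v u * k = 1" by (simp add: mult.commute)
    then show ?thesis using bspec[OF pos vS] by (simp add: pos_zmult_eq_1_iff)
  qed
  show "v \<in> S \<Longrightarrow> v u = 1" by (rule one)
  assume vw: "v \<in> S" "w \<in> S"
  show "v = w"
  proof
    fix h
    show "v h = w h"
    proof (cases "h = 0")
      case True
      then show ?thesis using pt_0[OF subsetD[OF S vw(1)]] pt_0[OF subsetD[OF S vw(2)]] by simp
    next
      case False
      then obtain k where "\<forall>v\<in>S. v h = k * v u" using prp by blast
      then have "v h = k * v u" "w h = k * w u" using vw by blast+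
      then show ?thesis by (simp add: one[OF vw(1)] one[OF vw(2)])
    qed
  qed
qed

lemma proportional_values_quotient:
  assumes S: "S \<subseteq> points F"
    and poly: "\<And>d. d \<noteq> 0 \<Longrightarrow> \<exists>k. \<forall>v\<in>S. v (of_rat_fn d) = k * v u"
    and polyff: "\<And>A B. A \<noteq> 0 \<or> B \<noteq> 0 \<Longrightarrow> \<exists>k. \<forall>v\<in>S. v (poly_ff A B) = k * v u"
    and h: "h \<noteq> 0"
  shows "\<exists>k. \<forall>v\<in>S. v h = k * v u"
proof -
  obtain d A B where d: "d \<noteq> 0" "ff_mult F (of_rat_fn d) h = poly_ff A B" using ff_as_quotient by blast
  then have "A \<noteq> 0 \<or> B \<noteq> 0" using h by (metis ff_mult_eq_0_iff of_rat_fn_eq_0 poly_ff_eq_0)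
  then obtain k where k: "\<forall>v\<in>S. v (poly_ff A B) = k * v u" using polyff by blast
  obtain l where l: "\<forall>v\<in>S. v (of_rat_fn d) = l * v u" using poly[OF d(1)] by blast
  have "v h = (k - l) * v u" if "v \<in> S" for v
    using pt_divide_poly[OF _ h d, of v] that S k l by (auto simp: algebra_simps)
  then show ?thesis by blast
qed

lemma ramified_values:
  assumes c: "centered v a 0" and a: "poly (geom F) a = 0"
  shows "v (of_rat_fn [:-a, 1:]) = 2 * v y_ff" "0 < v y_ff"
proof -
  have v: "v \<in> points F" and vx: "0 < v (of_rat_fn [:-a, 1:])" using c by (auto simp: centered_def)
  have "v (of_rat_fn (geom F)) = v (of_rat_fn [:-a, 1:])"
    using pt_poly_order[OF v vx, of "geom F"] order_geom[OF a] by simp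
  then show "v (of_rat_fn [:-a, 1:]) = 2 * v y_ff" using pt_y_twice[OF v] by simp
  then show "0 < v y_ff" using vx by simp
qed

lemma ramified_proportional:
  assumes a: "poly (geom F) a = 0" and h: "h \<noteq> 0"
  shows "\<exists>k. \<forall>v\<in>{v. centered v a 0}. v h = k * v y_ff"
proof (rule proportional_values_quotient[OF _ _ _ h])
  show "{v. centered v a 0} \<subseteq> points F" by (auto simp: centered_def)
  have poly: "v (of_rat_fn d) = 2 * int (Polynomial.order a d) * v y_ff" if "d \<noteq> 0" "centered v a 0" for d v
    using pt_poly_order[of v F a d] that ramified_values[OF that(2) a] by (simp add: centered_def)
  then show "\<exists>k. \<forall>v\<in>{v. centered v a 0}. v (of_rat_fn d) = k * v y_ff" if "d \<noteq> 0" for d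
    using that by blast
  fix A B :: "'k alg_closure poly" assume AB: "A \<noteq> 0 \<or> B \<noteq> 0"
  let ?k = "if B = 0 then 2 * int (Polynomial.order a A) else if A = 0 then 2 * int (Polynomial.order a B) + 1
    else min (2 * int (Polynomial.order a A)) (2 * int (Polynomial.order a B) + 1)"
  have "v (poly_ff A B) = ?k * v y_ff" if c: "centered v a 0" for v
    by (rule pt_poly_ff_parity[OF _ AB]) (use c poly ramified_values[OF c a] in \<open>auto simp: centered_def algebra_simps\<close>)
  then show "\<exists>k. \<forall>v\<in>{v. centered v a 0}. v (poly_ff A B) = k * v y_ff" by blast
qed

text \<open>Away from the branch points, common factors \<open>x - a\<close> are removed first; then one of \<open>A + B y\<close> and
  its conjugate does not vanish at the centre, and the norm gives the value of the other.\<close>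

lemma poly_pair_primitive:
  fixes A B :: "'k alg_closure poly"
  assumes "A \<noteq> 0 \<or> B \<noteq> 0"
  shows "\<exists>n A' B'. A = [:-a, 1:] ^ n * A' \<and> B = [:-a, 1:] ^ n * B' \<and> (poly A' a \<noteq> 0 \<or> poly B' a \<noteq> 0)"
  using assms
proof (induction "Polynomial.degree A + Polynomial.degree B" arbitrary: A B rule: less_induct)
  case less
  show ?case
  proof (cases "poly A a = 0 \<and> poly B a = 0")
    case False
    then show ?thesis by (intro exI[of _ 0] exI[of _ A] exI[of _ B]) auto
  next
    case True
    then obtain A1 B1 where 1: "A = [:-a, 1:] * A1" "B = [:-a, 1:] * B1" by (metis dvdE poly_eq_0_iff_dvd)
    have "Polynomial.degree ([:-a, 1:] * p) = (if p = 0 then 0 else Suc (Polynomial.degree p))" for p :: "'k alg_closure poly"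
      by (auto simp: degree_mult_eq simp del: mult_pCons_left)
    then have "Polynomial.degree A1 + Polynomial.degree B1 < Polynomial.degree A + Polynomial.degree B"
      using less.prems by (auto simp: 1 simp del: mult_pCons_left)
    moreover have "A1 \<noteq> 0 \<or> B1 \<noteq> 0" using less.prems 1 by auto
    ultimately obtain n A' B' where "A1 = [:-a, 1:] ^ n * A'" "B1 = [:-a, 1:] ^ n * B'"
      "poly A' a \<noteq> 0 \<or> poly B' a \<noteq> 0" using less.hyps by blast
    then show ?thesis by (intro exI[of _ "Suc n"] exI[of _ A'] exI[of _ B']) (simp add: 1 mult.assoc del: mult_pCons_left)
  qed
qed

lemma centered_y_nonneg: assumes "centered v a b" shows "vge v 0 (poly_ff A B)"
proof -
  have v: "v \<in> points F" and vx: "0 < v (of_rat_fn [:-a, 1:])" and vy: "0 < v (poly_ff [:-b:] 1)"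
    using assms by (auto simp: centered_def)
  note nn = vge_poly[OF v pt_poly_nonneg_x[OF v vx]]
  have "y_ff = poly_ff [:-b:] 1 + of_rat_fn [:b:]"
    by (simp add: y_ff_def poly_ff_def of_rat_fn_def to_fract_add[symmetric] del: to_fract_add)
  moreover have "vge v 0 (poly_ff [:-b:] 1)" using vy by (simp add: vge_def)
  ultimately have "vge v 0 y_ff" using vge_add[OF v] nn by metis
  then show ?thesis unfolding poly_ff_eq using vge_mult[OF v nn, of 0] vge_add[OF v] nn by simp
qed

lemma centered_poly_ff_unit:
  assumes c: "centered v a b" and nz: "poly A a + poly B a * b \<noteq> 0"
  shows "v (poly_ff A B) = 0"
proof -
  have v: "v \<in> points F" and vx: "0 < v (of_rat_fn [:-a, 1:])" and vy: "0 < v (poly_ff [:-b:] 1)"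
    using c by (auto simp: centered_def)
  define k where "k = poly A a + poly B a * b"
  have "[:-a, 1:] dvd p - [:poly p a:]" for p by (simp add: poly_eq_0_iff_dvd[symmetric])
  then obtain A' B' where A': "A = [:poly A a:] + [:-a, 1:] * A'" and B': "B = [:poly B a:] + [:-a, 1:] * B'"
    by (metis add.commute diff_add_cancel dvdE)
  let ?r = "ff_mult F (of_rat_fn [:-a, 1:]) (poly_ff A' B') + ff_mult F (of_rat_fn [:poly B a:]) (poly_ff [:-b:] 1)"
  have "vge v (1 + 0) (ff_mult F (of_rat_fn [:-a, 1:]) (poly_ff A' B'))"
    by (rule vge_mult[OF v _ centered_y_nonneg[OF c]]) (use vx in \<open>simp add: vge_def\<close>)
  moreover have "vge v (0 + 1) (ff_mult F (of_rat_fn [:poly B a:]) (poly_ff [:-b:] 1))"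
    by (rule vge_mult[OF v vge_poly[OF v pt_poly_nonneg_x[OF v vx]]]) (use vy in \<open>simp add: vge_def\<close>)
  ultimately have r: "vge v 1 ?r" using vge_add[OF v] by simp
  have kk: "[:k:] + [:poly B a:] * [:-b:] = [:poly A a:]" by (simp add: k_def)
  have swap: "p + (q + r) = (p + r) + q" for p q r :: "'k alg_closure poly" by simp
  have "[:k:] + ([:-a, 1:] * A' + [:poly B a:] * [:-b:]) = A"
    unfolding swap kk by (rule A'[symmetric])
  from arg_cong[OF this, of to_fract]
  have "to_fract A = to_fract [:k:] + (to_fract [:-a, 1:] * to_fract A' + to_fract [:poly B a:] * to_fract [:-b:])"
    unfolding to_fract_add to_fract_mult by (rule sym)
  moreover from arg_cong[OF B', of to_fract]
  have "to_fract B = to_fract [:-a, 1:] * to_fract B' + to_fract [:poly B a:]"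
    unfolding to_fract_add to_fract_mult by (simp only: add.commute)
  ultimately have eq: "poly_ff A B = of_rat_fn [:k:] + ?r"
    by (simp add: poly_ff_def of_rat_fn_def ff_mult_def)
  have "v (of_rat_fn [:k:]) = 0" using nz by (simp add: k_def pt_of_rat_fn_const[OF v])
  then have "v (of_rat_fn [:k:] + ?r) = 0"
    using pt_add_eq(2)[OF v, of "of_rat_fn [:k:]" ?r] r nz by (simp add: k_def)
  then show ?thesis by (simp only: eq)
qed

lemma unramified_proportional:
  assumes a: "b ^ 2 = poly (geom F) a" "b \<noteq> 0" and h: "h \<noteq> 0"
  shows "\<exists>k. \<forall>v\<in>{v. centered v a b}. v h = k * v (of_rat_fn [:-a, 1:])"
proof (rule proportional_values_quotient[OF _ _ _ h])
  show "{v. centered v a b} \<subseteq> points F" by (auto simp: centered_def)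
  have poly: "v (of_rat_fn d) = int (Polynomial.order a d) * v (of_rat_fn [:-a, 1:])" if "d \<noteq> 0" "centered v a b" for d v
    using pt_poly_order[of v F a d] that by (simp add: centered_def)
  then show "\<exists>k. \<forall>v\<in>{v. centered v a b}. v (of_rat_fn d) = k * v (of_rat_fn [:-a, 1:])" if "d \<noteq> 0" for d
    using that by blast
  fix A B :: "'k alg_closure poly" assume AB: "A \<noteq> 0 \<or> B \<noteq> 0"
  obtain n A' B' where n: "A = [:-a, 1:] ^ n * A'" "B = [:-a, 1:] ^ n * B'"
    and nz: "poly A' a \<noteq> 0 \<or> poly B' a \<noteq> 0" using poly_pair_primitive[OF AB, of a] by blast
  then have AB': "poly_ff A' B' \<noteq> 0" by auto
  define N where "N = A' * A' - B' * B' * geom F"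
  have N: "N \<noteq> 0" using AB' norm_ff_eq_0_iff[of "poly_ff A' B'"] unfolding norm_poly_ff N_def by (metis to_fract_0)
  define k where "k = (if poly A' a + poly B' a * b \<noteq> 0 then 0 else Polynomial.order a N)"
  have "v (poly_ff A B) = (int n + int k) * v (of_rat_fn [:-a, 1:])" if c: "centered v a b" for v
  proof -
    have v: "v \<in> points F" using c by (simp add: centered_def)
    have "poly_ff A B = ff_mult F (of_rat_fn ([:-a, 1:] ^ n)) (poly_ff A' B')"
      by (simp add: n poly_ff_def of_rat_fn_def ff_mult_def)
    then have "v (poly_ff A B) = v (of_rat_fn ([:-a, 1:] ^ n)) + v (poly_ff A' B')"
      using AB' by (simp add: pt_mult[OF v])
    moreover have "v (of_rat_fn ([:-a, 1:] ^ n)) = int n * v (of_rat_fn [:-a, 1:])"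
      by (simp add: pt_of_rat_fn_power[OF v])
    moreover have "v (poly_ff A' B') = int k * v (of_rat_fn [:-a, 1:])"
    proof (cases "poly A' a + poly B' a * b = 0")
      case False
      then show ?thesis using centered_poly_ff_unit[OF c False] by (simp add: k_def)
    next
      case True
      have "poly A' a + poly (- B') a * b \<noteq> 0"
      proof
        assume e: "poly A' a + poly (- B') a * b = 0"
        then have A: "poly A' a = poly B' a * b" by simp
        with True have "2 * (poly B' a * b) = 0" by (simp only: mult_2)
        then have "poly B' a * b = 0" by (simp only: mult_eq_0_iff zero_neq_numeral[symmetric] simp_thms)
        then show False using A nz a(2) by simp
      qed
      then have "v (conj_ff (poly_ff A' B')) = 0" using centered_poly_ff_unit[OF c] by (simp add: conj_poly_ff)
      then have "v (poly_ff A' B') = v (of_rat_fn N)"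
        using pt_conj[OF v AB'] by (simp add: norm_poly_ff N_def of_rat_fn_def)
      then show ?thesis using poly[OF N c] True by (simp add: k_def)
    qed
    ultimately show ?thesis by (simp add: algebra_simps)
  qed
  then show "\<exists>k. \<forall>v\<in>{v. centered v a b}. v (poly_ff A B) = k * v (of_rat_fn [:-a, 1:])" by blast
qed

lemma centered_unramified:
  assumes "b ^ 2 = poly (geom F) a" "b \<noteq> 0" "centered v a b"
  shows "v (of_rat_fn [:-a, 1:]) = 1" "centered w a b \<Longrightarrow> v = w"
proof -
  have S: "{v. centered v a b} \<subseteq> points F" by (auto simp: centered_def)
  have pos: "\<forall>v\<in>{v. centered v a b}. 0 < v (of_rat_fn [:-a, 1:])" by (simp add: centered_def)
  have prp: "\<forall>h. h \<noteq> 0 \<longrightarrow> (\<exists>k. \<forall>v\<in>{v. centered v a b}. v h = k * v (of_rat_fn [:-a, 1:]))"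
    using unramified_proportional[OF assms(1,2)] by blast
  note u = proportional_values_unique[where S = "{v. centered v a b}" and u = "of_rat_fn [:-a, 1:]",
      OF S pos prp]
  show "v (of_rat_fn [:-a, 1:]) = 1" "centered w a b \<Longrightarrow> v = w" using u(1)[of v] u(2)[of v w] assms(3) by auto
qed

lemma centered_ramified:
  assumes "poly (geom F) a = 0" "centered v a 0"
  shows "v y_ff = 1" "centered w a 0 \<Longrightarrow> v = w"
proof -
  have S: "{v. centered v a 0} \<subseteq> points F" by (auto simp: centered_def)
  have pos: "\<forall>v\<in>{v. centered v a 0}. 0 < v y_ff" using ramified_values(2) assms(1) by blast
  have prp: "\<forall>h. h \<noteq> 0 \<longrightarrow> (\<exists>k. \<forall>v\<in>{v. centered v a 0}. v h = k * v y_ff)"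
    using ramified_proportional[OF assms(1)] by blast
  note u = proportional_values_unique[where S = "{v. centered v a 0}" and u = y_ff, OF S pos prp]
  show "v y_ff = 1" "centered w a 0 \<Longrightarrow> v = w" using u(1)[of v] u(2)[of v w] assms(2) by auto
qed

lemma centered_unique:
  assumes "b ^ 2 = poly (geom F) a" "centered v a b" "centered w a b" shows "v = w"
  using centered_unramified(2)[OF assms(1) _ assms(2) assms(3)] centered_ramified(2)[of a v w] assms
  by (cases "b = 0") auto

subsection \<open>The point at infinity\<close>

definition at_infinity :: "('k ff \<Rightarrow> int) \<Rightarrow> bool" where
  "at_infinity v \<longleftrightarrow> v \<in> points F \<and> v (of_rat_fn [:0, 1:]) < 0"

text \<open>This function is \<open>x\<^sup>g / y\<close>, written without \<open>y\<close> in the denominator.\<close>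

definition inf_uniformizer :: "'k ff" where
  "inf_uniformizer = (0, to_fract (Polynomial.monom 1 g) / to_fract (geom F))"

lemma inf_uniformizer_y: "ff_mult F inf_uniformizer y_ff = of_rat_fn (Polynomial.monom 1 g)"
  by (simp add: inf_uniformizer_def ff_mult_def y_ff_def of_rat_fn_def)

lemma inf_uniformizer_nz: "inf_uniformizer \<noteq> 0"
  by (simp add: inf_uniformizer_def zero_prod_def)

lemma at_infinity_values:
  assumes c: "at_infinity v"
  shows "v (of_rat_fn [:0, 1:]) = - 2 * v inf_uniformizer"
    "v y_ff = - int (2 * g + 1) * v inf_uniformizer" "0 < v inf_uniformizer"
proof -
  have v: "v \<in> points F" and vx: "v (of_rat_fn [:0, 1:]) < 0" using c by (auto simp: at_infinity_def)
  have "v (of_rat_fn (Polynomial.monom 1 g)) = int g * v (of_rat_fn [:0, 1:])"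
    using pt_poly_degree[OF v vx, of "Polynomial.monom 1 g"] by (simp add: degree_monom_eq)
  then have 1: "v inf_uniformizer + v y_ff = int g * v (of_rat_fn [:0, 1:])"
    using pt_mult[OF v inf_uniformizer_nz y_ff_nz] by (simp add: inf_uniformizer_y)
  have 2: "2 * v y_ff = int (2 * g + 1) * v (of_rat_fn [:0, 1:])"
    using pt_poly_degree[OF v vx, of "geom F"] pt_y_twice[OF v] by (simp add: deg_geom)
  show x: "v (of_rat_fn [:0, 1:]) = - 2 * v inf_uniformizer"
    using 1 2 by (simp add: algebra_simps)
  show "v y_ff = - int (2 * g + 1) * v inf_uniformizer" using 1 x by (simp add: algebra_simps)
  show "0 < v inf_uniformizer" using x vx by simp
qed

lemma infinity_proportional:
  assumes h: "h \<noteq> 0"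
  shows "\<exists>k. \<forall>v\<in>{v. at_infinity v}. v h = k * v inf_uniformizer"
proof (rule proportional_values_quotient[OF _ _ _ h])
  show "{v. at_infinity v} \<subseteq> points F" by (auto simp: at_infinity_def)
  have poly: "v (of_rat_fn d) = 2 * (- int (Polynomial.degree d)) * v inf_uniformizer" if "d \<noteq> 0" "at_infinity v" for d v
    using pt_poly_degree[of v F d] that at_infinity_values[OF that(2)] by (simp add: at_infinity_def)
  then show "\<exists>k. \<forall>v\<in>{v. at_infinity v}. v (of_rat_fn d) = k * v inf_uniformizer" if "d \<noteq> 0" for d
    using that by blast
  fix A B :: "'k alg_closure poly" assume AB: "A \<noteq> 0 \<or> B \<noteq> 0"
  let ?i = "- int (Polynomial.degree A)" and ?j = "- int (Polynomial.degree B) - int g - 1"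
  let ?k = "if B = 0 then 2 * ?i else if A = 0 then 2 * ?j + 1 else min (2 * ?i) (2 * ?j + 1)"
  have "v (poly_ff A B) = ?k * v inf_uniformizer" if c: "at_infinity v" for v
  proof (rule pt_poly_ff_parity[OF _ AB])
    show "v \<in> points F" using c by (simp add: at_infinity_def)
    show "v (of_rat_fn A) = 2 * ?i * v inf_uniformizer" if "A \<noteq> 0" using poly[OF that c] .
    show "v (of_rat_fn B) + v y_ff = (2 * ?j + 1) * v inf_uniformizer" if "B \<noteq> 0"
      unfolding poly[OF that c] at_infinity_values(2)[OF c] by (simp add: algebra_simps)
    show "0 < v inf_uniformizer" by (rule at_infinity_values(3)[OF c])
  qed
  then show "\<exists>k. \<forall>v\<in>{v. at_infinity v}. v (poly_ff A B) = k * v inf_uniformizer" by blast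
qed

lemma at_infinity_unique:
  shows "at_infinity v \<Longrightarrow> v inf_uniformizer = 1" "at_infinity v \<Longrightarrow> at_infinity w \<Longrightarrow> v = w"
proof -
  have S: "{v. at_infinity v} \<subseteq> points F" by (auto simp: at_infinity_def)
  have pos: "\<forall>v\<in>{v. at_infinity v}. 0 < v inf_uniformizer" using at_infinity_values(3) by blast
  have prp: "\<forall>h. h \<noteq> 0 \<longrightarrow> (\<exists>k. \<forall>v\<in>{v. at_infinity v}. v h = k * v inf_uniformizer)"
    using infinity_proportional by blast
  note u = proportional_values_unique[where S = "{v. at_infinity v}" and u = inf_uniformizer, OF S pos prp]
  show "at_infinity v \<Longrightarrow> v inf_uniformizer = 1" "at_infinity v \<Longrightarrow> at_infinity w \<Longrightarrow> v = w"
    using u(1)[of v] u(2)[of v w] by auto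
qed

end

section \<open>Parametrisation of the points by Laurent series\<close>

lemma fps_sqrt_exists:
  fixes s :: "'c::field_char_0 fps"
  assumes "fps_nth s 0 = c ^ 2" "c \<noteq> 0"
  shows "\<exists>r. r ^ 2 = s \<and> fps_nth r 0 = c"
proof -
  have "(fps_radical (\<lambda>_ _. c) (Suc 1) s) ^ Suc 1 = s"
    using power_radical[of s "\<lambda>_ _. c" 1] assms by (simp add: power2_eq_square)
  moreover have "fps_nth (fps_radical (\<lambda>_ _. c) (Suc 1) s) 0 = c" by simp
  ultimately show ?thesis by (metis Suc_1)
qed

definition fls_poly :: "'c::field poly \<Rightarrow> 'c fls \<Rightarrow> 'c fls" where
  "fls_poly p u = poly (map_poly fls_const p) u"

lemma is_hom_fls_poly: "is_hom (\<lambda>p. fls_poly p u)"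
  unfolding fls_poly_def by (rule is_hom_eval, rule is_hom_fls_const)

lemma fls_poly_pCons: "fls_poly (pCons c p) u = fls_const c + u * fls_poly p u"
  by (simp add: fls_poly_def map_poly_hom_pCons[OF is_hom_fls_const])

lemma fls_poly_0 [simp]: "fls_poly 0 u = 0" by (simp add: fls_poly_def)

lemma fls_poly_fps:
  fixes p :: "'c::field poly"
  shows "fls_poly p (fps_to_fls s) = fps_to_fls (poly (map_poly fps_const p) s)"
proof -
  have "map_poly fps_to_fls (map_poly fps_const p) = map_poly fls_const p"
    by (simp add: map_poly_hom_compose[OF is_hom_fps_to_fls is_hom_fps_const])
  then show ?thesis
    using poly_map_poly_hom[OF is_hom_fps_to_fls, of "map_poly fps_const p" s] by (simp add: fls_poly_def)
qed

lemma poly_fps_nth_0: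
  fixes p :: "'c::field poly"
  shows "fps_nth (poly (map_poly fps_const p) s) 0 = poly p (fps_nth s 0)"
proof -
  have "map_poly (\<lambda>s. fps_nth s 0) (map_poly fps_const p) = p"
    by (simp add: map_poly_hom_compose[OF is_hom_fps_nth_0 is_hom_fps_const])
  then show ?thesis
    using poly_map_poly_hom[OF is_hom_fps_nth_0, of "map_poly fps_const p" s] by simp
qed

text \<open>Substitution of Laurent series \<open>u\<close> and \<open>w\<close> for \<open>x\<close> and \<open>y\<close>, and the order of the result.\<close>

definition fls_rat :: "'c::alg_closed_field poly fract \<Rightarrow> 'c fls \<Rightarrow> 'c fls" where
  "fls_rat a u = fract_ext (\<lambda>p. fls_poly p u) a"

definition fls_eval :: "'c::alg_closed_field fls \<Rightarrow> 'c fls \<Rightarrow> 'c poly fract \<times> 'c poly fract \<Rightarrow> 'c fls" where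
  "fls_eval u w h = fls_rat (fst h) u + fls_rat (snd h) u * w"

definition fls_val :: "'c::alg_closed_field fls \<Rightarrow> 'c fls \<Rightarrow> 'c poly fract \<times> 'c poly fract \<Rightarrow> int" where
  "fls_val u w h = fls_subdegree (fls_eval u w h)"

context
  fixes u :: "'c::alg_closed_field fls"
  assumes u: "\<And>c. u \<noteq> fls_const c"
begin

lemma injective_hom_fls_poly: "injective_hom (\<lambda>p. fls_poly p u)"
proof
  show "is_hom (\<lambda>p. fls_poly p u)" by (rule is_hom_fls_poly)
  show "p = 0" if "fls_poly p u = 0" for p
    by (rule eval_nonconstant_injective[OF is_hom_fls_const u that[unfolded fls_poly_def]])
qed

lemma is_hom_fls_rat: "is_hom (\<lambda>a. fls_rat a u)"
  unfolding fls_rat_def by (rule injective_hom.is_hom_fract_ext[OF injective_hom_fls_poly])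

lemma fls_rat_to_fract: "fls_rat (to_fract p) u = fls_poly p u"
  unfolding fls_rat_def by (rule injective_hom.fract_ext_to_fract[OF injective_hom_fls_poly])

lemma fls_eval_add: "fls_eval u w (h + h') = fls_eval u w h + fls_eval u w h'"
  by (simp add: fls_eval_def hom_simps[OF is_hom_fls_rat] algebra_simps)

lemma fls_eval_fst: "fls_eval u w (a, 0) = fls_rat a u"
  by (simp add: fls_eval_def hom_simps[OF is_hom_fls_rat])

lemma fls_eval_of_rat_fn: "fls_eval u w (to_fract p, 0) = fls_poly p u"
  by (simp add: fls_eval_fst fls_rat_to_fract)

lemma fls_eval_poly_pair: "fls_eval u w (to_fract p, to_fract q) = fls_poly p u + fls_poly q u * w"
  by (simp add: fls_eval_def fls_rat_to_fract)

lemma fls_eval_const: "fls_eval u w (const_fn c, 0) = fls_const c"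
  unfolding const_fn_def fls_eval_of_rat_fn by (simp add: fls_poly_pCons)

end

context hyperell
begin

text \<open>The last condition excludes parametrisations by a power of a local parameter, whose orders are
  proper multiples of a valuation.\<close>

definition branch :: "'k alg_closure fls \<Rightarrow> 'k alg_closure fls \<Rightarrow> bool" where
  "branch u w \<longleftrightarrow> (\<forall>c. u \<noteq> fls_const c) \<and> w ^ 2 = fls_poly (geom F) u \<and> (\<exists>h. fls_val u w h = 1)"

lemma fls_eval_mult:
  assumes "branch u w" shows "fls_eval u w (ff_mult F h h') = fls_eval u w h * fls_eval u w h'"
proof -
  have u: "\<And>c. u \<noteq> fls_const c" and w: "w * w = fls_poly (geom F) u"
    using assms by (auto simp: branch_def power2_eq_square)
  note s = hom_simps[OF is_hom_fls_rat[OF u]]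
  have "fls_eval u w (ff_mult F h h') = fls_rat (fst h) u * fls_rat (fst h') u
      + fls_rat (snd h) u * fls_rat (snd h') u * (w * w)
      + (fls_rat (fst h) u * fls_rat (snd h') u + fls_rat (snd h) u * fls_rat (fst h') u) * w"
    by (simp add: fls_eval_def ff_mult_def s fls_rat_to_fract[OF u] w)
  then show ?thesis by (simp add: fls_eval_def algebra_simps)
qed

lemma fls_eval_eq_0_iff: assumes b: "branch u w" shows "fls_eval u w h = 0 \<longleftrightarrow> h = 0"
proof
  have u: "\<And>c. u \<noteq> fls_const c" using b by (auto simp: branch_def)
  assume "fls_eval u w h = 0"
  then have "fls_eval u w (ff_mult F h (conj_ff h)) = 0" by (simp add: fls_eval_mult[OF b])
  then have "norm_ff F h = 0"
    by (simp add: ff_mult_conj fls_eval_fst[OF u] hom_eq_0_iff[OF is_hom_fls_rat[OF u]])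
  then show "h = 0" by simp
next
  have u: "\<And>c. u \<noteq> fls_const c" using b by (auto simp: branch_def)
  assume "h = 0" then show "fls_eval u w h = 0" using fls_eval_add[OF u, of w 0 0] by simp
qed

lemma fls_val_in_points: assumes b: "branch u w" shows "fls_val u w \<in> points F"
  unfolding points_def mem_Collect_eq
proof (intro conjI allI impI)
  have u: "\<And>c. u \<noteq> fls_const c" using b by (auto simp: branch_def)
  note z = fls_eval_eq_0_iff[OF b]
  show "fls_val u w 0 = 0" using z[of 0] by (simp add: fls_val_def)
  show "fls_val u w (ff_mult F h h') = fls_val u w h + fls_val u w h'" if "h \<noteq> 0" "h' \<noteq> 0" for h h'
    using z[of h] z[of h'] that by (simp add: fls_val_def fls_eval_mult[OF b])
  show "min (fls_val u w h) (fls_val u w h') \<le> fls_val u w (h + h')" if "h + h' \<noteq> 0" for h h'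
    using z[of "h + h'"] that unfolding fls_val_def fls_eval_add[OF u] by (simp add: fls_plus_subdegree)
  show "fls_val u w (const_fn c, 0) = 0" for c by (simp add: fls_val_def fls_eval_const[OF u])
  obtain h where h: "fls_val u w h = 1" using b by (auto simp: branch_def)
  then have "h \<noteq> 0" using z[of h] by (auto simp: fls_val_def)
  with h show "\<exists>h. h \<noteq> 0 \<and> fls_val u w h = 1" by blast
qed

text \<open>The residue is the constant coefficient of the series.\<close>

lemma fls_val_residue:
  assumes b: "branch u w" and h: "vge (fls_val u w) 0 h"
  shows "\<exists>c. vge (fls_val u w) 1 (h - (const_fn c, 0))"
proof -
  have u: "\<And>c. u \<noteq> fls_const c" using b by (auto simp: branch_def)
  let ?s = "fls_eval u w h"
  define c where "c = fls_nth ?s 0"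
  let ?h = "h - (const_fn c, 0)"
  have e: "fls_eval u w ?h = ?s - fls_const c"
    using fls_eval_add[OF u, of w ?h "(const_fn c, 0)"] by (simp add: fls_eval_const[OF u])
  have low: "fls_nth ?s k = 0" if "k < 0" for k
  proof (cases "h = 0")
    case True
    then show ?thesis using fls_eval_eq_0_iff[OF b, of h] by simp
  next
    case False
    then show ?thesis using h that by (intro fls_eq0_below_subdegree) (simp add: vge_def fls_val_def)
  qed
  have "1 \<le> fls_val u w ?h" if "?h \<noteq> 0"
    unfolding fls_val_def
  proof (rule fls_subdegree_geI)
    show "fls_eval u w ?h \<noteq> 0" using that fls_eval_eq_0_iff[OF b, of ?h] by simp
    show "fls_nth (fls_eval u w ?h) k = 0" if "k < 1" for k :: int
      unfolding e using low[of k] that by (cases "k = 0") (auto simp: c_def)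
  qed
  then show ?thesis by (auto simp: vge_def)
qed

subsection \<open>Existence of branches\<close>

text \<open>For \<open>b \<noteq> 0\<close>, the parameter is \<open>x - a\<close>, and \<open>y\<close> is a square root of the power series \<open>F(x)\<close>. At a branch
  point put \<open>x = a + z\<^sup>2\<close>; then \<open>F(x)\<close> is \<open>z\<^sup>2\<close> times a series with nonzero constant term, since \<open>F\<close> is
  separable.\<close>

lemma branch_at_affine_point:
  assumes b: "b ^ 2 = poly (geom F) a"
  obtains s t where "branch (fps_to_fls s) (fps_to_fls t)" "fps_nth s 0 = a" "fps_nth t 0 = b"
proof (cases "b = 0")
  case False
  define s :: "'k alg_closure fps" where "s = fps_const a + fps_X"
  have s0: "fps_nth s 0 = a" by (simp add: s_def)
  obtain t where t: "t ^ 2 = poly (map_poly fps_const (geom F)) s" "fps_nth t 0 = b"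
    using fps_sqrt_exists[of "poly (map_poly fps_const (geom F)) s" b] b False by (auto simp: poly_fps_nth_0 s0)
  have u: "fps_to_fls s \<noteq> fls_const c" for c
  proof
    assume "fps_to_fls s = fls_const c"
    then have "s = fps_const c" using fps_to_fls_eq_iff[of s "fps_const c"] by simp
    from arg_cong[OF this, of "\<lambda>s. fps_nth s 1"] show False by (simp add: s_def)
  qed
  have "fls_val (fps_to_fls s) (fps_to_fls t) (to_fract [:-a, 1:], 0) = 1"
    unfolding fls_val_def fls_eval_of_rat_fn[OF u] by (simp add: fls_poly_pCons s_def)
  moreover have "fps_to_fls t ^ 2 = fls_poly (geom F) (fps_to_fls s)"
    by (simp add: fls_poly_fps t(1)[symmetric] fps_to_fls_power)
  ultimately have "branch (fps_to_fls s) (fps_to_fls t)" using u by (auto simp: branch_def)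
  then show ?thesis using that s0 t(2) by blast
next
  case True
  then have root: "poly (geom F) a = 0" using b by simp
  then obtain q where q: "geom F = [:-a, 1:] * q" by (meson dvdE poly_eq_0_iff_dvd)
  have qa: "poly q a \<noteq> 0" using sepF[OF root] unfolding q by (simp add: pderiv_mult pderiv_pCons del: mult_pCons_left)
  obtain c where c: "c ^ 2 = poly q a" using nth_root_exists[of 2 "poly q a"] by auto
  then have cnz: "c \<noteq> 0" using qa by auto
  define s :: "'k alg_closure fps" where "s = fps_const a + fps_X ^ 2"
  have s0: "fps_nth s 0 = a" by (simp add: s_def)
  obtain r where r: "r ^ 2 = poly (map_poly fps_const q) s" "fps_nth r 0 = c"
    using fps_sqrt_exists[of "poly (map_poly fps_const q) s" c] c cnz by (auto simp: poly_fps_nth_0 s0)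
  define t where "t = fps_X * r"
  have t0: "fps_nth t 0 = b" using True by (simp add: t_def)
  have u: "fps_to_fls s \<noteq> fls_const d" for d
  proof
    assume "fps_to_fls s = fls_const d"
    then have "s = fps_const d" using fps_to_fls_eq_iff[of s "fps_const d"] by simp
    from arg_cong[OF this, of "\<lambda>s. fps_nth s 2"] show False by (simp add: s_def)
  qed
  have "poly (map_poly fps_const (geom F)) s = poly (map_poly fps_const [:-a, 1:]) s * poly (map_poly fps_const q) s"
    unfolding q by (simp only: hom_mult[OF is_hom_map_poly[OF is_hom_fps_const]] poly_mult)
  also have "poly (map_poly fps_const [:-a, 1:]) s = fps_X ^ 2"
    by (simp add: map_poly_hom_pCons[OF is_hom_fps_const] s_def fps_const_neg[symmetric] del: fps_const_neg)
  finally have "t ^ 2 = poly (map_poly fps_const (geom F)) s"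
    by (simp add: t_def power_mult_distrib r(1))
  then have "fps_to_fls t ^ 2 = fls_poly (geom F) (fps_to_fls s)"
    by (simp add: fls_poly_fps flip: fps_to_fls_power)
  moreover have "fls_val (fps_to_fls s) (fps_to_fls t) (to_fract 0, to_fract 1) = 1"
  proof -
    have "r \<noteq> 0" using r(2) cnz by auto
    have "subdegree r = 0" using r(2) cnz by (intro subdegree_eq_0) simp_all
    then have "subdegree t = 1" using \<open>r \<noteq> 0\<close> by (simp add: t_def)
    then show ?thesis
      unfolding fls_val_def fls_eval_poly_pair[OF u]
      by (simp add: fls_subdegree_fls_to_fps hom_1[OF is_hom_fls_poly])
  qed
  ultimately have "branch (fps_to_fls s) (fps_to_fls t)" using u by (auto simp: branch_def)
  then show ?thesis using that s0 t0 by blast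
qed

lemma fls_poly_inverse:
  fixes p :: "'c::field poly"
  assumes "z \<noteq> 0"
  shows "fls_poly (reflect_poly p) z = z ^ Polynomial.degree p * fls_poly p (inverse z)"
proof -
  have "map_poly fls_const (reflect_poly p) = reflect_poly (map_poly fls_const p)"
    by (rule poly_eqI)
      (simp add: coeff_map_poly coeff_reflect_poly degree_map_poly_hom[OF is_hom_fls_const])
  then show ?thesis
    by (simp add: fls_poly_def poly_reflect_poly_nz[OF assms] degree_map_poly_hom[OF is_hom_fls_const])
qed

text \<open>For \<open>x = z\<^sup>-\<^sup>2\<close> one has \<open>F(x) = z\<^bsup>-2 (2 g + 1)\<^esup> R(z\<^sup>2)\<close> with the reversed polynomial \<open>R\<close> of \<open>F\<close>, whose
  constant term is the leading coefficient of \<open>F\<close>.\<close>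

lemma branch_at_infinity:
  obtains u w where "branch u w" "fls_subdegree u = - 2"
proof -
  let ?R = "poly (map_poly fps_const (reflect_poly (geom F))) (fps_X ^ 2)"
  obtain c where c: "c ^ 2 = Polynomial.lead_coeff (geom F)"
    using nth_root_exists[of 2 "Polynomial.lead_coeff (geom F)"] by auto
  then have cnz: "c \<noteq> 0" by auto
  obtain r where r: "r ^ 2 = ?R" "fps_nth r 0 = c"
    using fps_sqrt_exists[of ?R c] c cnz by (auto simp: poly_fps_nth_0 poly_0_coeff_0)
  define z :: "'k alg_closure fls" where "z = fls_X ^ 2"
  have z: "z \<noteq> 0" "fls_subdegree z = 2" by (simp_all add: z_def fls_subdegree_pow)
  define u where "u = inverse z"
  define w where "w = inverse (fls_X ^ (2 * g + 1)) * fps_to_fls r"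
  have "fps_to_fls r ^ 2 = fls_poly (reflect_poly (geom F)) z"
  proof -
    have z': "z = fps_to_fls (fps_X ^ 2)" by (simp add: z_def fps_to_fls_power)
    show ?thesis unfolding z' fls_poly_fps by (simp only: r(1)[symmetric] fps_to_fls_power)
  qed
  then have r2: "fps_to_fls r ^ 2 = z ^ (2 * g + 1) * fls_poly (geom F) u"
    using fls_poly_inverse[OF z(1), of "geom F"] by (simp add: deg_geom u_def)
  have "w ^ 2 = inverse (z ^ (2 * g + 1)) * (fps_to_fls r ^ 2)"
    by (simp add: w_def z_def power_mult_distrib power_inverse power_mult[symmetric] mult.commute)
  then have w2: "w ^ 2 = fls_poly (geom F) u"
    unfolding r2 using z(1) by (simp only: mult.assoc[symmetric] left_inverse power_not_zero mult_1 not_False_eq_True)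
  have su: "fls_subdegree u = - 2" using z by (simp add: u_def)
  have u: "u \<noteq> fls_const d" for d using su by auto
  have sw: "fls_subdegree w = - int (2 * g + 1)"
  proof -
    have "r \<noteq> 0" "subdegree r = 0" using r(2) cnz by (auto intro: subdegree_eq_0)
    then show ?thesis by (simp add: w_def fls_subdegree_fls_to_fps fls_subdegree_pow)
  qed
  then have wnz: "w \<noteq> 0" by auto
  have unz: "u \<noteq> 0" using su by auto
  have "fls_eval u w inf_uniformizer * w = u ^ g"
  proof -
    have "fls_eval u w inf_uniformizer = fls_poly (Polynomial.monom 1 g) u / fls_poly (geom F) u * w"
      by (simp add: fls_eval_def inf_uniformizer_def hom_simps[OF is_hom_fls_rat[OF u]]
          hom_divide[OF is_hom_fls_rat[OF u]] fls_rat_to_fract[OF u])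
    also have "\<dots> * w = fls_poly (Polynomial.monom 1 g) u / fls_poly (geom F) u * w ^ 2"
      by (simp add: power2_eq_square)
    also have "\<dots> = fls_poly (Polynomial.monom 1 g) u" using w2 wnz by (simp add: w2[symmetric])
    also have "\<dots> = u ^ g" by (simp add: fls_poly_def map_poly_monom poly_monom)
    finally show ?thesis .
  qed
  then have "fls_subdegree (fls_eval u w inf_uniformizer * w) = - 2 * int g"
    using su by (simp add: fls_subdegree_pow)
  moreover have "fls_eval u w inf_uniformizer \<noteq> 0"
    using \<open>fls_eval u w inf_uniformizer * w = u ^ g\<close> unz by auto
  ultimately have "fls_val u w inf_uniformizer = 1" using wnz sw by (simp add: fls_val_def)
  then have "branch u w" using u w2 unfolding branch_def by blast
  then show ?thesis using that su by blast
qed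

lemma branch_affine_values:
  assumes b: "branch (fps_to_fls s) (fps_to_fls t)"
  shows "vge (fls_val (fps_to_fls s) (fps_to_fls t)) 0 (poly_ff A B)"
    "poly A (fps_nth s 0) + poly B (fps_nth s 0) * fps_nth t 0 = 0 \<longleftrightarrow>
      vge (fls_val (fps_to_fls s) (fps_to_fls t)) 1 (poly_ff A B)"
proof -
  have u: "\<And>c. fps_to_fls s \<noteq> fls_const c" using b by (auto simp: branch_def)
  let ?e = "poly (map_poly fps_const A) s + poly (map_poly fps_const B) s * t"
  have e: "fls_eval (fps_to_fls s) (fps_to_fls t) (poly_ff A B) = fps_to_fls ?e"
    unfolding poly_ff_def fls_eval_poly_pair[OF u] fls_poly_fps by (simp add: fls_times_fps_to_fls)
  have val: "fls_val (fps_to_fls s) (fps_to_fls t) (poly_ff A B) = int (subdegree ?e)"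
    unfolding fls_val_def e by (rule fls_subdegree_fls_to_fps)
  then show "vge (fls_val (fps_to_fls s) (fps_to_fls t)) 0 (poly_ff A B)" by (simp add: vge_def)
  have "poly_ff A B = 0 \<longleftrightarrow> ?e = 0"
    using fls_eval_eq_0_iff[OF b, of "poly_ff A B"] unfolding e fps_to_fls_eq_0_iff by (rule sym)
  moreover have "fps_nth ?e 0 = poly A (fps_nth s 0) + poly B (fps_nth s 0) * fps_nth t 0"
    by (simp add: poly_fps_nth_0)
  moreover have "?e = 0 \<or> 1 \<le> subdegree ?e \<longleftrightarrow> fps_nth ?e 0 = 0"
    using subdegree_pos_iff[of ?e] by (cases "?e = 0") (simp_all only: Suc_le_eq One_nat_def fps_zero_nth, simp_all)
  ultimately show "poly A (fps_nth s 0) + poly B (fps_nth s 0) * fps_nth t 0 = 0 \<longleftrightarrow>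
      vge (fls_val (fps_to_fls s) (fps_to_fls t)) 1 (poly_ff A B)"
    by (simp add: vge_def val del: poly_ff_eq_0)
qed

subsection \<open>The points\<close>

definition on_curve :: "'k alg_closure \<Rightarrow> 'k alg_closure \<Rightarrow> bool" where
  "on_curve a b \<longleftrightarrow> b ^ 2 = poly (geom F) a"

definition point :: "'k alg_closure \<Rightarrow> 'k alg_closure \<Rightarrow> ('k ff \<Rightarrow> int)" where
  "point a b = (THE v. centered v a b)"

definition infinity :: "'k ff \<Rightarrow> int" where
  "infinity = (THE v. at_infinity v)"

lemma point_eq_branch:
  assumes b: "on_curve a b"
  obtains s t where "branch (fps_to_fls s) (fps_to_fls t)" "fps_nth s 0 = a" "fps_nth t 0 = b"
    "point a b = fls_val (fps_to_fls s) (fps_to_fls t)" "centered (point a b) a b"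
proof -
  obtain s t where st: "branch (fps_to_fls s) (fps_to_fls t)" "fps_nth s 0 = a" "fps_nth t 0 = b"
    using branch_at_affine_point b unfolding on_curve_def by blast
  let ?v = "fls_val (fps_to_fls s) (fps_to_fls t)"
  have "vge ?v 1 (poly_ff [:-a, 1:] 0)" using branch_affine_values(2)[OF st(1), of "[:-a, 1:]" 0] st by simp
  moreover have "vge ?v 1 (poly_ff [:-b:] 1)" using branch_affine_values(2)[OF st(1), of "[:-b:]" 1] st by simp
  ultimately have c: "centered ?v a b"
    using fls_val_in_points[OF st(1)] by (simp add: centered_def vge_def poly_ff_def of_rat_fn_def zero_prod_def)
  then have "point a b = ?v"
    unfolding point_def using centered_unique b unfolding on_curve_def by blast
  then show thesis using that st c by simp
qed

lemma point_centered: "on_curve a b \<Longrightarrow> centered (point a b) a b"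
  using point_eq_branch by blast

lemma point_in_points: "on_curve a b \<Longrightarrow> point a b \<in> points F"
  using point_centered by (auto simp: centered_def)

lemma point_eqI: "on_curve a b \<Longrightarrow> centered v a b \<Longrightarrow> v = point a b"
  using centered_unique point_centered unfolding on_curve_def by blast

lemma infinity_eq_branch:
  obtains u w where "branch u w" "infinity = fls_val u w" "at_infinity infinity"
proof -
  obtain u w where b: "branch u w" "fls_subdegree u = - 2" using branch_at_infinity by blast
  have u: "\<And>c. u \<noteq> fls_const c" using b by (auto simp: branch_def)
  have c: "at_infinity (fls_val u w)"
    using fls_val_in_points[OF b(1)] b(2)
    by (simp add: at_infinity_def of_rat_fn_def fls_val_def fls_eval_of_rat_fn[OF u] fls_poly_pCons)
  then have "infinity = fls_val u w" unfolding infinity_def using at_infinity_unique(2) by blast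
  then show thesis using that b c by simp
qed

lemma infinity_at_infinity: "at_infinity infinity"
  using infinity_eq_branch by blast

lemma infinity_in_points: "infinity \<in> points F"
  using infinity_at_infinity by (simp add: at_infinity_def)

theorem points_cases:
  assumes v: "v \<in> points F"
  obtains "v = infinity" | a b where "on_curve a b" "v = point a b"
proof (cases "v (of_rat_fn [:0, 1:]) < 0")
  case True
  then have "at_infinity v" using v by (simp add: at_infinity_def)
  then show ?thesis using that at_infinity_unique(2)[OF _ infinity_at_infinity] by blast
next
  case False
  then obtain a b where ab: "b ^ 2 = poly (geom F) a" "centered v a b"
    using centered_exists[OF v] by auto
  then have "on_curve a b" by (simp add: on_curve_def)
  then show ?thesis using that point_eqI ab(2) by blast
qed

lemma point_neq_infinity: assumes "on_curve a b" shows "point a b \<noteq> infinity"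
proof -
  have "0 \<le> point a b (of_rat_fn [:0, 1:])"
    using pt_poly_nonneg_x[OF point_in_points[OF assms]] point_centered[OF assms] by (auto simp: centered_def)
  then show ?thesis using infinity_at_infinity by (auto simp: at_infinity_def)
qed

lemma point_poly_ff_pos:
  assumes c: "on_curve a b" and nz: "A \<noteq> 0 \<or> B \<noteq> 0"
  shows "0 \<le> point a b (poly_ff A B)" "0 < point a b (poly_ff A B) \<longleftrightarrow> poly A a + poly B a * b = 0"
proof -
  obtain s t where st: "branch (fps_to_fls s) (fps_to_fls t)" "fps_nth s 0 = a" "fps_nth t 0 = b"
    "point a b = fls_val (fps_to_fls s) (fps_to_fls t)" using point_eq_branch[OF c] by blast
  show "0 \<le> point a b (poly_ff A B)" "0 < point a b (poly_ff A B) \<longleftrightarrow> poly A a + poly B a * b = 0"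
    using branch_affine_values[OF st(1), of A B] st nz by (auto simp: vge_def)
qed

lemma point_inject:
  assumes "on_curve a b" "on_curve a' b'" shows "point a b = point a' b' \<longleftrightarrow> a = a' \<and> b = b'"
proof
  assume e: "point a b = point a' b'"
  have "0 < point a' b' (poly_ff [:-a, 1:] 0)" "0 < point a' b' (poly_ff [:-b:] 1)"
    using point_poly_ff_pos(2)[OF assms(1), of "[:-a, 1:]" 0] point_poly_ff_pos(2)[OF assms(1), of "[:-b:]" 1] e by simp_all
  then have "poly [:-a, 1:] a' + poly 0 a' * b' = 0" "poly [:-b:] a' + poly 1 a' * b' = 0"
    using point_poly_ff_pos(2)[OF assms(2), of "[:-a, 1:]" 0] point_poly_ff_pos(2)[OF assms(2), of "[:-b:]" 1] by auto
  then show "a = a' \<and> b = b'" by simp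
qed simp

lemma point_poly_value:
  assumes c: "on_curve a b" and "p \<noteq> 0"
  shows "point a b (of_rat_fn p) = (if b = 0 then 2 else 1) * int (Polynomial.order a p)"
proof -
  have ctr: "centered (point a b) a b" and pt: "point a b \<in> points F" and x: "0 < point a b (of_rat_fn [:-a, 1:])"
    using point_centered[OF c] by (auto simp: centered_def)
  have "point a b (of_rat_fn [:-a, 1:]) = (if b = 0 then 2 else 1)"
  proof (cases "b = 0")
    case True
    then have "poly (geom F) a = 0" using c by (simp add: on_curve_def)
    then show ?thesis using centered_ramified(1)[of a "point a b"] ramified_values(1)[of "point a b" a] ctr True by simp
  next
    case False
    then show ?thesis using centered_unramified(1)[OF _ False ctr] c by (simp add: on_curve_def)
  qed
  then show ?thesis using pt_poly_order[OF pt x assms(2)] by simp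
qed

lemma point_y_value: assumes "on_curve a 0" shows "point a 0 y_ff = 1"
  using centered_ramified(1)[of a "point a 0"] point_centered[OF assms] assms by (simp add: on_curve_def)

lemma infinity_values:
  "p \<noteq> 0 \<Longrightarrow> infinity (of_rat_fn p) = - 2 * int (Polynomial.degree p)"
  "infinity y_ff = - int (2 * g + 1)"
  using pt_poly_degree[OF infinity_in_points, of p] infinity_at_infinity at_infinity_values[OF infinity_at_infinity]
    at_infinity_unique(1)[OF infinity_at_infinity]
  by (auto simp: at_infinity_def)

theorem residue:
  assumes "v \<in> points F" "vge v 0 h"
  shows "\<exists>c. vge v 1 (h - (const_fn c, 0))"
  using assms(1)
proof (cases rule: points_cases)
  case 1
  then show ?thesis using infinity_eq_branch fls_val_residue assms(2) by metis
next
  case (2 a b)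
  then show ?thesis using point_eq_branch[OF 2(1)] fls_val_residue assms(2) by metis
qed

end

section \<open>Divisors of functions\<close>

lemma div_degree_superset:
  assumes "finite S" "Poly_Mapping.keys D \<subseteq> S"
  shows "div_degree D = (\<Sum>v\<in>S. Poly_Mapping.lookup D v)"
  unfolding div_degree_def
  by (rule sum.mono_neutral_left) (use assms in \<open>auto simp: in_keys_iff\<close>)

lemma div_degree_add: "div_degree (D + E) = div_degree D + div_degree E"
proof -
  let ?S = "Poly_Mapping.keys D \<union> Poly_Mapping.keys E"
  have "Poly_Mapping.keys (D + E) \<subseteq> ?S" by (rule keys_add)
  then show ?thesis
    by (simp add: div_degree_superset[of ?S] lookup_add sum.distrib)
qed

lemma div_degree_0 [simp]: "div_degree 0 = 0" by (simp add: div_degree_def)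

lemma div_degree_uminus [simp]: "div_degree (- D) = - div_degree D"
  using div_degree_add[of D "- D"] by simp

lemma div_degree_diff: "div_degree (D - E) = div_degree D - div_degree E"
  using div_degree_add[of D "- E"] by simp

lemma div_degree_frag_of [simp]: "div_degree (frag_of v) = 1"
  by (simp add: div_degree_def)

lemma div_degree_frag_cmul [simp]: "div_degree (frag_cmul c D) = c * div_degree D"
  by (subst div_degree_superset[of "Poly_Mapping.keys D"])
    (auto simp: div_degree_def sum_distrib_left dest: subsetD[OF keys_cmul])

definition conj_pt :: "('k::field ff \<Rightarrow> int) \<Rightarrow> ('k ff \<Rightarrow> int)" where
  "conj_pt v = (\<lambda>h. v (conj_ff h))"

lemma conj_pt_conj_pt [simp]: "conj_pt (conj_pt v) = v" by (simp add: conj_pt_def)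

lemma conj_pt_apply: "conj_pt v h = v (conj_ff h)" by (simp add: conj_pt_def)

text \<open>This applies to the hyperelliptic involution and to the Galois action, which moves the constants.\<close>

lemma points_precompose:
  fixes F :: "'k::field_char_0 poly"
  assumes v: "v \<in> points F"
    and add: "\<And>h h'. \<tau> (h + h') = \<tau> h + \<tau> h'"
    and mult: "\<And>h h'. \<tau> (ff_mult F h h') = ff_mult F (\<tau> h) (\<tau> h')"
    and zero: "\<And>h. \<tau> h = 0 \<longleftrightarrow> h = 0"
    and const: "\<And>c. c \<noteq> 0 \<Longrightarrow> \<exists>c'. c' \<noteq> 0 \<and> \<tau> (const_fn c, 0) = (const_fn c', 0)"
    and surj: "\<And>h. \<exists>h'. \<tau> h' = h"
  shows "(\<lambda>h. v (\<tau> h)) \<in> points F"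
  unfolding points_def mem_Collect_eq
proof (intro conjI allI impI)
  show "v (\<tau> 0) = 0" using pt_0[OF v] zero[of 0] by simp
  show "v (\<tau> (ff_mult F h h')) = v (\<tau> h) + v (\<tau> h')" if "h \<noteq> 0" "h' \<noteq> 0" for h h'
    unfolding mult by (rule pt_mult[OF v]) (use that zero in blast)+
  show "min (v (\<tau> h)) (v (\<tau> h')) \<le> v (\<tau> (h + h'))" if "h \<noteq> 0" "h' \<noteq> 0" "h + h' \<noteq> 0" for h h'
    unfolding add by (rule pt_add[OF v]) (use that zero[of h] zero[of h'] zero[of "h + h'"] add in \<open>simp_all\<close>)
  show "v (\<tau> (const_fn c, 0)) = 0" if "c \<noteq> 0" for c
    using const[OF that] pt_const[OF v] by metis
  obtain k where k: "k \<noteq> 0" "v k = 1" using pt_uniformizer[OF v] by blast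
  obtain h where "\<tau> h = k" using surj by blast
  then show "\<exists>h. h \<noteq> 0 \<and> v (\<tau> h) = 1" using k zero[of h] by blast
qed

lemma conj_pt_in_points: fixes F :: "'k::field_char_0 poly" assumes "v \<in> points F" shows "conj_pt v \<in> points F"
  unfolding conj_pt_def
proof (rule points_precompose[OF assms _ conj_ff_mult conj_ff_eq_0])
  show "conj_ff (h + h') = conj_ff h + conj_ff h'" for h h' by (simp add: conj_ff_def)
  show "\<exists>c'. c' \<noteq> 0 \<and> conj_ff (const_fn c, 0) = (const_fn c', 0)" if "c \<noteq> 0" for c
    using that by (auto simp: conj_ff_def)
  show "\<exists>h'. conj_ff h' = h" for h by (rule exI[of _ "conj_ff h"]) simp
qed

context hyperell
begin

lemma on_curve_conj: "on_curve a b \<Longrightarrow> on_curve a (- b)"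
  by (simp add: on_curve_def)

lemma on_curve_exists: "\<exists>b. on_curve a b"
  using nth_root_exists[of 2 "poly (geom F) a"] by (auto simp: on_curve_def)

lemma on_curve_iff: assumes "on_curve a b" shows "on_curve a c \<longleftrightarrow> c = b \<or> c = - b"
  using assms power2_eq_iff[of c b] by (auto simp: on_curve_def)

lemma conj_pt_point: assumes "on_curve a b" shows "conj_pt (point a b) = point a (- b)"
proof (rule point_eqI[OF on_curve_conj[OF assms]])
  have "poly_ff [:b:] 1 \<noteq> 0" by simp
  have c: "centered (point a b) a b" using point_centered[OF assms] .
  have "conj_ff (poly_ff [:- (- b):] 1) = - poly_ff [:-b:] 1"
    by (simp add: poly_ff_def conj_ff_def uminus_prod_def to_fract_uminus[symmetric] del: to_fract_uminus)
  then show "centered (conj_pt (point a b)) a (- b)"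
    using c conj_pt_in_points[OF point_in_points[OF assms]] pt_uminus[OF point_in_points[OF assms], of "poly_ff [:-b:] 1"]
    by (simp add: centered_def conj_pt_def) (simp add: of_rat_fn_def conj_ff_def)
qed

lemma finite_points_over: "finite {point a b | b. on_curve a b}"
proof -
  obtain b where b: "on_curve a b" using on_curve_exists by blast
  have "{point a b | b. on_curve a b} \<subseteq> {point a b, point a (- b)}" using on_curve_iff[OF b] by auto
  then show ?thesis by (rule finite_subset) simp
qed

lemma finite_poly_support:
  assumes "p \<noteq> 0" shows "finite {v \<in> points F. v (of_rat_fn p) \<noteq> 0}"
proof (rule finite_subset)
  show "{v \<in> points F. v (of_rat_fn p) \<noteq> 0} \<subseteq>
    insert infinity (\<Union>a\<in>{a. poly p a = 0}. {point a b | b. on_curve a b})"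
  proof
    fix v assume v: "v \<in> {v \<in> points F. v (of_rat_fn p) \<noteq> 0}"
    then have "v \<in> points F" by simp
    then show "v \<in> insert infinity (\<Union>a\<in>{a. poly p a = 0}. {point a b | b. on_curve a b})"
    proof (cases rule: points_cases)
      case (2 a b)
      then have "Polynomial.order a p \<noteq> 0" using v point_poly_value[OF 2(1) assms] by auto
      then show ?thesis using 2 order_root by blast
    qed simp
  qed
  show "finite (insert infinity (\<Union>a\<in>{a. poly p a = 0}. {point a b | b. on_curve a b}))"
    using finite_points_over poly_roots_finite[OF assms] by simp
qed

text \<open>In the affine part, a zero or pole of \<open>(A + B y) / d\<close> is a zero of \<open>d\<close> or of the norm of \<open>A + B y\<close>.\<close>

lemma finite_support: assumes "h \<noteq> 0" shows "finite {v \<in> points F. v h \<noteq> 0}"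
proof -
  obtain d A B where d: "d \<noteq> 0" "ff_mult F (of_rat_fn d) h = poly_ff A B" using ff_as_quotient by blast
  then have AB: "poly_ff A B \<noteq> 0" using assms by (metis ff_mult_eq_0_iff of_rat_fn_eq_0)
  then have AB': "A \<noteq> 0 \<or> B \<noteq> 0" by simp
  define N where "N = A * A - B * B * geom F"
  have N: "N \<noteq> 0" using AB norm_ff_eq_0_iff[of "poly_ff A B"] unfolding norm_poly_ff N_def by (metis to_fract_0)
  have "{v \<in> points F. v h \<noteq> 0} \<subseteq>
    insert infinity ({v \<in> points F. v (of_rat_fn d) \<noteq> 0} \<union> {v \<in> points F. v (of_rat_fn N) \<noteq> 0})"
  proof
    fix v assume "v \<in> {v \<in> points F. v h \<noteq> 0}"
    then have v: "v \<in> points F" and vh: "v h \<noteq> 0" by auto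
    from v show "v \<in> insert infinity ({v \<in> points F. v (of_rat_fn d) \<noteq> 0} \<union> {v \<in> points F. v (of_rat_fn N) \<noteq> 0})"
    proof (cases rule: points_cases)
      case (2 a b)
      have "v h = v (poly_ff A B) - v (of_rat_fn d)" by (rule pt_divide_poly[OF v assms d])
      moreover have "0 \<le> v (poly_ff A B)" "0 \<le> v (poly_ff A (- B))"
        using point_poly_ff_pos(1)[OF 2(1), of A B] point_poly_ff_pos(1)[OF 2(1), of A "- B"] AB' 2(2) by auto
      moreover have "v (poly_ff A B) + v (poly_ff A (- B)) = v (of_rat_fn N)"
        using pt_conj[OF v AB] unfolding norm_poly_ff N_def conj_poly_ff of_rat_fn_def .
      ultimately have "v (of_rat_fn d) \<noteq> 0 \<or> v (of_rat_fn N) \<noteq> 0" using vh by linarith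
      then show ?thesis using v by blast
    qed simp
  qed
  then show ?thesis
    by (rule finite_subset) (simp add: finite_poly_support d N)
qed

definition div_of :: "'k ff \<Rightarrow> (('k ff \<Rightarrow> int) \<Rightarrow>\<^sub>0 int)" where
  "div_of h = Abs_poly_mapping (\<lambda>v. if v \<in> points F \<and> h \<noteq> 0 then v h else 0)"

lemma lookup_div_of: "Poly_Mapping.lookup (div_of h) v = (if v \<in> points F \<and> h \<noteq> 0 then v h else 0)"
proof -
  have "finite {v. (if v \<in> points F \<and> h \<noteq> 0 then v h else 0) \<noteq> 0}"
  proof (cases "h = 0")
    case False
    have "{v. (if v \<in> points F \<and> h \<noteq> 0 then v h else 0) \<noteq> 0} = {v \<in> points F. v h \<noteq> 0}" using False by auto
    then show ?thesis using finite_support[OF False] by simp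
  qed simp
  then show ?thesis unfolding div_of_def by (subst Abs_poly_mapping_inverse) auto
qed

lemma keys_div_of: "Poly_Mapping.keys (div_of h) \<subseteq> points F"
  by (auto simp: in_keys_iff lookup_div_of split: if_splits)

lemma div_of_mult:
  assumes "h \<noteq> 0" "h' \<noteq> 0" shows "div_of (ff_mult F h h') = div_of h + div_of h'"
  by (rule poly_mapping_eqI) (simp add: lookup_div_of lookup_add assms pt_mult[OF _ assms])

lemma div_of_const: "c \<noteq> 0 \<Longrightarrow> div_of (const_fn c, 0) = 0"
  by (rule poly_mapping_eqI) (use pt_const in \<open>auto simp: lookup_div_of\<close>)

lemma ff_inverse: assumes "h \<noteq> 0" obtains h' where "h' \<noteq> 0" "ff_mult F h h' = (1, 0)"
proof -
  define h' where "h' = ff_mult F (inverse (norm_ff F h), 0) (conj_ff h)"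
  have "ff_mult F h h' = ff_mult F (inverse (norm_ff F h), 0) (ff_mult F h (conj_ff h))"
    unfolding h'_def by (metis ff_mult_assoc ff_mult_commute)
  also have "\<dots> = (1, 0)" using assms by (simp add: ff_mult_conj ff_mult_fst)
  finally have e: "ff_mult F h h' = (1, 0)" .
  moreover have "h' \<noteq> 0" using e assms ff_mult_eq_0_iff[of h h'] by (auto simp: zero_prod_def)
  ultimately show thesis using that by blast
qed

lemma one_ff: "(1, 0) = (const_fn 1, 0)" by (simp add: hom_1[OF is_hom_const_fn])

lemma div_of_inverse:
  assumes "h \<noteq> 0" shows "\<exists>h'. h' \<noteq> 0 \<and> ff_mult F h h' = (1, 0) \<and> div_of h' = - div_of h"
proof -
  obtain h' where h': "h' \<noteq> 0" "ff_mult F h h' = (1, 0)" using ff_inverse[OF assms] .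
  have "div_of h + div_of h' = div_of (ff_mult F h h')" using div_of_mult[OF assms h'(1)] by simp
  also have "\<dots> = 0" using div_of_const[of 1] unfolding h'(2) one_ff by simp
  finally have "div_of h' = - div_of h" by (simp add: eq_neg_iff_add_eq_0 add.commute)
  with h' show ?thesis by blast
qed

lemma principal_divisors_eq: "principal_divisors F = {div_of h | h. h \<noteq> 0}"
proof (intro equalityI subsetI)
  fix D assume "D \<in> principal_divisors F"
  then obtain h where h: "h \<noteq> 0" "\<And>v. v \<in> points F \<Longrightarrow> Poly_Mapping.lookup D v = v h" and D: "Poly_Mapping.keys D \<subseteq> points F"
    by (auto simp: principal_divisors_def)
  have "D = div_of h"
  proof (rule poly_mapping_eqI)
    fix v
    show "Poly_Mapping.lookup D v = Poly_Mapping.lookup (div_of h) v"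
      using h D by (cases "v \<in> points F") (auto simp: lookup_div_of in_keys_iff)
  qed
  then show "D \<in> {div_of h | h. h \<noteq> 0}" using h by blast
next
  fix D assume "D \<in> {div_of h | h. h \<noteq> 0}"
  then obtain h where h: "D = div_of h" "h \<noteq> 0" by blast
  have "\<forall>v\<in>points F. Poly_Mapping.lookup D v = v h" by (simp add: h lookup_div_of)
  then show "D \<in> principal_divisors F"
    using keys_div_of[of h] h unfolding principal_divisors_def mem_Collect_eq carrier_free_Abelian_group_iff
    by blast
qed

subsection \<open>Degree zero\<close>

lemma div_of_linear:
  assumes "on_curve a b"
  shows "div_of (of_rat_fn [:-a, 1:]) = frag_of (point a b) + frag_of (point a (- b)) - frag_cmul 2 (frag_of infinity)"
proof (rule poly_mapping_eqI)
  fix v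
  note c' = on_curve_conj[OF assms]
  show "Poly_Mapping.lookup (div_of (of_rat_fn [:-a, 1:])) v =
    Poly_Mapping.lookup (frag_of (point a b) + frag_of (point a (- b)) - frag_cmul 2 (frag_of infinity)) v"
  proof (cases "v \<in> points F")
    case False
    then have "v \<noteq> point a b" "v \<noteq> point a (- b)" "v \<noteq> infinity"
      using point_in_points[OF assms] point_in_points[OF c'] infinity_in_points by auto
    then show ?thesis using False by (simp add: lookup_div_of lookup_add lookup_minus)
  next
    case True
    then show ?thesis
    proof (cases rule: points_cases)
      case 1
      then show ?thesis
        using point_neq_infinity[OF assms] point_neq_infinity[OF c'] infinity_values(1)[of "[:-a, 1:]"] True
        by (auto simp: lookup_div_of lookup_add lookup_minus)
    next
      case (2 a' b')
      have "Polynomial.order a' [:-a, 1:] = (if a' = a then 1 else 0)"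
        using order_power_n_n[of a 1] by (auto intro: order_0I)
      then have "v (of_rat_fn [:-a, 1:]) = (if a' = a then if b' = 0 then 2 else 1 else 0)"
        using point_poly_value[OF 2(1), of "[:-a, 1:]"] 2(2) by auto
      moreover have "v \<noteq> infinity" using point_neq_infinity[OF 2(1)] 2(2) by simp
      moreover have "v = point a b \<longleftrightarrow> a' = a \<and> b' = b" "v = point a (- b) \<longleftrightarrow> a' = a \<and> b' = - b"
        using point_inject[OF 2(1) assms] point_inject[OF 2(1) c'] 2(2) by auto
      moreover have "a' = a \<Longrightarrow> b' = b \<or> b' = - b" using 2(1) on_curve_iff[OF assms] by blast
      ultimately show ?thesis using True by (auto simp: lookup_div_of lookup_add lookup_minus)
    qed
  qed
qed

lemma div_degree_poly: "p \<noteq> 0 \<Longrightarrow> div_degree (div_of (of_rat_fn p)) = 0"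
proof (induction "Polynomial.degree p" arbitrary: p rule: less_induct)
  case less
  show ?case
  proof (cases "Polynomial.degree p = 0")
    case True
    then obtain c where "p = [:c:]" by (metis degree_eq_zeroE)
    then show ?thesis using less.prems by (simp add: of_rat_fn_const div_of_const)
  next
    case False
    then obtain a where "poly p a = 0" using alg_closed_imp_poly_has_root by blast
    then obtain q where q: "p = [:-a, 1:] * q" by (meson dvdE poly_eq_0_iff_dvd)
    then have "q \<noteq> 0" using less.prems by auto
    then have "Polynomial.degree q < Polynomial.degree p" by (simp add: q degree_mult_eq del: mult_pCons_left)
    then have IH: "div_degree (div_of (of_rat_fn q)) = 0" using less.hyps \<open>q \<noteq> 0\<close> by blast
    obtain b where b: "on_curve a b" using on_curve_exists by blast
    have "div_of (of_rat_fn p) = div_of (of_rat_fn [:-a, 1:]) + div_of (of_rat_fn q)"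
      unfolding q of_rat_fn_mult[of _ _ F] by (rule div_of_mult) (use \<open>q \<noteq> 0\<close> in auto)
    then show ?thesis using IH by (simp add: div_degree_add div_degree_diff div_of_linear[OF b])
  qed
qed

lemma div_degree_rational: assumes "a \<noteq> 0" shows "div_degree (div_of (a, 0)) = 0"
proof -
  obtain p q where a: "a = Fract p q" "q \<noteq> 0" by (cases a) auto
  then have p: "p \<noteq> 0" using assms by (auto simp: Zero_fract_def eq_fract)
  have e: "of_rat_fn p = ff_mult F (a, 0) (of_rat_fn q)"
    using a by (simp add: of_rat_fn_def ff_mult_def Fract_conv_to_fract)
  have "(a, 0) \<noteq> (0 :: 'k ff)" using assms by (simp add: zero_prod_def)
  then have "div_of (of_rat_fn p) = div_of (a, 0) + div_of (of_rat_fn q)"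
    unfolding e by (rule div_of_mult) (simp add: a)
  then have "div_degree (div_of (of_rat_fn p)) = div_degree (div_of (a, 0)) + div_degree (div_of (of_rat_fn q))"
    by (simp add: div_degree_add)
  then show ?thesis by (simp add: div_degree_poly p a)
qed

text \<open>The hyperelliptic involution exchanges the divisors of \<open>h\<close> and its conjugate, so they have equal
  degrees; their sum is the divisor of the norm, which is a rational function of \<open>x\<close>.\<close>

theorem div_degree_principal: assumes "h \<noteq> 0" shows "div_degree (div_of h) = 0"
proof -
  have c: "conj_ff h \<noteq> 0" using assms by simp
  have keys: "Poly_Mapping.keys (div_of h) = {v \<in> points F. v h \<noteq> 0}" if "h \<noteq> 0" for h
    using that by (auto simp: in_keys_iff lookup_div_of split: if_splits)
  have "div_degree (div_of h) = div_degree (div_of (conj_ff h))"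
    unfolding div_degree_def keys[OF assms] keys[OF c]
    by (rule sum.reindex_bij_witness[of _ conj_pt conj_pt])
      (simp_all add: lookup_div_of conj_pt_in_points c assms conj_pt_apply)
  moreover have "div_of h + div_of (conj_ff h) = div_of (norm_ff F h, 0)"
    using div_of_mult[OF assms c] by (simp add: ff_mult_conj)
  then have "div_degree (div_of h) + div_degree (div_of (conj_ff h)) = 0"
    using div_degree_rational[of "norm_ff F h"] assms by (simp add: div_degree_add[symmetric])
  ultimately show ?thesis by simp
qed

subsection \<open>Functions without poles in the affine part\<close>

text \<open>This is the normality of the affine coordinate ring. If a root \<open>a\<close> of the denominator is left,
  the numerator \<open>A + B y\<close> vanishes at both points over \<open>a\<close>, or doubly at the single one, which forces
  \<open>A\<close> and \<open>B\<close> to vanish at \<open>a\<close>; so the fraction can be reduced.\<close>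

lemma affine_regular:
  assumes reg: "\<And>a b. on_curve a b \<Longrightarrow> vge (point a b) 0 h"
  shows "\<exists>A B. h = poly_ff A B"
proof (cases "h = 0")
  case True
  then show ?thesis by (metis poly_ff_eq_0)
next
  case h: False
  define P where "P = (\<lambda>d. d \<noteq> 0 \<and> (\<exists>A B. ff_mult F (of_rat_fn d) h = poly_ff A B))"
  obtain d0 where "P d0" unfolding P_def using ff_as_quotient by metis
  then obtain d where d: "P d" and min: "\<And>d'. P d' \<Longrightarrow> Polynomial.degree d \<le> Polynomial.degree d'"
    using ex_has_least_nat[of P d0 Polynomial.degree] by blast
  obtain A B where AB: "ff_mult F (of_rat_fn d) h = poly_ff A B" and dnz: "d \<noteq> 0" using d by (auto simp: P_def)
  have AB0: "poly_ff A B \<noteq> 0" using h dnz AB by (metis ff_mult_eq_0_iff of_rat_fn_eq_0)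
  have "Polynomial.degree d = 0"
  proof (rule ccontr)
    assume "Polynomial.degree d \<noteq> 0"
    then obtain a where a: "poly d a = 0" using alg_closed_imp_poly_has_root by blast
    obtain b where b: "on_curve a b" using on_curve_exists by blast
    have val: "point a c (of_rat_fn d) \<le> point a c (poly_ff A B)" "0 < point a c (of_rat_fn d)"
      "b = 0 \<Longrightarrow> 2 \<le> point a c (of_rat_fn d)" if c: "on_curve a c" for c
    proof -
      have o: "1 \<le> Polynomial.order a d" using a dnz order_root[of d a] by simp
      have "0 \<le> point a c h" using reg[OF c] h by (simp add: vge_def)
      then show "point a c (of_rat_fn d) \<le> point a c (poly_ff A B)"
        using pt_divide_poly[OF point_in_points[OF c] h dnz AB] by simp
      show "0 < point a c (of_rat_fn d)" "b = 0 \<Longrightarrow> 2 \<le> point a c (of_rat_fn d)"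
        using point_poly_value[OF c dnz] o on_curve_iff[OF b] c by auto
    qed
    have eq: "poly A a + poly B a * c = 0" if "on_curve a c" for c
      using point_poly_ff_pos(2)[OF that, of A B] val[OF that] AB0 by auto
    have "poly A a = 0 \<and> poly B a = 0"
    proof (cases "b = 0")
      case False
      have e: "poly A a + poly B a * b = 0" "poly A a - poly B a * b = 0"
        using eq[OF b] eq[OF on_curve_conj[OF b]] by simp_all
      then have "2 * poly A a = 0" by (simp only: mult_2) (metis eq_iff_diff_eq_0)
      then have "poly A a = 0" by simp
      then show ?thesis using e False by simp
    next
      case True
      then have b0: "on_curve a 0" using b by simp
      have Aa: "poly A a = 0" using eq[OF b0] by simp
      let ?v = "point a 0"
      have v: "?v \<in> points F" by (rule point_in_points[OF b0])
      have "vge ?v 2 (poly_ff A B)" using val(1,3)[OF b0] True by (simp add: vge_def)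
      moreover have "vge ?v 2 (of_rat_fn A)"
      proof (cases "A = 0")
        case False
        then have "1 \<le> Polynomial.order a A" using Aa order_root[of A a] by simp
        then show ?thesis using point_poly_value[OF b0 False] by (simp add: vge_def)
      qed (simp add: vge_def)
      ultimately have "vge ?v 2 (poly_ff A B - of_rat_fn A)" by (rule vge_diff[OF v])
      then have By: "vge ?v 2 (ff_mult F (of_rat_fn B) y_ff)" by (simp add: poly_ff_eq)
      have "poly B a = 0"
      proof (rule ccontr)
        assume "poly B a \<noteq> 0"
        then have Bnz: "B \<noteq> 0" and "Polynomial.order a B = 0" by (auto intro: order_0I)
        then have "?v (of_rat_fn B) = 0" using point_poly_value[OF b0 Bnz] by simp
        then show False using By Bnz point_y_value[OF b0] by (simp add: vge_def pt_mult[OF v])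
      qed
      then show ?thesis using Aa by simp
    qed
    then obtain A' B' d' where q: "A = [:-a, 1:] * A'" "B = [:-a, 1:] * B'" "d = [:-a, 1:] * d'"
      using a by (metis dvdE poly_eq_0_iff_dvd)
    have d'nz: "d' \<noteq> 0" using dnz q by auto
    have "ff_mult F (of_rat_fn [:-a, 1:]) (ff_mult F (of_rat_fn d') h - poly_ff A' B') = 0"
    proof -
      have "ff_mult F (of_rat_fn [:-a, 1:]) (ff_mult F (of_rat_fn d') h) = poly_ff A B"
        by (simp add: ff_mult_assoc[symmetric] of_rat_fn_mult[symmetric] q(3)[symmetric] AB del: mult_pCons_left)
      moreover have "ff_mult F (of_rat_fn [:-a, 1:]) (poly_ff A' B') = poly_ff A B"
        by (simp add: q of_rat_fn_def poly_ff_def ff_mult_def del: mult_pCons_left)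
      moreover have "ff_mult F z (w - w') = ff_mult F z w - ff_mult F z w'" for z w w'
        by (simp add: ff_mult_def algebra_simps)
      ultimately show ?thesis by simp
    qed
    then have "ff_mult F (of_rat_fn d') h = poly_ff A' B'" by simp
    then have "P d'" using d'nz by (auto simp: P_def)
    from min[OF this] show False using d'nz by (simp add: q degree_mult_eq del: mult_pCons_left)
  qed
  then obtain c where c: "d = [:c:]" by (metis degree_eq_zeroE)
  then have cnz: "c \<noteq> 0" using dnz by simp
  have "ff_mult F (of_rat_fn [:inverse c:]) (ff_mult F (of_rat_fn d) h) = h"
    using cnz by (simp add: ff_mult_assoc[symmetric] of_rat_fn_mult[symmetric] c)
      (simp add: of_rat_fn_def one_pCons[symmetric] ff_mult_fst)
  moreover have "ff_mult F (of_rat_fn [:inverse c:]) (poly_ff A B) = poly_ff ([:inverse c:] * A) ([:inverse c:] * B)"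
    by (simp only: of_rat_fn_def poly_ff_def ff_mult_fst fst_conv snd_conv to_fract_mult)
  ultimately show ?thesis unfolding AB by metis
qed

lemma infinity_poly_ff:
  assumes "A \<noteq> 0 \<or> B \<noteq> 0"
  shows "infinity (poly_ff A B) = (if B = 0 then - 2 * int (Polynomial.degree A)
    else if A = 0 then - 2 * int (Polynomial.degree B) - 2 * int g - 1
    else min (- 2 * int (Polynomial.degree A)) (- 2 * int (Polynomial.degree B) - 2 * int g - 1))"
proof -
  have "infinity (poly_ff A B) = (if B = 0 then 2 * - int (Polynomial.degree A)
    else if A = 0 then 2 * (- int (Polynomial.degree B) - int g - 1) + 1
    else min (2 * - int (Polynomial.degree A)) (2 * (- int (Polynomial.degree B) - int g - 1) + 1)) * 1"
    by (rule pt_poly_ff_parity[OF infinity_in_points assms]) (auto simp: infinity_values)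
  then show ?thesis by (auto simp: min_def)
qed

text \<open>A nonconstant polynomial in \<open>x\<close> and \<open>y\<close> has a pole at infinity.\<close>

theorem no_poles_constant:
  assumes "\<And>v. v \<in> points F \<Longrightarrow> vge v 0 h" shows "\<exists>c. h = (const_fn c, 0)"
proof -
  obtain A B where h: "h = poly_ff A B" using affine_regular assms point_in_points by blast
  show ?thesis
  proof (cases "h = 0")
    case True
    then show ?thesis by (intro exI[of _ 0]) (simp add: hom_0[OF is_hom_const_fn] zero_prod_def)
  next
    case False
    then have "0 \<le> infinity (poly_ff A B)" "A \<noteq> 0 \<or> B \<noteq> 0" using assms[OF infinity_in_points] by (auto simp: h vge_def)
    then have "B = 0" "Polynomial.degree A = 0" using infinity_poly_ff[of A B] by (auto split: if_splits)
    then obtain c where "A = [:c:]" by (metis degree_eq_zeroE)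
    then have "h = (const_fn c, 0)" using \<open>B = 0\<close> by (simp add: h poly_ff_def const_fn_def)
    then show ?thesis by blast
  qed
qed

corollary div_of_eq_0_imp_const: assumes "h \<noteq> 0" "div_of h = 0" shows "\<exists>c. c \<noteq> 0 \<and> h = (const_fn c, 0)"
proof -
  have "vge v 0 h" if "v \<in> points F" for v
    using arg_cong[OF assms(2), of "\<lambda>D. Poly_Mapping.lookup D v"] that assms(1) by (simp add: lookup_div_of vge_def)
  then obtain c where c: "h = (const_fn c, 0)" using no_poles_constant by blast
  then have "c \<noteq> 0" using assms(1) by (auto simp: hom_0[OF is_hom_const_fn] zero_prod_def)
  with c show ?thesis by blast
qed

end

section \<open>The genus\<close>

interpretation ffv: vector_space "ff_scale :: 'k::field alg_closure \<Rightarrow> 'k ff \<Rightarrow> 'k ff"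
  by (rule vector_space_ff_scale)

lemma ff_scale_eq: "ff_scale c h = ff_mult F (const_fn c, 0) h"
  by (simp add: ff_scale_def ff_mult_fst)

context hyperell
begin

lemma vge_scale: assumes "v \<in> points F" "vge v n h" shows "vge v n (ff_scale c h)"
  using vge_mult[OF assms(1) vge_const[OF assms(1)] assms(2), of c] by (simp add: ff_scale_eq[of _ _ F])

lemma vge_0 [simp]: "vge v n 0" by (simp add: vge_def)

lemma subspace_vge: "v \<in> points F \<Longrightarrow> ffv.subspace {h. vge v n h}"
  unfolding ffv.subspace_def Ball_def mem_Collect_eq by (blast intro: vge_0 vge_add vge_scale)

lemma riemann_roch_space_eq:
  "riemann_roch_space F D = {h. \<forall>v\<in>points F. vge v (- Poly_Mapping.lookup D v) h}"
  using infinity_in_points unfolding riemann_roch_space_def vge_def by (auto simp: algebra_simps)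

text \<open>The function of least value does not lie in the span of the others, which all have larger values.\<close>

lemma independent_if_inj_values:
  assumes v: "v \<in> points F" and S: "finite S" "0 \<notin> S" "inj_on v S"
  shows "ffv.independent S"
  using S
proof (induction S rule: finite_ranking_induct[where f = "\<lambda>h. - v h"])
  case empty
  show ?case by (rule ffv.independent_empty)
next
  case (insert h S)
  show ?case
  proof (cases "h \<in> S")
    case True
    then show ?thesis using insert by (simp add: insert_absorb)
  next
    case False
    have lt: "v h < v h'" if "h' \<in> S" for h'
    proof -
      have "v h \<le> v h'" using insert.hyps(2)[OF that] by simp
      moreover have "v h \<noteq> v h'" using insert.prems(2) that False by (auto simp: inj_on_def)
      ultimately show ?thesis by simp
    qed
    have "S \<subseteq> {k. vge v (v h + 1) k}"
    proof
      fix k assume "k \<in> S"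
      from lt[OF this] show "k \<in> {k. vge v (v h + 1) k}" by (simp add: vge_def)
    qed
    then have "ffv.span S \<subseteq> {k. vge v (v h + 1) k}" by (rule ffv.span_minimal[OF _ subspace_vge[OF v]])
    moreover have "\<not> vge v (v h + 1) h" using insert.prems(1) by (auto simp: vge_def)
    ultimately have "h \<notin> ffv.span S" by blast
    moreover have "ffv.independent S" using insert by (simp add: inj_on_def)
    ultimately show ?thesis by (rule ffv.independent_insertI)
  qed
qed

text \<open>One more pole adds at most one dimension, since the residue field is the constant field.\<close>

lemma riemann_roch_add_point:
  assumes P: "P \<in> points F" and B: "riemann_roch_space F D \<subseteq> ffv.span B"
  shows "\<exists>b. riemann_roch_space F (D + frag_of P) \<subseteq> ffv.span (insert b B)"
proof (cases "riemann_roch_space F (D + frag_of P) \<subseteq> riemann_roch_space F D")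
  case True
  then show ?thesis using B ffv.span_mono[of B "insert 0 B"] by blast
next
  case False
  then obtain b where b: "b \<in> riemann_roch_space F (D + frag_of P)" "b \<notin> riemann_roch_space F D" by blast
  have look: "Poly_Mapping.lookup (D + frag_of P) v = Poly_Mapping.lookup D v + (if v = P then 1 else 0)" for v
    by (simp add: lookup_add)
  have bge: "vge v (- Poly_Mapping.lookup (D + frag_of P) v) b" if "v \<in> points F" for v
    using b(1) that by (auto simp: riemann_roch_space_eq)
  have bnz: "b \<noteq> 0" using b(2) by (auto simp: riemann_roch_space_def)
  obtain v where v: "v \<in> points F" "\<not> vge v (- Poly_Mapping.lookup D v) b"
    using b(2) by (auto simp: riemann_roch_space_eq)
  then have "v = P" using bge[OF v(1)] look[of v] by (auto split: if_splits)
  then have Pb: "P b = - Poly_Mapping.lookup D P - 1" using v bge[OF P] look[of P] bnz by (auto simp: vge_def)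
  obtain b' where b': "b' \<noteq> 0" "ff_mult F b b' = (1, 0)" using ff_inverse[OF bnz] .
  have "P b' = - P b" using pt_mult[OF P bnz b'(1)] pt_const[OF P, of 1] by (simp add: b' one_ff)
  have "h \<in> ffv.span (insert b B)" if h: "h \<in> riemann_roch_space F (D + frag_of P)" for h
  proof -
    have hge: "vge v (- Poly_Mapping.lookup (D + frag_of P) v) h" if "v \<in> points F" for v
      using h that by (auto simp: riemann_roch_space_eq)
    have "vge P (P b) h" using hge[OF P] look[of P] Pb by simp
    moreover have "vge P (- P b) b'" using \<open>P b' = - P b\<close> by (simp add: vge_def)
    ultimately have "vge P 0 (ff_mult F h b')" using vge_mult[OF P, of "P b" h "- P b" b'] by simp
    then obtain c where c: "vge P 1 (ff_mult F h b' - (const_fn c, 0))" using residue[OF P] by blast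
    have "ff_mult F (ff_mult F h b' - (const_fn c, 0)) b = h - ff_scale c b"
    proof -
      have "ff_mult F (w - w') z = ff_mult F w z - ff_mult F w' z" for z w w'
        by (simp add: ff_mult_def algebra_simps)
      moreover have "ff_mult F (ff_mult F h b') b = h"
        by (simp add: ff_mult_assoc ff_mult_commute[of F b' b] b') (simp add: ff_mult_def)
      ultimately show ?thesis by (simp add: ff_scale_eq[of _ _ F])
    qed
    then have PP: "vge P (1 + P b) (h - ff_scale c b)"
      using vge_mult[OF P c, of "P b" b] by (simp add: vge_def)
    have "vge v (- Poly_Mapping.lookup D v) (h - ff_scale c b)" if v: "v \<in> points F" for v
    proof (cases "v = P")
      case True
      then show ?thesis using PP Pb by simp
    next
      case False
      then show ?thesis
        using vge_diff[OF v hge[OF v] vge_scale[OF v bge[OF v]], of c] look[of v] by simp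
    qed
    then have "h - ff_scale c b \<in> riemann_roch_space F D" by (simp add: riemann_roch_space_eq)
    then have "h - ff_scale c b \<in> ffv.span B" using B by blast
    then have "h - ff_scale c b \<in> ffv.span (insert b B)" using ffv.span_mono[of B "insert b B"] by blast
    moreover have "ff_scale c b \<in> ffv.span (insert b B)" by (intro ffv.span_scale ffv.span_base) simp
    ultimately show ?thesis using ffv.span_add by fastforce
  qed
  then show ?thesis by blast
qed

text \<open>Induction on the degree of \<open>E - D\<close>, one point at a time.\<close>

lemma riemann_roch_enlarge:
  assumes keys: "Poly_Mapping.keys D \<subseteq> points F" "Poly_Mapping.keys E \<subseteq> points F"
    and le: "\<And>v. Poly_Mapping.lookup D v \<le> Poly_Mapping.lookup E v"
    and B: "riemann_roch_space F D \<subseteq> ffv.span B" "finite B"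
  shows "\<exists>B'. riemann_roch_space F E \<subseteq> ffv.span B' \<and> finite B' \<and>
    int (card B') \<le> int (card B) + div_degree E - div_degree D"
  using keys(1) le B
proof (induction "nat (div_degree (E - D))" arbitrary: D B)
  have pos: "0 \<le> div_degree (E - D)" if "\<And>v. Poly_Mapping.lookup D v \<le> Poly_Mapping.lookup E v" for D
    unfolding div_degree_def using that by (intro sum_nonneg) (simp add: lookup_minus)
  have zero: "E = D" if "\<And>v. Poly_Mapping.lookup D v \<le> Poly_Mapping.lookup E v" "div_degree (E - D) \<le> 0" for D
  proof -
    have "\<forall>v\<in>Poly_Mapping.keys (E - D). Poly_Mapping.lookup (E - D) v = 0"
      using that pos[OF that(1)] unfolding div_degree_def
      by (subst sum_nonneg_eq_0_iff[symmetric]) (auto simp: lookup_minus)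
    then have "Poly_Mapping.lookup (E - D) v = 0" for v
      by (cases "v \<in> Poly_Mapping.keys (E - D)") (auto simp: in_keys_iff)
    then show ?thesis by (intro poly_mapping_eqI) (simp add: lookup_minus)
  qed
  {
    case 0
    then have "E = D" using zero[of D] by simp
    then show ?case using 0 by (intro exI[of _ B]) simp
  next
    case (Suc n)
    have "E \<noteq> D" using Suc.hyps(2) by auto
    then obtain P where P: "Poly_Mapping.lookup D P \<noteq> Poly_Mapping.lookup E P" by (metis poly_mapping_eqI)
    then have "P \<in> Poly_Mapping.keys D \<union> Poly_Mapping.keys E" by (auto simp: in_keys_iff)
    then have Pp: "P \<in> points F" using Suc.prems(1) keys(2) by blast
    obtain b where b: "riemann_roch_space F (D + frag_of P) \<subseteq> ffv.span (insert b B)"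
      using riemann_roch_add_point[OF Pp Suc.prems(3)] by blast
    have "n = nat (div_degree (E - (D + frag_of P)))"
      using Suc.hyps(2) by (simp add: div_degree_diff div_degree_add)
    moreover have "Poly_Mapping.keys (D + frag_of P) \<subseteq> points F"
      using keys_add[of D "frag_of P"] Suc.prems(1) Pp by auto
    moreover have "Poly_Mapping.lookup (D + frag_of P) v \<le> Poly_Mapping.lookup E v" for v
      using Suc.prems(2)[of v] P by (auto simp: lookup_add)
    moreover have "finite (insert b B)" using Suc.prems(4) by simp
    ultimately obtain B' where B': "riemann_roch_space F E \<subseteq> ffv.span B'" "finite B'"
      "int (card B') \<le> int (card (insert b B)) + div_degree E - div_degree (D + frag_of P)"
      using Suc.hyps(1)[of "D + frag_of P" "insert b B"] b by blast
    moreover have "int (card (insert b B)) \<le> int (card B) + 1" using Suc.prems(4) by (simp add: card_insert_if)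
    ultimately show ?case by (intro exI[of _ B']) (simp add: div_degree_add)
  }
qed

text \<open>Multiplication by \<open>p\<close> turns the functions in question into those without affine poles and with a pole
  of order at most \<open>2 M\<close> at infinity. These are the \<open>A + B y\<close> with \<open>deg A \<le> M\<close> and \<open>deg B < M - g\<close>, as \<open>y\<close> has
  a pole of order \<open>2 g + 1\<close>. The monomials have distinct pole orders.\<close>

definition rr_basis :: "'k alg_closure poly \<Rightarrow> nat \<Rightarrow> 'k ff set" where
  "rr_basis p M = (\<lambda>i. (to_fract (Polynomial.monom 1 i) / to_fract p, 0)) ` {..M} \<union>
     (\<lambda>j. (0, to_fract (Polynomial.monom 1 j) / to_fract p)) ` {..<M - g}"

definition rr_divisor :: "'k alg_closure poly \<Rightarrow> nat \<Rightarrow> (('k ff \<Rightarrow> int) \<Rightarrow>\<^sub>0 int)" where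
  "rr_divisor p M = frag_cmul (int (2 * M)) (frag_of infinity) + div_of (of_rat_fn p)"

lemma rr_basis_inf:
  assumes p: "p \<noteq> 0"
  shows "infinity (to_fract (Polynomial.monom 1 i) / to_fract p, 0) = - 2 * int i + 2 * int (Polynomial.degree p)"
    "infinity (0, to_fract (Polynomial.monom 1 j) / to_fract p) = - 2 * int j - 2 * int g - 1 + 2 * int (Polynomial.degree p)"
proof -
  note v = infinity_in_points
  have 1: "ff_mult F (of_rat_fn p) (to_fract (Polynomial.monom 1 i) / to_fract p, 0) = poly_ff (Polynomial.monom 1 i) 0"
    "ff_mult F (of_rat_fn p) (0, to_fract (Polynomial.monom 1 j) / to_fract p) = poly_ff 0 (Polynomial.monom 1 j)"
    using p by (simp_all add: of_rat_fn_def poly_ff_def ff_mult_def)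
  have m: "Polynomial.monom (1 :: 'k alg_closure) i \<noteq> 0" "Polynomial.monom (1 :: 'k alg_closure) j \<noteq> 0" by simp_all
  have nz: "(to_fract (Polynomial.monom 1 i) / to_fract p, 0) \<noteq> (0 :: 'k ff)"
    "(0, to_fract (Polynomial.monom 1 j) / to_fract p) \<noteq> (0 :: 'k ff)"
    using p by (simp_all add: zero_prod_def)
  show "infinity (to_fract (Polynomial.monom 1 i) / to_fract p, 0) = - 2 * int i + 2 * int (Polynomial.degree p)"
    using pt_divide_poly[OF v nz(1) p 1(1)] infinity_poly_ff[of "Polynomial.monom 1 i" 0] infinity_values(1)[OF p]
    by (simp add: degree_monom_eq)
  show "infinity (0, to_fract (Polynomial.monom 1 j) / to_fract p) = - 2 * int j - 2 * int g - 1 + 2 * int (Polynomial.degree p)"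
    using pt_divide_poly[OF v nz(2) p 1(2)] infinity_poly_ff[of 0 "Polynomial.monom 1 j"] infinity_values(1)[OF p]
    by (simp add: degree_monom_eq)
qed

lemma rr_basis_card:
  assumes p: "p \<noteq> 0" and M: "g \<le> M"
  shows "finite (rr_basis p M)" "card (rr_basis p M) = 2 * M + 1 - g" "ffv.independent (rr_basis p M)"
proof -
  let ?f = "\<lambda>i. (to_fract (Polynomial.monom 1 i) / to_fract p, 0) :: 'k ff"
  let ?h = "\<lambda>j. (0, to_fract (Polynomial.monom 1 j) / to_fract p) :: 'k ff"
  note inf = rr_basis_inf[OF p]
  have inj: "inj_on ?f A" "inj_on ?h A" for A
    by (rule inj_onI, drule arg_cong[of _ _ infinity], simp add: inf)+
  have "?f i \<noteq> ?h j" for i j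
  proof
    assume "?f i = ?h j"
    from arg_cong[OF this, of infinity] show False unfolding inf by presburger
  qed
  then have disj: "?f ` {..M} \<inter> ?h ` {..<M - g} = {}" by blast
  show "finite (rr_basis p M)" by (simp add: rr_basis_def)
  show "card (rr_basis p M) = 2 * M + 1 - g"
    unfolding rr_basis_def using disj M by (simp add: card_Un_disjoint card_image inj)
  have "inj_on infinity (rr_basis p M)"
  proof (rule inj_onI)
    fix b b' assume b: "b \<in> rr_basis p M" "b' \<in> rr_basis p M" and e: "infinity b = infinity b'"
    from b consider i j where "b = ?f i" "b' = ?f j" | i j where "b = ?h i" "b' = ?h j"
      | i j where "b = ?f i" "b' = ?h j" | i j where "b = ?h i" "b' = ?f j"
      unfolding rr_basis_def by blast
    then show "b = b'"
    proof cases
      case 1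
      then have "i = j" using e by (simp add: inf)
      then show ?thesis using 1 by simp
    next
      case 2
      then have "i = j" using e by (simp add: inf)
      then show ?thesis using 2 by simp
    next
      case 3
      have False using e unfolding 3 inf by presburger
      then show ?thesis by (rule FalseE)
    next
      case 4
      have False using e unfolding 4 inf by presburger
      then show ?thesis by (rule FalseE)
    qed
  qed
  moreover have "0 \<notin> rr_basis p M" using p by (auto simp: rr_basis_def zero_prod_def)
  ultimately show "ffv.independent (rr_basis p M)"
    by (intro independent_if_inj_values[OF infinity_in_points]) (simp_all add: rr_basis_def)
qed

lemma keys_rr_divisor: "Poly_Mapping.keys (rr_divisor p M) \<subseteq> points F"
proof -
  have "Poly_Mapping.keys (frag_cmul (int (2 * M)) (frag_of infinity)) \<subseteq> points F"
    using keys_cmul[of "int (2 * M)" "frag_of infinity"] infinity_in_points by auto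
  then show ?thesis unfolding rr_divisor_def using keys_add keys_div_of by fast
qed

lemma div_degree_rr_divisor: "p \<noteq> 0 \<Longrightarrow> div_degree (rr_divisor p M) = int (2 * M)"
  by (simp add: rr_divisor_def div_degree_add div_degree_poly)

lemma lookup_rr_divisor:
  "p \<noteq> 0 \<Longrightarrow> v \<in> points F \<Longrightarrow> Poly_Mapping.lookup (rr_divisor p M) v =
     (if v = infinity then 2 * int M else 0) + v (of_rat_fn p)"
  by (auto simp: rr_divisor_def lookup_add lookup_div_of)

lemma rr_basis_subset:
  assumes p: "p \<noteq> 0" and M: "g \<le> M"
  shows "rr_basis p M \<subseteq> riemann_roch_space F (rr_divisor p M)"
proof
  fix b assume b: "b \<in> rr_basis p M"
  have inf: "- 2 * int M + 2 * int (Polynomial.degree p) \<le> infinity b"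
    using b M unfolding rr_basis_def by (auto simp: rr_basis_inf[OF p])
  have bnz: "b \<noteq> 0" using b p by (auto simp: rr_basis_def zero_prod_def)
  obtain A B where AB: "ff_mult F (of_rat_fn p) b = poly_ff A B"
  proof -
    from b consider i where "b = (to_fract (Polynomial.monom 1 i) / to_fract p, 0)"
      | j where "b = (0, to_fract (Polynomial.monom 1 j) / to_fract p)" by (auto simp: rr_basis_def)
    then show thesis
    proof cases
      case 1
      then have "ff_mult F (of_rat_fn p) b = poly_ff (Polynomial.monom 1 i) 0"
        using p by (simp add: of_rat_fn_def poly_ff_def ff_mult_def)
      then show thesis by (rule that)
    next
      case 2
      then have "ff_mult F (of_rat_fn p) b = poly_ff 0 (Polynomial.monom 1 j)"
        using p by (simp add: of_rat_fn_def poly_ff_def ff_mult_def)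
      then show thesis by (rule that)
    qed
  qed
  have nz: "poly_ff A B \<noteq> 0" using AB bnz p by (metis ff_mult_eq_0_iff of_rat_fn_eq_0)
  have "vge v (- Poly_Mapping.lookup (rr_divisor p M) v) b" if v: "v \<in> points F" for v
    using v
  proof (cases rule: points_cases)
    case 1
    then show ?thesis using inf lookup_rr_divisor[OF p v, of M] infinity_values(1)[OF p] by (simp add: vge_def)
  next
    case (2 a c)
    have "0 \<le> v (poly_ff A B)" using point_poly_ff_pos(1)[OF 2(1), of A B] nz 2(2) by simp
    then have "- v (of_rat_fn p) \<le> v b" using pt_divide_poly[OF v bnz p AB] by simp
    then show ?thesis using point_neq_infinity[OF 2(1)] 2(2) lookup_rr_divisor[OF p v, of M] by (simp add: vge_def)
  qed
  then show "b \<in> riemann_roch_space F (rr_divisor p M)" by (simp add: riemann_roch_space_eq)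
qed

lemma rr_basis_spans:
  assumes p: "p \<noteq> 0"
  shows "riemann_roch_space F (rr_divisor p M) \<subseteq> ffv.span (rr_basis p M)"
proof
  fix h assume h: "h \<in> riemann_roch_space F (rr_divisor p M)"
  let ?k = "ff_mult F (of_rat_fn p) h"
  have kge: "vge v (- (if v = infinity then 2 * int M else 0)) ?k" if v: "v \<in> points F" for v
  proof -
    have "vge v (- Poly_Mapping.lookup (rr_divisor p M) v) h" using h v by (simp add: riemann_roch_space_eq)
    moreover have "vge v (v (of_rat_fn p)) (of_rat_fn p)" by (simp add: vge_def)
    ultimately show ?thesis
      using vge_mult[OF v, of "v (of_rat_fn p)" "of_rat_fn p" "- Poly_Mapping.lookup (rr_divisor p M) v" h]
      by (simp add: lookup_rr_divisor[OF p v] split: if_splits)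
  qed
  have "vge (point a b) 0 ?k" if "on_curve a b" for a b
    using kge[OF point_in_points[OF that]] point_neq_infinity[OF that] by simp
  then obtain A B where AB: "?k = poly_ff A B" using affine_regular by blast
  have inf: "vge infinity (- 2 * int M) (poly_ff A B)" using kge[OF infinity_in_points] AB by simp
  have degA: "Polynomial.degree A \<le> M"
    using inf infinity_poly_ff[of A B] by (cases "A = 0") (auto simp: vge_def min_def split: if_splits)
  have degB: "Polynomial.degree B < M - g" if "B \<noteq> 0"
    using inf infinity_poly_ff[of A B] that by (auto simp: vge_def min_def split: if_splits)
  have sumA: "A = (\<Sum>i\<le>M. Polynomial.monom (poly.coeff A i) i)" by (rule poly_as_sum_of_monoms'[symmetric, OF degA])
  have sumB: "B = (\<Sum>j<M - g. Polynomial.monom (poly.coeff B j) j)"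
  proof (cases "B = 0")
    case False
    then obtain l where l: "M - g = Suc l" using degB by (cases "M - g") auto
    then have "Polynomial.degree B \<le> l" using degB False by simp
    from poly_as_sum_of_monoms'[OF this] show ?thesis unfolding l lessThan_Suc_atMost by (rule sym)
  qed simp
  have mon: "to_fract (Polynomial.monom c i) = const_fn c * to_fract (Polynomial.monom 1 i)" for c :: "'k alg_closure" and i
    unfolding const_fn_def to_fract_mult[symmetric] by (simp add: smult_monom)
  let ?f = "\<lambda>i. (to_fract (Polynomial.monom 1 i) / to_fract p, 0) :: 'k ff"
  let ?h = "\<lambda>j. (0, to_fract (Polynomial.monom 1 j) / to_fract p) :: 'k ff"
  have fst_sum: "fst (sum q S) = (\<Sum>i\<in>S. fst (q i))" and snd_sum: "snd (sum q S) = (\<Sum>i\<in>S. snd (q i))"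
    for q :: "nat \<Rightarrow> 'k ff" and S
    by (induction S rule: infinite_finite_induct) simp_all
  have "h = (to_fract A / to_fract p, to_fract B / to_fract p)"
    using AB p by (cases h) (auto simp: of_rat_fn_def poly_ff_def ff_mult_def nonzero_eq_divide_eq mult.commute)
  also have "\<dots> = (\<Sum>i\<le>M. ff_scale (poly.coeff A i) (?f i)) + (\<Sum>j<M - g. ff_scale (poly.coeff B j) (?h j))"
  proof (rule prod_eqI)
    have "to_fract A = (\<Sum>i\<le>M. const_fn (poly.coeff A i) * to_fract (Polynomial.monom 1 i))"
      by (subst sumA) (simp add: mon[symmetric])
    then show "fst (to_fract A / to_fract p, to_fract B / to_fract p) =
        fst ((\<Sum>i\<le>M. ff_scale (poly.coeff A i) (?f i)) + (\<Sum>j<M - g. ff_scale (poly.coeff B j) (?h j)))"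
      by (simp add: fst_sum ff_scale_def sum_divide_distrib)
    have "to_fract B = (\<Sum>j<M - g. const_fn (poly.coeff B j) * to_fract (Polynomial.monom 1 j))"
      by (subst sumB) (simp add: mon[symmetric])
    then show "snd (to_fract A / to_fract p, to_fract B / to_fract p) =
        snd ((\<Sum>i\<le>M. ff_scale (poly.coeff A i) (?f i)) + (\<Sum>j<M - g. ff_scale (poly.coeff B j) (?h j)))"
      by (simp add: snd_sum ff_scale_def sum_divide_distrib)
  qed
  also have "\<dots> \<in> ffv.span (rr_basis p M)"
    by (intro ffv.span_add ffv.span_sum ffv.span_scale ffv.span_base) (auto simp: rr_basis_def)
  finally show "h \<in> ffv.span (rr_basis p M)" .
qed

lemma ell_rr_divisor:
  assumes "p \<noteq> 0" "g \<le> M" shows "ell F (rr_divisor p M) = 2 * M + 1 - g"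
  unfolding ell_def
  using ffv.basis_card_eq_dim[OF rr_basis_subset[OF assms] rr_basis_spans[OF assms(1)] rr_basis_card(3)[OF assms]]
    rr_basis_card(2)[OF assms] by simp

text \<open>The polynomial \<open>p\<close> takes care of the affine points, and \<open>M\<close> of the remaining one.\<close>

lemma divisor_le_rr_divisor:
  assumes D: "Poly_Mapping.keys D \<subseteq> points F"
  shows "\<exists>p M. p \<noteq> 0 \<and> g \<le> M \<and> (\<forall>v. Poly_Mapping.lookup D v \<le> Poly_Mapping.lookup (rr_divisor p M) v)"
proof -
  have "\<exists>p. p \<noteq> 0 \<and> (\<forall>v\<in>S. v \<noteq> infinity \<longrightarrow> Poly_Mapping.lookup D v \<le> v (of_rat_fn p)) \<and>
      (\<forall>v\<in>points F. v \<noteq> infinity \<longrightarrow> 0 \<le> v (of_rat_fn p))"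
    if "finite S" "S \<subseteq> points F" for S
    using that
  proof (induction S rule: finite_induct)
    case empty
    have z: "v (of_rat_fn 1) = 0" if "v \<in> points F" for v using pt_of_rat_fn_const[OF that, of 1] by (simp add: one_pCons)
    show ?case
    proof (intro exI[of _ 1] conjI ballI impI)
      show "0 \<le> v (of_rat_fn 1)" if "v \<in> points F" for v using z[OF that] by simp
    qed simp_all
  next
    case (insert w S)
    then obtain p where p: "p \<noteq> 0" "\<forall>v\<in>S. v \<noteq> infinity \<longrightarrow> Poly_Mapping.lookup D v \<le> v (of_rat_fn p)"
      and p': "\<forall>v\<in>points F. v \<noteq> infinity \<longrightarrow> 0 \<le> v (of_rat_fn p)" by auto
    have w: "w \<in> points F" using insert by simp
    show ?case
    proof (cases "w = infinity")
      case True
      then show ?thesis using p p' by blast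
    next
      case False
      then obtain a b where ab: "on_curve a b" "w = point a b" using points_cases[OF w] by metis
      define q where "q = [:-a, 1:] ^ nat (Poly_Mapping.lookup D w)"
      have q: "q \<noteq> 0" by (simp add: q_def)
      have qpos: "0 \<le> v (of_rat_fn q)" if "v \<in> points F" "v \<noteq> infinity" for v
        using that(1)
      proof (cases rule: points_cases)
        case (2 a b)
        then show ?thesis using point_poly_value[OF 2(1) q] by simp
      qed (use that in simp)
      have qD: "Poly_Mapping.lookup D w \<le> w (of_rat_fn q)"
        using point_poly_value[OF ab(1) q] ab(2) by (simp add: q_def order_power_n_n)
      have val: "v (of_rat_fn (q * p)) = v (of_rat_fn q) + v (of_rat_fn p)" if "v \<in> points F" for v
        by (rule pt_of_rat_fn_mult[OF that q p(1)])
      show ?thesis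
      proof (intro exI[of _ "q * p"] conjI ballI impI)
        show "q * p \<noteq> 0" using q p by simp
        show "0 \<le> v (of_rat_fn (q * p))" if "v \<in> points F" "v \<noteq> infinity" for v
          using val[OF that(1)] qpos[OF that] bspec[OF p' that(1)] that(2) by simp
        show "Poly_Mapping.lookup D v \<le> v (of_rat_fn (q * p))" if v: "v \<in> insert w S" "v \<noteq> infinity" for v
        proof -
          have vp: "v \<in> points F" using v insert.prems by blast
          have pos: "0 \<le> v (of_rat_fn p)" "0 \<le> v (of_rat_fn q)" using p' qpos vp v(2) by auto
          show ?thesis
          proof (cases "v = w")
            case True
            then show ?thesis using qD pos val[OF vp] by simp
          next
            case False
            then have "Poly_Mapping.lookup D v \<le> v (of_rat_fn p)" using p(2) v by blast
            then show ?thesis using pos val[OF vp] by simp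
          qed
        qed
      qed
    qed
  qed
  then obtain p where p: "p \<noteq> 0" "\<forall>v\<in>Poly_Mapping.keys D. v \<noteq> infinity \<longrightarrow> Poly_Mapping.lookup D v \<le> v (of_rat_fn p)"
    and p': "\<forall>v\<in>points F. v \<noteq> infinity \<longrightarrow> 0 \<le> v (of_rat_fn p)"
    using D finite_keys[of D] by blast
  define M where "M = g + nat (Poly_Mapping.lookup D infinity - infinity (of_rat_fn p))"
  have "Poly_Mapping.lookup D v \<le> Poly_Mapping.lookup (rr_divisor p M) v" for v
  proof (cases "v \<in> points F")
    case True
    show ?thesis
    proof (cases "v = infinity")
      case True
      then show ?thesis using lookup_rr_divisor[OF p(1) infinity_in_points, of M] by (simp add: M_def)
    next
      case False
      then show ?thesis
        using lookup_rr_divisor[OF p(1) True, of M] p p' True by (cases "v \<in> Poly_Mapping.keys D") (auto simp: in_keys_iff)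
    qed
  next
    case False
    then have "v \<notin> Poly_Mapping.keys D" "v \<notin> Poly_Mapping.keys (rr_divisor p M)"
      using D keys_rr_divisor by blast+
    then show ?thesis by (simp add: in_keys_iff)
  qed
  then show ?thesis using p(1) by (intro exI[of _ p] exI[of _ M]) (simp add: M_def)
qed

text \<open>For \<open>E = rr_divisor p M\<close> the number \<open>deg E + 1 - \<ell>(E)\<close> is \<open>g\<close>, and it can only grow when a divisor is
  enlarged, since each new point contributes at most one to the dimension.\<close>

theorem genus: "has_genus F g"
  unfolding has_genus_def
proof (intro conjI ballI)
  fix D assume "D \<in> carrier (divisors F)"
  then have D: "Poly_Mapping.keys D \<subseteq> points F" by simp
  obtain p M where p: "p \<noteq> 0" and M: "g \<le> M"
    and le: "\<And>v. Poly_Mapping.lookup D v \<le> Poly_Mapping.lookup (rr_divisor p M) v"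
    using divisor_le_rr_divisor[OF D] by blast
  obtain B where B: "B \<subseteq> riemann_roch_space F D" "ffv.independent B" "riemann_roch_space F D \<subseteq> ffv.span B"
    "card B = ell F D" unfolding ell_def using ffv.basis_exists by blast
  have "riemann_roch_space F D \<subseteq> riemann_roch_space F (rr_divisor p M)"
    using le unfolding riemann_roch_space_def by (auto intro: order_trans add_left_mono)
  then have "B \<subseteq> ffv.span (rr_basis p M)" using B(1) rr_basis_spans[OF p] by blast
  then have fin: "finite B" using ffv.independent_span_bound[OF rr_basis_card(1)[OF p M] B(2)] by blast
  obtain B' where B': "riemann_roch_space F (rr_divisor p M) \<subseteq> ffv.span B'" "finite B'"
    "int (card B') \<le> int (card B) + div_degree (rr_divisor p M) - div_degree D"
    using riemann_roch_enlarge[OF D keys_rr_divisor le B(3) fin] by blast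
  have "rr_basis p M \<subseteq> ffv.span B'" using rr_basis_subset[OF p M] B'(1) by blast
  then have "card (rr_basis p M) \<le> card B'" using ffv.independent_span_bound[OF B'(2) rr_basis_card(3)[OF p M]] by blast
  then show "div_degree D + 1 - int (ell F D) \<le> int g"
    using B'(3) M by (simp add: rr_basis_card(2)[OF p M] div_degree_rr_divisor[OF p] B(4))
next
  have "rr_divisor 1 g \<in> carrier (divisors F)" using keys_rr_divisor by simp
  moreover have "div_degree (rr_divisor 1 g) + 1 - int (ell F (rr_divisor 1 g)) = int g"
    by (simp add: ell_rr_divisor div_degree_rr_divisor)
  ultimately show "\<exists>D\<in>carrier (divisors F). div_degree D + 1 - int (ell F D) = int g" by blast
qed

text \<open>A factorisation into linear factors would make \<open>F\<close> a square, but its degree is odd.\<close>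

theorem irreducible_equation: "Factorial_Ring.irreducible [:- geom F, 0, 1:]"
proof (rule Factorial_Ring.irreducibleI)
  show "[:- geom F, 0, 1:] \<noteq> 0" by simp
  show "\<not> [:- geom F, 0, 1:] dvd 1"
  proof
    assume "[:- geom F, 0, 1:] dvd 1"
    then have "Polynomial.degree [:- geom F, 0, 1:] \<le> Polynomial.degree (1 :: 'k alg_closure poly poly)"
      by (rule dvd_imp_degree_le) simp
    then show False by simp
  qed
  fix P Q assume PQ: "[:- geom F, 0, 1:] = P * Q"
  have nz: "P \<noteq> 0" "Q \<noteq> 0" using PQ by auto
  have deg: "Polynomial.degree P + Polynomial.degree Q = 2"
    using degree_mult_eq[OF nz] PQ by (metis degree_pCons_eq_if degree_1 numeral_2_eq_2 one_pCons pCons_eq_0_iff zero_neq_one)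
  have lead: "Polynomial.lead_coeff P * Polynomial.lead_coeff Q = 1"
    using lead_coeff_mult[of P Q] PQ[symmetric] by simp
  have unit: "p dvd 1" if "p = [:c:]" "c * d = 1" for p :: "'k alg_closure poly poly" and c d
  proof -
    have "p * [:d:] = 1" using that by (simp add: one_pCons mult.commute)
    then show ?thesis by (metis dvd_triv_left)
  qed
  consider "Polynomial.degree P = 0" | "Polynomial.degree Q = 0" | "Polynomial.degree P = 1" "Polynomial.degree Q = 1"
    using deg by linarith
  then show "P dvd 1 \<or> Q dvd 1"
  proof cases
    case 1
    then obtain c where "P = [:c:]" by (metis degree_eq_zeroE)
    then show ?thesis using unit[of P c] lead by simp
  next
    case 2
    then obtain c where "Q = [:c:]" by (metis degree_eq_zeroE)
    then show ?thesis using unit[of Q c] lead by (simp add: mult.commute)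
  next
    case 3
    obtain p q where P: "P = [:p, q:]" using 3(1) by (metis degree1_coeffs)
    obtain r s where Q: "Q = [:r, s:]" using 3(2) by (metis degree1_coeffs)
    have "[:p * r, p * s + q * r, q * s:] = [:- geom F, 0, 1:]" unfolding PQ P Q by (simp add: algebra_simps)
    then have e: "p * r = - geom F" "p * s + q * r = 0" "q * s = 1" by simp_all
    have ps: "p * s = - (q * r)" using e(2) by (simp add: eq_neg_iff_add_eq_0)
    have "p * s * (p * s) = p * s * - (q * r)" using ps by (rule arg_cong)
    also have "\<dots> = q * s * - (p * r)" by (simp add: algebra_simps)
    also have "\<dots> = geom F" by (simp add: e)
    finally have sq: "p * s * (p * s) = geom F" .
    then have "2 * Polynomial.degree (p * s) = 2 * g + 1"
      using deg_geom by (metis degree_mult_eq geom_nz mult_2 mult_eq_0_iff)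
    then show ?thesis by presburger
  qed
qed

corollary imaginary_hyperelliptic: "imaginary_hyperelliptic_curve F g"
  unfolding imaginary_hyperelliptic_curve_def hyperelliptic_curve_def
  using irreducible_equation genus degF by simp

end

section \<open>The Galois action and the rational points of the Jacobian\<close>

context
  fixes F :: "'k::field_char_0 poly" and \<sigma> :: "'k alg_closure \<Rightarrow> 'k alg_closure"
  assumes \<sigma>: "\<sigma> \<in> galois_group"
begin

lemma map_poly_galois_geom: "map_poly \<sigma> (map_poly to_ac p) = map_poly to_ac p"
  by (simp add: map_poly_hom_compose[OF galois_groupD(1)[OF \<sigma>] is_hom_to_ac] galois_groupD(3)[OF \<sigma>])

lemma galois_ff_add: "galois_ff \<sigma> (h + h') = galois_ff \<sigma> h + galois_ff \<sigma> h'"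
  by (simp add: galois_ff_def hom_add[OF is_hom_galois_rat[OF galois_groupD(1)[OF \<sigma>]]])

lemma galois_ff_mult: "galois_ff \<sigma> (ff_mult F h h') = ff_mult F (galois_ff \<sigma> h) (galois_ff \<sigma> h')"
proof -
  note s = hom_simps[OF is_hom_galois_rat[OF galois_groupD(1)[OF \<sigma>]]]
  have "galois_rat \<sigma> (to_fract (geom F)) = to_fract (geom F)"
    by (simp add: galois_rat_to_fract[OF galois_groupD(1)[OF \<sigma>]] geom_def map_poly_galois_geom)
  then show ?thesis by (simp add: galois_ff_def ff_mult_def s)
qed

lemma galois_ff_eq_0: "galois_ff \<sigma> h = 0 \<longleftrightarrow> h = 0"
  by (cases h) (simp add: galois_ff_def zero_prod_def hom_eq_0_iff[OF is_hom_galois_rat[OF galois_groupD(1)[OF \<sigma>]]])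

lemma galois_ff_poly: "galois_ff \<sigma> (to_fract A, to_fract B) = (to_fract (map_poly \<sigma> A), to_fract (map_poly \<sigma> B))"
  by (simp add: galois_ff_def galois_rat_to_fract[OF galois_groupD(1)[OF \<sigma>]])

lemma galois_ff_of_rat_fn: "galois_ff \<sigma> (of_rat_fn A) = of_rat_fn (map_poly \<sigma> A)"
  using galois_ff_poly[of A 0] by (simp add: of_rat_fn_def)

lemma galois_ff_const: "galois_ff \<sigma> (const_fn c, 0) = (const_fn (\<sigma> c), 0)"
  using galois_ff_of_rat_fn[of "[:c:]"] by (simp add: of_rat_fn_const map_poly_hom_pCons[OF galois_groupD(1)[OF \<sigma>]])

lemma galois_ff_inv: "galois_ff \<sigma> (galois_ff (inv_into UNIV \<sigma>) h) = h"
  "galois_ff (inv_into UNIV \<sigma>) (galois_ff \<sigma> h) = h"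
proof -
  let ?t = "inv_into UNIV \<sigma>"
  note h1 = galois_groupD(1)[OF \<sigma>] and h2 = galois_groupD(1)[OF galois_inv(1)[OF \<sigma>]]
  have m: "map_poly \<sigma> (map_poly ?t p) = p" "map_poly ?t (map_poly \<sigma> p) = p" for p
    by (simp_all add: map_poly_hom_compose h1 h2 galois_inv[OF \<sigma>])
  have "galois_rat \<sigma> (galois_rat ?t a) = a \<and> galois_rat ?t (galois_rat \<sigma> a) = a" for a
  proof -
    obtain p q where "a = to_fract p / to_fract q" by (cases a) (auto simp: Fract_conv_to_fract)
    then show ?thesis
      by (simp add: hom_divide[OF is_hom_galois_rat[OF h1]] hom_divide[OF is_hom_galois_rat[OF h2]]
          galois_rat_to_fract[OF h1] galois_rat_to_fract[OF h2] m)
  qed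
  then show "galois_ff \<sigma> (galois_ff ?t h) = h" "galois_ff ?t (galois_ff \<sigma> h) = h"
    by (simp_all add: galois_ff_def)
qed

lemma inj_galois_point: "galois_point \<sigma> v = galois_point \<sigma> w \<longleftrightarrow> v = w"
proof
  assume "galois_point \<sigma> v = galois_point \<sigma> w"
  from fun_cong[OF this] have "v (galois_ff (inv_into UNIV \<sigma>) (galois_ff \<sigma> h)) = w (galois_ff (inv_into UNIV \<sigma>) (galois_ff \<sigma> h))" for h
    unfolding galois_point_def .
  then show "v = w" unfolding galois_ff_inv by (rule ext)
qed simp

lemma lookup_galois_div: "Poly_Mapping.lookup (galois_div \<sigma> D) (galois_point \<sigma> v) = Poly_Mapping.lookup D v"
proof -
  have "Poly_Mapping.lookup (galois_div \<sigma> D) (galois_point \<sigma> v) =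
      (\<Sum>i\<in>Poly_Mapping.keys D. Poly_Mapping.lookup D i * (if i = v then 1 else 0))"
    unfolding galois_div_def frag_extend_def lookup_sum by (auto intro!: sum.cong simp: inj_galois_point)
  also have "\<dots> = (\<Sum>i\<in>Poly_Mapping.keys D. if i = v then Poly_Mapping.lookup D v else 0)"
    by (intro sum.cong) auto
  also have "\<dots> = Poly_Mapping.lookup D v" by (auto simp: in_keys_iff)
  finally show ?thesis .
qed

lemma keys_galois_div: "Poly_Mapping.keys (galois_div \<sigma> D) \<subseteq> galois_point \<sigma> ` Poly_Mapping.keys D"
  unfolding galois_div_def using keys_frag_extend[of "\<lambda>v. frag_of (galois_point \<sigma> v)" D] by auto

lemma galois_div_add: "galois_div \<sigma> (D + E) = galois_div \<sigma> D + galois_div \<sigma> E"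
  and galois_div_diff: "galois_div \<sigma> (D - E) = galois_div \<sigma> D - galois_div \<sigma> E"
  and galois_div_cmul: "galois_div \<sigma> (frag_cmul c D) = frag_cmul c (galois_div \<sigma> D)"
  and galois_div_of: "galois_div \<sigma> (frag_of v) = frag_of (galois_point \<sigma> v)"
  unfolding galois_div_def by (simp_all add: frag_extend_add frag_extend_diff frag_extend_cmul)

lemma div_degree_galois_div: "div_degree (galois_div \<sigma> D) = div_degree D"
proof -
  have "div_degree (galois_div \<sigma> D) = (\<Sum>w\<in>galois_point \<sigma> ` Poly_Mapping.keys D. Poly_Mapping.lookup (galois_div \<sigma> D) w)"
    by (rule div_degree_superset[OF _ keys_galois_div]) simp
  also have "\<dots> = (\<Sum>v\<in>Poly_Mapping.keys D. Poly_Mapping.lookup (galois_div \<sigma> D) (galois_point \<sigma> v))"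
    by (rule sum.reindex_cong[of "galois_point \<sigma>"]) (auto simp: inj_on_def inj_galois_point)
  finally show ?thesis by (simp add: lookup_galois_div div_degree_def)
qed

end

lemma galois_point_in_points:
  fixes F :: "'k::field_char_0 poly"
  assumes \<sigma>: "\<sigma> \<in> galois_group" and v: "v \<in> points F"
  shows "galois_point \<sigma> v \<in> points F"
proof -
  let ?t = "inv_into UNIV \<sigma>"
  note t = galois_inv(1)[OF \<sigma>]
  show ?thesis
    unfolding galois_point_def
  proof (rule points_precompose[OF v galois_ff_add[OF t] galois_ff_mult[OF t] galois_ff_eq_0[OF t]])
    show "\<exists>c'. c' \<noteq> 0 \<and> galois_ff ?t (const_fn c, 0) = (const_fn c', 0)" if "c \<noteq> 0" for c
      using that by (intro exI[of _ "?t c"]) (simp add: galois_ff_const[OF t] hom_eq_0_iff[OF galois_groupD(1)[OF t]])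
    show "\<exists>h'. galois_ff ?t h' = h" for h using galois_ff_inv(2)[OF \<sigma>] by blast
  qed
qed

lemma galois_inv_inv:
  assumes "\<sigma> \<in> galois_group" shows "inv_into UNIV (inv_into UNIV \<sigma>) = \<sigma>"
  using galois_groupD(2)[OF assms] by (rule inv_inv_eq)

lemma galois_point_inv:
  fixes v :: "'k::field_char_0 ff \<Rightarrow> int"
  assumes \<sigma>: "\<sigma> \<in> galois_group" shows "galois_point \<sigma> (galois_point (inv_into UNIV \<sigma>) v) = v"
  unfolding galois_point_def galois_inv_inv[OF \<sigma>] by (simp add: galois_ff_inv[OF \<sigma>])

context hyperell
begin

lemma galois_on_curve: assumes "\<sigma> \<in> galois_group" "on_curve a b" shows "on_curve (\<sigma> a) (\<sigma> b)"
proof -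
  note h = galois_groupD(1)[OF assms(1)]
  have "poly (map_poly \<sigma> (geom F)) (\<sigma> a) = \<sigma> (b ^ 2)"
    using assms(2) by (simp add: poly_map_poly_hom[OF h] on_curve_def)
  then show ?thesis by (simp add: on_curve_def geom_def map_poly_galois_geom[OF assms(1)] hom_power[OF h])
qed

text \<open>The centre of a point determines it, and centres are mapped by \<open>\<sigma>\<close>.\<close>

lemma galois_point_point:
  assumes \<sigma>: "\<sigma> \<in> galois_group" and c: "on_curve a b"
  shows "galois_point \<sigma> (point a b) = point (\<sigma> a) (\<sigma> b)"
proof (rule point_eqI[OF galois_on_curve[OF assms]])
  let ?t = "inv_into UNIV \<sigma>"
  note t = galois_inv(1)[OF \<sigma>] note th = galois_groupD(1)[OF t]
  have "galois_ff ?t (of_rat_fn [:- \<sigma> a, 1:]) = of_rat_fn [:- a, 1:]"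
    by (simp add: galois_ff_of_rat_fn[OF t] map_poly_hom_pCons[OF th] hom_simps[OF th] galois_inv[OF \<sigma>])
  moreover have "galois_ff ?t (poly_ff [:- \<sigma> b:] 1) = poly_ff [:- b:] 1"
    by (simp add: poly_ff_def galois_ff_poly[OF t] map_poly_hom_pCons[OF th] hom_simps[OF th] galois_inv[OF \<sigma>]
        del: to_fract_1)
  ultimately show "centered (galois_point \<sigma> (point a b)) (\<sigma> a) (\<sigma> b)"
    using point_centered[OF c] galois_point_in_points[OF \<sigma> point_in_points[OF c]]
    by (simp add: centered_def galois_point_def)
qed

lemma galois_point_infinity: assumes \<sigma>: "\<sigma> \<in> galois_group" shows "galois_point \<sigma> infinity = infinity"
proof -
  let ?t = "inv_into UNIV \<sigma>"
  note t = galois_inv(1)[OF \<sigma>] note th = galois_groupD(1)[OF t]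
  have "galois_ff ?t (of_rat_fn [:0, 1:]) = of_rat_fn [:0, 1:]"
    by (simp add: galois_ff_of_rat_fn[OF t] map_poly_hom_pCons[OF th] hom_simps[OF th])
  then have "at_infinity (galois_point \<sigma> infinity)"
    using infinity_at_infinity galois_point_in_points[OF \<sigma> infinity_in_points]
    by (simp add: at_infinity_def galois_point_def)
  then show ?thesis using at_infinity_unique(2) infinity_at_infinity by blast
qed

lemma galois_div_keys_points:
  "\<sigma> \<in> galois_group \<Longrightarrow> Poly_Mapping.keys D \<subseteq> points F \<Longrightarrow> Poly_Mapping.keys (galois_div \<sigma> D) \<subseteq> points F"
  using keys_galois_div galois_point_in_points by blast

lemma galois_div_eqI:
  assumes \<sigma>: "\<sigma> \<in> galois_group" and keys: "Poly_Mapping.keys D \<subseteq> points F" "Poly_Mapping.keys E \<subseteq> points F"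
    and eq: "\<And>v. v \<in> points F \<Longrightarrow> Poly_Mapping.lookup E (galois_point \<sigma> v) = Poly_Mapping.lookup D v"
  shows "galois_div \<sigma> D = E"
proof (rule poly_mapping_eqI)
  fix w
  show "Poly_Mapping.lookup (galois_div \<sigma> D) w = Poly_Mapping.lookup E w"
  proof (cases "w \<in> points F")
    case True
    define v where "v = galois_point (inv_into UNIV \<sigma>) w"
    have "w = galois_point \<sigma> v" unfolding v_def by (rule galois_point_inv[OF \<sigma>, symmetric])
    moreover have "v \<in> points F" unfolding v_def by (rule galois_point_in_points[OF galois_inv(1)[OF \<sigma>] True])
    ultimately show ?thesis using eq by (simp add: lookup_galois_div[OF \<sigma>])
  next
    case False
    then have "w \<notin> Poly_Mapping.keys (galois_div \<sigma> D)" "w \<notin> Poly_Mapping.keys E"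
      using galois_div_keys_points[OF \<sigma> keys(1)] keys(2) by blast+
    then show ?thesis by (simp add: in_keys_iff)
  qed
qed

lemma galois_div_div_of:
  assumes \<sigma>: "\<sigma> \<in> galois_group" and "h \<noteq> 0" shows "galois_div \<sigma> (div_of h) = div_of (galois_ff \<sigma> h)"
proof (rule galois_div_eqI[OF \<sigma> keys_div_of keys_div_of])
  fix v assume "v \<in> points F"
  then show "Poly_Mapping.lookup (div_of (galois_ff \<sigma> h)) (galois_point \<sigma> v) = Poly_Mapping.lookup (div_of h) v"
    using assms galois_point_in_points[OF \<sigma>]
    by (simp add: lookup_div_of galois_ff_eq_0[OF \<sigma>]) (simp add: galois_point_def galois_ff_inv[OF \<sigma>])
qed

subsection \<open>Divisor classes\<close>

text \<open>The elements of \<open>Pic0 F\<close> are these cosets of the principal divisors, for \<open>D\<close> of degree 0.\<close>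

definition div_class :: "(('k ff \<Rightarrow> int) \<Rightarrow>\<^sub>0 int) \<Rightarrow> (('k ff \<Rightarrow> int) \<Rightarrow>\<^sub>0 int) set" where
  "div_class D = {E. E - D \<in> principal_divisors F}"

definition deg0_divisors :: "(('k ff \<Rightarrow> int) \<Rightarrow>\<^sub>0 int) set" where
  "deg0_divisors = {D. Poly_Mapping.keys D \<subseteq> points F \<and> div_degree D = 0}"

lemma deg0_add: "D \<in> deg0_divisors \<Longrightarrow> E \<in> deg0_divisors \<Longrightarrow> D + E \<in> deg0_divisors"
  and deg0_diff: "D \<in> deg0_divisors \<Longrightarrow> E \<in> deg0_divisors \<Longrightarrow> D - E \<in> deg0_divisors"
  and deg0_cmul: "D \<in> deg0_divisors \<Longrightarrow> frag_cmul c D \<in> deg0_divisors"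
  unfolding deg0_divisors_def
  using keys_add[of D E] keys_diff[of D E] keys_cmul[of c D] by (auto simp: div_degree_add div_degree_diff)

lemma deg0_div_of: "h \<noteq> 0 \<Longrightarrow> div_of h \<in> deg0_divisors"
  using keys_div_of div_degree_principal by (simp add: deg0_divisors_def)

lemma principal_div_of: "h \<noteq> 0 \<Longrightarrow> div_of h \<in> principal_divisors F"
  unfolding principal_divisors_eq by blast

lemma principal_add: "D \<in> principal_divisors F \<Longrightarrow> E \<in> principal_divisors F \<Longrightarrow> D + E \<in> principal_divisors F"
  unfolding principal_divisors_eq using div_of_mult ff_mult_eq_0_iff by (smt (verit, best) mem_Collect_eq)

lemma principal_uminus: "D \<in> principal_divisors F \<Longrightarrow> - D \<in> principal_divisors F"
  unfolding principal_divisors_eq using div_of_inverse by (smt (verit, best) mem_Collect_eq)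

lemma principal_diff: "D \<in> principal_divisors F \<Longrightarrow> E \<in> principal_divisors F \<Longrightarrow> D - E \<in> principal_divisors F"
  using principal_add[of D "- E"] principal_uminus[of E] by simp

lemma principal_0: "0 \<in> principal_divisors F"
proof -
  have "(const_fn 1, 0) \<noteq> (0 :: 'k ff)" by (simp add: zero_prod_def hom_1[OF is_hom_const_fn])
  from principal_div_of[OF this] show ?thesis using div_of_const[of 1] by simp
qed

lemma principal_cmul: assumes "D \<in> principal_divisors F" shows "frag_cmul c D \<in> principal_divisors F"
proof (induction c rule: int_induct[of _ 0])
  case base
  then show ?case by (simp add: principal_0)
next
  case (step1 i)
  then show ?case using principal_add[OF _ assms] by (simp add: frag_cmul_distrib)
next
  case (step2 i)
  then show ?case using principal_diff[OF _ assms] by (simp add: frag_cmul_diff_distrib)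
qed

lemma div_class_eq_iff: "div_class D = div_class E \<longleftrightarrow> D - E \<in> principal_divisors F"
proof
  assume eq: "div_class D = div_class E"
  have "D \<in> div_class D" using principal_0 by (simp add: div_class_def)
  then have "D \<in> div_class E" unfolding eq .
  then show "D - E \<in> principal_divisors F" by (simp add: div_class_def)
next
  assume DE: "D - E \<in> principal_divisors F"
  have "W - D \<in> principal_divisors F \<longleftrightarrow> W - E \<in> principal_divisors F" for W
  proof
    assume "W - D \<in> principal_divisors F"
    from principal_add[OF this DE] show "W - E \<in> principal_divisors F" by simp
  next
    assume "W - E \<in> principal_divisors F"
    from principal_diff[OF this DE] show "W - D \<in> principal_divisors F" by simp
  qed
  then show "div_class D = div_class E" by (simp add: div_class_def)
qed

lemma galois_div_inv:
  fixes D :: "('k ff \<Rightarrow> int) \<Rightarrow>\<^sub>0 int"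
  assumes \<sigma>: "\<sigma> \<in> galois_group"
  shows "galois_div \<sigma> (galois_div (inv_into UNIV \<sigma>) D) = D"
proof (rule poly_mapping_eqI)
  fix w :: "'k ff \<Rightarrow> int"
  have "Poly_Mapping.lookup (galois_div \<sigma> (galois_div (inv_into UNIV \<sigma>) D))
      (galois_point \<sigma> (galois_point (inv_into UNIV \<sigma>) w)) = Poly_Mapping.lookup D w"
    by (simp only: lookup_galois_div[OF \<sigma>] lookup_galois_div[OF galois_inv(1)[OF \<sigma>]])
  then show "Poly_Mapping.lookup (galois_div \<sigma> (galois_div (inv_into UNIV \<sigma>) D)) w = Poly_Mapping.lookup D w"
    unfolding galois_point_inv[OF \<sigma>] .
qed

lemma galois_div_principal:
  assumes \<sigma>: "\<sigma> \<in> galois_group" and "D \<in> principal_divisors F" shows "galois_div \<sigma> D \<in> principal_divisors F"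
proof -
  obtain h where h: "h \<noteq> 0" "D = div_of h" using assms(2) unfolding principal_divisors_eq by blast
  then show ?thesis
    using galois_div_div_of[OF \<sigma> h(1)] principal_div_of[of "galois_ff \<sigma> h"] galois_ff_eq_0[OF \<sigma>, of h] by simp
qed

lemma galois_div_class:
  assumes \<sigma>: "\<sigma> \<in> galois_group" shows "galois_div \<sigma> ` div_class D = div_class (galois_div \<sigma> D)"
proof (intro equalityI subsetI)
  fix E assume "E \<in> galois_div \<sigma> ` div_class D"
  then show "E \<in> div_class (galois_div \<sigma> D)"
    using galois_div_principal[OF \<sigma>] by (auto simp: div_class_def galois_div_diff[OF \<sigma>, symmetric])
next
  let ?t = "inv_into UNIV \<sigma>"
  note t = galois_inv(1)[OF \<sigma>]
  fix E assume "E \<in> div_class (galois_div \<sigma> D)"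
  then have "galois_div ?t (E - galois_div \<sigma> D) \<in> principal_divisors F"
    by (intro galois_div_principal[OF t]) (simp add: div_class_def)
  moreover have "galois_div ?t (galois_div \<sigma> D) = D"
    using galois_div_inv[OF t] by (simp add: galois_inv_inv[OF \<sigma>])
  ultimately have "galois_div ?t E \<in> div_class D" by (simp add: div_class_def galois_div_diff[OF t])
  then show "E \<in> galois_div \<sigma> ` div_class D" by (rule rev_image_eqI) (simp add: galois_div_inv[OF \<sigma>])
qed

lemma
  shows carrier_Pic0: "carrier (Pic0 F) = div_class ` deg0_divisors"
    and mult_Pic0: "D \<in> deg0_divisors \<Longrightarrow> E \<in> deg0_divisors \<Longrightarrow>
      div_class D \<otimes>\<^bsub>Pic0 F\<^esub> div_class E = div_class (D + E)"
    and one_Pic0: "\<one>\<^bsub>Pic0 F\<^esub> = div_class 0"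
proof -
  let ?Z = "(divisors F)\<lparr>carrier := {D \<in> carrier (divisors F). div_degree D = 0}\<rparr>"
  have Z: "carrier ?Z = deg0_divisors" by (auto simp: deg0_divisors_def)
  have coset: "principal_divisors F #>\<^bsub>?Z\<^esub> D = div_class D" for D
  proof (intro equalityI subsetI)
    fix E assume "E \<in> div_class D"
    then show "E \<in> principal_divisors F #>\<^bsub>?Z\<^esub> D"
      unfolding r_coset_def div_class_def by (intro UN_I[of "E - D"]) simp_all
  qed (auto simp: r_coset_def div_class_def)
  show "carrier (Pic0 F) = div_class ` deg0_divisors"
  proof -
    have "carrier (Pic0 F) = (\<Union>D\<in>carrier ?Z. {principal_divisors F #>\<^bsub>?Z\<^esub> D})"
      by (simp only: Pic0_def FactGroup_def partial_object.select_convs RCOSETS_def)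
    then show ?thesis unfolding coset Z by blast
  qed
  show "\<one>\<^bsub>Pic0 F\<^esub> = div_class 0"
    by (simp add: Pic0_def FactGroup_def div_class_def)
  show "div_class D \<otimes>\<^bsub>Pic0 F\<^esub> div_class E = div_class (D + E)" if "D \<in> deg0_divisors" "E \<in> deg0_divisors" for D E
  proof -
    have "div_class D \<otimes>\<^bsub>Pic0 F\<^esub> div_class E = {x + y | x y. x \<in> div_class D \<and> y \<in> div_class E}"
      by (auto simp: Pic0_def FactGroup_def set_mult_def)
    also have "\<dots> = div_class (D + E)"
    proof (intro equalityI subsetI)
      fix W assume "W \<in> {x + y | x y. x \<in> div_class D \<and> y \<in> div_class E}"
      then obtain x y where "W = x + y" "x - D \<in> principal_divisors F" "y - E \<in> principal_divisors F"
        by (auto simp: div_class_def)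
      then show "W \<in> div_class (D + E)" using principal_add[of "x - D" "y - E"] by (simp add: div_class_def algebra_simps)
    next
      fix W assume "W \<in> div_class (D + E)"
      then have "W - E \<in> div_class D" "E \<in> div_class E" using principal_0 by (auto simp: div_class_def algebra_simps)
      then show "W \<in> {x + y | x y. x \<in> div_class D \<and> y \<in> div_class E}" by force
    qed
    finally show ?thesis .
  qed
qed

subsection \<open>Invariant classes contain invariant divisors\<close>

definition galois_invariant :: "(('k ff \<Rightarrow> int) \<Rightarrow>\<^sub>0 int) \<Rightarrow> bool" where
  "galois_invariant D \<longleftrightarrow> (\<forall>\<sigma>\<in>galois_group. galois_div \<sigma> D = D)"

text \<open>The rational point at infinity is left out, so that it can be used to bring the degree to 0; the
  degree then counts the affine points.\<close>

definition effective :: "(('k ff \<Rightarrow> int) \<Rightarrow>\<^sub>0 int) \<Rightarrow> bool" where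
  "effective D \<longleftrightarrow> Poly_Mapping.keys D \<subseteq> points F - {infinity} \<and> (\<forall>v. 0 \<le> Poly_Mapping.lookup D v)"

definition reduced_at_inf :: "(('k ff \<Rightarrow> int) \<Rightarrow>\<^sub>0 int) \<Rightarrow> (('k ff \<Rightarrow> int) \<Rightarrow>\<^sub>0 int)" where
  "reduced_at_inf D = D - frag_cmul (div_degree D) (frag_of infinity)"

lemma effective_degree_nonneg: "effective D \<Longrightarrow> 0 \<le> div_degree D"
  unfolding effective_def div_degree_def by (simp add: sum_nonneg)

text \<open>The affine poles of \<open>D0\<close> are removed by a polynomial in \<open>x\<close> with sufficiently many zeros.\<close>

lemma effective_representative_exists:
  assumes D0: "D0 \<in> deg0_divisors"
  shows "\<exists>D. effective D \<and> reduced_at_inf D \<in> div_class D0"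
proof -
  have D0': "Poly_Mapping.keys D0 \<subseteq> points F" "div_degree D0 = 0" using D0 by (auto simp: deg0_divisors_def)
  then have "Poly_Mapping.keys (- D0) \<subseteq> points F" by simp
  from divisor_le_rr_divisor[OF this] obtain p M where p: "p \<noteq> 0"
    and le: "\<And>v. Poly_Mapping.lookup (- D0) v \<le> Poly_Mapping.lookup (rr_divisor p M) v" by blast
  define E where "E = D0 + div_of (of_rat_fn p)"
  define D where "D = E - frag_cmul (Poly_Mapping.lookup E infinity) (frag_of infinity)"
  have keysE: "Poly_Mapping.keys E \<subseteq> points F" unfolding E_def using keys_add keys_div_of D0'(1) by fast
  have look: "Poly_Mapping.lookup D v = (if v = infinity then 0 else Poly_Mapping.lookup E v)" for v
    by (simp add: D_def lookup_minus)
  have "0 \<le> Poly_Mapping.lookup D v" for v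
    using le[of v] by (auto simp: look E_def rr_divisor_def lookup_add split: if_splits)
  moreover have "Poly_Mapping.keys D \<subseteq> points F - {infinity}"
    using keysE by (auto simp: in_keys_iff look split: if_splits)
  ultimately have "effective D" by (simp add: effective_def)
  moreover have "div_degree D = - Poly_Mapping.lookup E infinity"
    by (simp add: D_def E_def div_degree_diff div_degree_add div_degree_poly[OF p] D0'(2))
  then have "reduced_at_inf D = E" by (simp add: reduced_at_inf_def D_def)
  then have "reduced_at_inf D \<in> div_class D0" using principal_div_of[of "of_rat_fn p"] p by (simp add: E_def div_class_def)
  ultimately show ?thesis by blast
qed

text \<open>If \<open>E = D + div h\<close> with \<open>E \<noteq> D\<close> of the least degree, then \<open>h\<close> is a unit at infinity and \<open>h - c\<close> has a zero
  there for a constant \<open>c\<close>. The poles of \<open>h - c\<close> are bounded by \<open>D\<close>, so that \<open>D + div (h - c)\<close> gives an effective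
  representative of smaller degree.\<close>

lemma minimal_effective_unique:
  assumes D: "effective D" "reduced_at_inf D \<in> div_class D0"
    and E: "effective E" "reduced_at_inf E \<in> div_class D0" "div_degree E = div_degree D"
    and min: "\<And>W. effective W \<Longrightarrow> reduced_at_inf W \<in> div_class D0 \<Longrightarrow> div_degree D \<le> div_degree W"
  shows "E = D"
proof (rule ccontr)
  assume ne: "E \<noteq> D"
  have "reduced_at_inf E - reduced_at_inf D \<in> principal_divisors F"
    using principal_diff[of "reduced_at_inf E - D0" "reduced_at_inf D - D0"] D E by (simp add: div_class_def)
  then obtain h where h: "h \<noteq> 0" "E = D + div_of h"
    using E(3) by (auto simp: reduced_at_inf_def principal_divisors_eq diff_eq_eq add.commute)
  have inf0: "Poly_Mapping.lookup W infinity = 0" if "effective W" for W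
    using that by (auto simp: effective_def in_keys_iff)
  have "infinity h = 0"
    using arg_cong[OF h(2), of "\<lambda>D. Poly_Mapping.lookup D infinity"] inf0[OF D(1)] inf0[OF E(1)] h(1) infinity_in_points
    by (simp add: lookup_add lookup_div_of)
  then obtain c where c: "vge infinity 1 (h - (const_fn c, 0))"
    using residue[OF infinity_in_points, of h] by (auto simp: vge_def)
  define k where "k = h - (const_fn c, 0)"
  have k: "k \<noteq> 0"
  proof
    assume "k = 0"
    then have hc: "h = (const_fn c, 0)" by (simp add: k_def)
    then have "c \<noteq> 0" using h(1) by (auto simp: hom_0[OF is_hom_const_fn] zero_prod_def)
    then show False using ne h(2) div_of_const[of c] unfolding hc by simp
  qed
  have ki: "1 \<le> infinity k" using c k by (simp add: vge_def k_def)
  define W where "W = D + div_of k - frag_cmul (infinity k) (frag_of infinity)"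
  have look: "Poly_Mapping.lookup W v = (if v = infinity then 0 else Poly_Mapping.lookup D v + Poly_Mapping.lookup (div_of k) v)" for v
    using inf0[OF D(1)] k infinity_in_points by (simp add: W_def lookup_add lookup_minus lookup_div_of)
  have "0 \<le> Poly_Mapping.lookup W v" for v
  proof (cases "v \<in> points F \<and> v \<noteq> infinity")
    case True
    then have v: "v \<in> points F" by simp
    have Dv: "0 \<le> Poly_Mapping.lookup D v" using D(1) by (simp add: effective_def)
    have "0 \<le> Poly_Mapping.lookup E v" using E(1) by (simp add: effective_def)
    then have "vge v (- Poly_Mapping.lookup D v) h"
      using h True by (simp add: vge_def lookup_add lookup_div_of)
    moreover have "vge v (- Poly_Mapping.lookup D v) (const_fn c, 0)"
      using vge_mono[OF v vge_const[OF v]] Dv by simp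
    ultimately have "vge v (- Poly_Mapping.lookup D v) k" unfolding k_def by (rule vge_diff[OF v])
    then show ?thesis using True k by (simp add: look vge_def lookup_div_of)
  next
    case False
    then show ?thesis using D(1) by (auto simp: look lookup_div_of effective_def)
  qed
  moreover have "Poly_Mapping.keys W \<subseteq> points F - {infinity}"
    using D(1) by (auto simp: in_keys_iff look lookup_div_of effective_def subset_iff split: if_splits)
  ultimately have "effective W" by (simp add: effective_def)
  moreover have deg: "div_degree W = div_degree D - infinity k"
    by (simp add: W_def div_degree_add div_degree_diff div_degree_principal[OF k])
  then have "reduced_at_inf W = reduced_at_inf D + div_of k"
    by (simp add: reduced_at_inf_def W_def frag_cmul_diff_distrib)
  then have "reduced_at_inf W \<in> div_class D0"
    using D(2) principal_add[of "reduced_at_inf D - D0" "div_of k"] principal_div_of[OF k]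
    by (simp add: div_class_def diff_add_eq)
  ultimately show False using min deg ki by fastforce
qed

lemma galois_div_effective:
  assumes \<sigma>: "\<sigma> \<in> galois_group" and D: "effective D" shows "effective (galois_div \<sigma> D)"
proof -
  have "0 \<le> Poly_Mapping.lookup (galois_div \<sigma> D) w" for w
    using lookup_galois_div[OF \<sigma>, of D "galois_point (inv_into UNIV \<sigma>) w"] D
    unfolding galois_point_inv[OF \<sigma>] by (simp add: effective_def)
  moreover have "Poly_Mapping.keys (galois_div \<sigma> D) \<subseteq> points F - {infinity}"
  proof
    fix w assume "w \<in> Poly_Mapping.keys (galois_div \<sigma> D)"
    then obtain v where v: "v \<in> Poly_Mapping.keys D" "w = galois_point \<sigma> v" using keys_galois_div[OF \<sigma>] by blast
    then have "v \<in> points F" "v \<noteq> infinity" using D by (auto simp: effective_def)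
    then show "w \<in> points F - {infinity}"
      using v galois_point_in_points[OF \<sigma>] inj_galois_point[OF \<sigma>, of v infinity] galois_point_infinity[OF \<sigma>] by auto
  qed
  ultimately show ?thesis by (simp add: effective_def)
qed

lemma galois_reduced_at_inf:
  "\<sigma> \<in> galois_group \<Longrightarrow> galois_div \<sigma> (reduced_at_inf D) = reduced_at_inf (galois_div \<sigma> D)"
  by (simp add: reduced_at_inf_def galois_div_diff galois_div_cmul galois_div_of galois_point_infinity div_degree_galois_div)

text \<open>The conjugates of an effective representative of least degree are again effective representatives
  of least degree, hence equal to it.\<close>

theorem invariant_class_has_invariant_divisor:
  assumes D0: "D0 \<in> deg0_divisors" and inv: "\<forall>\<sigma>\<in>galois_group. galois_div \<sigma> ` div_class D0 = div_class D0"
  shows "\<exists>D. effective D \<and> galois_invariant D \<and> reduced_at_inf D \<in> div_class D0"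
proof -
  define P where "P = (\<lambda>D. effective D \<and> reduced_at_inf D \<in> div_class D0)"
  obtain D1 where "P D1" unfolding P_def using effective_representative_exists[OF D0] by blast
  then obtain D where D: "P D" and min: "\<And>W. P W \<Longrightarrow> nat (div_degree D) \<le> nat (div_degree W)"
    using ex_has_least_nat[of P D1 "\<lambda>D. nat (div_degree D)"] by blast
  have min': "div_degree D \<le> div_degree W" if "effective W" "reduced_at_inf W \<in> div_class D0" for W
    using min[of W] that effective_degree_nonneg[of W] by (auto simp: P_def)
  have "galois_div \<sigma> D = D" if \<sigma>: "\<sigma> \<in> galois_group" for \<sigma>
  proof (rule minimal_effective_unique[OF _ _ _ _ _ min'])
    show "effective D" "reduced_at_inf D \<in> div_class D0" using D by (auto simp: P_def)
    then show "effective (galois_div \<sigma> D)" by (intro galois_div_effective[OF \<sigma>])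
    show "div_degree (galois_div \<sigma> D) = div_degree D" by (rule div_degree_galois_div[OF \<sigma>])
    have "galois_div \<sigma> (reduced_at_inf D) \<in> galois_div \<sigma> ` div_class D0"
      using \<open>reduced_at_inf D \<in> div_class D0\<close> by blast
    then show "reduced_at_inf (galois_div \<sigma> D) \<in> div_class D0"
      using inv \<sigma> galois_reduced_at_inf[OF \<sigma>] by auto
  qed
  then show ?thesis using D by (auto simp: P_def galois_invariant_def)
qed

subsection \<open>A criterion for the rank\<close>

text \<open>The homomorphism from the free abelian group that sends the generators to the classes of the \<open>E i\<close> is
  onto \<open>J(K)\<close>, since every invariant class contains an invariant divisor. So \<open>J(K)\<close> is free, and the finite
  factor is trivial.\<close>

theorem jacobian_free:
  fixes E :: "nat \<Rightarrow> ('k ff \<Rightarrow> int) \<Rightarrow>\<^sub>0 int"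
  assumes E: "\<And>i. i < r \<Longrightarrow> E i \<in> deg0_divisors" "\<And>i. i < r \<Longrightarrow> galois_invariant (E i)"
    and span: "\<And>D. effective D \<Longrightarrow> galois_invariant D \<Longrightarrow>
      \<exists>c. reduced_at_inf D - (\<Sum>i<r. frag_cmul (c i) (E i)) \<in> principal_divisors F"
    and indep: "\<And>c. (\<Sum>i<r. frag_cmul (c i) (E i)) \<in> principal_divisors F \<Longrightarrow> \<forall>i<r. c i = 0"
  shows "fg_abelian_of_rank (jacobian_points F) r"
proof -
  let ?A = "free_Abelian_group {..<r}" and ?J = "jacobian_points F"
  define S where "S x = (\<Sum>i<r. frag_cmul (Poly_Mapping.lookup x i) (E i))" for x :: "nat \<Rightarrow>\<^sub>0 int"
  have S0: "S x \<in> deg0_divisors" for x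
  proof -
    have "(\<Sum>i\<in>I. frag_cmul (Poly_Mapping.lookup x i) (E i)) \<in> deg0_divisors" if "finite I" "I \<subseteq> {..<r}" for I
      using that
    proof (induction I rule: finite_induct)
      case empty
      then show ?case by (simp add: deg0_divisors_def)
    next
      case (insert i I)
      then show ?case by (simp add: deg0_add deg0_cmul E(1))
    qed
    then show ?thesis unfolding S_def by blast
  qed
  have Sadd: "S (x + y) = S x + S y" for x y
    by (simp add: S_def lookup_add frag_cmul_distrib sum.distrib)
  have Sinv: "galois_div \<sigma> (S x) = S x" if "\<sigma> \<in> galois_group" for \<sigma> x
  proof -
    have "galois_div \<sigma> (\<Sum>i\<in>I. frag_cmul (Poly_Mapping.lookup x i) (E i)) = (\<Sum>i\<in>I. frag_cmul (Poly_Mapping.lookup x i) (E i))"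
      if "finite I" "I \<subseteq> {..<r}" for I
      using that
      by (induction I rule: finite_induct)
        (use E(2) \<open>\<sigma> \<in> galois_group\<close> in \<open>auto simp: galois_div_add galois_div_cmul galois_invariant_def, simp add: galois_div_def\<close>)
    then show ?thesis unfolding S_def by blast
  qed
  have carrier_J: "carrier ?J = {div_class D | D. D \<in> deg0_divisors \<and> (\<forall>\<sigma>\<in>galois_group. galois_div \<sigma> ` div_class D = div_class D)}"
    by (auto simp: jacobian_points_def carrier_Pic0)
  have mult_J: "div_class D \<otimes>\<^bsub>?J\<^esub> div_class D' = div_class (D + D')" if "D \<in> deg0_divisors" "D' \<in> deg0_divisors" for D D'
    using mult_Pic0[OF that] by (simp add: jacobian_points_def)
  have one_J: "\<one>\<^bsub>?J\<^esub> = div_class 0" using one_Pic0 by (simp add: jacobian_points_def)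
  define \<psi> where "\<psi> x = div_class (S x)" for x
  have "\<psi> \<in> iso ?A ?J"
    unfolding iso_def hom_def mem_Collect_eq
  proof (intro conjI ballI)
    show "\<psi> \<in> carrier ?A \<rightarrow> carrier ?J"
      using S0 Sinv by (auto simp: \<psi>_def carrier_J galois_div_class)
    show "\<psi> (x \<otimes>\<^bsub>?A\<^esub> y) = \<psi> x \<otimes>\<^bsub>?J\<^esub> \<psi> y" for x y
      by (simp add: \<psi>_def Sadd mult_J[OF S0 S0])
    show "bij_betw \<psi> (carrier ?A) (carrier ?J)"
      unfolding bij_betw_def
    proof
      show "inj_on \<psi> (carrier ?A)"
      proof (rule inj_onI)
        fix x y assume xy: "x \<in> carrier ?A" "y \<in> carrier ?A" and e: "\<psi> x = \<psi> y"
        have "S x - S y \<in> principal_divisors F" using e by (simp add: \<psi>_def div_class_eq_iff)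
        moreover have "S x - S y = (\<Sum>i<r. frag_cmul (Poly_Mapping.lookup x i - Poly_Mapping.lookup y i) (E i))"
          by (simp add: S_def frag_cmul_diff_distrib sum_subtractf)
        ultimately have eq: "\<forall>i<r. Poly_Mapping.lookup x i = Poly_Mapping.lookup y i" using indep by fastforce
        show "x = y"
        proof (rule poly_mapping_eqI)
          fix i show "Poly_Mapping.lookup x i = Poly_Mapping.lookup y i"
          proof (cases "i < r")
            case False
            then have "i \<notin> Poly_Mapping.keys x" "i \<notin> Poly_Mapping.keys y" using xy by auto
            then show ?thesis by (simp add: in_keys_iff)
          qed (use eq in simp)
        qed
      qed
      show "\<psi> ` carrier ?A = carrier ?J"
      proof
        show "\<psi> ` carrier ?A \<subseteq> carrier ?J" using S0 Sinv by (auto simp: \<psi>_def carrier_J galois_div_class)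
        show "carrier ?J \<subseteq> \<psi> ` carrier ?A"
        proof
          fix C assume "C \<in> carrier ?J"
          then obtain D0 where D0: "C = div_class D0" "D0 \<in> deg0_divisors"
            "\<forall>\<sigma>\<in>galois_group. galois_div \<sigma> ` div_class D0 = div_class D0" by (auto simp: carrier_J)
          obtain D where D: "effective D" "galois_invariant D" "reduced_at_inf D \<in> div_class D0"
            using invariant_class_has_invariant_divisor[OF D0(2,3)] by blast
          obtain c where c: "reduced_at_inf D - (\<Sum>i<r. frag_cmul (c i) (E i)) \<in> principal_divisors F"
            using span[OF D(1,2)] by blast
          define x where "x = (\<Sum>i<r. frag_cmul (c i) (frag_of i))"
          have look: "Poly_Mapping.lookup x i = (if i < r then c i else 0)" for i
          proof -
            have "Poly_Mapping.lookup x i = (\<Sum>j<r. c j * (if j = i then 1 else 0))"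
              unfolding x_def lookup_sum by (intro sum.cong) auto
            also have "\<dots> = (\<Sum>j<r. if j = i then c j else 0)" by (intro sum.cong) auto
            finally show ?thesis by simp
          qed
          have "x \<in> carrier ?A" by (auto simp: in_keys_iff look split: if_splits)
          moreover have "S x = (\<Sum>i<r. frag_cmul (c i) (E i))" unfolding S_def by (simp add: look)
          then have "S x - D0 \<in> principal_divisors F"
            using principal_diff[of "reduced_at_inf D - D0" "reduced_at_inf D - S x"] c D(3) by (simp add: div_class_def)
          then have "\<psi> x = C" by (simp add: \<psi>_def D0(1) div_class_eq_iff)
          ultimately show "C \<in> \<psi> ` carrier ?A" by blast
        qed
      qed
    qed
  qed
  then have iso: "\<psi> \<in> iso ?A ?J" .
  interpret A: comm_group ?A by (rule abelian_free_Abelian_group)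
  have "\<psi> \<one>\<^bsub>?A\<^esub> = \<one>\<^bsub>?J\<^esub>" by (simp add: \<psi>_def S_def one_J)
  then have J: "comm_group ?J" using A.iso_imp_img_comm_group[OF iso] by simp
  interpret J: comm_group ?J by (rule J)
  let ?H = "{\<one>\<^bsub>?J\<^esub>}"
  have H: "subgroup ?H ?J" by (rule J.triv_subgroup)
  have "(\<lambda>x. (x, \<one>\<^bsub>?J\<^esub>)) \<in> iso ?A (?A \<times>\<times> ?J\<lparr>carrier := ?H\<rparr>)"
    by (auto simp: iso_def hom_def bij_betw_def inj_on_def DirProd_def)
  then have "?A \<cong> ?A \<times>\<times> ?J\<lparr>carrier := ?H\<rparr>" by (auto simp: is_iso_def)
  moreover have "?J \<cong> ?A" using iso A.iso_sym by (auto simp: is_iso_def)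
  ultimately have "?J \<cong> ?A \<times>\<times> ?J\<lparr>carrier := ?H\<rparr>" using iso_trans by blast
  then show ?thesis unfolding fg_abelian_of_rank_def using J H by (intro conjI exI[of _ ?H]) auto
qed

end

section \<open>Polynomials in two variables\<close>

text \<open>A nonzero element \<open>w\<close> of least degree in the ideal of \<open>p\<close> and \<open>q\<close> divides every element of the ideal up to
  a constant factor, by pseudo-division. If \<open>w\<close> were not constant, a prime factor of positive degree of
  its primitive part would divide \<open>p\<close> and \<open>q\<close>. The consequence of interest is that the common zeros have
  algebraic inner coordinates.\<close>

lemma coprime_poly_poly_combination:
  fixes p q :: "rat poly poly"
  assumes cop: "coprime p q"
  shows "\<exists>e s t. e \<noteq> 0 \<and> [:e:] = s * p + t * q"
proof -
  define J where "J = {s * p + t * q | s t. True}"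
  have comb: "a * x + b * y \<in> J" if xy: "x \<in> J" "y \<in> J" for a b x y
  proof -
    obtain s t s' t' where "x = s * p + t * q" "y = s' * p + t' * q" using xy unfolding J_def by blast
    then have "a * x + b * y = (a * s + b * s') * p + (a * t + b * t') * q" by (simp add: algebra_simps)
    then show ?thesis unfolding J_def by blast
  qed
  have pJ: "p \<in> J" unfolding J_def mem_Collect_eq by (rule exI[of _ 1], rule exI[of _ 0]) simp
  have qJ: "q \<in> J" unfolding J_def mem_Collect_eq by (rule exI[of _ 0], rule exI[of _ 1]) simp
  have "p \<noteq> 0 \<or> q \<noteq> 0" using cop by auto
  then obtain w0 where "w0 \<in> J \<and> w0 \<noteq> 0" using pJ qJ by blast
  then obtain w where w: "w \<in> J" "w \<noteq> 0"
    and min: "\<And>z. z \<in> J \<Longrightarrow> z \<noteq> 0 \<Longrightarrow> Polynomial.degree w \<le> Polynomial.degree z"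
    using ex_has_least_nat[of "\<lambda>z. z \<in> J \<and> z \<noteq> 0" w0 Polynomial.degree] by blast
  have "Polynomial.degree w = 0"
  proof (rule ccontr)
    assume dw: "Polynomial.degree w \<noteq> 0"
    define P where "P = primitive_part w"
    have wP: "w = Polynomial.smult (content w) P" by (simp add: P_def)
    have P0: "P \<noteq> 0" "Polynomial.degree P \<noteq> 0" using w(2) dw by (simp_all add: P_def)
    then have "\<not> is_unit P" by (metis is_unit_polyE degree_pCons_0)
    then obtain \<pi> where \<pi>: "\<pi> dvd P" "prime_elem \<pi>" using prime_divisor_exists[OF P0(1)] by blast
    have d\<pi>: "Polynomial.degree \<pi> \<noteq> 0"
    proof
      assume "Polynomial.degree \<pi> = 0"
      then obtain a where a: "\<pi> = [:a:]" by (metis degree_eq_zeroE)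
      then have "a dvd content P" using \<pi>(1) const_poly_dvd_iff_dvd_content by blast
      then have "is_unit a" using w(2) by (simp add: P_def)
      then show False using \<pi>(2) a by (simp add: is_unit_const_poly_iff prime_elem_def)
    qed
    have "\<pi> dvd z" if z: "z \<in> J" for z
    proof -
      obtain k r where kr: "pseudo_divmod z w = (k, r)" by (cases "pseudo_divmod z w")
      define c where "c = poly.coeff w (Polynomial.degree w) ^ (Suc (Polynomial.degree z) - Polynomial.degree w)"
      have c: "c \<noteq> 0" using w(2) by (simp add: c_def)
      have e: "Polynomial.smult c z = w * k + r" and r: "r = 0 \<or> Polynomial.degree r < Polynomial.degree w"
        using pseudo_divmod[OF w(2) kr] by (auto simp: c_def)
      have "r = [:c:] * z + (- k) * w" using e by (simp add: algebra_simps)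
      then have "r \<in> J" by (simp only: comb[OF z w(1)])
      then have "r = 0" using r min[of r] by (cases "r = 0") auto
      then have "[:c:] * z = w * k" using e by simp
      moreover have "\<pi> dvd w" using \<pi>(1) by (subst wP) (rule dvd_smult)
      ultimately have "\<pi> dvd [:c:] * z" by simp
      then have "\<pi> dvd [:c:] \<or> \<pi> dvd z" using \<pi>(2) prime_elem_dvd_multD by blast
      moreover have "\<not> \<pi> dvd [:c:]" using d\<pi> c by (metis dvd_imp_degree_le degree_pCons_0 le_zero_eq pCons_eq_0_iff)
      ultimately show ?thesis by blast
    qed
    then have "is_unit \<pi>" using cop pJ qJ coprime_common_divisor by blast
    then show False using \<pi>(2) by (simp add: prime_elem_def)
  qed
  then obtain e where e: "w = [:e:]" by (metis degree_eq_zeroE)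
  obtain s t where st: "w = s * p + t * q" using w(1) unfolding J_def by blast
  have "e \<noteq> 0" using w(2) unfolding e by simp
  moreover have "[:e:] = s * p + t * q" using st unfolding e .
  ultimately show ?thesis by (intro exI conjI)
qed

text \<open>Every coefficient, a polynomial in the inner variable, is turned into a polynomial in the outer one
  with constant coefficients; then the outer variable of \<open>P\<close> is replaced by the inner one.\<close>

definition swap_poly :: "'a::comm_ring_1 poly poly \<Rightarrow> 'a poly poly" where
  "swap_poly P = poly (map_poly (map_poly (\<lambda>c. [:c:])) P) [:[:0, 1:]:]"

lemma is_hom_swap_poly: "is_hom swap_poly"
  unfolding swap_poly_def by (rule is_hom_eval[OF is_hom_map_poly[OF is_hom_const_poly]])

text \<open>A homomorphism on polynomials in two variables is determined by its values at constants and at the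
  two variables.\<close>

lemma hom_poly_poly_eqI:
  fixes \<phi> \<psi> :: "'a::comm_ring_1 poly poly \<Rightarrow> 'b::comm_ring_1"
  assumes \<phi>: "is_hom \<phi>" and \<psi>: "is_hom \<psi>" and c: "\<And>c. \<phi> [:[:c:]:] = \<psi> [:[:c:]:]"
    and x: "\<phi> [:[:0, 1:]:] = \<psi> [:[:0, 1:]:]" and y: "\<phi> [:0, 1:] = \<psi> [:0, 1:]"
  shows "\<phi> P = \<psi> P"
proof (induction P)
  case 0
  then show ?case by (simp add: hom_0 \<phi> \<psi>)
next
  case (pCons p P)
  have "\<phi> [:p:] = \<psi> [:p:]"
  proof (induction p)
    case 0
    then show ?case by (simp add: hom_0 \<phi> \<psi>)
  next
    case (pCons a p)
    have "[:pCons a p:] = [:[:a:]:] + [:[:0, 1:]:] * [:p:]" by simp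
    then show ?case using pCons by (simp only: hom_add[OF \<phi>] hom_mult[OF \<phi>] hom_add[OF \<psi>] hom_mult[OF \<psi>] c x)
  qed
  moreover have "pCons p P = [:p:] + [:0, 1:] * P" by simp
  ultimately show ?case using pCons by (simp only: hom_add[OF \<phi>] hom_mult[OF \<phi>] hom_add[OF \<psi>] hom_mult[OF \<psi>] y)
qed

lemma swap_poly_gens: "swap_poly [:[:c:]:] = [:[:c:]:]" "swap_poly [:[:0, 1:]:] = [:0, 1:]"
  "swap_poly [:0, 1:] = [:[:0, 1:]:]"
  by (simp_all add: swap_poly_def map_poly_hom_pCons[OF is_hom_const_poly]
      map_poly_hom_pCons[OF is_hom_map_poly[OF is_hom_const_poly]] one_pCons[symmetric]
      hom_1[OF is_hom_map_poly[OF is_hom_const_poly]])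

lemma swap_poly_swap_poly [simp]: "swap_poly (swap_poly P) = P"
  by (rule hom_poly_poly_eqI[OF is_hom_compose[OF is_hom_swap_poly is_hom_swap_poly] is_hom_id])
    (simp_all add: swap_poly_gens)

lemma swap_poly_eq_0_iff [simp]: "swap_poly P = 0 \<longleftrightarrow> P = 0"
  by (metis hom_0[OF is_hom_swap_poly] swap_poly_swap_poly)

lemma swap_poly_dvd: "swap_poly P dvd swap_poly Q \<longleftrightarrow> P dvd Q"
  by (metis dvd_def hom_mult[OF is_hom_swap_poly] swap_poly_swap_poly)

lemma coprime_swap_poly:
  fixes P Q :: "rat poly poly"
  assumes "coprime P Q" shows "coprime (swap_poly P) (swap_poly Q)"
proof (rule coprimeI)
  fix d assume "d dvd swap_poly P" "d dvd swap_poly Q"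
  then have "swap_poly d dvd P" "swap_poly d dvd Q" using swap_poly_dvd[of "swap_poly d"] by simp_all
  then have "swap_poly d dvd 1" using assms coprime_common_divisor by blast
  then show "is_unit d" by (metis hom_1[OF is_hom_swap_poly] swap_poly_dvd swap_poly_swap_poly)
qed

text \<open>The inner variable, evaluated at \<open>a\<close>, plays the role of \<open>x\<close>, and the outer one that of \<open>y\<close>.\<close>

definition eval2 :: "('a::comm_ring_1 \<Rightarrow> 'b::comm_ring_1) \<Rightarrow> 'b \<Rightarrow> 'b \<Rightarrow> 'a poly poly \<Rightarrow> 'b" where
  "eval2 \<iota> a b P = poly (map_poly (\<lambda>c. poly (map_poly \<iota> c) a) P) b"

context
  fixes \<iota> :: "'a::comm_ring_1 \<Rightarrow> 'b::comm_ring_1"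
  assumes \<iota>: "is_hom \<iota>"
begin

lemma is_hom_eval2: "is_hom (eval2 \<iota> a b)"
  unfolding eval2_def by (rule is_hom_eval[OF is_hom_eval[OF \<iota>]])

lemma eval2_const: "eval2 \<iota> a b [:p:] = poly (map_poly \<iota> p) a"
  by (simp add: eval2_def map_poly_hom_pCons[OF is_hom_eval[OF \<iota>]])

lemma eval2_pCons: "eval2 \<iota> a b (pCons p P) = poly (map_poly \<iota> p) a + b * eval2 \<iota> a b P"
  by (simp add: eval2_def map_poly_hom_pCons[OF is_hom_eval[OF \<iota>]])

lemma eval2_y: "eval2 \<iota> a b [:0, 1:] = b"
  by (simp add: eval2_def map_poly_hom_pCons[OF is_hom_eval[OF \<iota>]] hom_simps[OF is_hom_eval[OF \<iota>]])

lemma eval2_x: "eval2 \<iota> a b [:[:0, 1:]:] = a"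
  by (simp add: eval2_const map_poly_hom_pCons[OF \<iota>] hom_simps[OF \<iota>])

lemma eval2_const_const: "eval2 \<iota> a b [:[:c:]:] = \<iota> c"
  by (simp add: eval2_const map_poly_hom_pCons[OF \<iota>])

lemma eval2_swap: "eval2 \<iota> a b (swap_poly P) = eval2 \<iota> b a P"
  by (rule hom_poly_poly_eqI[OF is_hom_compose[OF is_hom_eval2 is_hom_swap_poly] is_hom_eval2])
    (simp_all add: swap_poly_gens eval2_const_const eval2_x eval2_y)

end

section \<open>The algebraic closure of \<open>\<rat>(T)\<close>\<close>

type_synonym qt = "rat poly fract"
type_synonym qtc = "rat poly fract alg_closure"

text \<open>Rational numbers, and below the variable \<open>T\<close>, as elements of the algebraic closure of \<open>\<rat>(T)\<close>.\<close>

definition rat_ac :: "rat \<Rightarrow> qtc" where "rat_ac c = to_ac (const_fn c)"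

definition T_ac :: qtc where "T_ac = to_ac (to_fract [:0, 1:])"

lemma is_hom_rat_ac: "is_hom rat_ac"
  unfolding rat_ac_def by (rule is_hom_compose[OF is_hom_to_ac is_hom_const_fn])

lemma poly_T_ac: "poly (map_poly rat_ac p) T_ac = to_ac (to_fract p)"
proof (induction p)
  case (pCons c p)
  have "to_fract (pCons c p) = const_fn c + to_fract [:0, 1:] * to_fract p"
    by (simp add: const_fn_def flip: to_fract_mult to_fract_add)
  then have "to_ac (to_fract (pCons c p)) = rat_ac c + T_ac * to_ac (to_fract p)"
    by (simp add: T_ac_def rat_ac_def)
  then show ?case by (simp add: map_poly_hom_pCons[OF is_hom_rat_ac] pCons)
qed simp

definition alg_over_rat :: "qtc \<Rightarrow> bool" where
  "alg_over_rat z \<longleftrightarrow> (\<exists>p. p \<noteq> 0 \<and> poly (map_poly rat_ac p) z = 0)"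

lemma T_ac_transcendental: "\<not> alg_over_rat T_ac"
  by (simp add: alg_over_rat_def poly_T_ac)

lemma T_ac_nz: "T_ac \<noteq> 0" by (simp add: T_ac_def)

interpretation ratv: vector_space "\<lambda>c z. rat_ac c * z"
  by standard (simp_all add: hom_simps[OF is_hom_rat_ac] algebra_simps)

text \<open>That sums, products and inverses of algebraic numbers are algebraic is shown with finite-dimensional
  spaces over \<open>\<rat>\<close> that multiplication by the given numbers maps to themselves.\<close>

definition stable :: "qtc set \<Rightarrow> qtc \<Rightarrow> bool" where
  "stable B z \<longleftrightarrow> (\<forall>v\<in>ratv.span B. z * v \<in> ratv.span B)"

lemma stable_add: "stable B z \<Longrightarrow> stable B w \<Longrightarrow> stable B (z + w)"
  by (simp add: stable_def distrib_right ratv.span_add)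

lemma stable_mult: "stable B z \<Longrightarrow> stable B w \<Longrightarrow> stable B (z * w)"
  by (simp add: stable_def mult.assoc)

lemma stable_rat: "stable B (rat_ac c)"
  by (simp add: stable_def ratv.span_scale)

lemma stable_poly: "stable B z \<Longrightarrow> stable B (poly (map_poly rat_ac p) z)"
proof (induction p)
  case 0
  then show ?case using stable_rat[of B 0] by (simp add: hom_0[OF is_hom_rat_ac])
next
  case (pCons c p)
  then show ?case by (simp add: map_poly_hom_pCons[OF is_hom_rat_ac] stable_add stable_mult stable_rat)
qed

text \<open>The powers of \<open>z\<close> lie in a finite-dimensional space, so they are dependent.\<close>

lemma stable_imp_alg:
  assumes B: "finite B" "1 \<in> ratv.span B" and z: "stable B z"
  shows "alg_over_rat z"
proof (rule ccontr)
  assume nalg: "\<not> alg_over_rat z"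
  have pow: "z ^ i \<in> ratv.span B" for i
  proof (induction i)
    case (Suc i)
    then show ?case using z by (simp add: stable_def)
  qed (simp add: B)
  define n where "n = card B"
  define S where "S = (\<lambda>i. z ^ i) ` {..n}"
  have inj: "inj_on (\<lambda>i. z ^ i) {..n}"
  proof (rule inj_onI)
    fix i j assume e: "z ^ i = z ^ j"
    have "poly (map_poly rat_ac (Polynomial.monom 1 i - Polynomial.monom 1 j)) z = 0"
      using e by (simp add: hom_diff[OF is_hom_map_poly[OF is_hom_rat_ac]] map_poly_monom poly_monom hom_simps[OF is_hom_rat_ac])
    then have "Polynomial.monom (1 :: rat) i - Polynomial.monom 1 j = 0" using nalg unfolding alg_over_rat_def by blast
    then have "Polynomial.degree (Polynomial.monom (1 :: rat) i) = Polynomial.degree (Polynomial.monom (1 :: rat) j)" by simp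
    then show "i = j" by (simp add: degree_monom_eq)
  qed
  have "ratv.independent S"
  proof
    assume "ratv.dependent S"
    moreover have "finite S" by (simp add: S_def)
    ultimately obtain u v where u: "v \<in> S" "u v \<noteq> 0" "(\<Sum>v\<in>S. rat_ac (u v) * v) = 0"
      using ratv.dependent_finite by blast
    define p where "p = (\<Sum>i\<le>n. Polynomial.monom (u (z ^ i)) i)"
    have "poly (map_poly rat_ac p) z = (\<Sum>i\<le>n. rat_ac (u (z ^ i)) * z ^ i)"
      by (simp add: p_def hom_sum[OF is_hom_eval[OF is_hom_rat_ac]] map_poly_monom poly_monom hom_simps[OF is_hom_rat_ac])
    also have "\<dots> = (\<Sum>v\<in>S. rat_ac (u v) * v)" unfolding S_def by (simp add: sum.reindex[OF inj])
    finally have "p = 0" using u(3) nalg by (auto simp: alg_over_rat_def)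
    obtain i where i: "i \<le> n" "v = z ^ i" using u(1) by (auto simp: S_def)
    have "poly.coeff p i = u (z ^ i)" using i(1) by (simp add: p_def coeff_sum)
    then show False using u(2) i(2) \<open>p = 0\<close> by simp
  qed
  moreover have "S \<subseteq> ratv.span B" using pow by (auto simp: S_def)
  ultimately have "card S \<le> n" using ratv.independent_span_bound[OF B(1)] by (auto simp: n_def)
  moreover have "card S = Suc n" by (simp add: S_def card_image[OF inj])
  ultimately show False by simp
qed

lemma alg_nonzero_constant_term:
  assumes "alg_over_rat z" "z \<noteq> 0"
  shows "\<exists>c q. c \<noteq> 0 \<and> z * poly (map_poly rat_ac q) z = rat_ac c"
proof -
  obtain p0 where "p0 \<noteq> 0 \<and> poly (map_poly rat_ac p0) z = 0" using assms by (auto simp: alg_over_rat_def)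
  then obtain p where p: "p \<noteq> 0" "poly (map_poly rat_ac p) z = 0"
    and min: "\<And>q. q \<noteq> 0 \<Longrightarrow> poly (map_poly rat_ac q) z = 0 \<Longrightarrow> Polynomial.degree p \<le> Polynomial.degree q"
    using ex_has_least_nat[of "\<lambda>p. p \<noteq> 0 \<and> poly (map_poly rat_ac p) z = 0" p0 Polynomial.degree] by blast
  obtain c q where cq: "p = pCons c q" by (cases p)
  have e: "rat_ac c + z * poly (map_poly rat_ac q) z = 0" using p(2) by (simp add: cq map_poly_hom_pCons[OF is_hom_rat_ac])
  have "c \<noteq> 0"
  proof
    assume "c = 0"
    then have "poly (map_poly rat_ac q) z = 0" "q \<noteq> 0" using e assms(2) p(1) by (auto simp: cq hom_0[OF is_hom_rat_ac])
    from min[OF this(2,1)] show False using \<open>q \<noteq> 0\<close> by (simp add: cq)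
  qed
  moreover have "z * poly (map_poly rat_ac q) z = rat_ac (- c)"
    using e by (simp add: hom_uminus[OF is_hom_rat_ac] eq_neg_iff_add_eq_0 add.commute)
  ultimately show ?thesis by (intro exI[of _ "- c"] exI[of _ q]) simp
qed

text \<open>The inverse of an algebraic number is a polynomial in it.\<close>

lemma stable_inverse:
  assumes B: "finite B" "1 \<in> ratv.span B" and z: "stable B z" "z \<noteq> 0"
  shows "stable B (inverse z)"
proof -
  obtain c q where cq: "c \<noteq> 0" "z * poly (map_poly rat_ac q) z = rat_ac c"
    using alg_nonzero_constant_term[OF stable_imp_alg[OF B z(1)] z(2)] by blast
  have "rat_ac c \<noteq> 0" using cq(1) by (simp add: hom_eq_0_iff[OF is_hom_rat_ac])
  then have "z * (poly (map_poly rat_ac q) z * inverse (rat_ac c)) = 1" using cq(2) by (simp add: mult.assoc[symmetric])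
  then have "inverse z = poly (map_poly rat_ac q) z * rat_ac (inverse c)"
    by (simp add: hom_inverse[OF is_hom_rat_ac] inverse_unique)
  then show ?thesis by (simp add: stable_mult stable_poly stable_rat z)
qed

lemma alg_monic:
  assumes "alg_over_rat z"
  shows "\<exists>n. 0 < n \<and> z ^ n \<in> ratv.span ((\<lambda>i. z ^ i) ` {..<n})"
proof -
  obtain p where p: "p \<noteq> 0" "poly (map_poly rat_ac p) z = 0" using assms by (auto simp: alg_over_rat_def)
  define n where "n = Polynomial.degree p"
  define l where "l = Polynomial.lead_coeff p"
  have l: "rat_ac l \<noteq> 0" using p(1) by (simp add: l_def hom_eq_0_iff[OF is_hom_rat_ac])
  have "n \<noteq> 0"
  proof
    assume "n = 0"
    then obtain c where "p = [:c:]" unfolding n_def by (metis degree_eq_zeroE)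
    then show False using p by (simp add: map_poly_hom_pCons[OF is_hom_rat_ac] hom_eq_0_iff[OF is_hom_rat_ac])
  qed
  have "poly (map_poly rat_ac p) z = (\<Sum>i\<le>n. rat_ac (poly.coeff p i) * z ^ i)"
    by (simp add: poly_altdef degree_map_poly_hom[OF is_hom_rat_ac] n_def coeff_map_poly hom_0[OF is_hom_rat_ac])
  then have "(\<Sum>i<n. rat_ac (poly.coeff p i) * z ^ i) + rat_ac l * z ^ n = 0"
    using p(2) by (simp add: lessThan_Suc_atMost[symmetric] l_def n_def)
  then have "rat_ac l * z ^ n = - (\<Sum>i<n. rat_ac (poly.coeff p i) * z ^ i)"
    by (simp add: eq_neg_iff_add_eq_0 add.commute)
  then have "inverse (rat_ac l) * (rat_ac l * z ^ n) = rat_ac (- inverse l) * (\<Sum>i<n. rat_ac (poly.coeff p i) * z ^ i)"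
    by (simp add: hom_uminus[OF is_hom_rat_ac] hom_inverse[OF is_hom_rat_ac])
  then have "z ^ n = rat_ac (- inverse l) * (\<Sum>i<n. rat_ac (poly.coeff p i) * z ^ i)"
    using l by (simp add: mult.assoc[symmetric])
  also have "\<dots> \<in> ratv.span ((\<lambda>i. z ^ i) ` {..<n})"
    by (intro ratv.span_scale ratv.span_sum ratv.span_base) simp
  finally show ?thesis using \<open>n \<noteq> 0\<close> by blast
qed

text \<open>The space is spanned by the products \<open>a\<^sup>i b\<^sup>j\<close> with \<open>i\<close> and \<open>j\<close> below the degrees of
  polynomials over \<open>\<rat>\<close> that vanish at \<open>a\<close> and \<open>b\<close>.\<close>

lemma alg_pair_stable:
  assumes "alg_over_rat a" "alg_over_rat b"
  shows "\<exists>B. finite B \<and> 1 \<in> ratv.span B \<and> stable B a \<and> stable B b"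
proof -
  obtain n where n: "0 < n" "a ^ n \<in> ratv.span ((\<lambda>i. a ^ i) ` {..<n})" using alg_monic[OF assms(1)] by blast
  obtain m where m: "0 < m" "b ^ m \<in> ratv.span ((\<lambda>i. b ^ i) ` {..<m})" using alg_monic[OF assms(2)] by blast
  define B where "B = (\<lambda>(i, j). a ^ i * b ^ j) ` ({..<n} \<times> {..<m})"
  have base: "a ^ i * b ^ j \<in> ratv.span B" if "i < n" "j < m" for i j
    using that by (intro ratv.span_base) (auto simp: B_def)
  have mult_span: "c * w \<in> ratv.span B" if w: "w \<in> ratv.span S" and S: "\<And>s. s \<in> S \<Longrightarrow> c * s \<in> ratv.span B" for c w S
    using w
  proof (induction rule: ratv.span_induct_alt)
    case base
    then show ?case by (simp add: ratv.span_zero)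
  next
    case (step k x y)
    have "c * (rat_ac k * x + y) = rat_ac k * (c * x) + c * y" by (simp add: algebra_simps)
    then show ?case using step S by (simp add: ratv.span_add ratv.span_scale)
  qed
  have an: "a ^ n * b ^ j \<in> ratv.span B" if "j < m" for j
    using mult_span[OF n(2), of "b ^ j"] base that by (auto simp: mult.commute)
  have bm: "a ^ i * b ^ m \<in> ratv.span B" if "i < n" for i
    using mult_span[OF m(2), of "a ^ i"] base that by auto
  have "stable B a"
    unfolding stable_def
  proof
    fix v assume v: "v \<in> ratv.span B"
    show "a * v \<in> ratv.span B"
    proof (rule mult_span[OF v])
      fix s assume "s \<in> B"
      then obtain i j where ij: "s = a ^ i * b ^ j" "i < n" "j < m" by (auto simp: B_def)
      then have "a * s = a ^ Suc i * b ^ j" by (simp add: mult.assoc)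
      then show "a * s \<in> ratv.span B" using an[OF ij(3)] base[of "Suc i" j] ij(2,3) by (cases "Suc i = n") (simp_all del: power_Suc)
    qed
  qed
  moreover have "stable B b"
    unfolding stable_def
  proof
    fix v assume v: "v \<in> ratv.span B"
    show "b * v \<in> ratv.span B"
    proof (rule mult_span[OF v])
      fix s assume "s \<in> B"
      then obtain i j where ij: "s = a ^ i * b ^ j" "i < n" "j < m" by (auto simp: B_def)
      then have "b * s = a ^ i * b ^ Suc j" by (simp add: mult.left_commute)
      then show "b * s \<in> ratv.span B" using bm[OF ij(2)] base[of i "Suc j"] ij(2,3) by (cases "Suc j = m") (simp_all del: power_Suc)
    qed
  qed
  moreover have "1 \<in> ratv.span B" using base[of 0 0] n(1) m(1) by simp
  ultimately show ?thesis by (intro exI[of _ B]) (simp add: B_def)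
qed

text \<open>On the curve \<open>y\<^sup>2 = 1 + T f(x)\<close>, outside the fibre \<open>f = 0\<close>, the function \<open>T\<close> is a rational
  function of the coordinates, so the coordinates are not both algebraic numbers.\<close>

lemma coordinates_not_both_algebraic:
  assumes e: "b ^ 2 = T_ac * poly (map_poly rat_ac f) a + 1" and f: "poly (map_poly rat_ac f) a \<noteq> 0"
    and alg: "alg_over_rat a" "alg_over_rat b"
  shows False
proof -
  obtain B where B: "finite B" "1 \<in> ratv.span B" "stable B a" "stable B b" using alg_pair_stable[OF alg] by blast
  have "stable B (b * b + rat_ac (- 1))" by (intro stable_add stable_mult stable_rat B)
  moreover have "stable B (inverse (poly (map_poly rat_ac f) a))" by (intro stable_inverse stable_poly B f)
  ultimately have "stable B ((b * b + rat_ac (- 1)) * inverse (poly (map_poly rat_ac f) a))" by (rule stable_mult)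
  moreover have "(b * b + rat_ac (- 1)) * inverse (poly (map_poly rat_ac f) a) = T_ac"
    using e f by (simp add: hom_simps[OF is_hom_rat_ac] power2_eq_square)
  ultimately show False using stable_imp_alg[OF B(1,2)] T_ac_transcendental by simp
qed

text \<open>By elimination of either variable, a common zero would have algebraic coordinates.\<close>

lemma coprime_no_common_zero:
  assumes e: "b ^ 2 = T_ac * poly (map_poly rat_ac f) a + 1" and f: "poly (map_poly rat_ac f) a \<noteq> 0"
    and cop: "coprime P Q" and P: "eval2 rat_ac a b P = 0" and Q: "eval2 rat_ac a b Q = 0"
  shows False
proof -
  note h = is_hom_eval2[OF is_hom_rat_ac]
  have alg: "alg_over_rat a" if PQ: "coprime P Q" "eval2 rat_ac a b P = 0" "eval2 rat_ac a b Q = 0" for a b P Q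
  proof -
    obtain c s t where c: "c \<noteq> 0" "[:c:] = s * P + t * Q" using coprime_poly_poly_combination[OF PQ(1)] by blast
    have "eval2 rat_ac a b [:c:] = 0" unfolding c(2) by (simp add: hom_simps[OF h] PQ)
    then show ?thesis using c(1) by (auto simp: alg_over_rat_def eval2_const[OF is_hom_rat_ac])
  qed
  have "alg_over_rat a" by (rule alg[OF cop P Q])
  moreover have "alg_over_rat b"
    by (rule alg[OF coprime_swap_poly[OF cop], where b = a]) (simp_all add: eval2_swap[OF is_hom_rat_ac] P Q)
  ultimately show False using coordinates_not_both_algebraic[OF e f] by blast
qed

section \<open>The curves \<open>y\<^sup>2 = 1 + T f(x)\<close>\<close>

locale pencil =
  fixes f :: "rat poly" and g :: nat and F :: "qt poly"
  assumes degf: "Polynomial.degree f = 2 * g + 1"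
    and sepf: "\<And>a. poly (map_poly rat_ac f) a = 0 \<Longrightarrow> poly (pderiv (map_poly rat_ac f)) a \<noteq> 0"
    and F_def: "F = Polynomial.smult (to_fract [:0, 1:]) (map_poly const_fn f) + 1"
begin

abbreviation fC :: "qtc poly" where "fC \<equiv> map_poly rat_ac f"

lemma geom_F: "geom F = Polynomial.smult T_ac fC + 1"
proof -
  have "map_poly to_ac (map_poly const_fn f) = fC"
    by (simp add: map_poly_hom_compose[OF is_hom_to_ac is_hom_const_fn] rat_ac_def[abs_def])
  then show ?thesis
    by (simp add: geom_def F_def T_ac_def hom_add[OF is_hom_map_poly[OF is_hom_to_ac]]
        hom_1[OF is_hom_map_poly[OF is_hom_to_ac]] map_poly_hom_smult[OF is_hom_to_ac])
qed

lemma f_nz: "f \<noteq> 0" using degf by auto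

lemma fC_nz: "fC \<noteq> 0" using f_nz by (simp add: map_poly_hom_eq_0_iff[OF is_hom_rat_ac])

lemma degree_fC: "Polynomial.degree fC = 2 * g + 1"
  by (simp add: degree_map_poly_hom[OF is_hom_rat_ac] degf)

text \<open>A double root \<open>a\<close> of \<open>1 + T f\<close> would be a root of \<open>f'\<close>, hence algebraic over \<open>\<rat>\<close>, and with it
  \<open>T = -1 / f(a)\<close>.\<close>

sublocale hyperell F g
proof
  have "Polynomial.degree (geom F) = 2 * g + 1"
    unfolding geom_F using T_ac_nz degree_fC by (subst degree_add_eq_left) simp_all
  then show "Polynomial.degree F = 2 * g + 1" by (simp add: geom_def degree_map_poly_hom[OF is_hom_to_ac])
  fix a assume a: "poly (geom F) a = 0"
  show "poly (pderiv (geom F)) a \<noteq> 0"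
  proof
    assume "poly (pderiv (geom F)) a = 0"
    then have "poly (pderiv fC) a = 0" using T_ac_nz by (simp add: geom_F pderiv_add pderiv_smult)
    then have "poly (map_poly rat_ac (pderiv f)) a = 0" by (simp add: map_poly_hom_pderiv[OF is_hom_rat_ac])
    moreover have "pderiv f \<noteq> 0" using degf by (simp add: pderiv_eq_0_iff)
    ultimately have "alg_over_rat a" by (auto simp: alg_over_rat_def)
    moreover have "alg_over_rat 0" unfolding alg_over_rat_def
      by (rule exI[of _ "[:0, 1:]"]) (simp add: map_poly_hom_pCons[OF is_hom_rat_ac] hom_0[OF is_hom_rat_ac])
    moreover have "0 ^ 2 = T_ac * poly fC a + 1" "poly fC a \<noteq> 0" using a by (auto simp: geom_F)
    ultimately show False using coordinates_not_both_algebraic by blast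
  qed
qed

lemma on_curve_iff_eq: "on_curve a b \<longleftrightarrow> b ^ 2 = T_ac * poly fC a + 1"
  by (simp add: on_curve_def geom_F)

lemma root_points: assumes "poly fC a = 0" shows "on_curve a b \<longleftrightarrow> b = 1 \<or> b = - 1"
  using assms by (auto simp: on_curve_iff_eq power2_eq_1_iff)

text \<open>The points where \<open>T\<close> is a rational function of the coordinates.\<close>

definition regular :: "qtc \<Rightarrow> qtc \<Rightarrow> bool" where
  "regular a b \<longleftrightarrow> on_curve a b \<and> poly fC a \<noteq> 0"

lemma regular_T: assumes "regular a b" shows "T_ac = (b ^ 2 - 1) / poly fC a"
  using assms by (auto simp: regular_def on_curve_iff_eq)

subsection \<open>The prime polynomial of a point\<close>

text \<open>A relation between \<open>x\<close> and \<open>T\<close> becomes one between \<open>x\<close> and \<open>y\<close>, because \<open>T f = y\<^sup>2 - 1\<close>.\<close>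

lemma substitute_T:
  "\<exists>H N. (U \<noteq> 0 \<longrightarrow> H \<noteq> 0) \<and>
     (\<forall>a b. on_curve a b \<longrightarrow> eval2 rat_ac a b H = poly fC a ^ N * eval2 rat_ac a T_ac U)"
proof (induction U)
  case 0
  show ?case by (rule exI[of _ 0], rule exI[of _ 0]) (simp add: hom_0[OF is_hom_eval2[OF is_hom_rat_ac]])
next
  case (pCons p U)
  note h = is_hom_eval2[OF is_hom_rat_ac]
  show ?case
  proof (cases "U = 0")
    case True
    show ?thesis
      by (rule exI[of _ "[:p:]"], rule exI[of _ 0])
        (use pCons.hyps True in \<open>simp add: eval2_const[OF is_hom_rat_ac]\<close>)
  next
    case False
    obtain H N where H: "H \<noteq> 0" and e: "\<And>a b. on_curve a b \<Longrightarrow> eval2 rat_ac a b H = poly fC a ^ N * eval2 rat_ac a T_ac U"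
      using pCons.IH False by blast
    let ?q = "[:0, 1:] ^ 2 - 1 :: rat poly poly"
    let ?H = "?q * H + [:p * f ^ Suc N:]"
    have dq: "Polynomial.degree ?q = 2"
    proof -
      have "?q = [:-1, 0, 1:]" by (simp add: power2_eq_square one_pCons)
      then show ?thesis by simp
    qed
    then have "Polynomial.degree (?q * H) = 2 + Polynomial.degree H" using H by (subst degree_mult_eq) auto
    then have "Polynomial.degree ?H = 2 + Polynomial.degree H" by (subst degree_add_eq_left) simp_all
    then have "?H \<noteq> 0" by auto
    moreover have "eval2 rat_ac a b ?H = poly fC a ^ Suc N * eval2 rat_ac a T_ac (pCons p U)" if c: "on_curve a b" for a b
    proof -
      have q: "eval2 rat_ac a b ?q = T_ac * poly fC a"
        using c by (simp add: hom_simps[OF h] eval2_y[OF is_hom_rat_ac] on_curve_iff_eq)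
      have pf: "eval2 rat_ac a b [:p * f ^ Suc N:] = poly (map_poly rat_ac p) a * poly fC a ^ Suc N"
        by (simp add: eval2_const[OF is_hom_rat_ac] hom_simps[OF is_hom_map_poly[OF is_hom_rat_ac]])
      have "eval2 rat_ac a b ?H = T_ac * poly fC a * (poly fC a ^ N * eval2 rat_ac a T_ac U)
          + poly (map_poly rat_ac p) a * poly fC a ^ Suc N"
        by (simp only: hom_add[OF h] hom_mult[OF h] q pf e[OF c])
      then show ?thesis by (simp add: eval2_pCons[OF is_hom_rat_ac] algebra_simps)
    qed
    ultimately show ?thesis by blast
  qed
qed

text \<open>The coordinate \<open>a\<close> is algebraic over \<open>\<rat>(T)\<close>.\<close>

lemma vanishing_polynomial_exists: assumes c: "on_curve a b" shows "\<exists>H. H \<noteq> 0 \<and> eval2 rat_ac a b H = 0"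
proof -
  obtain p :: "qt poly" where p: "p \<noteq> 0" "poly (map_poly to_ac p) a = 0" using alg_closure_algebraic[of a] by blast
  obtain k p' where k: "p = Polynomial.smult k (map_poly to_fract p')" using content_decompose_fract by metis
  then have "k \<noteq> 0" "p' \<noteq> 0" using p(1) by auto
  have "map_poly to_ac (map_poly to_fract p') = map_poly (\<lambda>c. poly (map_poly rat_ac c) T_ac) p'"
    by (simp add: map_poly_hom_compose[OF is_hom_to_ac is_hom_to_fract] poly_T_ac)
  then have "eval2 rat_ac T_ac a p' = 0"
    using p(2) \<open>k \<noteq> 0\<close> by (simp add: k map_poly_hom_smult[OF is_hom_to_ac] eval2_def)
  then have "eval2 rat_ac a T_ac (swap_poly p') = 0" by (simp add: eval2_swap[OF is_hom_rat_ac])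
  moreover have "swap_poly p' \<noteq> 0" using \<open>p' \<noteq> 0\<close> by simp
  moreover obtain H N where "swap_poly p' \<noteq> 0 \<longrightarrow> H \<noteq> 0"
    "eval2 rat_ac a b H = poly fC a ^ N * eval2 rat_ac a T_ac (swap_poly p')" using substitute_T c by meson
  ultimately show ?thesis by (intro exI[of _ H]) simp
qed

lemma prime_of_point: assumes c: "on_curve a b" shows "\<exists>G. prime_elem G \<and> eval2 rat_ac a b G = 0"
proof -
  note h = is_hom_eval2[OF is_hom_rat_ac, of a b]
  have "H \<noteq> 0 \<Longrightarrow> eval2 rat_ac a b H = 0 \<Longrightarrow> \<exists>G. prime_elem G \<and> eval2 rat_ac a b G = 0" for H
  proof (induction H rule: prime_divisors_induct)
    case (unit H)
    then obtain H' where "H * H' = 1" by (metis dvdE)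
    then have "eval2 rat_ac a b H * eval2 rat_ac a b H' = 1" by (metis hom_mult[OF h] hom_1[OF h])
    then show ?case using unit by simp
  next
    case (factor G H)
    then have "eval2 rat_ac a b G = 0 \<or> eval2 rat_ac a b H = 0" "H \<noteq> 0" by (auto simp: hom_mult[OF h])
    then show ?case using factor prime_imp_prime_elem by blast
  qed simp
  then show ?thesis using vanishing_polynomial_exists[OF c] by blast
qed

text \<open>A polynomial that vanishes at the point is not coprime to \<open>G\<close>.\<close>

lemma vanishing_iff_dvd:
  assumes r: "regular a b" and G: "prime_elem G" "eval2 rat_ac a b G = 0"
  shows "eval2 rat_ac a b H = 0 \<longleftrightarrow> G dvd H"
proof
  note h = is_hom_eval2[OF is_hom_rat_ac, of a b]
  assume H: "eval2 rat_ac a b H = 0"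
  show "G dvd H"
  proof (rule ccontr)
    assume "\<not> G dvd H"
    then have "coprime G H" using G(1) by (rule prime_elem_imp_coprime[rotated])
    then show False using coprime_no_common_zero[OF _ _ _ G(2) H] r by (auto simp: regular_def on_curve_iff_eq)
  qed
next
  note h = is_hom_eval2[OF is_hom_rat_ac, of a b]
  assume "G dvd H"
  then show "eval2 rat_ac a b H = 0" using G(2) by (auto simp: dvd_def hom_mult[OF h])
qed

text \<open>The values of rational functions over \<open>\<rat>\<close> at two points with the same prime are related by an
  isomorphism of fields over \<open>\<rat>\<close>; it fixes \<open>T\<close>, as \<open>T\<close> is such a function.\<close>

lemma same_prime_conjugate:
  assumes r: "regular a b" "regular a' b'"
    and G: "prime_elem G" "eval2 rat_ac a b G = 0" "eval2 rat_ac a' b' G = 0"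
  shows "\<exists>\<sigma>\<in>galois_group. \<sigma> a = a' \<and> \<sigma> b = b'"
proof -
  let ?e = "eval2 rat_ac a b" and ?e' = "eval2 rat_ac a' b'"
  note h = is_hom_eval2[OF is_hom_rat_ac]
  have iff: "?e t = 0 \<longleftrightarrow> ?e' t = 0" for t
    using vanishing_iff_dvd[OF r(1) G(1,2)] vanishing_iff_dvd[OF r(2) G(1,3)] by blast
  \<comment> \<open>The graph of the isomorphism between the fields generated by the coordinates of the points.\<close>
  define R where "R = {(?e s / ?e t, ?e' s / ?e' t) | s t. ?e t \<noteq> 0}"
  have R_add: "(x + z, y + w) \<in> R" and R_mult: "(x * z, y * w) \<in> R" if xy: "(x, y) \<in> R" "(z, w) \<in> R" for x y z w
  proof -
    obtain s t s' t' where st: "x = ?e s / ?e t" "y = ?e' s / ?e' t" "?e t \<noteq> 0"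
      "z = ?e s' / ?e t'" "w = ?e' s' / ?e' t'" "?e t' \<noteq> 0" using xy unfolding R_def by blast
    have nz: "?e' t \<noteq> 0" "?e' t' \<noteq> 0" "?e (t * t') \<noteq> 0" using st iff by (simp_all add: hom_mult[OF h])
    have "x + z = ?e (s * t' + s' * t) / ?e (t * t')" "y + w = ?e' (s * t' + s' * t) / ?e' (t * t')"
      using st nz by (simp_all add: hom_simps[OF h] add_frac_eq)
    then show "(x + z, y + w) \<in> R" unfolding R_def using nz(3) by blast
    have "x * z = ?e (s * s') / ?e (t * t')" "y * w = ?e' (s * s') / ?e' (t * t')"
      using st by (simp_all add: hom_simps[OF h])
    then show "(x * z, y * w) \<in> R" unfolding R_def using nz(3) by blast
  qed
  have R_inv: "(inverse x, inverse y) \<in> R" if xy: "(x, y) \<in> R" "x \<noteq> 0" for x y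
  proof -
    obtain s t where st: "x = ?e s / ?e t" "y = ?e' s / ?e' t" "?e t \<noteq> 0" using xy(1) unfolding R_def by blast
    then have "?e s \<noteq> 0" using xy(2) by auto
    moreover have "inverse x = ?e t / ?e s" "inverse y = ?e' t / ?e' s" using st by simp_all
    ultimately show ?thesis unfolding R_def by blast
  qed
  have R_poly: "(?e s, ?e' s) \<in> R" for s
    unfolding R_def mem_Collect_eq by (rule exI[of _ s], rule exI[of _ 1]) (simp add: hom_1[OF h])
  have R_rat: "(rat_ac c, rat_ac c) \<in> R" for c
    using R_poly[of "[:[:c:]:]"] by (simp add: eval2_const_const[OF is_hom_rat_ac])
  have R_T: "(T_ac, T_ac) \<in> R"
  proof -
    have "(?e ([:0, 1:] ^ 2 - 1), ?e' ([:0, 1:] ^ 2 - 1)) \<in> R" by (rule R_poly)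
    then have "(b ^ 2 - 1, b' ^ 2 - 1) \<in> R" by (simp add: hom_simps[OF h] eval2_y[OF is_hom_rat_ac])
    moreover have "(inverse (poly fC a), inverse (poly fC a')) \<in> R"
      using R_inv[OF R_poly[of "[:f:]"]] r by (simp add: eval2_const[OF is_hom_rat_ac] regular_def)
    ultimately show ?thesis
      using R_mult regular_T[OF r(1)] regular_T[OF r(2)] by (metis divide_inverse)
  qed
  have R_ring: "(to_ac (to_fract p), to_ac (to_fract p)) \<in> R" for p
  proof -
    have "(poly (map_poly rat_ac p) T_ac, poly (map_poly rat_ac p) T_ac) \<in> R"
    proof (induction p)
      case 0
      then show ?case using R_rat[of 0] by (simp add: hom_0[OF is_hom_rat_ac])
    next
      case (pCons c p)
      then show ?case using R_add[OF R_rat R_mult[OF R_T pCons(2)]] by (simp add: map_poly_hom_pCons[OF is_hom_rat_ac])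
    qed
    then show ?thesis by (simp add: poly_T_ac)
  qed
  have "partial_aut R"
    unfolding partial_aut_def
  proof (intro conjI allI impI)
    show "(to_ac c, to_ac c) \<in> R" for c
    proof -
      obtain p q where c: "c = to_fract p / to_fract q" "q \<noteq> 0" by (cases c) (auto simp: Fract_conv_to_fract)
      then show ?thesis
        using R_mult[OF R_ring R_inv[OF R_ring], of q p] by (simp add: divide_inverse)
    qed
    show "y = 0" if "(0, y) \<in> R" for y
    proof -
      obtain s t where st: "0 = ?e s / ?e t" "y = ?e' s / ?e' t" "?e t \<noteq> 0" using \<open>(0, y) \<in> R\<close> unfolding R_def by blast
      then have "?e s = 0" by simp
      then show ?thesis using st(2) iff by simp
    qed
  qed (intro R_add R_mult; assumption)+
  from partial_aut_extends_to_galois_group[OF this]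
  obtain \<sigma> where \<sigma>: "\<sigma> \<in> galois_group" "\<forall>x y. (x, y) \<in> R \<longrightarrow> \<sigma> x = y" by (elim bexE)
  have "(a, a') \<in> R" using R_poly[of "[:[:0, 1:]:]"] by (simp add: eval2_x[OF is_hom_rat_ac])
  moreover have "(b, b') \<in> R" using R_poly[of "[:0, 1:]"] by (simp add: eval2_y[OF is_hom_rat_ac])
  ultimately show ?thesis using \<sigma> by blast
qed

subsection \<open>The prime polynomial as a function on the curve\<close>

text \<open>Powers of \<open>y\<close> are reduced with \<open>y\<^sup>2 = F(x)\<close>. The identities are needed at points of the curve and along
  branches; along a branch, \<open>A + B y\<close> is the substitution of the branch in \<open>H\<close>.\<close>

lemma polynomial_as_function:
  "\<exists>A B. (\<forall>\<sigma>\<in>galois_group. map_poly \<sigma> A = A \<and> map_poly \<sigma> B = B) \<and>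
     (\<forall>a b. on_curve a b \<longrightarrow> poly A a + poly B a * b = eval2 rat_ac a b H) \<and>
     (\<forall>u w. w ^ 2 = fls_poly (geom F) u \<longrightarrow>
        fls_poly A u + fls_poly B u * w = eval2 (\<lambda>c. fls_const (rat_ac c)) u w H)"
proof (induction H)
  case 0
  show ?case
    by (rule exI[of _ 0], rule exI[of _ 0])
      (simp add: hom_0[OF is_hom_eval2[OF is_hom_rat_ac]] hom_0[OF is_hom_eval2[OF is_hom_compose[OF is_hom_fls_const is_hom_rat_ac]]])
next
  case (pCons p H)
  note hr = is_hom_compose[OF is_hom_fls_const is_hom_rat_ac]
  obtain A B where inv: "\<And>\<sigma>. \<sigma> \<in> galois_group \<Longrightarrow> map_poly \<sigma> A = A \<and> map_poly \<sigma> B = B"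
    and ev: "\<And>a b. on_curve a b \<Longrightarrow> poly A a + poly B a * b = eval2 rat_ac a b H"
    and fl: "\<And>u w. w ^ 2 = fls_poly (geom F) u \<Longrightarrow> fls_poly A u + fls_poly B u * w = eval2 (\<lambda>c. fls_const (rat_ac c)) u w H"
    using pCons.IH by blast
  let ?A = "map_poly rat_ac p + geom F * B"
  have "map_poly \<sigma> ?A = ?A \<and> map_poly \<sigma> A = A" if \<sigma>: "\<sigma> \<in> galois_group" for \<sigma>
  proof -
    note h = is_hom_map_poly[OF galois_groupD(1)[OF \<sigma>]]
    have "map_poly rat_ac p = map_poly to_ac (map_poly const_fn p)"
      by (simp add: map_poly_hom_compose[OF is_hom_to_ac is_hom_const_fn] rat_ac_def[abs_def])
    then show ?thesis
      using inv[OF \<sigma>] by (simp add: hom_simps[OF h] map_poly_galois_geom[OF \<sigma>] geom_def)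
  qed
  moreover have "poly ?A a + poly A a * b = eval2 rat_ac a b (pCons p H)" if c: "on_curve a b" for a b
  proof -
    have "b * eval2 rat_ac a b H = poly A a * b + b ^ 2 * poly B a"
      using ev[OF c] by (simp add: power2_eq_square algebra_simps flip: ev[OF c])
    then show ?thesis using c by (simp add: eval2_pCons[OF is_hom_rat_ac] on_curve_def)
  qed
  moreover have "fls_poly ?A u + fls_poly A u * w = eval2 (\<lambda>c. fls_const (rat_ac c)) u w (pCons p H)"
    if c: "w ^ 2 = fls_poly (geom F) u" for u w
  proof -
    have "w * eval2 (\<lambda>c. fls_const (rat_ac c)) u w H = fls_poly A u * w + w ^ 2 * fls_poly B u"
      by (simp add: power2_eq_square algebra_simps flip: fl[OF c])
    moreover have "poly (map_poly (\<lambda>c. fls_const (rat_ac c)) p) u = fls_poly (map_poly rat_ac p) u"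
      by (simp add: fls_poly_def map_poly_hom_compose[OF is_hom_fls_const is_hom_rat_ac])
    ultimately show ?thesis by (simp add: eval2_pCons[OF hr] hom_simps[OF is_hom_fls_poly] c)
  qed
  ultimately show ?case by blast
qed

text \<open>All values at the point of rational functions over \<open>\<rat>\<close> in \<open>x\<close> and \<open>y\<close> are multiples of the value
  of its prime polynomial. Among these functions are the polynomials in \<open>x\<close> over \<open>\<rat>(T)\<close>, and the
  minimal polynomial of the coordinate \<open>a\<close> has value 1 (unless \<open>b = 0\<close>, where \<open>y\<close> has value 1).\<close>

lemma prime_is_uniformizer:
  assumes r: "regular a b" and G: "prime_elem G" "eval2 rat_ac a b G = 0"
    and AB: "\<And>u w. w ^ 2 = fls_poly (geom F) u \<Longrightarrow>
        fls_poly A u + fls_poly B u * w = eval2 (\<lambda>c. fls_const (rat_ac c)) u w G"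
  shows "poly_ff A B \<noteq> 0" "point a b (poly_ff A B) = 1"
proof -
  have c: "on_curve a b" and fa: "poly fC a \<noteq> 0" using r by (auto simp: regular_def)
  note hr = is_hom_compose[OF is_hom_fls_const is_hom_rat_ac]
  obtain s t where st: "branch (fps_to_fls s) (fps_to_fls t)" "fps_nth s 0 = a" "fps_nth t 0 = b"
    "point a b = fls_val (fps_to_fls s) (fps_to_fls t)" using point_eq_branch[OF c] by metis
  define u where "u = fps_to_fls s"
  define w where "w = fps_to_fls t"
  have br: "branch u w" and pt: "point a b = fls_val u w" using st by (simp_all add: u_def w_def)
  have nc: "\<And>d. u \<noteq> fls_const d" and w2: "w ^ 2 = fls_poly (geom F) u" using br by (auto simp: branch_def)
  define \<epsilon> where "\<epsilon> = eval2 (\<lambda>c. fls_const (rat_ac c)) u w"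
  have h\<epsilon>: "is_hom \<epsilon>" unfolding \<epsilon>_def by (rule is_hom_eval2[OF hr])
  have fps: "\<exists>\<eta>. \<epsilon> H = fps_to_fls \<eta> \<and> fps_nth \<eta> 0 = eval2 rat_ac a b H" for H
  proof -
    obtain A' B' where AB': "\<And>a b. on_curve a b \<Longrightarrow> poly A' a + poly B' a * b = eval2 rat_ac a b H"
      "\<And>u w. w ^ 2 = fls_poly (geom F) u \<Longrightarrow> fls_poly A' u + fls_poly B' u * w = eval2 (\<lambda>c. fls_const (rat_ac c)) u w H"
      using polynomial_as_function[of H] by blast
    let ?\<eta> = "poly (map_poly fps_const A') s + poly (map_poly fps_const B') s * t"
    have "\<epsilon> H = fps_to_fls ?\<eta>"
      using AB'(2)[OF w2] by (simp add: \<epsilon>_def u_def w_def fls_poly_fps fls_times_fps_to_fls)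
    moreover have "fps_nth ?\<eta> 0 = eval2 rat_ac a b H" using AB'(1)[OF c] st by (simp add: poly_fps_nth_0)
    ultimately show ?thesis by blast
  qed
  \<comment> \<open>A polynomial not divisible by \<open>G\<close> does not vanish at the point. So the values of polynomials over \<open>\<rat>\<close>
    are multiples of \<open>e\<close>; and if the branch were a zero of \<open>G\<close>, all of them would be 0.\<close>
  define e where "e = fls_subdegree (\<epsilon> G)"
  have num: "e dvd fls_subdegree (\<epsilon> s) \<and> (\<epsilon> G = 0 \<longrightarrow> fls_subdegree (\<epsilon> s) = 0)" for s
  proof (cases "s = 0")
    case True
    then show ?thesis by (simp add: hom_0[OF h\<epsilon>])
  next
    case False
    have "\<not> is_unit G" using G(1) by (simp add: prime_elem_def)
    then obtain y where y: "s = G ^ multiplicity G s * y" "\<not> G dvd y"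
      by (rule multiplicity_decompose'[OF False])
    have "eval2 rat_ac a b y \<noteq> 0" using y(2) vanishing_iff_dvd[OF r G] by blast
    moreover obtain \<eta> where \<eta>: "\<epsilon> y = fps_to_fls \<eta>" "fps_nth \<eta> 0 = eval2 rat_ac a b y" using fps by blast
    ultimately have y0: "\<epsilon> y \<noteq> 0" "fls_subdegree (\<epsilon> y) = 0"
      by (auto simp: fls_subdegree_fls_to_fps intro: subdegree_eq_0)
    have eq: "\<epsilon> s = \<epsilon> G ^ multiplicity G s * \<epsilon> y" using y(1) by (metis hom_mult[OF h\<epsilon>] hom_power[OF h\<epsilon>])
    show ?thesis
    proof (cases "\<epsilon> G = 0")
      case True
      then show ?thesis using eq y0(2) by (cases "multiplicity G s") (simp_all add: e_def)
    next
      case False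
      then have "fls_subdegree (\<epsilon> s) = int (multiplicity G s) * e" using y0 by (simp add: eq e_def fls_subdegree_pow)
      then show ?thesis using False by simp
    qed
  qed
  \<comment> \<open>The field generated by \<open>x\<close> and \<open>y\<close> over \<open>\<rat>\<close> contains \<open>T\<close>.\<close>
  define L where "L = {\<epsilon> s / \<epsilon> t | s t. \<epsilon> t \<noteq> 0}"
  have L_val: "e dvd fls_subdegree z \<and> (\<epsilon> G = 0 \<longrightarrow> fls_subdegree z = 0)" if zL: "z \<in> L" for z
  proof -
    obtain s t where z: "z = \<epsilon> s / \<epsilon> t" "\<epsilon> t \<noteq> 0" using zL unfolding L_def by blast
    show ?thesis
    proof (cases "\<epsilon> s = 0")
      case False
      then have "fls_subdegree z = fls_subdegree (\<epsilon> s) - fls_subdegree (\<epsilon> t)" using z by (simp add: fls_divide_subdegree)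
      then show ?thesis using num[of s] num[of t] by auto
    qed (simp add: z)
  qed
  have L_add: "x + y \<in> L" and L_mult: "x * y \<in> L" if xy: "x \<in> L" "y \<in> L" for x y
  proof -
    obtain s t s' t' where z: "x = \<epsilon> s / \<epsilon> t" "\<epsilon> t \<noteq> 0" "y = \<epsilon> s' / \<epsilon> t'" "\<epsilon> t' \<noteq> 0" using xy unfolding L_def by blast
    have nz: "\<epsilon> (t * t') \<noteq> 0" using z by (simp add: hom_mult[OF h\<epsilon>])
    have "x + y = \<epsilon> (s * t' + s' * t) / \<epsilon> (t * t')" using z by (simp add: hom_simps[OF h\<epsilon>] add_frac_eq)
    then show "x + y \<in> L" unfolding L_def using nz by blast
    have "x * y = \<epsilon> (s * s') / \<epsilon> (t * t')" using z by (simp add: hom_simps[OF h\<epsilon>])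
    then show "x * y \<in> L" unfolding L_def using nz by blast
  qed
  have L_inv: "inverse x \<in> L" if xL: "x \<in> L" for x
  proof -
    obtain s t where z: "x = \<epsilon> s / \<epsilon> t" "\<epsilon> t \<noteq> 0" using xL unfolding L_def by blast
    show ?thesis
    proof (cases "\<epsilon> s = 0")
      case True
      then show ?thesis using xL z by simp
    next
      case False
      moreover have "inverse x = \<epsilon> t / \<epsilon> s" by (simp add: z)
      ultimately show ?thesis unfolding L_def by blast
    qed
  qed
  have L_poly: "\<epsilon> s \<in> L" for s
    unfolding L_def mem_Collect_eq by (rule exI[of _ s], rule exI[of _ 1]) (simp add: hom_1[OF h\<epsilon>])
  have L_u: "u \<in> L" using L_poly[of "[:[:0, 1:]:]"] unfolding \<epsilon>_def eval2_x[OF hr] .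
  have L_w: "w \<in> L" using L_poly[of "[:0, 1:]"] unfolding \<epsilon>_def eval2_y[OF hr] .
  have L_rat: "fls_const (rat_ac c) \<in> L" for c using L_poly[of "[:[:c:]:]"] unfolding \<epsilon>_def eval2_const_const[OF hr] .
  have L_T: "fls_const T_ac \<in> L"
  proof -
    have "\<epsilon> [:f:] = fls_poly fC u"
      unfolding \<epsilon>_def eval2_const[OF hr] by (simp add: fls_poly_def map_poly_hom_compose[OF is_hom_fls_const is_hom_rat_ac])
    then have "inverse (fls_poly fC u) \<in> L" using L_inv[OF L_poly[of "[:f:]"]] by simp
    moreover have "w * w + fls_const (rat_ac (- 1)) \<in> L" by (intro L_add L_mult L_w L_rat)
    ultimately have "(w * w + fls_const (rat_ac (- 1))) * inverse (fls_poly fC u) \<in> L" by (rule L_mult[rotated])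
    moreover have "w * w + fls_const (rat_ac (- 1)) = fls_const T_ac * fls_poly fC u"
    proof -
      have "w * w = fls_const T_ac * fls_poly fC u + 1"
        using w2 by (simp add: geom_F power2_eq_square hom_simps[OF is_hom_fls_poly])
          (simp add: fls_poly_def map_poly_hom_smult[OF is_hom_fls_const])
      then show ?thesis by (simp add: hom_simps[OF is_hom_rat_ac] fls_const_uminus[symmetric])
    qed
    moreover have "fls_poly fC u \<noteq> 0"
      using injective_hom.inj[OF injective_hom_fls_poly[OF nc]] fC_nz by blast
    ultimately show ?thesis by (simp add: mult.assoc)
  qed
  have L_ring: "fls_const (to_ac (to_fract p)) \<in> L" for p
  proof -
    have "fls_const (poly (map_poly rat_ac p) T_ac) \<in> L"
    proof (induction p)
      case 0
      then show ?case using L_rat[of 0] by (simp add: hom_0[OF is_hom_rat_ac])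
    next
      case (pCons c p)
      have "fls_const (rat_ac c) + fls_const T_ac * fls_const (poly (map_poly rat_ac p) T_ac) \<in> L"
        by (intro L_add L_mult L_rat L_T pCons)
      then show ?case
        by (simp only: map_poly_hom_pCons[OF is_hom_rat_ac] poly_pCons hom_add[OF is_hom_fls_const] hom_mult[OF is_hom_fls_const])
    qed
    then show ?thesis by (simp add: poly_T_ac)
  qed
  have L_K: "fls_const (to_ac c) \<in> L" for c
  proof -
    obtain p q where c: "c = to_fract p / to_fract q" by (cases c) (auto simp: Fract_conv_to_fract)
    have "fls_const (to_ac (to_fract p)) * inverse (fls_const (to_ac (to_fract q))) \<in> L"
      by (intro L_mult L_inv L_ring)
    then show ?thesis
      by (simp only: c divide_inverse to_ac_mult to_ac_inverse hom_inverse[OF is_hom_fls_const, symmetric] hom_mult[OF is_hom_fls_const, symmetric])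
  qed
  have L_Kx: "fls_poly (map_poly to_ac q) u \<in> L" for q
  proof (induction q)
    case 0
    then show ?case using L_rat[of 0] by (simp add: hom_0[OF is_hom_rat_ac])
  next
    case (pCons c q)
    then show ?case
      by (simp add: map_poly_hom_pCons[OF is_hom_to_ac] fls_poly_pCons L_add L_mult L_K L_u)
  qed
  have ex: "\<exists>z\<in>L. fls_subdegree z = 1"
  proof (cases "b = 0")
    case True
    have "fls_subdegree w = point a b y_ff"
      unfolding pt fls_val_def y_ff_def using fls_eval_poly_pair[OF nc, of w 0 1] by (simp add: hom_1[OF is_hom_fls_poly])
    then show ?thesis using point_y_value c True L_w by auto
  next
    case False
    obtain p :: "qt poly" where p: "p \<noteq> 0" "\<And>q. poly (map_poly to_ac q) a = 0 \<longleftrightarrow> p dvd q"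
      "poly (map_poly to_ac (pderiv p)) a \<noteq> 0" using minimal_polynomial[of a] by blast
    let ?p = "map_poly to_ac p"
    have pnz: "?p \<noteq> 0" using p(1) by (simp add: map_poly_hom_eq_0_iff[OF is_hom_to_ac])
    have "poly ?p a = 0" using p(2)[of p] by simp
    then have "Polynomial.order a ?p = 1"
      using p(3) by (intro order_simple_root) (simp_all add: map_poly_hom_pderiv[OF is_hom_to_ac])
    then have "point a b (of_rat_fn ?p) = 1" using point_poly_value[OF c pnz] False by simp
    then have "fls_subdegree (fls_poly ?p u) = 1"
      unfolding pt fls_val_def of_rat_fn_def fls_eval_of_rat_fn[OF nc] .
    then show ?thesis using L_Kx by blast
  qed
  have e1: "e dvd 1" "\<epsilon> G \<noteq> 0"
  proof -
    from ex obtain z where z: "z \<in> L" "fls_subdegree z = 1" by (elim bexE)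
    show "e dvd 1" "\<epsilon> G \<noteq> 0" using L_val[OF z(1)] z(2) by auto
  qed
  have eG: "fls_eval u w (poly_ff A B) = \<epsilon> G"
    unfolding poly_ff_def fls_eval_poly_pair[OF nc] \<epsilon>_def by (rule AB[OF w2])
  then show "poly_ff A B \<noteq> 0" using e1(2) fls_eval_eq_0_iff[OF br, of "poly_ff A B"] by metis
  have "0 \<le> e"
  proof -
    obtain \<eta> where "\<epsilon> G = fps_to_fls \<eta>" using fps by blast
    then show ?thesis by (simp add: e_def fls_subdegree_fls_to_fps)
  qed
  then have "e = 1" using e1(1) by simp
  then show "point a b (poly_ff A B) = 1" by (simp add: pt fls_val_def eG e_def)
qed

end

section \<open>Generators of the Jacobian\<close>

definition restrict_div :: "('p \<Rightarrow> bool) \<Rightarrow> ('p \<Rightarrow>\<^sub>0 int) \<Rightarrow> ('p \<Rightarrow>\<^sub>0 int)" where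
  "restrict_div S D = Abs_poly_mapping (\<lambda>v. if S v then Poly_Mapping.lookup D v else 0)"

lemma lookup_restrict_div: "Poly_Mapping.lookup (restrict_div S D) v = (if S v then Poly_Mapping.lookup D v else 0)"
proof -
  have "finite {v. (if S v then Poly_Mapping.lookup D v else 0) \<noteq> 0}"
    by (rule finite_subset[OF _ finite_keys[of D]]) (auto simp: in_keys_iff split: if_splits)
  then show ?thesis unfolding restrict_div_def by (subst Abs_poly_mapping_inverse) auto
qed

lemma id_in_galois_group: "id \<in> galois_group"
  by (simp add: galois_group_def)

lemma comp_in_galois_group: "\<sigma> \<in> galois_group \<Longrightarrow> \<tau> \<in> galois_group \<Longrightarrow> \<sigma> \<circ> \<tau> \<in> galois_group"
  by (auto simp: galois_group_def bij_comp)

definition galois_orbit :: "'k::field alg_closure \<Rightarrow> 'k alg_closure set" where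
  "galois_orbit a = (\<lambda>\<sigma>. \<sigma> a) ` galois_group"

lemma galois_orbit_self: "a \<in> galois_orbit a"
  unfolding galois_orbit_def using id_in_galois_group by (metis id_apply image_eqI)

lemma galois_orbit_trans: assumes "b \<in> galois_orbit a" shows "galois_orbit b \<subseteq> galois_orbit a"
proof
  fix c assume "c \<in> galois_orbit b"
  then obtain \<sigma> \<tau> where "\<sigma> \<in> galois_group" "\<tau> \<in> galois_group" "b = \<sigma> a" "c = \<tau> b" using assms by (auto simp: galois_orbit_def)
  then show "c \<in> galois_orbit a" unfolding galois_orbit_def by (intro image_eqI[of _ _ "\<tau> \<circ> \<sigma>"] comp_in_galois_group) simp_all
qed

lemma galois_orbit_sym: assumes "b \<in> galois_orbit a" shows "a \<in> galois_orbit b"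
proof -
  obtain \<sigma> where s: "\<sigma> \<in> galois_group" "b = \<sigma> a" using assms by (auto simp: galois_orbit_def)
  then show ?thesis unfolding galois_orbit_def
    by (intro image_eqI[of _ _ "inv_into UNIV \<sigma>"]) (simp_all add: galois_inv[OF s(1)])
qed

lemma galois_orbit_eq: "b \<in> galois_orbit a \<Longrightarrow> galois_orbit b = galois_orbit a"
  using galois_orbit_trans galois_orbit_sym by blast

lemma galois_image_orbit:
  assumes s: "\<sigma> \<in> galois_group" shows "\<sigma> ` galois_orbit a = galois_orbit a"
proof
  have *: "\<tau> ` galois_orbit a \<subseteq> galois_orbit a" if t: "\<tau> \<in> galois_group" for \<tau>
  proof
    fix c assume "c \<in> \<tau> ` galois_orbit a"
    then obtain \<rho> where "\<rho> \<in> galois_group" "c = \<tau> (\<rho> a)" by (auto simp: galois_orbit_def)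
    then show "c \<in> galois_orbit a" unfolding galois_orbit_def
      by (intro image_eqI[of _ _ "\<tau> \<circ> \<rho>"] comp_in_galois_group t) simp_all
  qed
  show "\<sigma> ` galois_orbit a \<subseteq> galois_orbit a" by (rule *[OF s])
  show "galois_orbit a \<subseteq> \<sigma> ` galois_orbit a"
  proof
    fix c assume "c \<in> galois_orbit a"
    then have "inv_into UNIV \<sigma> c \<in> galois_orbit a" using *[OF galois_inv(1)[OF s]] by blast
    then show "c \<in> \<sigma> ` galois_orbit a" by (rule rev_image_eqI) (simp add: galois_inv[OF s])
  qed
qed

context hyperell
begin

lemma effective_degree_pos: assumes D: "effective D" and v: "0 < Poly_Mapping.lookup D v" shows "0 < div_degree D"
  unfolding div_degree_def
  by (rule sum_pos2[of _ v]) (use D v in \<open>auto simp: effective_def in_keys_iff\<close>)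

lemma galois_invariantI:
  assumes keys: "Poly_Mapping.keys D \<subseteq> points F"
    and "\<And>\<sigma> v. \<sigma> \<in> galois_group \<Longrightarrow> v \<in> points F \<Longrightarrow> Poly_Mapping.lookup D (galois_point \<sigma> v) = Poly_Mapping.lookup D v"
  shows "galois_invariant D"
  unfolding galois_invariant_def using galois_div_eqI[OF _ keys keys] assms(2) by blast

lemma galois_invariant_lookup:
  assumes "galois_invariant D" "\<sigma> \<in> galois_group"
  shows "Poly_Mapping.lookup D (galois_point \<sigma> v) = Poly_Mapping.lookup D v"
  using lookup_galois_div[OF assms(2), of D v] assms by (simp add: galois_invariant_def)

text \<open>The coefficient at infinity is determined by the degree.\<close>

lemma deg0_eqI:
  assumes D: "D \<in> deg0_divisors" "E \<in> deg0_divisors"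
    and eq: "\<And>a b. on_curve a b \<Longrightarrow> Poly_Mapping.lookup D (point a b) = Poly_Mapping.lookup E (point a b)"
  shows "D = E"
proof -
  define k where "k = Poly_Mapping.lookup (D - E) infinity"
  have "D - E = frag_cmul k (frag_of infinity)"
  proof (rule poly_mapping_eqI)
    fix v
    show "Poly_Mapping.lookup (D - E) v = Poly_Mapping.lookup (frag_cmul k (frag_of infinity)) v"
    proof (cases "v \<in> points F")
      case True
      then show ?thesis
      proof (cases rule: points_cases)
        case 1
        then show ?thesis by (simp add: k_def)
      next
        case (2 a b)
        then show ?thesis using eq[OF 2(1)] point_neq_infinity[OF 2(1)] by (simp add: lookup_minus)
      qed
    next
      case False
      then have "v \<notin> Poly_Mapping.keys D" "v \<notin> Poly_Mapping.keys E" "v \<noteq> infinity"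
        using D infinity_in_points by (auto simp: deg0_divisors_def)
      then show ?thesis by (simp add: lookup_minus in_keys_iff)
    qed
  qed
  moreover have "div_degree (D - E) = 0" using D by (simp add: div_degree_diff deg0_divisors_def)
  ultimately have "k = 0" by simp
  then show ?thesis using \<open>D - E = frag_cmul k (frag_of infinity)\<close> by simp
qed

lemma reduced_at_inf_deg0: "Poly_Mapping.keys D \<subseteq> points F \<Longrightarrow> reduced_at_inf D \<in> deg0_divisors"
  using keys_diff[of D "frag_cmul (div_degree D) (frag_of infinity)"] keys_cmul[of "div_degree D" "frag_of infinity"] infinity_in_points
  by (auto simp: deg0_divisors_def reduced_at_inf_def div_degree_diff)

lemma lookup_reduced_at_inf:
  "on_curve a b \<Longrightarrow> Poly_Mapping.lookup (reduced_at_inf D) (point a b) = Poly_Mapping.lookup D (point a b)"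
  using point_neq_infinity[of a b] by (simp add: reduced_at_inf_def lookup_minus)

lemma deg0_0: "0 \<in> deg0_divisors" by (simp add: deg0_divisors_def)

lemma deg0_sum: "(\<And>i. i \<in> I \<Longrightarrow> D i \<in> deg0_divisors) \<Longrightarrow> sum D I \<in> deg0_divisors"
  by (induction I rule: infinite_finite_induct) (simp_all add: deg0_0 deg0_add)

end

context pencil
begin

definition roots :: "qtc set" where "roots = {a. poly fC a = 0}"

lemma finite_roots: "finite roots"
  unfolding roots_def by (rule poly_roots_finite[OF fC_nz])

lemma galois_fC: assumes s: "\<sigma> \<in> galois_group" shows "poly fC (\<sigma> a) = \<sigma> (poly fC a)"
proof -
  have "fC = map_poly to_ac (map_poly const_fn f)"
    by (simp add: map_poly_hom_compose[OF is_hom_to_ac is_hom_const_fn] rat_ac_def[abs_def])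
  then have "map_poly \<sigma> fC = fC" by (simp add: map_poly_galois_geom[OF s])
  then show ?thesis using poly_map_poly_hom[OF galois_groupD(1)[OF s], of fC a] by simp
qed

lemma galois_roots: "\<sigma> \<in> galois_group \<Longrightarrow> \<sigma> a \<in> roots \<longleftrightarrow> a \<in> roots"
  by (simp add: roots_def galois_fC hom_eq_0_iff[OF galois_groupD(1)])

lemma orbit_subset_roots: "a \<in> roots \<Longrightarrow> galois_orbit a \<subseteq> roots"
  by (auto simp: galois_orbit_def galois_roots)

lemma root_on_curve: "a \<in> roots \<Longrightarrow> on_curve a 1" "a \<in> roots \<Longrightarrow> on_curve a (- 1)"
  using root_points by (auto simp: roots_def)

definition in_fibre :: "(qt ff \<Rightarrow> int) \<Rightarrow> bool" where
  "in_fibre v \<longleftrightarrow> (\<exists>a b. a \<in> roots \<and> on_curve a b \<and> v = point a b)"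

lemma in_fibre_point: "on_curve a b \<Longrightarrow> in_fibre (point a b) \<longleftrightarrow> a \<in> roots"
  unfolding in_fibre_def using point_inject by blast

lemma not_in_fibre_infinity: "\<not> in_fibre infinity"
  unfolding in_fibre_def using point_neq_infinity by metis

lemma in_fibre_galois:
  assumes s: "\<sigma> \<in> galois_group" and v: "v \<in> points F" shows "in_fibre (galois_point \<sigma> v) \<longleftrightarrow> in_fibre v"
  using v
proof (cases rule: points_cases)
  case 1
  then show ?thesis using galois_point_infinity[OF s] by simp
next
  case (2 a b)
  then show ?thesis
    using galois_point_point[OF s 2(1)] in_fibre_point[OF 2(1)] in_fibre_point[OF galois_on_curve[OF s 2(1)]] galois_roots[OF s] by simp
qed

definition root_class :: "qtc \<Rightarrow> (qt ff \<Rightarrow> int) \<Rightarrow>\<^sub>0 int" where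
  "root_class a = frag_of (point a 1) - frag_of infinity"

definition orbit_class :: "qtc set \<Rightarrow> (qt ff \<Rightarrow> int) \<Rightarrow>\<^sub>0 int" where
  "orbit_class S = (\<Sum>a\<in>S. root_class a)"

lemma root_class_deg0: "a \<in> roots \<Longrightarrow> root_class a \<in> deg0_divisors"
  using keys_diff[of "frag_of (point a 1)" "frag_of infinity"] point_in_points[OF root_on_curve(1)] infinity_in_points
  by (auto simp: root_class_def deg0_divisors_def div_degree_diff)

lemma lookup_root_class:
  assumes "a \<in> roots" "on_curve c d"
  shows "Poly_Mapping.lookup (root_class a) (point c d) = (if c = a \<and> d = 1 then 1 else 0)"
  using point_inject[OF root_on_curve(1)[OF assms(1)] assms(2)] point_neq_infinity[OF assms(2)]
  by (auto simp: root_class_def lookup_minus)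

lemma lookup_sum_root_class:
  assumes "S \<subseteq> roots" "on_curve c d"
  shows "Poly_Mapping.lookup (\<Sum>a\<in>S. frag_cmul (n a) (root_class a)) (point c d) = (if c \<in> S \<and> d = 1 then n c else 0)"
proof -
  have fin: "finite S" using assms(1) finite_roots finite_subset by blast
  have "Poly_Mapping.lookup (\<Sum>a\<in>S. frag_cmul (n a) (root_class a)) (point c d) =
      (\<Sum>a\<in>S. if a = c then (if d = 1 then n c else 0) else 0)"
    unfolding lookup_sum using assms by (intro sum.cong) (auto simp: lookup_root_class subset_iff)
  then show ?thesis using fin by simp
qed

lemma orbit_class_deg0: "S \<subseteq> roots \<Longrightarrow> orbit_class S \<in> deg0_divisors"
  unfolding orbit_class_def by (rule deg0_sum) (use root_class_deg0 in blast)

lemma lookup_orbit_class: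
  "S \<subseteq> roots \<Longrightarrow> on_curve c d \<Longrightarrow> Poly_Mapping.lookup (orbit_class S) (point c d) = (if c \<in> S \<and> d = 1 then 1 else 0)"
  using lookup_sum_root_class[of S c d "\<lambda>_. 1"] by (simp add: orbit_class_def)

lemma orbit_class_invariant:
  assumes a: "a \<in> roots" shows "galois_invariant (orbit_class (galois_orbit a))"
proof (rule galois_invariantI)
  note S = orbit_subset_roots[OF a]
  show keys: "Poly_Mapping.keys (orbit_class (galois_orbit a)) \<subseteq> points F"
    using orbit_class_deg0[OF S] by (simp add: deg0_divisors_def)
  fix \<sigma> :: "qtc \<Rightarrow> qtc" and v :: "qt ff \<Rightarrow> int"
  assume s: "\<sigma> \<in> galois_group" and "v \<in> points F"
  from this(2) show "Poly_Mapping.lookup (orbit_class (galois_orbit a)) (galois_point \<sigma> v) = Poly_Mapping.lookup (orbit_class (galois_orbit a)) v"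
  proof (cases rule: points_cases)
    case 1
    then show ?thesis using galois_point_infinity[OF s] by simp
  next
    case (2 c d)
    note h = galois_groupD(1)[OF s]
    have "\<sigma> d = 1 \<longleftrightarrow> d = 1" using hom_eq_iff[OF h, of d 1] by (simp add: hom_1[OF h])
    moreover have "\<sigma> c \<in> galois_orbit a \<longleftrightarrow> c \<in> galois_orbit a"
    proof
      assume "\<sigma> c \<in> galois_orbit a"
      then have "\<sigma> c \<in> \<sigma> ` galois_orbit a" unfolding galois_image_orbit[OF s] .
      then show "c \<in> galois_orbit a" using hom_eq_iff[OF h] by auto
    next
      assume "c \<in> galois_orbit a"
      then have "\<sigma> c \<in> \<sigma> ` galois_orbit a" by blast
      then show "\<sigma> c \<in> galois_orbit a" unfolding galois_image_orbit[OF s] .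
    qed
    ultimately show ?thesis
      using 2 lookup_orbit_class[OF S 2(1)] lookup_orbit_class[OF S galois_on_curve[OF s 2(1)]] galois_point_point[OF s 2(1)] by simp
  qed
qed

lemma order_fC: assumes "a \<in> roots" shows "Polynomial.order a fC = 1"
  using assms sepf by (intro order_simple_root) (simp_all add: roots_def)

lemma y_minus_one_times: "ff_mult F (poly_ff [:- c:] 1) (poly_ff [:c:] 1) = of_rat_fn (Polynomial.smult T_ac fC)" if "c * c = 1"
proof -
  have "[:- c:] * [:c:] = - (1 :: qtc poly)" using that by (simp add: one_pCons)
  then have "to_fract [:- c:] * to_fract [:c:] = - 1" by (metis to_fract_mult to_fract_uminus to_fract_1)
  moreover have "to_fract [:- c:] + to_fract [:c:] = 0" by (simp add: to_fract_add[symmetric] del: to_fract_add)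
  moreover have "to_fract (geom F) = to_fract (Polynomial.smult T_ac fC) + 1" unfolding geom_F by (simp only: to_fract_add to_fract_1)
  ultimately show ?thesis by (simp add: ff_mult_def poly_ff_def of_rat_fn_def)
qed

text \<open>By \<open>(y - 1) (y + 1) = T f(x)\<close>, the function \<open>y - 1\<close> can only vanish over a root of \<open>f\<close>, and there it
  has a simple zero at \<open>(a, 1)\<close>, where \<open>y + 1\<close> is a unit. The same holds for \<open>y + 1\<close> and \<open>(a, -1)\<close>.\<close>

lemma y_minus_value:
  assumes c: "on_curve a b" and e: "e = 1 \<or> e = - 1"
  shows "point a b (poly_ff [:- e:] 1) = (if a \<in> roots \<and> b = e then 1 else 0)"
proof -
  have ee: "e * e = 1" using e by auto
  note v = point_in_points[OF c]
  have pos: "0 \<le> point a b (poly_ff [:- k:] 1)" "0 < point a b (poly_ff [:- k:] 1) \<longleftrightarrow> b = k" for k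
    using point_poly_ff_pos[OF c, of "[:- k:]" 1] by (auto simp: eq_neg_iff_add_eq_0)
  show ?thesis
  proof (cases "b = e")
    case False
    then show ?thesis using pos[of e] by auto
  next
    case True
    then have "T_ac * poly fC a = 0" using c ee by (simp add: on_curve_iff_eq power2_eq_square)
    then have a: "a \<in> roots" using T_ac_nz by (simp add: roots_def)
    have "b \<noteq> - e" using True e by auto
    then have "point a b (poly_ff [:- (- e):] 1) = 0" using pos[of "- e"] by (metis order_le_less)
    moreover have nz: "Polynomial.smult T_ac fC \<noteq> 0" using T_ac_nz fC_nz by simp
    have "point a b (of_rat_fn (Polynomial.smult T_ac fC)) = 1"
      using point_poly_value[OF c nz] order_fC[OF a] True e T_ac_nz by (auto simp: order_smult)
    ultimately have "point a b (poly_ff [:- e:] 1) = 1"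
      using pt_mult[OF v, of "poly_ff [:- e:] 1" "poly_ff [:e:] 1"] y_minus_one_times[OF ee] by simp
    then show ?thesis using True a by simp
  qed
qed

text \<open>It is the divisor of \<open>y - 1\<close>.\<close>

lemma orbit_class_roots_principal: "orbit_class roots \<in> principal_divisors F"
proof -
  have nz: "poly_ff [:- 1:] 1 \<noteq> 0" by simp
  have "orbit_class roots = div_of (poly_ff [:- 1:] 1)"
  proof (rule deg0_eqI[OF orbit_class_deg0[OF subset_refl] deg0_div_of[OF nz]])
    fix a b assume c: "on_curve a b"
    then show "Poly_Mapping.lookup (orbit_class roots) (point a b) = Poly_Mapping.lookup (div_of (poly_ff [:- 1:] 1)) (point a b)"
      using lookup_orbit_class[OF subset_refl c] y_minus_value[OF c, of 1] point_in_points[OF c] nz by (simp add: lookup_div_of)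
  qed
  then show ?thesis using principal_div_of[OF nz] by simp
qed

subsection \<open>Every invariant class is a combination of the classes of orbits\<close>

definition root_orbits :: "qtc set set" where "root_orbits = galois_orbit ` roots"

lemma finite_root_orbits: "finite root_orbits"
  by (simp add: root_orbits_def finite_roots)

lemma root_orbits_disjoint: "S \<in> root_orbits \<Longrightarrow> S' \<in> root_orbits \<Longrightarrow> S \<noteq> S' \<Longrightarrow> S \<inter> S' = {}"
  unfolding root_orbits_def using galois_orbit_eq by blast

lemma Union_root_orbits: "\<Union>root_orbits = roots"
  unfolding root_orbits_def using orbit_subset_roots galois_orbit_self by blast

definition orbit_span :: "((qt ff \<Rightarrow> int) \<Rightarrow>\<^sub>0 int) set" where
  "orbit_span = {D. \<exists>c. D - (\<Sum>S\<in>root_orbits. frag_cmul (c S) (orbit_class S)) \<in> principal_divisors F}"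

lemma orbit_span_add: assumes "D \<in> orbit_span" "E \<in> orbit_span" shows "D + E \<in> orbit_span"
proof -
  obtain c d where "D - (\<Sum>S\<in>root_orbits. frag_cmul (c S) (orbit_class S)) \<in> principal_divisors F"
    "E - (\<Sum>S\<in>root_orbits. frag_cmul (d S) (orbit_class S)) \<in> principal_divisors F"
    using assms by (auto simp: orbit_span_def)
  from principal_add[OF this] have "D + E - (\<Sum>S\<in>root_orbits. frag_cmul (c S + d S) (orbit_class S)) \<in> principal_divisors F"
    by (simp add: frag_cmul_distrib sum.distrib algebra_simps)
  then show ?thesis unfolding orbit_span_def mem_Collect_eq by (rule exI[of _ "\<lambda>S. c S + d S"])
qed

lemma orbit_span_uminus: assumes "D \<in> orbit_span" shows "- D \<in> orbit_span"
proof -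
  obtain c where "D - (\<Sum>S\<in>root_orbits. frag_cmul (c S) (orbit_class S)) \<in> principal_divisors F"
    using assms by (auto simp: orbit_span_def)
  from principal_uminus[OF this] have "- D - (\<Sum>S\<in>root_orbits. frag_cmul (- c S) (orbit_class S)) \<in> principal_divisors F"
    by (simp add: minus_frag_cmul[symmetric] sum_negf del: minus_frag_cmul)
  then show ?thesis unfolding orbit_span_def mem_Collect_eq by (rule exI[of _ "\<lambda>S. - c S"])
qed

lemma orbit_span_principal: "D \<in> principal_divisors F \<Longrightarrow> D \<in> orbit_span"
  unfolding orbit_span_def mem_Collect_eq by (rule exI[of _ "\<lambda>_. 0"]) simp

text \<open>The divisor of \<open>x - a\<close> is \<open>(a, 1) + (a, -1) - 2 \<infinity>\<close>, so the points \<open>(a, -1)\<close> can be eliminated. By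
  invariance, the resulting coefficients of the \<open>(a, 1)\<close> are constant on orbits.\<close>

lemma fibre_divisor_in_span:
  assumes D: "effective D" "galois_invariant D" and fib: "\<And>v. v \<in> Poly_Mapping.keys D \<Longrightarrow> in_fibre v"
  shows "reduced_at_inf D \<in> orbit_span"
proof -
  define m where "m a = Poly_Mapping.lookup D (point a (- 1))" for a
  define n where "n a = Poly_Mapping.lookup D (point a 1) - m a" for a
  define N where "N = (\<Sum>a\<in>roots. frag_cmul (n a) (root_class a))"
  define M where "M = (\<Sum>a\<in>roots. frag_cmul (m a) (div_of (of_rat_fn [:-a, 1:])))"
  have keysD: "Poly_Mapping.keys D \<subseteq> points F" using D(1) by (auto simp: effective_def)
  have lin: "of_rat_fn [:-a, 1:] \<noteq> 0" for a :: qtc by simp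
  have Mp: "M \<in> principal_divisors F"
  proof -
    have "(\<Sum>a\<in>S. frag_cmul (m a) (div_of (of_rat_fn [:-a, 1:]))) \<in> principal_divisors F" if "finite S" for S
      using that by (induction S rule: finite_induct) (simp_all add: principal_0 principal_add principal_cmul principal_div_of)
    then show ?thesis unfolding M_def using finite_roots by blast
  qed
  have "reduced_at_inf D = N + M"
  proof (rule deg0_eqI)
    show "reduced_at_inf D \<in> deg0_divisors" by (rule reduced_at_inf_deg0[OF keysD])
    have "N \<in> deg0_divisors" "M \<in> deg0_divisors"
      unfolding N_def M_def by (intro deg0_sum deg0_cmul root_class_deg0 deg0_div_of lin; assumption)+
    then show "N + M \<in> deg0_divisors" by (rule deg0_add)
    fix a b assume c: "on_curve a b"
    have N: "Poly_Mapping.lookup N (point a b) = (if a \<in> roots \<and> b = 1 then n a else 0)"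
      unfolding N_def by (rule lookup_sum_root_class[OF subset_refl c])
    have "Poly_Mapping.lookup M (point a b) = (\<Sum>r\<in>roots. if r = a then m a else 0)"
      unfolding M_def lookup_sum
    proof (rule sum.cong)
      fix r assume r: "r \<in> roots"
      have b0: "b \<noteq> 0" if "r = a" using r c that root_points[of a b] by (auto simp: roots_def)
      have "Polynomial.order a [:- r, 1:] = (if r = a then 1 else 0)"
        using order_power_n_n[of a 1] by (auto intro: order_0I)
      then have "Poly_Mapping.lookup (div_of (of_rat_fn [:- r, 1:])) (point a b) = (if r = a then 1 else 0)"
        using point_poly_value[OF c, of "[:- r, 1:]"] b0 point_in_points[OF c] by (simp add: lookup_div_of)
      then show "Poly_Mapping.lookup (frag_cmul (m r) (div_of (of_rat_fn [:- r, 1:]))) (point a b) = (if r = a then m a else 0)"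
        by simp
    qed simp
    then have M: "Poly_Mapping.lookup M (point a b) = (if a \<in> roots then m a else 0)" using finite_roots by simp
    show "Poly_Mapping.lookup (reduced_at_inf D) (point a b) = Poly_Mapping.lookup (N + M) (point a b)"
    proof (cases "a \<in> roots")
      case True
      then have "b = 1 \<or> b = - 1" using c root_points[of a b] by (simp add: roots_def)
      then show ?thesis using True by (auto simp: lookup_reduced_at_inf[OF c] lookup_add N M n_def m_def)
    next
      case False
      then have "point a b \<notin> Poly_Mapping.keys D" using fib in_fibre_point[OF c] by blast
      then show ?thesis using False by (simp add: lookup_reduced_at_inf[OF c] lookup_add N M in_keys_iff)
    qed
  qed
  moreover have "N = (\<Sum>S\<in>root_orbits. frag_cmul (n (SOME a. a \<in> S)) (orbit_class S))"
  proof -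
    have nconst: "n b = n a" if a: "a \<in> roots" and b: "b \<in> galois_orbit a" for a b
    proof -
      obtain \<sigma> where s: "\<sigma> \<in> galois_group" "b = \<sigma> a" using b by (auto simp: galois_orbit_def)
      note h = galois_groupD(1)[OF s(1)]
      have "galois_point \<sigma> (point a 1) = point b 1" "galois_point \<sigma> (point a (- 1)) = point b (- 1)"
        using galois_point_point[OF s(1) root_on_curve(1)[OF a]] galois_point_point[OF s(1) root_on_curve(2)[OF a]]
        by (simp_all add: hom_simps[OF h] s(2))
      then show ?thesis
        using galois_invariant_lookup[OF D(2) s(1), of "point a 1"] galois_invariant_lookup[OF D(2) s(1), of "point a (- 1)"]
        by (simp add: n_def m_def)
    qed
    have fin: "\<forall>S\<in>root_orbits. finite S"
      using finite_subset[OF orbit_subset_roots finite_roots] by (auto simp: root_orbits_def)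
    have disj: "\<forall>S\<in>root_orbits. \<forall>S'\<in>root_orbits. S \<noteq> S' \<longrightarrow> S \<inter> S' = {}" using root_orbits_disjoint by blast
    have "N = (\<Sum>S\<in>root_orbits. \<Sum>a\<in>S. frag_cmul (n a) (root_class a))"
      unfolding N_def Union_root_orbits[symmetric] by (rule sum.Union_disjoint[OF fin disj, unfolded comp_def])
    also have "\<dots> = (\<Sum>S\<in>root_orbits. frag_cmul (n (SOME a. a \<in> S)) (orbit_class S))"
    proof (rule sum.cong)
      fix S assume S: "S \<in> root_orbits"
      then obtain r where r: "r \<in> roots" "S = galois_orbit r" by (auto simp: root_orbits_def)
      then have some: "(SOME a. a \<in> S) \<in> S" using someI[of "\<lambda>a. a \<in> S" r] galois_orbit_self[of r] by simp
      have "n a = n (SOME a. a \<in> S)" if "a \<in> S" for a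
        using nconst[OF r(1)] that some r(2) by metis
      then have "(\<Sum>a\<in>S. frag_cmul (n a) (root_class a)) = (\<Sum>a\<in>S. frag_cmul (n (SOME a. a \<in> S)) (root_class a))"
        by (intro sum.cong) auto
      then show "(\<Sum>a\<in>S. frag_cmul (n a) (root_class a)) = frag_cmul (n (SOME a. a \<in> S)) (orbit_class S)"
        by (simp add: orbit_class_def frag_cmul_sum)
    qed simp
    finally show ?thesis .
  qed
  ultimately show ?thesis
    unfolding orbit_span_def mem_Collect_eq using Mp by (intro exI[of _ "\<lambda>S. n (SOME a. a \<in> S)"]) simp
qed

text \<open>Induction on the degree. Outside the fibre \<open>f = 0\<close>, the divisor of the prime polynomial of a point \<open>v\<close> of
  \<open>D\<close> is the sum \<open>D1\<close> of the conjugates of \<open>v\<close>, all of which occur in the invariant divisor \<open>D\<close>; so \<open>D1\<close> can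
  be subtracted. Its part \<open>D2\<close> in the fibre has been treated before.\<close>

theorem invariant_divisor_in_span:
  "effective D \<Longrightarrow> galois_invariant D \<Longrightarrow> reduced_at_inf D \<in> orbit_span"
proof (induction "nat (div_degree D)" arbitrary: D rule: less_induct)
  case less
  show ?case
  proof (cases "\<forall>v\<in>Poly_Mapping.keys D. in_fibre v")
    case True
    then show ?thesis using fibre_divisor_in_span less.prems by blast
  next
    case False
    then obtain v where v: "v \<in> Poly_Mapping.keys D" "\<not> in_fibre v" by blast
    have vp: "v \<in> points F" "v \<noteq> infinity" using v less.prems(1) by (auto simp: effective_def)
    obtain a b where ab: "on_curve a b" "v = point a b" using points_cases[OF vp(1)] vp(2) by metis
    have r: "regular a b" using v(2) ab in_fibre_point[OF ab(1)] by (simp add: regular_def roots_def)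
    obtain G where G: "prime_elem G" "eval2 rat_ac a b G = 0" using prime_of_point[OF ab(1)] by blast
    obtain A B where inv: "\<And>\<sigma>. \<sigma> \<in> galois_group \<Longrightarrow> map_poly \<sigma> A = A \<and> map_poly \<sigma> B = B"
      and ev: "\<And>a b. on_curve a b \<Longrightarrow> poly A a + poly B a * b = eval2 rat_ac a b G"
      and fl: "\<And>u w. w ^ 2 = fls_poly (geom F) u \<Longrightarrow> fls_poly A u + fls_poly B u * w = eval2 (\<lambda>c. fls_const (rat_ac c)) u w G"
      using polynomial_as_function[of G] by blast
    define h where "h = poly_ff A B"
    have h: "h \<noteq> 0" unfolding h_def by (rule prime_is_uniformizer(1)[OF r G fl])
    have h_inv: "galois_ff \<sigma> h = h" if "\<sigma> \<in> galois_group" for \<sigma>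
      using inv[OF that] by (simp add: h_def poly_ff_def galois_ff_poly[OF that])
    have val: "w h = (if eval2 rat_ac c d G = 0 then 1 else 0)" if w: "w = point c d" "regular c d" for w c d
    proof (cases "eval2 rat_ac c d G = 0")
      case True
      then show ?thesis using prime_is_uniformizer(2)[OF w(2) G(1) True fl] w by (simp add: h_def)
    next
      case False
      have cd: "on_curve c d" using w by (simp add: regular_def)
      have nz: "A \<noteq> 0 \<or> B \<noteq> 0" using h by (simp add: h_def)
      have "\<not> 0 < w h" "0 \<le> w h" using point_poly_ff_pos[OF cd nz] ev[OF cd] False by (auto simp: w h_def)
      then show ?thesis using False by simp
    qed
    have nonneg: "0 \<le> w h" if wp: "w \<in> points F" "w \<noteq> infinity" for w
    proof -
      obtain c d where "on_curve c d" "w = point c d" using points_cases[OF wp(1)] wp(2) by metis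
      then show ?thesis using point_poly_ff_pos(1)[of c d A B] h by (auto simp: h_def)
    qed
    have div_inv: "Poly_Mapping.lookup (div_of h) (galois_point \<sigma> w) = Poly_Mapping.lookup (div_of h) w"
      if "\<sigma> \<in> galois_group" for \<sigma> w
      using lookup_galois_div[OF that, of "div_of h" w] galois_div_div_of[OF that h] h_inv[OF that] by simp
    define D1 where "D1 = restrict_div (\<lambda>w. w \<noteq> infinity \<and> \<not> in_fibre w) (div_of h)"
    define D2 where "D2 = restrict_div in_fibre (div_of h)"
    have inf_iff: "galois_point \<sigma> w = infinity \<longleftrightarrow> w = infinity" if "\<sigma> \<in> galois_group" for \<sigma> w
      using inj_galois_point[OF that, of w infinity] galois_point_infinity[OF that] by simp
    have e1: "effective D1" "galois_invariant D1"
    proof -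
      have k: "Poly_Mapping.keys D1 \<subseteq> points F - {infinity}"
        by (auto simp: D1_def in_keys_iff lookup_restrict_div lookup_div_of split: if_splits)
      then show "effective D1"
        using nonneg by (auto simp: effective_def D1_def lookup_restrict_div lookup_div_of)
      show "galois_invariant D1"
        by (rule galois_invariantI) (use k in_fibre_galois div_inv inf_iff in \<open>auto simp: D1_def lookup_restrict_div\<close>)
    qed
    have e2: "effective D2" "galois_invariant D2"
    proof -
      have k: "Poly_Mapping.keys D2 \<subseteq> points F - {infinity}"
        using not_in_fibre_infinity by (auto simp: D2_def in_keys_iff lookup_restrict_div lookup_div_of split: if_splits)
      have "w \<noteq> infinity" if "in_fibre w" for w using that not_in_fibre_infinity by blast
      then show "effective D2"
        using k nonneg by (auto simp: effective_def D2_def lookup_restrict_div lookup_div_of)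
      show "galois_invariant D2"
        by (rule galois_invariantI) (use k in_fibre_galois div_inv in \<open>auto simp: D2_def lookup_restrict_div\<close>)
    qed
    have k1: "Poly_Mapping.keys D1 \<subseteq> points F" and k2: "Poly_Mapping.keys D2 \<subseteq> points F" and kD: "Poly_Mapping.keys D \<subseteq> points F"
      using e1(1) e2(1) less.prems(1) by (auto simp: effective_def)
    have split: "reduced_at_inf D1 + reduced_at_inf D2 = div_of h"
    proof (rule deg0_eqI[OF deg0_add[OF reduced_at_inf_deg0[OF k1] reduced_at_inf_deg0[OF k2]] deg0_div_of[OF h]])
      fix c d assume c: "on_curve c d"
      then show "Poly_Mapping.lookup (reduced_at_inf D1 + reduced_at_inf D2) (point c d) = Poly_Mapping.lookup (div_of h) (point c d)"
        using point_neq_infinity[OF c] by (simp add: lookup_add lookup_reduced_at_inf[OF c] D1_def D2_def lookup_restrict_div)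
    qed
    have le: "Poly_Mapping.lookup D1 w \<le> Poly_Mapping.lookup D w" for w
    proof (cases "w \<in> points F \<and> w \<noteq> infinity \<and> \<not> in_fibre w")
      case True
      then obtain c d where cd: "on_curve c d" "w = point c d" using points_cases[of w] by metis
      have rw: "regular c d" using True cd in_fibre_point[OF cd(1)] by (simp add: regular_def roots_def)
      have D1w: "Poly_Mapping.lookup D1 w = w h" using True h by (simp add: D1_def lookup_restrict_div lookup_div_of)
      show ?thesis
      proof (cases "eval2 rat_ac c d G = 0")
        case True
        obtain \<sigma> where s: "\<sigma> \<in> galois_group" "\<sigma> a = c" "\<sigma> b = d" using same_prime_conjugate[OF r rw G True] by blast
        have "Poly_Mapping.lookup D w = Poly_Mapping.lookup D v"
          using galois_invariant_lookup[OF less.prems(2) s(1), of v] galois_point_point[OF s(1) ab(1)] ab cd s by simp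
        moreover have "0 \<le> Poly_Mapping.lookup D v" "Poly_Mapping.lookup D v \<noteq> 0"
          using less.prems(1) v(1) by (auto simp: effective_def in_keys_iff)
        ultimately show ?thesis using D1w val[OF cd(2) rw] by simp
      next
        case False
        then show ?thesis using D1w val[OF cd(2) rw] less.prems(1) by (simp add: effective_def)
      qed
    next
      case False
      then have "Poly_Mapping.lookup D1 w = 0" by (auto simp: D1_def lookup_restrict_div lookup_div_of)
      then show ?thesis using less.prems(1) by (simp add: effective_def)
    qed
    define D' where "D' = D - D1"
    have "effective D'"
    proof -
      have "Poly_Mapping.keys D' \<subseteq> points F - {infinity}"
        unfolding D'_def using keys_diff[of D D1] less.prems(1) e1(1) by (auto simp: effective_def)
      then show ?thesis using le by (simp add: effective_def D'_def lookup_minus)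
    qed
    moreover have "galois_invariant D'"
      using less.prems(2) e1(2) by (auto simp: galois_invariant_def D'_def galois_div_diff)
    moreover have "0 < Poly_Mapping.lookup D1 v"
      using val[OF ab(2) r] G(2) vp v(2) h by (simp add: D1_def lookup_restrict_div lookup_div_of)
    then have "0 < div_degree D1" by (rule effective_degree_pos[OF e1(1)])
    then have "nat (div_degree D') < nat (div_degree D)"
      using effective_degree_nonneg[OF \<open>effective D'\<close>] by (simp add: D'_def div_degree_diff)
    ultimately have D': "reduced_at_inf D' \<in> orbit_span" using less.hyps by blast
    have "reduced_at_inf D2 \<in> orbit_span"
      by (rule fibre_divisor_in_span[OF e2]) (auto simp: D2_def in_keys_iff lookup_restrict_div split: if_splits)
    from orbit_span_add[OF orbit_span_principal[OF principal_div_of[OF h]] orbit_span_uminus[OF this]]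
    have "div_of h + - reduced_at_inf D2 \<in> orbit_span" .
    then have D1: "reduced_at_inf D1 \<in> orbit_span" unfolding split[symmetric] by simp
    have "reduced_at_inf D = reduced_at_inf D' + reduced_at_inf D1"
      by (simp add: reduced_at_inf_def D'_def div_degree_diff frag_cmul_diff_distrib)
    then show ?thesis using orbit_span_add[OF D' D1] by simp
  qed
qed

end

section \<open>Relations between the classes\<close>

text \<open>Compare the multiplicities of the roots of \<open>p\<close>, which are at most the degree.\<close>

lemma all_roots_imp_dvd_power:
  fixes p q :: "'a::alg_closed_field poly"
  assumes "p \<noteq> 0" "\<And>a. poly p a = 0 \<Longrightarrow> poly q a = 0"
  shows "p dvd q ^ Polynomial.degree p"
  using assms
proof (induction "Polynomial.degree p" arbitrary: p rule: less_induct)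
  case less
  show ?case
  proof (cases "Polynomial.degree p = 0")
    case True
    then obtain c where "p = [:c:]" by (metis degree_eq_zeroE)
    then have "is_unit p" using less.prems(1) by (simp add: is_unit_pCons_iff)
    then show ?thesis by (rule unit_imp_dvd)
  next
    case False
    then obtain a where a: "poly p a = 0" using alg_closed_imp_poly_has_root by blast
    then obtain p1 where p1: "p = [:-a, 1:] * p1" by (meson dvdE poly_eq_0_iff_dvd)
    then have nz: "p1 \<noteq> 0" using less.prems(1) by auto
    then have deg: "Polynomial.degree p = Suc (Polynomial.degree p1)"
      by (simp add: p1 degree_mult_eq del: mult_pCons_left)
    have "p1 dvd q ^ Polynomial.degree p1"
      by (rule less.hyps) (use deg nz less.prems(2) in \<open>auto simp: p1\<close>)
    moreover have "[:-a, 1:] dvd q" using less.prems(2)[OF a] by (simp add: poly_eq_0_iff_dvd)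
    ultimately show ?thesis unfolding deg by (simp add: p1 mult_dvd_mono del: mult_pCons_left)
  qed
qed

text \<open>Polynomials in \<open>x\<close> with coefficients in \<open>\<rat>[T]\<close>; here \<open>x\<close> is the outer variable.\<close>

definition emb2 :: "rat poly poly \<Rightarrow> qtc poly" where
  "emb2 P = map_poly (\<lambda>c. to_ac (to_fract c)) P"

lemma is_hom_to_ac_to_fract: "is_hom (\<lambda>c :: rat poly. to_ac (to_fract c))"
  by (rule is_hom_compose[OF is_hom_to_ac is_hom_to_fract])

lemma is_hom_emb2: "is_hom emb2"
  unfolding emb2_def[abs_def] by (rule is_hom_map_poly[OF is_hom_to_ac_to_fract])

lemma emb2_eq_0_iff [simp]: "emb2 P = 0 \<longleftrightarrow> P = 0"
  unfolding emb2_def by (rule map_poly_eq_0_iff) simp_all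

lemma emb2_eq_iff: "emb2 P = emb2 Q \<longleftrightarrow> P = Q"
  using emb2_eq_0_iff[of "P - Q"] by (simp add: hom_diff[OF is_hom_emb2])

lemma emb2_const: "emb2 [:c:] = [:to_ac (to_fract c):]"
  by (simp add: emb2_def map_poly_hom_pCons[OF is_hom_to_ac_to_fract])

lemma common_denominator_poly:
  fixes p :: "qt poly"
  shows "\<exists>d P. d \<noteq> 0 \<and> Polynomial.smult (to_fract d) p = map_poly to_fract P"
proof (induction p)
  case 0
  show ?case by (rule exI[of _ 1], rule exI[of _ 0]) simp
next
  case (pCons c p)
  obtain d P where d: "d \<noteq> 0" "Polynomial.smult (to_fract d) p = map_poly to_fract P" using pCons by blast
  obtain r s where c: "c = to_fract r / to_fract s" "s \<noteq> 0" by (cases c) (auto simp: Fract_conv_to_fract)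
  have "Polynomial.smult (to_fract (s * d)) (pCons c p) = pCons (to_fract (d * r)) (Polynomial.smult (to_fract s) (map_poly to_fract P))"
    using c by (simp add: d(2)[symmetric])
  also have "\<dots> = map_poly to_fract (pCons (d * r) (Polynomial.smult s P))"
    by (simp only: map_poly_hom_pCons[OF is_hom_to_fract] map_poly_hom_smult[OF is_hom_to_fract])
  finally have "Polynomial.smult (to_fract (s * d)) (pCons c p) = map_poly to_fract (pCons (d * r) (Polynomial.smult s P))" .
  moreover have "s * d \<noteq> 0" using c d by simp
  ultimately show ?case by (intro exI conjI)
qed

text \<open>The coefficients lie in \<open>\<rat>(T)\<close>.\<close>

lemma fixed_poly_denominator:
  fixes p :: "qtc poly"
  assumes "\<And>\<sigma>. \<sigma> \<in> galois_group \<Longrightarrow> map_poly \<sigma> p = p"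
  shows "\<exists>d P. d \<noteq> 0 \<and> Polynomial.smult (to_ac (to_fract d)) p = emb2 P"
proof -
  have "poly.coeff p i \<in> range to_ac" for i
  proof (rule galois_fixed_field)
    fix \<sigma> assume s: "\<sigma> \<in> (galois_group :: (qtc \<Rightarrow> qtc) set)"
    have "poly.coeff (map_poly \<sigma> p) i = \<sigma> (poly.coeff p i)"
      by (simp add: coeff_map_poly hom_0[OF galois_groupD(1)[OF s]])
    then show "\<sigma> (poly.coeff p i) = poly.coeff p i" using assms[OF s] by simp
  qed
  then have "to_ac (of_ac (poly.coeff p i)) = poly.coeff p i" for i by (simp add: to_ac_of_ac)
  then have p: "p = map_poly to_ac (map_poly of_ac p)"
    by (intro poly_eqI) (simp add: coeff_map_poly)
  obtain d P where d: "d \<noteq> 0" "Polynomial.smult (to_fract d) (map_poly of_ac p) = map_poly to_fract P"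
    using common_denominator_poly by blast
  have "Polynomial.smult (to_ac (to_fract d)) p = map_poly to_ac (Polynomial.smult (to_fract d) (map_poly of_ac p))"
    unfolding map_poly_hom_smult[OF is_hom_to_ac] using p by simp
  also have "\<dots> = emb2 P" unfolding d(2) emb2_def by (rule map_poly_hom_compose[OF is_hom_to_ac is_hom_to_fract])
  finally show ?thesis using d(1) by blast
qed

lemma galois_emb2: "\<sigma> \<in> galois_group \<Longrightarrow> map_poly \<sigma> (emb2 P) = emb2 P"
  unfolding emb2_def
  by (simp add: map_poly_hom_compose[OF galois_groupD(1) is_hom_to_ac_to_fract] galois_groupD(3))

text \<open>Reduction of \<open>\<rat>[T][x]\<close> modulo a prime of \<open>\<rat>[T]\<close> is realised as the evaluation of \<open>T\<close> at a complex root \<open>\<tau>\<close>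
  of the prime, which has the advantage that the reduced polynomials have coefficients in a field.\<close>

lemma reduction_mod_prime:
  fixes \<pi> :: "rat poly"
  assumes \<pi>: "prime_elem \<pi>"
  shows "\<exists>\<tau> :: complex. \<forall>P. map_poly (\<lambda>c. poly (map_poly of_rat c) \<tau>) P = 0 \<longleftrightarrow> [:\<pi>:] dvd P"
proof -
  have h: "is_hom (of_rat :: rat \<Rightarrow> complex)" by (rule is_homI) (simp_all add: of_rat_add of_rat_mult)
  have "Polynomial.degree \<pi> \<noteq> 0"
  proof
    assume "Polynomial.degree \<pi> = 0"
    then obtain c where "\<pi> = [:c:]" by (metis degree_eq_zeroE)
    then show False using \<pi> by (auto simp: prime_elem_def is_unit_pCons_iff)
  qed
  then have "0 < Polynomial.degree (map_poly (of_rat :: rat \<Rightarrow> complex) \<pi>)" by (simp add: degree_map_poly_hom[OF h])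
  then obtain \<tau> where \<tau>: "poly (map_poly of_rat \<pi>) \<tau> = (0 :: complex)" using alg_closed_imp_poly_has_root by blast
  let ?e = "\<lambda>c :: rat poly. poly (map_poly of_rat c) \<tau>"
  have he: "is_hom ?e" by (rule is_hom_eval[OF h])
  have ker: "?e c = 0 \<longleftrightarrow> \<pi> dvd c" for c
  proof
    assume c: "?e c = 0"
    show "\<pi> dvd c"
    proof (rule ccontr)
      assume "\<not> \<pi> dvd c"
      then have "gcd \<pi> c = 1" using prime_elem_imp_coprime[OF \<pi>] by (simp add: coprime_iff_gcd_eq_1)
      then obtain s t where "s * \<pi> + t * c = 1" by (metis bezout_coefficients_fst_snd)
      then have "?e s * ?e \<pi> + ?e t * ?e c = 1" by (metis hom_1[OF he] hom_add[OF he] hom_mult[OF he])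
      then show False using \<tau> c by simp
    qed
  qed (auto simp: dvd_def hom_mult[OF he] \<tau>)
  let ?\<theta> = "\<lambda>P. map_poly ?e P"
  have "?\<theta> P = 0 \<longleftrightarrow> [:\<pi>:] dvd P" for P
  proof -
    have "?\<theta> P = 0 \<longleftrightarrow> (\<forall>i. ?e (poly.coeff P i) = 0)"
      by (simp add: poly_eq_iff coeff_map_poly)
    then show ?thesis by (simp add: ker const_poly_dvd_iff)
  qed
  then show ?thesis by (intro exI allI)
qed

context pencil
begin

text \<open>The polynomials \<open>f\<close> and \<open>1 + T f\<close> as elements of \<open>\<rat>[T][x]\<close>.\<close>

definition fW :: "rat poly poly" where "fW = map_poly (\<lambda>c. [:c:]) f"

definition FW :: "rat poly poly" where "FW = [:[:0, 1:]:] * fW + 1"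

lemma emb2_fW: "emb2 fW = fC"
  unfolding emb2_def fW_def
  by (simp add: map_poly_hom_compose[OF is_hom_to_ac_to_fract is_hom_const_poly] rat_ac_def[abs_def] const_fn_def)

lemma emb2_FW: "emb2 FW = geom F"
  unfolding FW_def hom_add[OF is_hom_emb2] hom_mult[OF is_hom_emb2] hom_1[OF is_hom_emb2] emb2_fW emb2_const geom_F T_ac_def
  by simp

text \<open>This additive function of \<open>h\<close> vanishes on functions of \<open>x\<close>, and on \<open>y - 1\<close> and \<open>y + 1\<close> it is \<open>1\<close> and \<open>-1\<close> at
  all roots. It therefore takes the same value at all roots for every \<open>h\<close> that is obtained from such
  functions by multiplication and division.\<close>

definition value_gap :: "qtc \<Rightarrow> qt ff \<Rightarrow> int" where
  "value_gap a h = point a 1 h - point a (- 1) h"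

lemma value_gap_mult:
  assumes "a \<in> roots" "h \<noteq> 0" "h' \<noteq> 0" shows "value_gap a (ff_mult F h h') = value_gap a h + value_gap a h'"
  using pt_mult[OF point_in_points[OF root_on_curve(1)[OF assms(1)]] assms(2,3)]
    pt_mult[OF point_in_points[OF root_on_curve(2)[OF assms(1)]] assms(2,3)] by (simp add: value_gap_def)

lemma value_gap_poly: "a \<in> roots \<Longrightarrow> p \<noteq> 0 \<Longrightarrow> value_gap a (of_rat_fn p) = 0"
  using point_poly_value[OF root_on_curve(1)] point_poly_value[OF root_on_curve(2)] by (simp add: value_gap_def)

lemma value_gap_y_minus_one: "a \<in> roots \<Longrightarrow> value_gap a (poly_ff [:- 1:] 1) = 1"
  using y_minus_value[OF root_on_curve(1), of a 1] y_minus_value[OF root_on_curve(2), of a 1] by (simp add: value_gap_def)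

lemma value_gap_y_plus_one: "a \<in> roots \<Longrightarrow> value_gap a (poly_ff [:1:] 1) = - 1"
  using y_minus_value[OF root_on_curve(1), of a "- 1"] y_minus_value[OF root_on_curve(2), of a "- 1"] by (simp add: value_gap_def)

definition constant_gap :: "qt ff \<Rightarrow> bool" where
  "constant_gap h \<longleftrightarrow> (\<exists>k. \<forall>a\<in>roots. value_gap a h = k)"

lemma constant_gap_scale:
  assumes "c \<noteq> 0" "h \<noteq> 0" "constant_gap h" shows "constant_gap (ff_mult F (of_rat_fn [:c:]) h)"
proof -
  obtain k where "\<forall>a\<in>roots. value_gap a h = k" using assms(3) by (auto simp: constant_gap_def)
  then have "\<forall>a\<in>roots. value_gap a (ff_mult F (of_rat_fn [:c:]) h) = k"
    using assms(1,2) by (simp add: value_gap_mult value_gap_poly)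
  then show ?thesis unfolding constant_gap_def by (rule exI)
qed

text \<open>With \<open>y\<^sup>2 = t u + 1\<close> and \<open>A \<equiv> e B\<close> modulo \<open>t\<close>, one has \<open>(y - e) (A + B y) = t (A' + C y)\<close> for
  \<open>A' = B u - e C\<close>, and \<open>N\<close> is the norm.\<close>

lemma descent_step_identities:
  fixes A B C e t u :: "'a::idom"
  assumes e: "e = 1 \<or> e = - 1" and A: "A - e * B = t * C"
  defines "N \<equiv> \<lambda>p q. p * p - (t * u + 1) * (q * q)"
  shows "t * (B * u - e * C) = B * (t * u + 1) - e * A" (is "t * ?A' = _")
    and "t * N (B * u - e * C) C = - (N A B * u)"
proof -
  have A': "A = e * B + t * C" using A by (simp add: algebra_simps)
  show "t * ?A' = B * (t * u + 1) - e * A" using e unfolding A' by (auto simp: algebra_simps)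
  show "t * N ?A' C = - (N A B * u)" using e unfolding A' N_def by (auto simp: algebra_simps)
qed

text \<open>The norm of \<open>A + B y\<close> divides \<open>c(T) f\<^sup>M\<close>, and prime factors of \<open>c\<close> are removed one by one. A prime other
  than \<open>T\<close> that divides the norm divides \<open>A\<close> and \<open>B\<close>, as \<open>1 + T f\<close> has odd degree modulo it. If \<open>T\<close> divides
  the norm, but not both \<open>A\<close> and \<open>B\<close>, it divides \<open>A - B\<close> or \<open>A + B\<close>, and \<open>(y \<mp> 1) (A + B y)\<close> is divisible
  by \<open>T\<close>; the norm of \<open>y \<mp> 1\<close> is \<open>-T f\<close>, so that the quotient has a factor \<open>T\<close> less in its norm and a factor
  \<open>f\<close> more. When \<open>c\<close> is constant, the norm has degree 0 in \<open>T\<close>; but \<open>A\<^sup>2\<close> has even degree and \<open>(1 + T f) B\<^sup>2\<close> has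
  odd degree in \<open>T\<close>, whence \<open>B = 0\<close>.\<close>

lemma norm_dividing_imp_constant_gap:
  assumes "c \<noteq> 0" "A \<noteq> 0 \<or> B \<noteq> 0" "(A * A - FW * (B * B)) * E = [:c:] * fW ^ M"
  shows "constant_gap (poly_ff (emb2 A) (emb2 B))"
  using assms
proof (induction "Polynomial.degree c" arbitrary: c A B E M rule: less_induct)
  case less
  have fWnz: "fW \<noteq> 0" using emb2_fW fC_nz emb2_eq_0_iff[of fW] by auto
  show ?case
  proof (cases "Polynomial.degree c = 0")
    case True
    then obtain c0 where c0: "c = [:c0:]" "c0 \<noteq> 0" using less.prems(1) by (metis degree_eq_zeroE pCons_eq_0_iff)
    note hs = is_hom_swap_poly
    have swf: "swap_poly fW = [:f:]"
    proof -
      have "swap_poly [:f:] = fW"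
        by (simp add: swap_poly_def fW_def map_poly_hom_pCons[OF is_hom_map_poly[OF is_hom_const_poly]])
      then show ?thesis by (metis swap_poly_swap_poly)
    qed
    have swF: "swap_poly FW = [:1, f:]"
      unfolding FW_def hom_add[OF hs] hom_mult[OF hs] hom_1[OF hs] swap_poly_gens swf by (simp add: one_pCons)
    define a b n where "a = swap_poly A" and "b = swap_poly B" and "n = a * a - [:1, f:] * (b * b)"
    have "n * swap_poly E = [:[:c0:]:] * [:f:] ^ M"
      using arg_cong[OF less.prems(3), of swap_poly]
      unfolding n_def a_def b_def c0 hom_mult[OF hs] hom_diff[OF hs] hom_power[OF hs] swap_poly_gens swF swf .
    moreover have "[:f:] ^ M = [:f ^ M:]" by (induction M) (simp_all add: one_pCons)
    ultimately have e: "n * swap_poly E = [:[:c0:] * f ^ M:]" by simp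
    have "[:c0:] * f ^ M \<noteq> 0" using c0 f_nz by simp
    then have "n * swap_poly E \<noteq> 0" unfolding e by simp
    then have nz: "n \<noteq> 0" "swap_poly E \<noteq> 0" by simp_all
    have "Polynomial.degree n + Polynomial.degree (swap_poly E) = 0"
      using degree_mult_eq[OF nz] unfolding e by simp
    then have dn: "Polynomial.degree n = 0" by simp
    have "b = 0"
    proof (rule ccontr)
      assume b: "b \<noteq> 0"
      define w where "w = [:1, f:] * (b * b)"
      have dw: "Polynomial.degree w = 1 + 2 * Polynomial.degree b"
        unfolding w_def using b f_nz by (subst degree_mult_eq) (simp_all add: degree_mult_eq)
      have da: "Polynomial.degree (a * a) = 2 * Polynomial.degree a" by (cases "a = 0") (simp_all add: degree_mult_eq)
      have ne: "Polynomial.degree (a * a) \<noteq> Polynomial.degree w" unfolding da dw by presburger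
      have n: "n = a * a + - w" by (simp add: n_def w_def)
      have "1 \<le> Polynomial.degree n"
      proof (cases "Polynomial.degree (a * a) < Polynomial.degree w")
        case True
        then show ?thesis unfolding n using degree_add_eq_right[of "a * a" "- w"] dw by simp
      next
        case False
        then have "Polynomial.degree w < Polynomial.degree (a * a)" using ne by simp
        then show ?thesis unfolding n using degree_add_eq_left[of "- w" "a * a"] dw by simp
      qed
      then show False using dn by simp
    qed
    then have B: "B = 0" by (simp add: b_def)
    then have "poly_ff (emb2 A) (emb2 B) = of_rat_fn (emb2 A)" by (simp add: poly_ff_def of_rat_fn_def)
    then show ?thesis using less.prems(2) B by (auto simp: constant_gap_def value_gap_poly)
  next
    case False
    then have "\<not> is_unit c" unfolding is_unit_iff_degree[OF less.prems(1)] .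
    then obtain \<pi> where \<pi>: "\<pi> dvd c" "prime_elem \<pi>" using prime_divisor_exists[OF less.prems(1)] by blast
    then obtain c1 where c1: "c = \<pi> * c1" by blast
    have nz: "\<pi> \<noteq> 0" "c1 \<noteq> 0" using c1 less.prems(1) by auto
    have "Polynomial.degree \<pi> \<noteq> 0" using \<pi>(2) nz(1) is_unit_iff_degree[OF nz(1)] by (auto simp: prime_elem_def)
    then have dc1: "Polynomial.degree c1 < Polynomial.degree c" unfolding c1 using nz by (simp add: degree_mult_eq)
    have P: "prime_elem [:\<pi>:]" using \<pi>(2) prime_elem_const_poly_iff by blast
    let ?N = "A * A - FW * (B * B)"
    have eq: "?N * E = [:\<pi>:] * ([:c1:] * fW ^ M)" unfolding less.prems(3) c1 by (simp add: mult.commute)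
    show ?thesis
    proof (cases "[:\<pi>:] dvd E")
      case True
      then obtain E1 where "E = [:\<pi>:] * E1" by blast
      then have "[:\<pi>:] * (?N * E1) = [:\<pi>:] * ([:c1:] * fW ^ M)" using eq by (metis mult.left_commute)
      then have "?N * E1 = [:c1:] * fW ^ M" using nz(1) by (simp only: mult_cancel_left pCons_eq_0_iff simp_thms)
      then show ?thesis using less.hyps[OF dc1 nz(2) less.prems(2)] by blast
    next
      case notE: False
      have "[:\<pi>:] dvd ?N * E" unfolding eq by (rule dvd_triv_left)
      then have dvdN: "[:\<pi>:] dvd ?N" using P notE prime_elem_dvd_multD by blast
      obtain \<tau> :: complex where ker0: "\<forall>P. map_poly (\<lambda>c. poly (map_poly of_rat c) \<tau>) P = 0 \<longleftrightarrow> [:\<pi>:] dvd P"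
        using reduction_mod_prime[OF \<pi>(2)] by (rule exE)
      have hr: "is_hom (of_rat :: rat \<Rightarrow> complex)" by (rule is_homI) (simp_all add: of_rat_add of_rat_mult)
      have he: "is_hom (\<lambda>c. poly (map_poly of_rat c) \<tau>)" by (rule is_hom_eval[OF hr])
      define \<theta> where "\<theta> = (\<lambda>P. map_poly (\<lambda>c. poly (map_poly (of_rat :: rat \<Rightarrow> complex) c) \<tau>) P)"
      have \<theta>: "is_hom \<theta>" "\<And>P. \<theta> P = map_poly (\<lambda>c. poly (map_poly of_rat c) \<tau>) P"
        unfolding \<theta>_def using is_hom_map_poly[OF he] by simp_all
      have ker: "\<theta> P = 0 \<longleftrightarrow> [:\<pi>:] dvd P" for P unfolding \<theta>_def by (rule ker0[rule_format])
      have \<theta>c: "\<theta> [:c:] = [:poly (map_poly of_rat c) \<tau>:]" for c by (simp add: \<theta>(2) map_poly_hom_pCons[OF he])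
      have T\<tau>: "poly (map_poly of_rat [:0, 1:]) \<tau> = \<tau>" by (simp add: map_poly_hom_pCons[OF hr])
      have \<theta>f: "\<theta> fW = map_poly of_rat f"
        by (simp add: \<theta>(2) fW_def map_poly_hom_compose[OF he is_hom_const_poly] map_poly_hom_pCons[OF hr])
      have \<theta>F: "\<theta> FW = Polynomial.smult \<tau> (map_poly of_rat f) + 1"
        by (simp only: FW_def hom_add[OF \<theta>(1)] hom_mult[OF \<theta>(1)] hom_1[OF \<theta>(1)] \<theta>c T\<tau> \<theta>f) simp
      have \<theta>N: "\<theta> A * \<theta> A = \<theta> FW * (\<theta> B * \<theta> B)"
        using dvdN unfolding ker[symmetric] by (simp add: hom_simps[OF \<theta>(1)])
      show ?thesis
      proof (cases "[:\<pi>:] dvd A \<and> [:\<pi>:] dvd B")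
        case True
        then obtain A1 B1 where AB1: "A = [:\<pi>:] * A1" "B = [:\<pi>:] * B1" by (metis dvdE)
        have "?N = [:\<pi>:] * ([:\<pi>:] * (A1 * A1 - FW * (B1 * B1)))"
          unfolding AB1 by (simp only: right_diff_distrib mult.assoc mult.left_commute)
        then have "[:\<pi>:] * ((A1 * A1 - FW * (B1 * B1)) * ([:\<pi>:] * E)) = [:\<pi>:] * ([:c1:] * fW ^ M)"
          using eq by (simp only: mult.assoc mult.left_commute)
        then have "(A1 * A1 - FW * (B1 * B1)) * ([:\<pi>:] * E) = [:c1:] * fW ^ M"
          using nz(1) by (simp only: mult_cancel_left pCons_eq_0_iff simp_thms)
        moreover have AB1nz: "A1 \<noteq> 0 \<or> B1 \<noteq> 0" using less.prems(2) AB1 by auto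
        ultimately have "constant_gap (poly_ff (emb2 A1) (emb2 B1))" using less.hyps[OF dc1 nz(2)] by blast
        moreover have "poly_ff (emb2 A) (emb2 B) = ff_mult F (of_rat_fn [:to_ac (to_fract \<pi>):]) (poly_ff (emb2 A1) (emb2 B1))"
          unfolding AB1 hom_mult[OF is_hom_emb2] emb2_const
          by (simp only: poly_ff_def of_rat_fn_def ff_mult_fst fst_conv snd_conv to_fract_mult)
        moreover have "poly_ff (emb2 A1) (emb2 B1) \<noteq> 0" using AB1nz by simp
        ultimately show ?thesis using constant_gap_scale nz(1) by simp
      next
        case notAB: False
        have "\<tau> = 0"
        proof (rule ccontr)
          assume t: "\<tau> \<noteq> 0"
          have degF': "Polynomial.degree (\<theta> FW) = 2 * g + 1"
            unfolding \<theta>F using t by (subst degree_add_eq_left) (simp_all add: degree_map_poly_hom[OF hr] degf)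
          then have Fnz: "\<theta> FW \<noteq> 0" by auto
          have "\<theta> B = 0"
          proof (rule ccontr)
            assume b: "\<theta> B \<noteq> 0"
            then have a: "\<theta> A \<noteq> 0" using \<theta>N Fnz by auto
            have "2 * Polynomial.degree (\<theta> A) = 2 * g + 1 + 2 * Polynomial.degree (\<theta> B)"
              using arg_cong[OF \<theta>N, of Polynomial.degree] a b Fnz by (simp add: degree_mult_eq degF')
            then show False by presburger
          qed
          then have "\<theta> A = 0" using \<theta>N by simp
          then have "[:\<pi>:] dvd A" "[:\<pi>:] dvd B" using ker[of A] ker[of B] \<open>\<theta> B = 0\<close> by simp_all
          then show False using notAB by simp
        qed
        then have "[:\<pi>:] dvd [:[:0, 1:]:]" unfolding ker[symmetric] \<theta>c T\<tau> by simp
        have T\<pi>: "[:0, 1:] dvd \<pi>"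
        proof -
          have "\<theta> [:\<pi>:] = 0" unfolding ker by (rule dvd_refl)
          then have "poly (map_poly of_rat \<pi>) (0 :: complex) = 0" unfolding \<theta>c \<open>\<tau> = 0\<close> by simp
          moreover have "poly (map_poly of_rat \<pi>) (0 :: complex) = of_rat (poly \<pi> 0)"
            using poly_map_poly_hom[OF hr, of \<pi> 0] by simp
          ultimately show ?thesis by (simp add: dvd_iff_poly_eq_0)
        qed
        have Tdvd: "[:[:0, 1:]:] dvd P" if "[:\<pi>:] dvd P" for P
        proof -
          have "[:[:0, 1:]:] dvd [:\<pi>:]" using T\<pi> by (simp add: const_poly_dvd_const_poly_iff)
          then show ?thesis using that by (rule dvd_trans)
        qed
        obtain c2 where c2: "c = [:0, 1:] * c2" using dvd_trans[OF T\<pi> \<pi>(1)] by (rule dvdE)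
        have c2nz: "c2 \<noteq> 0" using c2 less.prems(1) by auto
        have dc2: "Polynomial.degree c2 < Polynomial.degree c" unfolding c2 using c2nz by simp
        let ?T = "[:[:0, 1:]:] :: rat poly poly"
        have "\<theta> A * \<theta> A = \<theta> B * \<theta> B" using \<theta>N unfolding \<theta>F \<open>\<tau> = 0\<close> by simp
        then have "(\<theta> A - \<theta> B) * (\<theta> A + \<theta> B) = 0" by (simp add: algebra_simps)
        then have "\<theta> (A - B) = 0 \<or> \<theta> (A + B) = 0" by (simp add: hom_simps[OF \<theta>(1)])
        then obtain e :: rat where e: "e = 1 \<or> e = - 1" and \<theta>e: "\<theta> (A - [:[:e:]:] * B) = 0"
        proof
          assume "\<theta> (A - B) = 0" then show thesis using that[of 1] by (simp add: one_pCons[symmetric])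
        next
          assume "\<theta> (A + B) = 0"
          moreover have "A - [:[:- 1:]:] * B = A + B"
          proof -
            have "[:[:- 1:]:] = (- 1 :: rat poly poly)" by (simp add: one_pCons)
            then show ?thesis by (simp only: mult_minus1 diff_minus_eq_add)
          qed
          ultimately have "\<theta> (A - [:[:- 1:]:] * B) = 0" by (simp only:)
          then show thesis by (rule that[of "- 1", OF disjI2[OF refl]])
        qed
        have "?T dvd A - [:[:e:]:] * B" using \<theta>e unfolding ker by (rule Tdvd)
        then obtain C where C: "A - [:[:e:]:] * B = ?T * C" by blast
        let ?e = "[:[:e:]:] :: rat poly poly"
        have e': "?e = 1 \<or> ?e = - 1" using e by (auto simp: one_pCons)
        define A' where "A' = B * fW - ?e * C"
        have TA': "?T * A' = B * FW - ?e * A" and N': "?T * (A' * A' - FW * (C * C)) = - (?N * fW)"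
          unfolding A'_def FW_def by (rule descent_step_identities[OF e' C])+
        have "?T * ((A' * A' - FW * (C * C)) * (- E)) = ?T * ([:c2:] * fW ^ Suc M)"
        proof -
          have "?T * ((A' * A' - FW * (C * C)) * (- E)) = (?T * (A' * A' - FW * (C * C))) * (- E)"
            by (simp only: mult.assoc)
          also have "\<dots> = (?N * E) * fW" unfolding N' by (simp only: minus_mult_minus mult.assoc mult.commute[of fW])
          also have "\<dots> = [:c:] * fW ^ Suc M" unfolding less.prems(3) by (simp only: power_Suc2 mult.assoc)
          also have "\<dots> = ?T * ([:c2:] * fW ^ Suc M)"
            unfolding c2 hom_mult[OF is_hom_const_poly] by (simp only: mult.assoc)
          finally show ?thesis .
        qed
        then have E': "(A' * A' - FW * (C * C)) * (- E) = [:c2:] * fW ^ Suc M"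
          by (simp only: mult_cancel_left pCons_eq_0_iff) simp
        have "A' \<noteq> 0 \<or> C \<noteq> 0"
        proof (rule ccontr)
          assume "\<not> (A' \<noteq> 0 \<or> C \<noteq> 0)"
          then show False using E' c2nz fWnz by simp
        qed
        then have gap': "constant_gap (poly_ff (emb2 A') (emb2 C))" and nz': "poly_ff (emb2 A') (emb2 C) \<noteq> 0"
          using less.hyps[OF dc2 c2nz _ E'] by auto
        have nzh: "poly_ff (emb2 A) (emb2 B) \<noteq> 0" using less.prems(2) by simp
        have prod: "ff_mult F (poly_ff [:- rat_ac e:] 1) (poly_ff (emb2 A) (emb2 B)) =
            ff_mult F (of_rat_fn [:T_ac:]) (poly_ff (emb2 A') (emb2 C))"
        proof -
          have ee2: "emb2 ?e = [:rat_ac e:]" by (simp add: emb2_const rat_ac_def const_fn_def)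
          have eT: "emb2 ?T = [:T_ac:]" by (simp add: emb2_const T_ac_def)
          have 1: "[:T_ac:] * emb2 A' = emb2 B * geom F - [:rat_ac e:] * emb2 A"
            using arg_cong[OF TA', of emb2] unfolding hom_mult[OF is_hom_emb2] hom_diff[OF is_hom_emb2] emb2_FW ee2 eT .
          have 2: "[:T_ac:] * emb2 C = emb2 A - [:rat_ac e:] * emb2 B"
            using arg_cong[OF C[symmetric], of emb2] unfolding hom_mult[OF is_hom_emb2] hom_diff[OF is_hom_emb2] ee2 eT .
          have 3: "to_fract [:- rat_ac e:] = - to_fract [:rat_ac e:]"
            by (simp add: to_fract_uminus[symmetric] del: to_fract_uminus)
          show ?thesis
            using arg_cong[OF 1, of to_fract] arg_cong[OF 2, of to_fract]
            by (simp only: ff_mult_def poly_ff_def of_rat_fn_def fst_conv snd_conv to_fract_mult to_fract_diff 3) (simp add: algebra_simps)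
        qed
        have "constant_gap (ff_mult F (of_rat_fn [:T_ac:]) (poly_ff (emb2 A') (emb2 C)))"
          by (rule constant_gap_scale[OF T_ac_nz nz' gap'])
        then obtain k where k: "\<And>a. a \<in> roots \<Longrightarrow> value_gap a (ff_mult F (poly_ff [:- rat_ac e:] 1) (poly_ff (emb2 A) (emb2 B))) = k"
          unfolding prod[symmetric] constant_gap_def by blast
        have "\<exists>k'. \<forall>a\<in>roots. value_gap a (poly_ff [:- rat_ac e:] 1) = k'"
        proof -
          have "rat_ac e = 1 \<or> rat_ac e = - 1" using e by (auto simp: hom_simps[OF is_hom_rat_ac])
          then show ?thesis using value_gap_y_minus_one value_gap_y_plus_one by auto
        qed
        then obtain k' where k': "\<And>a. a \<in> roots \<Longrightarrow> value_gap a (poly_ff [:- rat_ac e:] 1) = k'" by blast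
        have "value_gap a (poly_ff (emb2 A) (emb2 B)) = k - k'" if "a \<in> roots" for a
          using k[OF that] k'[OF that] value_gap_mult[OF that _ nzh, of "poly_ff [:- rat_ac e:] 1"] by simp
        then show ?thesis unfolding constant_gap_def by blast
      qed
    qed
  qed
qed

subsection \<open>Independence\<close>

text \<open>As \<open>h\<close> has no affine poles, it is a polynomial in \<open>x\<close> and \<open>y\<close>. Its conjugates have the same divisor, so
  they are constant multiples of it; normalisation of one coefficient makes all coefficients invariant,
  hence elements of \<open>\<rat>(T)\<close>. After clearing denominators, \<open>h\<close> is of the form just considered.\<close>

lemma fibre_function_constant_gap:
  assumes h: "h \<noteq> 0" and inv: "galois_invariant (div_of h)"
    and reg: "\<And>a b. on_curve a b \<Longrightarrow> 0 \<le> point a b h"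
    and fib: "\<And>a b. on_curve a b \<Longrightarrow> a \<notin> roots \<Longrightarrow> point a b h = 0"
  shows "constant_gap h"
proof -
  obtain A B where AB: "h = poly_ff A B" using affine_regular[of h] reg by (auto simp: vge_def)
  have AB0: "A \<noteq> 0 \<or> B \<noteq> 0" using h AB by simp
  have scaled: "\<exists>c. c \<noteq> 0 \<and> map_poly \<sigma> A = Polynomial.smult c A \<and> map_poly \<sigma> B = Polynomial.smult c B"
    if s: "\<sigma> \<in> galois_group" for \<sigma>
  proof -
    obtain h' where h': "h' \<noteq> 0" "ff_mult F h h' = (1, 0)" "div_of h' = - div_of h" using div_of_inverse[OF h] by blast
    have sh: "galois_ff \<sigma> h \<noteq> 0" using h galois_ff_eq_0[OF s] by simp
    have "div_of (galois_ff \<sigma> h) = div_of h"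
      using galois_div_div_of[OF s h] inv s by (simp add: galois_invariant_def)
    then have "div_of (ff_mult F (galois_ff \<sigma> h) h') = 0" using div_of_mult[OF sh h'(1)] h'(3) by simp
    then obtain c where c: "c \<noteq> 0" "ff_mult F (galois_ff \<sigma> h) h' = (const_fn c, 0)"
      using div_of_eq_0_imp_const[of "ff_mult F (galois_ff \<sigma> h) h'"] sh h'(1) by auto
    have "galois_ff \<sigma> h = ff_mult F (ff_mult F (galois_ff \<sigma> h) h') h"
      by (simp add: ff_mult_assoc ff_mult_commute[of F h' h] h'(2)) (simp add: ff_mult_def)
    also have "\<dots> = (const_fn c * to_fract A, const_fn c * to_fract B)" unfolding c(2) by (simp add: ff_mult_fst AB poly_ff_def)
    also have "\<dots> = poly_ff (Polynomial.smult c A) (Polynomial.smult c B)"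
      by (simp add: const_fn_def poly_ff_def flip: to_fract_mult)
    finally have "poly_ff (map_poly \<sigma> A) (map_poly \<sigma> B) = poly_ff (Polynomial.smult c A) (Polynomial.smult c B)"
      by (simp add: AB poly_ff_def galois_ff_poly[OF s])
    then show ?thesis using c(1) by (auto simp: poly_ff_def)
  qed
  define l where "l = (if A \<noteq> 0 then Polynomial.lead_coeff A else Polynomial.lead_coeff B)"
  have l: "l \<noteq> 0" using AB0 by (auto simp: l_def)
  define A1 B1 where "A1 = Polynomial.smult (inverse l) A" and "B1 = Polynomial.smult (inverse l) B"
  have fixed: "map_poly \<sigma> A1 = A1 \<and> map_poly \<sigma> B1 = B1" if s: "\<sigma> \<in> galois_group" for \<sigma>
  proof -
    note hs = galois_groupD(1)[OF s]
    obtain c where c: "c \<noteq> 0" "map_poly \<sigma> A = Polynomial.smult c A" "map_poly \<sigma> B = Polynomial.smult c B" using scaled[OF s] by blast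
    have "\<sigma> (Polynomial.lead_coeff p) = c * Polynomial.lead_coeff p" if "map_poly \<sigma> p = Polynomial.smult c p" for p
      using arg_cong[OF that, of "\<lambda>q. poly.coeff q (Polynomial.degree p)"] by (simp add: coeff_map_poly hom_0[OF hs])
    then have "\<sigma> l = c * l" using c by (simp add: l_def)
    then have "\<sigma> (inverse l) * c = inverse l" unfolding hom_inverse[OF hs] using l c(1) by (simp add: field_simps)
    then show ?thesis by (simp add: A1_def B1_def map_poly_hom_smult[OF hs] c)
  qed
  obtain d1 P where d1: "d1 \<noteq> 0" "Polynomial.smult (to_ac (to_fract d1)) A1 = emb2 P" using fixed_poly_denominator[of A1] fixed by blast
  obtain d2 Q where d2: "d2 \<noteq> 0" "Polynomial.smult (to_ac (to_fract d2)) B1 = emb2 Q" using fixed_poly_denominator[of B1] fixed by blast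
  define A2 B2 where "A2 = Polynomial.smult d2 P" and "B2 = Polynomial.smult d1 Q"
  define k where "k = to_ac (to_fract (d1 * d2)) * inverse l"
  have k: "k \<noteq> 0" using d1(1) d2(1) l by (simp add: k_def)
  have emb2_smult: "emb2 (Polynomial.smult d R) = Polynomial.smult (to_ac (to_fract d)) (emb2 R)" for d R
    unfolding emb2_def by (rule map_poly_hom_smult[OF is_hom_to_ac_to_fract])
  have A2: "emb2 A2 = Polynomial.smult k A" and B2: "emb2 B2 = Polynomial.smult k B"
    by (simp_all add: A2_def B2_def emb2_smult d1(2)[symmetric] d2(2)[symmetric] A1_def B1_def k_def mult_ac)
  have h2: "poly_ff (emb2 A2) (emb2 B2) = ff_mult F (of_rat_fn [:k:]) h"
    unfolding A2 B2 AB by (simp add: poly_ff_def of_rat_fn_def ff_mult_fst flip: to_fract_mult)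
  \<comment> \<open>The norm has no zeros outside the fibre, so it divides a power of \<open>f\<close>.\<close>
  define N where "N = A2 * A2 - FW * (B2 * B2)"
  have eN: "emb2 N = emb2 A2 * emb2 A2 - geom F * (emb2 B2 * emb2 B2)"
    unfolding N_def hom_diff[OF is_hom_emb2] hom_mult[OF is_hom_emb2] emb2_FW ..
  have h2nz: "poly_ff (emb2 A2) (emb2 B2) \<noteq> 0" unfolding h2 using k h by simp
  have norm2: "norm_ff F (poly_ff (emb2 A2) (emb2 B2)) = to_fract (emb2 N)"
    unfolding norm_poly_ff eN by (simp only: mult.commute)
  have eNnz: "emb2 N \<noteq> 0" using norm2 h2nz norm_ff_eq_0_iff[of "poly_ff (emb2 A2) (emb2 B2)"] by (metis to_fract_0)
  have rootsN: "poly fC a = 0" if a: "poly (emb2 N) a = 0" for a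
  proof (rule ccontr)
    assume "poly fC a \<noteq> 0"
    then have ar: "a \<notin> roots" by (simp add: roots_def)
    obtain b where b: "on_curve a b" using on_curve_exists by blast
    have val: "point a c (poly_ff (emb2 A2) (emb2 B2)) = 0" if c: "on_curve a c" for c
      unfolding h2 using pt_mult[OF point_in_points[OF c], of "of_rat_fn [:k:]" h]
        pt_of_rat_fn_const[OF point_in_points[OF c] k] fib[OF c ar] k h by simp
    have "point a b (conj_ff (poly_ff (emb2 A2) (emb2 B2))) = point a (- b) (poly_ff (emb2 A2) (emb2 B2))"
      unfolding conj_pt_point[OF b, symmetric] conj_pt_apply ..
    then have "point a b (of_rat_fn (emb2 N)) = 0"
      using pt_conj[OF point_in_points[OF b] h2nz] val[OF b] val[OF on_curve_conj[OF b]]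
      unfolding norm2 of_rat_fn_def by simp
    moreover have "Polynomial.order a (emb2 N) \<noteq> 0" using a eNnz order_root[of "emb2 N" a] by simp
    ultimately show False using point_poly_value[OF b eNnz] by (simp split: if_splits)
  qed
  define M where "M = Polynomial.degree (emb2 N)"
  have "emb2 N dvd fC ^ M" unfolding M_def by (rule all_roots_imp_dvd_power[OF eNnz rootsN])
  then obtain E where E: "fC ^ M = emb2 N * E" by blast
  have "map_poly \<sigma> E = E" if s: "\<sigma> \<in> galois_group" for \<sigma>
  proof -
    note hm = is_hom_map_poly[OF galois_groupD(1)[OF s]]
    have "map_poly \<sigma> fC = fC" unfolding emb2_fW[symmetric] by (rule galois_emb2[OF s])
    then have "fC ^ M = emb2 N * map_poly \<sigma> E"
      using arg_cong[OF E, of "map_poly \<sigma>"] by (simp add: hom_power[OF hm] hom_mult[OF hm] galois_emb2[OF s])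
    then have "emb2 N * map_poly \<sigma> E = emb2 N * E" unfolding E by (rule sym)
    then show ?thesis unfolding mult_cancel_left using eNnz by blast
  qed
  then obtain d E2 where d: "d \<noteq> 0" "Polynomial.smult (to_ac (to_fract d)) E = emb2 E2"
    using fixed_poly_denominator[of E] by blast
  have "emb2 (N * E2) = emb2 ([:d:] * fW ^ M)"
    unfolding hom_mult[OF is_hom_emb2] hom_power[OF is_hom_emb2] emb2_fW emb2_const d(2)[symmetric] by (simp add: E)
  then have "(A2 * A2 - FW * (B2 * B2)) * E2 = [:d:] * fW ^ M" unfolding emb2_eq_iff N_def .
  moreover have "A2 \<noteq> 0 \<or> B2 \<noteq> 0" using h2nz by simp
  ultimately have "constant_gap (poly_ff (emb2 A2) (emb2 B2))" using norm_dividing_imp_constant_gap[OF d(1)] by blast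
  from constant_gap_scale[OF _ h2nz this, of "inverse k"]
  have "constant_gap (ff_mult F (of_rat_fn [:inverse k:]) (ff_mult F (of_rat_fn [:k:]) h))" using k unfolding h2 by simp
  moreover have "ff_mult F (of_rat_fn [:inverse k:]) (ff_mult F (of_rat_fn [:k:]) h) = h"
    using k by (simp add: ff_mult_assoc[symmetric] of_rat_fn_mult[symmetric])
      (simp add: of_rat_fn_def one_pCons[symmetric] ff_mult_fst)
  ultimately show ?thesis by simp
qed

text \<open>If the combination is the divisor of \<open>h\<close>, the gap of \<open>h\<close> at a root \<open>a\<close> is the coefficient of the orbit of
  \<open>a\<close>, because the divisor does not involve \<open>(a, -1)\<close>.\<close>

theorem orbit_classes_relation:
  assumes rel: "(\<Sum>S\<in>root_orbits. frag_cmul (c S) (orbit_class S)) \<in> principal_divisors F"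
    and S: "S \<in> root_orbits" "S' \<in> root_orbits"
  shows "c S = c S'"
proof -
  define D where "D = (\<Sum>S\<in>root_orbits. frag_cmul (c S) (orbit_class S))"
  obtain h where h: "h \<noteq> 0" "D = div_of h" using rel unfolding D_def[symmetric] principal_divisors_eq by blast
  have sub: "S \<subseteq> roots" if "S \<in> root_orbits" for S using that orbit_subset_roots by (auto simp: root_orbits_def)
  have look: "Poly_Mapping.lookup D (point a b) = (if a \<in> roots \<and> b = 1 then c (galois_orbit a) else 0)" if ab: "on_curve a b" for a b
  proof -
    have "Poly_Mapping.lookup D (point a b) = (\<Sum>S\<in>root_orbits. if S = galois_orbit a then (if a \<in> roots \<and> b = 1 then c S else 0) else 0)"
      unfolding D_def lookup_sum
    proof (rule sum.cong)
      fix S assume S: "S \<in> root_orbits"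
      then obtain r where r: "r \<in> roots" "S = galois_orbit r" by (auto simp: root_orbits_def)
      have "a \<in> S \<longleftrightarrow> S = galois_orbit a" using r(2) galois_orbit_eq galois_orbit_self by metis
      moreover have "a \<in> S \<Longrightarrow> a \<in> roots" using sub[OF S] by blast
      ultimately show "Poly_Mapping.lookup (frag_cmul (c S) (orbit_class S)) (point a b) =
          (if S = galois_orbit a then if a \<in> roots \<and> b = 1 then c S else 0 else 0)"
        using lookup_orbit_class[OF sub[OF S] ab] by auto
    qed simp
    also have "\<dots> = (if a \<in> roots \<and> b = 1 then c (galois_orbit a) else 0)"
      using finite_root_orbits by (auto simp: root_orbits_def)
    finally show ?thesis .
  qed
  have val: "point a b h = (if a \<in> roots \<and> b = 1 then c (galois_orbit a) else 0)" if "on_curve a b" for a b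
    using look[OF that] h point_in_points[OF that] by (simp add: lookup_div_of)
  \<comment> \<open>Multiplication by a sufficient power of \<open>f\<close> removes the poles in the fibre.\<close>
  define n where "n = (\<Sum>S\<in>root_orbits. nat \<bar>c S\<bar>)"
  have n: "- c S \<le> int n" if "S \<in> root_orbits" for S
  proof -
    have "nat \<bar>c S\<bar> \<le> n" unfolding n_def by (rule member_le_sum[OF that]) (simp_all add: finite_root_orbits)
    then show ?thesis by linarith
  qed
  define h' where "h' = ff_mult F (of_rat_fn (fC ^ n)) h"
  have fn: "fC ^ n \<noteq> 0" using fC_nz by simp
  have h': "h' \<noteq> 0" using fn h(1) by (simp add: h'_def)
  have val': "point a b h' = (if a \<in> roots then int n + (if b = 1 then c (galois_orbit a) else 0) else 0)" if ab: "on_curve a b" for a b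
  proof -
    have v: "point a b (of_rat_fn fC) = (if a \<in> roots then 1 else 0)"
    proof (cases "a \<in> roots")
      case True
      then have "b \<noteq> 0" using root_points[of a b] ab by (auto simp: roots_def)
      then show ?thesis using True point_poly_value[OF ab fC_nz] order_fC[OF True] by simp
    next
      case False
      then have "Polynomial.order a fC = 0" by (intro order_0I) (simp add: roots_def)
      then show ?thesis using False point_poly_value[OF ab fC_nz] by simp
    qed
    have "point a b h' = point a b (of_rat_fn (fC ^ n)) + point a b h"
      unfolding h'_def by (rule pt_mult[OF point_in_points[OF ab]]) (use fn h(1) in auto)
    then show ?thesis using pt_of_rat_fn_power[OF point_in_points[OF ab] fC_nz, of n] v val[OF ab] by simp
  qed
  have "constant_gap h'"
  proof (rule fibre_function_constant_gap[OF h'])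
    have "galois_div \<sigma> (div_of h') = div_of h'" if s: "\<sigma> \<in> galois_group" for \<sigma>
    proof (rule deg0_eqI)
      show "div_of h' \<in> deg0_divisors" by (rule deg0_div_of[OF h'])
      show "galois_div \<sigma> (div_of h') \<in> deg0_divisors"
        using deg0_div_of[OF h'] galois_div_keys_points[OF s] div_degree_galois_div[OF s] by (simp add: deg0_divisors_def)
      fix a b assume ab: "on_curve a b"
      let ?t = "inv_into UNIV \<sigma>"
      note t = galois_inv(1)[OF s]
      note ht = galois_groupD(1)[OF t]
      have "Poly_Mapping.lookup (galois_div \<sigma> (div_of h')) (galois_point \<sigma> (point (?t a) (?t b))) =
          Poly_Mapping.lookup (div_of h') (point (?t a) (?t b))" by (rule lookup_galois_div[OF s])
      moreover have "galois_point \<sigma> (point (?t a) (?t b)) = point a b"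
        using galois_point_point[OF s galois_on_curve[OF t ab]] by (simp add: galois_inv[OF s])
      moreover have "?t a \<in> roots \<longleftrightarrow> a \<in> roots" by (rule galois_roots[OF t])
      moreover have "?t b = 1 \<longleftrightarrow> b = 1" using hom_eq_iff[OF ht, of b 1] by (simp add: hom_1[OF ht])
      moreover have "galois_orbit (?t a) = galois_orbit a"
        by (rule galois_orbit_eq) (use t in \<open>auto simp: galois_orbit_def\<close>)
      ultimately show "Poly_Mapping.lookup (galois_div \<sigma> (div_of h')) (point a b) = Poly_Mapping.lookup (div_of h') (point a b)"
        using val'[OF ab] val'[OF galois_on_curve[OF t ab]] h' point_in_points[OF ab] point_in_points[OF galois_on_curve[OF t ab]]
        by (simp add: lookup_div_of)
    qed
    then show "galois_invariant (div_of h')" by (simp add: galois_invariant_def)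
    show "0 \<le> point a b h'" if "on_curve a b" for a b
      using val'[OF that] n[of "galois_orbit a"] by (auto simp: root_orbits_def)
    show "point a b h' = 0" if "on_curve a b" "a \<notin> roots" for a b using val'[OF that(1)] that(2) by simp
  qed
  then obtain k where k: "\<And>a. a \<in> roots \<Longrightarrow> value_gap a h' = k" by (auto simp: constant_gap_def)
  have "c (galois_orbit a) = k" if a: "a \<in> roots" for a
  proof -
    have "(1 :: qtc) \<noteq> - 1" by simp
    then show ?thesis using k[OF a] val'[OF root_on_curve(1)[OF a]] val'[OF root_on_curve(2)[OF a]] a by (auto simp: value_gap_def)
  qed
  then show ?thesis using S by (auto simp: root_orbits_def)
qed

text \<open>The orbit classes generate, and all relations between them are multiples of the one from \<open>y - 1\<close>. So
  the classes of all orbits but one, \<open>e r\<close>, form a basis.\<close>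

theorem pencil_rank:
  assumes card: "card root_orbits = Suc r"
  shows "fg_abelian_of_rank (jacobian_points F) r"
proof -
  obtain e where e: "bij_betw e {..<Suc r} root_orbits"
    using ex_bij_betw_nat_finite[OF finite_root_orbits] card by (metis atLeast0LessThan)
  have e_mem: "e i \<in> root_orbits" if "i \<le> r" for i using e that by (auto simp: bij_betw_def)
  have sub: "S \<subseteq> roots" if "S \<in> root_orbits" for S using that orbit_subset_roots by (auto simp: root_orbits_def)
  have reindex: "(\<Sum>S\<in>root_orbits. q S) = (\<Sum>i<r. q (e i)) + q (e r)" for q :: "qtc set \<Rightarrow> (qt ff \<Rightarrow> int) \<Rightarrow>\<^sub>0 int"
    using sum.reindex_bij_betw[OF e, of q] by simp
  have total: "(\<Sum>S\<in>root_orbits. orbit_class S) = orbit_class roots"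
  proof -
    have fin: "\<forall>S\<in>root_orbits. finite S" using finite_subset[OF sub finite_roots] by blast
    have disj: "\<forall>S\<in>root_orbits. \<forall>S'\<in>root_orbits. S \<noteq> S' \<longrightarrow> S \<inter> S' = {}" using root_orbits_disjoint by blast
    show ?thesis
      unfolding orbit_class_def Union_root_orbits[symmetric] by (rule sum.Union_disjoint[OF fin disj, unfolded comp_def, symmetric])
  qed
  show ?thesis
  proof (rule jacobian_free[where E = "\<lambda>i. orbit_class (e i)"])
    fix i assume "i < r"
    then have i: "e i \<in> root_orbits" using e_mem by simp
    show "orbit_class (e i) \<in> deg0_divisors" by (rule orbit_class_deg0[OF sub[OF i]])
    show "galois_invariant (orbit_class (e i))" using i orbit_class_invariant by (auto simp: root_orbits_def)
  next
    fix D assume D: "effective D" "galois_invariant D"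
    obtain c where c: "reduced_at_inf D - (\<Sum>S\<in>root_orbits. frag_cmul (c S) (orbit_class S)) \<in> principal_divisors F"
      using invariant_divisor_in_span[OF D] by (auto simp: orbit_span_def)
    have "frag_cmul (c (e r)) (\<Sum>S\<in>root_orbits. orbit_class S) \<in> principal_divisors F"
      unfolding total by (rule principal_cmul[OF orbit_class_roots_principal])
    from principal_add[OF c this]
    have "reduced_at_inf D - (\<Sum>i<r. frag_cmul (c (e i) - c (e r)) (orbit_class (e i))) \<in> principal_divisors F"
      unfolding reindex by (simp add: frag_cmul_diff_distrib frag_cmul_distrib2 frag_cmul_sum sum_subtractf algebra_simps)
    then show "\<exists>c. reduced_at_inf D - (\<Sum>i<r. frag_cmul (c i) (orbit_class (e i))) \<in> principal_divisors F"
      by (intro exI[of _ "\<lambda>i. c (e i) - c (e r)"])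
  next
    fix c :: "nat \<Rightarrow> int"
    assume rel: "(\<Sum>i<r. frag_cmul (c i) (orbit_class (e i))) \<in> principal_divisors F"
    define c' where "c' S = (let i = inv_into {..<Suc r} e S in if i < r then c i else 0)" for S
    have c': "c' (e i) = (if i < r then c i else 0)" if "i \<le> r" for i
      using bij_betw_inv_into_left[OF e, of i] that by (simp add: c'_def)
    have "(\<Sum>S\<in>root_orbits. frag_cmul (c' S) (orbit_class S)) = (\<Sum>i<r. frag_cmul (c i) (orbit_class (e i)))"
      unfolding reindex by (simp add: c')
    then have "c' (e i) = c' (e r)" if "i < r" for i
      using orbit_classes_relation[of c' "e i" "e r"] rel e_mem that by simp
    then show "\<forall>i<r. c i = 0" using c' by simp
  qed
qed

end

section \<open>The roots of \<open>f\<close> and their Galois orbits\<close>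

text \<open>A multiple root would leave too few distinct ones.\<close>

lemma as_many_roots_as_degree_imp_simple:
  fixes p :: "'a::field_char_0 poly"
  assumes p: "p \<noteq> 0" and card: "Polynomial.degree p \<le> card {x. poly p x = 0}" and a: "poly p a = 0"
  shows "poly (pderiv p) a \<noteq> 0"
proof
  assume d: "poly (pderiv p) a = 0"
  obtain q where q: "p = [:- a, 1:] * q" using a by (auto simp: poly_eq_0_iff_dvd)
  then have "poly q a = 0" using d by (simp only: pderiv_mult) (simp add: pderiv_pCons)
  then obtain u where u: "q = [:- a, 1:] * u" by (auto simp: poly_eq_0_iff_dvd)
  have nz: "u \<noteq> 0" "q \<noteq> 0" using p q u by auto
  have "{x. poly p x = 0} \<subseteq> insert a {x. poly u x = 0}" by (auto simp: q u)
  then have "card {x. poly p x = 0} \<le> card (insert a {x. poly u x = 0})"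
    by (rule card_mono[rotated]) (use poly_roots_finite[OF nz(1)] in simp)
  also have "\<dots> \<le> Suc (Polynomial.degree u)"
    using card_poly_roots_bound[OF nz(1)] poly_roots_finite[OF nz(1)] by (simp add: card_insert_if)
  also have "\<dots> < Polynomial.degree p"
    unfolding q using nz degree_mult_eq[of "[:- a, 1:]" q] degree_mult_eq[of "[:- a, 1:]" u] by (simp add: u del: mult_pCons_left)
  finally show False using card by simp
qed

text \<open>The field \<open>\<rat>(T)\<close> can be ordered.\<close>

lemma square_neq_minus_square:
  fixes c d :: qt assumes "d \<noteq> 0" shows "c ^ 2 \<noteq> - (d ^ 2)"
proof -
  have "- (d ^ 2) < 0" using assms by simp
  then have "- (d ^ 2) < c ^ 2" by (rule less_le_trans[OF _ zero_le_power2])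
  then show ?thesis by simp
qed

lemma galois_orbit_rational: "galois_orbit (rat_ac q) = {rat_ac q}"
  using id_in_galois_group by (auto simp: galois_orbit_def rat_ac_def galois_groupD(3))

text \<open>An automorphism can only change the sign of a square root of \<open>-q\<^sup>2\<close>, and as \<open>\<rat>(T)\<close> contains
  no such root, some automorphism does.\<close>

lemma galois_orbit_imaginary:
  assumes i: "i ^ 2 = (- 1 :: qtc)" and q: "q \<noteq> 0"
  shows "galois_orbit (i * rat_ac q) = {i * rat_ac q, - (i * rat_ac q)}"
proof -
  let ?z = "i * rat_ac q"
  have sq: "?z ^ 2 = - (rat_ac q ^ 2)" by (simp add: power_mult_distrib i)
  have sign: "\<sigma> ?z = ?z \<or> \<sigma> ?z = - ?z" if s: "\<sigma> \<in> galois_group" for \<sigma>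
  proof -
    note h = galois_groupD(1)[OF s]
    have "\<sigma> ?z ^ 2 = ?z ^ 2"
      using galois_groupD(3)[OF s, of "const_fn q"]
      unfolding hom_power[OF h, symmetric] sq hom_uminus[OF h] unfolding hom_power[OF h] by (simp add: rat_ac_def)
    then show ?thesis by (simp only: power2_eq_iff)
  qed
  have "\<exists>\<sigma>\<in>galois_group. \<sigma> ?z \<noteq> ?z"
  proof (rule ccontr)
    assume "\<not> (\<exists>\<sigma>\<in>galois_group. \<sigma> ?z \<noteq> ?z)"
    then obtain c where c: "?z = to_ac c" using galois_fixed_field[of ?z] by auto
    have "to_ac (c ^ 2) = to_ac (- (const_fn q ^ 2))" using sq unfolding c by (simp add: rat_ac_def)
    then have "c ^ 2 = - (const_fn q ^ 2)" by (simp only: to_ac_eq_iff)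
    moreover have "const_fn q \<noteq> 0" using q by (simp add: hom_eq_0_iff[OF is_hom_const_fn])
    ultimately show False using square_neq_minus_square by blast
  qed
  then obtain \<sigma> where "\<sigma> \<in> galois_group" "- ?z = \<sigma> ?z" using sign by metis
  then have "- ?z \<in> galois_orbit ?z" unfolding galois_orbit_def by blast
  then show ?thesis using galois_orbit_self[of ?z] sign by (auto simp: galois_orbit_def)
qed

lemma card_symmetric_set:
  fixes s :: "nat \<Rightarrow> rat"
  assumes pos: "\<And>k. k \<in> I \<Longrightarrow> 0 < s k" and inj: "inj_on s I" and fin: "finite I"
  shows "card (s ` I \<union> (\<lambda>k. - s k) ` I) = 2 * card I" "0 \<notin> s ` I \<union> (\<lambda>k. - s k) ` I"
proof -
  have "s j \<noteq> - s k" if "j \<in> I" "k \<in> I" for j k using pos[OF that(1)] pos[OF that(2)] by linarith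
  then have "s ` I \<inter> (\<lambda>k. - s k) ` I = {}" by blast
  moreover have "inj_on (\<lambda>k. - s k) I" using inj by (simp add: inj_on_def)
  ultimately show "card (s ` I \<union> (\<lambda>k. - s k) ` I) = 2 * card I"
    using inj fin by (simp add: card_Un_disjoint card_image)
  have "s k \<noteq> 0" if "k \<in> I" for k using pos[OF that] by simp
  then show "0 \<notin> s ` I \<union> (\<lambda>k. - s k) ` I" by force
qed

locale root_sequences =
  fixes m n :: nat and a b :: "nat \<Rightarrow> rat" and i :: qtc
  assumes a_mono: "strict_mono_on {0..m} a" and a_0: "a 0 = 0"
    and b_mono: "strict_mono_on {0..n} b" and b_0: "b 0 = 0"
    and i_square: "i ^ 2 = - 1"
begin

definition f where
  "f = [:0, 1:] * (\<Prod>k=1..m. [:0, 1:] ^ 2 - [:(a k) ^ 2:]) * (\<Prod>l=1..n. [:0, 1:] ^ 2 + [:(b l) ^ 2:])"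

lemma a_pos: "k \<in> {1..m} \<Longrightarrow> 0 < a k"
  using strict_mono_onD[OF a_mono, of 0 k] a_0 by auto

lemma b_pos: "l \<in> {1..n} \<Longrightarrow> 0 < b l"
  using strict_mono_onD[OF b_mono, of 0 l] b_0 by auto

lemma inj_a: "inj_on a {1..m}"
  using inj_on_subset[OF strict_mono_on_imp_inj_on[OF a_mono]] by auto

lemma inj_b: "inj_on b {1..n}"
  using inj_on_subset[OF strict_mono_on_imp_inj_on[OF b_mono]] by auto

lemma degree_f: "Polynomial.degree f = 1 + 2 * m + 2 * n"
proof -
  have 1: "Polynomial.degree ([:0, 1:] ^ 2 - [:c:]) = 2" "[:0, 1:] ^ 2 - [:c:] \<noteq> 0" for c :: rat
    by (simp_all add: power2_eq_square)
  have 2: "Polynomial.degree ([:0, 1:] ^ 2 + [:c:]) = 2" "[:0, 1:] ^ 2 + [:c:] \<noteq> 0" for c :: rat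
    by (simp_all add: power2_eq_square)
  have nz: "(\<Prod>k=1..m. [:0, 1:] ^ 2 - [:(a k) ^ 2:]) \<noteq> 0" "(\<Prod>l=1..n. [:0, 1:] ^ 2 + [:(b l) ^ 2:]) \<noteq> 0"
    using 1(2) 2(2) by (simp_all only: prod_zero_iff finite_atLeastAtMost) simp_all
  have "Polynomial.degree (\<Prod>k=1..m. [:0, 1:] ^ 2 - [:(a k) ^ 2:]) = 2 * m"
    "Polynomial.degree (\<Prod>l=1..n. [:0, 1:] ^ 2 + [:(b l) ^ 2:]) = 2 * n"
    by (subst degree_prod_sum_eq; simp only: 1 2 not_False_eq_True; simp)+
  moreover have "Polynomial.degree ([:0, 1:] * p * q) = 1 + Polynomial.degree p + Polynomial.degree q"
    if "p \<noteq> 0" "q \<noteq> 0" for p q :: "rat poly"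
    using that by (simp add: degree_mult_eq)
  ultimately show ?thesis using nz unfolding f_def by presburger
qed

definition A :: "rat set" where "A = {0} \<union> a ` {1..m} \<union> (\<lambda>k. - a k) ` {1..m}"
definition B :: "rat set" where "B = b ` {1..n} \<union> (\<lambda>l. - b l) ` {1..n}"

lemma card_A: "card A = 1 + 2 * m"
  using card_symmetric_set[OF a_pos inj_a] by (simp add: A_def Un_assoc)

lemma card_B: "card B = 2 * n"
  using card_symmetric_set(1)[OF b_pos inj_b] by (simp add: B_def)

lemma zero_notin_B: "0 \<notin> B"
  using card_symmetric_set(2)[OF b_pos inj_b] by (simp add: B_def)

text \<open>The roots of \<open>x\<^sup>2 + b\<^sub>l\<^sup>2\<close> are \<open>\<plusminus>i b\<^sub>l\<close>.\<close>

lemma root_iff: "poly (map_poly rat_ac f) x = 0 \<longleftrightarrow> x \<in> rat_ac ` A \<or> x \<in> (\<lambda>q. i * rat_ac q) ` B"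
proof -
  note h = is_hom_eval[OF is_hom_rat_ac, of x]
  note hr = is_hom_rat_ac
  have e: "poly (map_poly rat_ac [:c:]) x = rat_ac c" "poly (map_poly rat_ac [:0, 1:]) x = x" for c
    by (simp_all add: map_poly_hom_pCons[OF hr] hom_0[OF hr] hom_1[OF hr])
  have "poly (map_poly rat_ac f) x =
      x * (\<Prod>k=1..m. x ^ 2 - rat_ac (a k) ^ 2) * (\<Prod>l=1..n. x ^ 2 + rat_ac (b l) ^ 2)"
    unfolding f_def hom_mult[OF h] hom_prod[OF h] hom_diff[OF h] hom_add[OF h] hom_power[OF h] e hom_power[OF hr] ..
  then have "poly (map_poly rat_ac f) x = 0 \<longleftrightarrow>
      x = 0 \<or> (\<exists>k\<in>{1..m}. x ^ 2 = rat_ac (a k) ^ 2) \<or> (\<exists>l\<in>{1..n}. x ^ 2 = (i * rat_ac (b l)) ^ 2)"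
    by (simp add: power_mult_distrib i_square add_eq_0_iff2)
  also have "\<dots> \<longleftrightarrow> x \<in> rat_ac ` A \<or> x \<in> (\<lambda>q. i * rat_ac q) ` B"
  proof -
    have n: "rat_ac (- q) = - rat_ac q" "i * - rat_ac q = - (i * rat_ac q)" for q by (simp_all add: hom_uminus[OF hr])
    show ?thesis
      unfolding A_def B_def power2_eq_iff image_Un image_image n image_insert image_empty hom_0[OF hr] Un_iff image_iff insert_iff
      by blast
  qed
  finally show ?thesis .
qed

lemma rat_ac_eq_iff: "rat_ac p = rat_ac q \<longleftrightarrow> p = q" by (rule hom_eq_iff[OF is_hom_rat_ac])

lemma i_nz: "i \<noteq> 0" using i_square by auto

lemma imaginary_not_rational: assumes "q \<noteq> 0" shows "i * rat_ac q \<noteq> rat_ac p"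
proof
  assume "i * rat_ac q = rat_ac p"
  then have "(i * rat_ac q) ^ 2 = rat_ac p ^ 2" by simp
  then have "rat_ac (- (q ^ 2)) = rat_ac (p ^ 2)"
    by (simp add: power_mult_distrib i_square hom_uminus[OF is_hom_rat_ac] hom_power[OF is_hom_rat_ac])
  then have "- (q ^ 2) = p ^ 2" by (simp only: rat_ac_eq_iff)
  then show False using assms zero_le_power2[of p] zero_less_power2[of q] by linarith
qed

lemma card_roots: "card {x. poly (map_poly rat_ac f) x = 0} = 1 + 2 * m + 2 * n"
proof -
  have "card (rat_ac ` A) = 1 + 2 * m" by (subst card_image) (simp_all add: card_A inj_on_def rat_ac_eq_iff)
  moreover have "card ((\<lambda>q. i * rat_ac q) ` B) = 2 * n"
    by (subst card_image) (simp_all add: card_B inj_on_def rat_ac_eq_iff i_nz)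
  moreover have "rat_ac ` A \<inter> (\<lambda>q. i * rat_ac q) ` B = {}"
  proof -
    have "x \<noteq> y" if xy: "x \<in> rat_ac ` A" "y \<in> (\<lambda>q. i * rat_ac q) ` B" for x y
    proof -
      obtain p q where "x = rat_ac p" "y = i * rat_ac q" "q \<in> B" using xy by blast
      then show ?thesis using imaginary_not_rational[of q p] zero_notin_B by metis
    qed
    then show ?thesis by blast
  qed
  moreover have "{x. poly (map_poly rat_ac f) x = 0} = rat_ac ` A \<union> (\<lambda>q. i * rat_ac q) ` B"
    using root_iff by blast
  moreover have "finite A" "finite B" by (simp_all add: A_def B_def)
  ultimately show ?thesis by (simp add: card_Un_disjoint)
qed

text \<open>The orbits are \<open>{0}\<close>, the \<open>2 m\<close> singletons \<open>{a\<^sub>k}\<close> and \<open>{-a\<^sub>k}\<close>, and the \<open>n\<close> pairs \<open>{i b\<^sub>l, - i b\<^sub>l}\<close>.\<close>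

lemma card_orbits: "card (galois_orbit ` {x. poly (map_poly rat_ac f) x = 0}) = 1 + 2 * m + n"
proof -
  let ?P = "\<lambda>l. {i * rat_ac (b l), - (i * rat_ac (b l))}"
  have pair: "galois_orbit (i * rat_ac q) = {i * rat_ac q, - (i * rat_ac q)}" if "q \<in> B" for q
    by (rule galois_orbit_imaginary[OF i_square]) (use that zero_notin_B in blast)
  have bB: "b l \<in> B" "- b l \<in> B" if "l \<in> {1..n}" for l using that by (auto simp: B_def)
  have "(\<lambda>q. galois_orbit (i * rat_ac q)) ` B = ?P ` {1..n}"
  proof -
    have "galois_orbit (i * rat_ac (b l)) = ?P l" "galois_orbit (i * rat_ac (- b l)) = ?P l" if "l \<in> {1..n}" for l
      unfolding pair[OF bB(1)[OF that]] pair[OF bB(2)[OF that]] by (auto simp: hom_uminus[OF is_hom_rat_ac])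
    then show ?thesis unfolding B_def image_Un image_image by simp
  qed
  moreover have "{x. poly (map_poly rat_ac f) x = 0} = rat_ac ` A \<union> (\<lambda>q. i * rat_ac q) ` B"
    using root_iff by blast
  ultimately have "galois_orbit ` {x. poly (map_poly rat_ac f) x = 0} = (\<lambda>p. {rat_ac p}) ` A \<union> ?P ` {1..n}"
    by (simp add: image_Un image_image galois_orbit_rational)
  moreover have "card ((\<lambda>p. {rat_ac p}) ` A) = 1 + 2 * m"
    by (subst card_image) (simp_all add: card_A inj_on_def rat_ac_eq_iff)
  moreover have "card (?P ` {1..n}) = n"
  proof -
    have "inj_on ?P {1..n}"
    proof (rule inj_onI)
      fix k l assume kl: "k \<in> {1..n}" "l \<in> {1..n}" "?P k = ?P l"
      then have "i * rat_ac (b k) = i * rat_ac (b l) \<or> i * rat_ac (b k) = i * rat_ac (- b l)"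
        by (simp only: hom_uminus[OF is_hom_rat_ac] mult_minus_right doubleton_eq_iff) blast
      then have "b k = b l \<or> b k = - b l" by (simp add: i_nz rat_ac_eq_iff)
      then show "k = l" using b_pos[OF kl(1)] b_pos[OF kl(2)] inj_onD[OF inj_b _ kl(1,2)] by auto
    qed
    then show ?thesis by (simp add: card_image)
  qed
  moreover have "(\<lambda>p. {rat_ac p}) ` A \<inter> ?P ` {1..n} = {}"
  proof -
    have "i * rat_ac (b l) \<noteq> rat_ac p" if "l \<in> {1..n}" for l p
      by (rule imaginary_not_rational) (use b_pos[OF that] in simp)
    then show ?thesis by blast
  qed
  moreover have "finite A" by (simp add: A_def)
  ultimately show ?thesis by (simp add: card_Un_disjoint)
qed

end

section \<open>The curve and the rank of its Jacobian\<close>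

theorem theorem1p4:
  fixes g r m n :: nat
    and a b :: "nat \<Rightarrow> rat"
    and f :: "rat poly"
    and T :: "rat poly fract"
    and F :: "rat poly fract poly"
  assumes "1 \<le> g" and "g \<le> r" and "r < 2 * g + 1"
    and "m = r - g" and "n = 2 * g - r"
    and "strict_mono_on {0..m} a" and "convex_seq m a"
    and "\<forall>k\<le>m. 0 \<le> a k" and "a 0 = 0"
    and "strict_mono_on {0..n} b" and "convex_seq n b"
    and "\<forall>l\<le>n. 0 \<le> b l" and "b 0 = 0"
    and "f = [:0, 1:] * (\<Prod>k=1..m. [:0, 1:] ^ 2 - [:(a k) ^ 2:])
                      * (\<Prod>l=1..n. [:0, 1:] ^ 2 + [:(b l) ^ 2:])"
    and "T = to_fract [:0, 1:]"
    and "F = smult T (map_poly const_fn f) + 1"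
  shows "imaginary_hyperelliptic_curve F g \<and> fg_abelian_of_rank (jacobian_points F) r"
proof -
  have "\<exists>i :: qtc. poly [:1, 0, 1:] i = 0" by (rule alg_closed_imp_poly_has_root) simp
  then obtain i :: qtc where "i ^ 2 = - 1" by (auto simp: power2_eq_square add_eq_0_iff)
  then interpret R: root_sequences m n a b i
    by unfold_locales (use assms in simp_all)
  have f: "f = R.f" using assms(14) by (simp only: R.f_def)
  have deg: "Polynomial.degree f = 2 * g + 1" using R.degree_f assms(2-5) by (simp add: f)
  have nz: "map_poly rat_ac f \<noteq> 0" using deg by (auto simp: map_poly_hom_eq_0_iff[OF is_hom_rat_ac])
  have card: "card {x. poly (map_poly rat_ac f) x = 0} = Polynomial.degree (map_poly rat_ac f)"
    unfolding f R.card_roots degree_map_poly_hom[OF is_hom_rat_ac] R.degree_f ..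
  interpret pencil f g F
  proof
    show "poly (pderiv (map_poly rat_ac f)) x \<noteq> 0" if "poly (map_poly rat_ac f) x = 0" for x
      by (rule as_many_roots_as_degree_imp_simple[OF nz _ that]) (simp add: card)
  qed (use deg assms in simp_all)
  have "card root_orbits = Suc r"
    using R.card_orbits[folded f] assms(2-5) unfolding root_orbits_def roots_def by linarith
  then show ?thesis using imaginary_hyperelliptic pencil_rank by blast
qed

end
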